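(* Let $K$ be a local field of characteristic $p$ with perfect residue field $\mathbb{F}$, and let $L/K$ be a totally ramified $C_p^n$-extension with a single ramification break $b>0$. Assume there is Artin–Schreier data $(\beta,\vec{\omega},\vec{\epsilon})$ for $L/K$ such that $v_K(\epsilon_i)>-b/p^{n-2}$ for $1\le i\le n$. Then for $2\le k\le p$ the set of VC$_k$-refined breaks of $L/K$ is defined and equal to the set of SS$_k$-refined breaks of $L/K$.
   Context: A local field is a complete discretely valued field; $K$ has characteristic $p$ and perfect residue field $\mathbb{F}$, so $K\cong\mathbb{F}((t))$ and we regard $\mathbb{F}\subset K$. $v_K,v_L$ are the normalized valuations ($v(0)=\infty$). $C_p$ is the cyclic group of order $p$. $L/K$ is totally ramified Galois with $G=\mathrm{Gal}(L/K)\cong C_p^n$ and a single (lower, equivalently upper) ramification break $b>0$ (then $p\nmid b$). Artin–Schreier data for $L/K$: a triple $(\beta,\vec{\omega},\vec{\epsilon})$ with $\beta\in K$, $v_K(\beta)=-b$, $\vec{\omega}=(\omega_1,\ldots,\omega_n)^T\in\mathbb{F}^n$ with $\omega_1,\ldots,\omega_n$ linearly independent over $\mathbb{F}_p$, and $\vec{\epsilon}=(\epsilon_1,\ldots,\epsilon_n)^T\in K^n$ with $v_K(\epsilon_i)>-b$ and, for each $i$, either $v_K(\epsilon_i)<0$ and $p\nmid v_K(\epsilon_i)$, or $\epsilon_i\in\mathbb{F}$, such that $L=K(x_1,\ldots,x_n)$ where $x_i$ in the separable closure of $K$ satisfies $x_i^p-x_i=\omega_i^{p^n}\beta+\epsilon_i$.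 Refined breaks. Let $R=\mathbb{F}[G]$ (acting $K$-linearly on $L$) with augmentation ideal $A$. Fix $2\le k\le p$ and set $\overline{R}=R/A^k$, $\overline{\gamma}=\gamma+A^k$. For $\gamma\in 1+A$ and $\omega\in\mathbb{F}$ define the truncated power $\gamma^{[\omega]}=\sum_{i=0}^{p-1}\binom{\omega}{i}(\gamma-1)^i$, where $\binom{\omega}{i}=\omega(\omega-1)\cdots(\omega-i+1)/i!$. The multiplicative group $(1+A)/(1+A^k)$, identified with the image of $1+A$ in $\overline{R}^\times$, is an $\mathbb{F}$-vector space with scalar multiplication $\omega\cdot\overline{\gamma}=\overline{\gamma^{[\omega]}}$; let $\overline{G}^{[\mathbb{F}]}$ be the $\mathbb{F}$-span of the image of $G$ in it. VC$_k$: a valuation criterion element is $\rho\in L$ with $v_L(\rho)\equiv b\pmod{p^n}$ (such $\rho$ generates a normal basis of $L/K$). For $\overline{\gamma}\in\overline{G}^{[\mathbb{F}]}$ put $i_\rho(\overline{\gamma})=\max\{v_L((\gamma'-1)(\rho)):\gamma'\in\overline{\gamma}\}$ and $B_{\rho,k}=\{i_\rho(\overline{\gamma})-v_L(\rho):\overline{\gamma}\in\overline{G}^{[\mathbb{F}]},\ \overline{\gamma}\ne\overline{1}\}$. If $B_{\rho,k}$ is the same set for all valuation criterion elements $\rho$, the VC$_k$-refined breaks of $L/K$ are said to be defined, and are the elements of this common set. SS$_k$: for $\gamma\in R$ let $\hat v_L(\gamma)=\min\{v_L(\gamma(x))-v_L(x):x\in L^\times\}$, and for $\overline{\gamma}\in\overline{R}$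 let $\hat v_L(\overline{\gamma})=\max\{\hat v_L(\gamma'):\gamma'\in\overline{\gamma}\}$. For $h\ge 0$ let $\overline{G}^{[\mathbb{F}]}_h=\{\overline{\gamma}\in\overline{G}^{[\mathbb{F}]}:\hat v_L(\overline{\gamma}-\overline{1})\ge h\}$. An integer $h\ge0$ is an SS$_k$-refined break of $L/K$ if $\overline{G}^{[\mathbb{F}]}_{h+1}\ne\overline{G}^{[\mathbb{F}]}_h$. *)

theory Defs
  imports
    "HOL-Library.Extended_Real"
    "HOL-Number_Theory.Cong"
    "HOL-Algebra.QuotRing"
    "HOL-Algebra.Ideal_Product"
    "HOL-Algebra.Product_Groups"
begin

section \<open>Local fields\<close>

text \<open>Valuations take values in \<open>\<int> \<union> {\<infinity>}\<close>, which is embedded in the extended reals;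
  normalized means that the value group is all of \<open>\<int>\<close>.\<close>

definition normalized_valuation :: "('a::field \<Rightarrow> ereal) \<Rightarrow> bool" where
  "normalized_valuation v \<longleftrightarrow>
     (\<forall>x. v x = \<infinity> \<longleftrightarrow> x = 0) \<and>
     (\<forall>x y. v (x * y) = v x + v y) \<and>
     (\<forall>x y. min (v x) (v y) \<le> v (x + y)) \<and>
     v ` (UNIV - {0}) = range (\<lambda>m::int. ereal (real_of_int m))"

definition valuation_Cauchy :: "('a::field \<Rightarrow> ereal) \<Rightarrow> (nat \<Rightarrow> 'a) \<Rightarrow> bool" where
  "valuation_Cauchy v X \<longleftrightarrow>
     (\<forall>N::int. \<exists>M. \<forall>i\<ge>M. \<forall>j\<ge>M. v (X i - X j) \<ge> ereal (real_of_int N))"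

definition valuation_converges :: "('a::field \<Rightarrow> ereal) \<Rightarrow> (nat \<Rightarrow> 'a) \<Rightarrow> 'a \<Rightarrow> bool" where
  "valuation_converges v X x \<longleftrightarrow>
     (\<forall>N::int. \<exists>M. \<forall>i\<ge>M. v (X i - x) \<ge> ereal (real_of_int N))"

definition local_field :: "('a::field \<Rightarrow> ereal) \<Rightarrow> bool" where
  "local_field v \<longleftrightarrow> normalized_valuation v \<and>
     (\<forall>X. valuation_Cauchy v X \<longrightarrow> (\<exists>x. valuation_converges v X x))"

definition is_subfield :: "'a::field set \<Rightarrow> bool" where
  "is_subfield S \<longleftrightarrow> 1 \<in> S \<and> (\<forall>x\<in>S. \<forall>y\<in>S. x - y \<in> S \<and> x * y \<in> S) \<and>
     (\<forall>x\<in>S. inverse x \<in> S)"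

text \<open>A copy of the residue field inside the valued field: a subfield of the valuation ring
  that contains exactly one representative of every residue class.\<close>

definition coefficient_field :: "('a::field \<Rightarrow> ereal) \<Rightarrow> 'a set \<Rightarrow> bool" where
  "coefficient_field v F \<longleftrightarrow> is_subfield F \<and> (\<forall>a\<in>F. v a \<ge> 0) \<and>
     (\<forall>x. v x \<ge> 0 \<longrightarrow> (\<exists>!a. a \<in> F \<and> v (x - a) > 0))"

definition perfect_subfield :: "'a::field set \<Rightarrow> bool" where
  "perfect_subfield F \<longleftrightarrow> is_subfield F \<and>
     (CHAR('a) = 0 \<or> (\<forall>a\<in>F. \<exists>c\<in>F. c ^ CHAR('a) = a))"


section \<open>Galois extensions and ramification\<close>

text \<open>An extension \<open>L/K\<close> is a homomorphism \<open>emb\<close> of the field \<open>'k\<close> into the field \<open>'l\<close>.\<close>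

definition field_embedding :: "('k::field \<Rightarrow> 'l::field) \<Rightarrow> bool" where
  "field_embedding f \<longleftrightarrow> f 1 = 1 \<and> (\<forall>x y. f (x + y) = f x + f y) \<and> (\<forall>x y. f (x * y) = f x * f y)"

definition finite_extension :: "('k::field \<Rightarrow> 'l::field) \<Rightarrow> bool" where
  "finite_extension emb \<longleftrightarrow> field_embedding emb \<and>
     (\<exists>B. finite_dimensional_vector_space (\<lambda>c x. emb c * x) B)"

definition ext_degree :: "('k::field \<Rightarrow> 'l::field) \<Rightarrow> nat" where
  "ext_degree emb = vector_space.dim (\<lambda>c x. emb c * x) (UNIV :: 'l set)"

definition galois_group :: "('k::field \<Rightarrow> 'l::field) \<Rightarrow> ('l \<Rightarrow> 'l) monoid" where
  "galois_group emb =
     \<lparr>carrier = {\<sigma>. field_embedding \<sigma> \<and> bij \<sigma> \<and> (\<forall>c. \<sigma> (emb c) = emb c)},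
      monoid.mult = (\<circ>), one = id\<rparr>"

definition galois_extension :: "('k::field \<Rightarrow> 'l::field) \<Rightarrow> bool" where
  "galois_extension emb \<longleftrightarrow> finite_extension emb \<and>
     {x. \<forall>\<sigma>\<in>carrier (galois_group emb). \<sigma> x = x} = range emb"

text \<open>The ramification index \<open>e\<close>, given by \<open>v\<^sub>L = e v\<^sub>K\<close> on \<open>K\<close>, equals the degree.\<close>

definition totally_ramified ::
    "('k::field \<Rightarrow> ereal) \<Rightarrow> ('l::field \<Rightarrow> ereal) \<Rightarrow> ('k \<Rightarrow> 'l) \<Rightarrow> bool" where
  "totally_ramified vK vL emb \<longleftrightarrow> finite_extension emb \<and>
     (\<forall>c. vL (emb c) = ereal (real (ext_degree emb)) * vK c)"

definition ramification_group ::
    "('l::field \<Rightarrow> ereal) \<Rightarrow> ('k::field \<Rightarrow> 'l) \<Rightarrow> int \<Rightarrow> ('l \<Rightarrow> 'l) set" where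
  "ramification_group vL emb i =
     {\<sigma> \<in> carrier (galois_group emb). \<forall>x. vL x \<ge> 0 \<longrightarrow> vL (\<sigma> x - x) \<ge> ereal (real_of_int (i + 1))}"

definition ramification_breaks :: "('l::field \<Rightarrow> ereal) \<Rightarrow> ('k::field \<Rightarrow> 'l) \<Rightarrow> int set" where
  "ramification_breaks vL emb =
     {i. i \<ge> -1 \<and> ramification_group vL emb (i + 1) \<noteq> ramification_group vL emb i}"


section \<open>Artin--Schreier data\<close>

text \<open>Linear independence over the prime field \<open>\<bbbF>\<^sub>p = {of_int c | c}\<close> of a family indexed by
  \<open>{1..n}\<close>.\<close>

definition prime_field_independent :: "nat \<Rightarrow> nat \<Rightarrow> (nat \<Rightarrow> 'k::field) \<Rightarrow> bool" where
  "prime_field_independent p n \<omega> \<longleftrightarrow>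
     (\<forall>c :: nat \<Rightarrow> int. (\<Sum>i=1..n. of_int (c i) * \<omega> i) = 0 \<longrightarrow> (\<forall>i\<in>{1..n}. int p dvd c i))"

definition adjoin :: "('k::field \<Rightarrow> 'l::field) \<Rightarrow> 'l set \<Rightarrow> 'l set" where
  "adjoin emb X = \<Inter> {S. is_subfield S \<and> range emb \<subseteq> S \<and> X \<subseteq> S}"

definition artin_schreier_data ::
    "('k::field \<Rightarrow> ereal) \<Rightarrow> 'k set \<Rightarrow> ('k \<Rightarrow> 'l::field) \<Rightarrow> nat \<Rightarrow> nat \<Rightarrow> int \<Rightarrow>
      'k \<Rightarrow> (nat \<Rightarrow> 'k) \<Rightarrow> (nat \<Rightarrow> 'k) \<Rightarrow> bool" where
  "artin_schreier_data vK F emb p n b \<beta> \<omega> \<epsilon> \<longleftrightarrow>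
     vK \<beta> = ereal (real_of_int (- b)) \<and>
     (\<forall>i\<in>{1..n}. \<omega> i \<in> F) \<and>
     prime_field_independent p n \<omega> \<and>
     (\<forall>i\<in>{1..n}. vK (\<epsilon> i) > ereal (real_of_int (- b))) \<and>
     (\<forall>i\<in>{1..n}. (\<exists>m::int. vK (\<epsilon> i) = ereal (real_of_int m) \<and> m < 0 \<and> \<not> int p dvd m) \<or> \<epsilon> i \<in> F) \<and>
     (\<exists>x :: nat \<Rightarrow> 'l.
        (\<forall>i\<in>{1..n}. x i ^ p - x i = emb (\<omega> i ^ (p ^ n) * \<beta> + \<epsilon> i)) \<and>
        adjoin emb (x ` {1..n}) = UNIV)"


section \<open>The group algebra and its truncated powers\<close>

text \<open>The group algebra \<open>F[G]\<close> of a finite group \<open>G\<close>: coefficient functions supported on \<open>G\<close>,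
  with convolution as product.\<close>

definition group_algebra ::
    "'k::field set \<Rightarrow> ('g, 'm) monoid_scheme \<Rightarrow> ('g \<Rightarrow> 'k) ring" where
  "group_algebra F G =
     \<lparr>carrier = {a. (\<forall>g\<in>carrier G. a g \<in> F) \<and> (\<forall>g. g \<notin> carrier G \<longrightarrow> a g = 0)},
      monoid.mult = (\<lambda>a c g. \<Sum>(s, t)\<in>{(s, t). s \<in> carrier G \<and> t \<in> carrier G \<and> s \<otimes>\<^bsub>G\<^esub> t = g}. a s * c t),
      one = (\<lambda>g. if g = \<one>\<^bsub>G\<^esub> then 1 else 0),
      zero = (\<lambda>g. 0),
      add = (\<lambda>a c g. a g + c g)\<rparr>"

definition group_element :: "'g \<Rightarrow> 'g \<Rightarrow> 'k::field" where
  "group_element g = (\<lambda>h. if h = g then 1 else 0)"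

definition augmentation_ideal ::
    "'k::field set \<Rightarrow> ('g, 'm) monoid_scheme \<Rightarrow> ('g \<Rightarrow> 'k) set" where
  "augmentation_ideal F G = {a \<in> carrier (group_algebra F G). (\<Sum>g\<in>carrier G. a g) = 0}"

definition augmentation_power ::
    "'k::field set \<Rightarrow> ('g, 'm) monoid_scheme \<Rightarrow> nat \<Rightarrow> ('g \<Rightarrow> 'k) set" where
  "augmentation_power F G k = augmentation_ideal F G [^]\<^bsub>ideals_set (group_algebra F G)\<^esub> k"

text \<open>The binomial coefficient in characteristic \<open>p\<close>, meaningful for \<open>i < p\<close>
  (\<open>gbinomial\<close> requires characteristic 0).\<close>

definition field_binomial :: "'k::field \<Rightarrow> nat \<Rightarrow> 'k" where
  "field_binomial w i = (\<Prod>j<i. w - of_nat j) / of_nat (fact i)"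

definition truncated_power ::
    "'k::field set \<Rightarrow> ('g, 'm) monoid_scheme \<Rightarrow> nat \<Rightarrow> ('g \<Rightarrow> 'k) \<Rightarrow> 'k \<Rightarrow> ('g \<Rightarrow> 'k)" where
  "truncated_power F G p \<gamma> w =
     (\<lambda>g. \<Sum>i<p. field_binomial w i *
        ((\<gamma> \<ominus>\<^bsub>group_algebra F G\<^esub> \<one>\<^bsub>group_algebra F G\<^esub>) [^]\<^bsub>group_algebra F G\<^esub> i) g)"

definition truncated_algebra ::
    "'k::field set \<Rightarrow> ('g, 'm) monoid_scheme \<Rightarrow> nat \<Rightarrow> ('g \<Rightarrow> 'k) set ring" where
  "truncated_algebra F G k = group_algebra F G Quot augmentation_power F G k"

definition truncated_class ::
    "'k::field set \<Rightarrow> ('g, 'm) monoid_scheme \<Rightarrow> nat \<Rightarrow> ('g \<Rightarrow> 'k) \<Rightarrow> ('g \<Rightarrow> 'k) set" where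
  "truncated_class F G k \<gamma> = augmentation_power F G k +>\<^bsub>group_algebra F G\<^esub> \<gamma>"

text \<open>The \<open>F\<close>-span of the image of \<open>G\<close> in the \<open>F\<close>-vector space \<open>(1 + A) / (1 + A\<^sup>k)\<close>, viewed inside
  \<open>F[G] / A\<^sup>k\<close>: vector addition is multiplication in the quotient ring, and scalar multiplication
  is the truncated power. Its elements are cosets, i.e. sets of elements of \<open>F[G]\<close>. The set \<open>1 + A\<close>
  is the coset of \<open>1\<close> modulo \<open>A\<close>.\<close>

inductive_set G_span ::
    "'k::field set \<Rightarrow> ('g, 'm) monoid_scheme \<Rightarrow> nat \<Rightarrow> nat \<Rightarrow> ('g \<Rightarrow> 'k) set set"
  for F :: "'k::field set" and G :: "('g, 'm) monoid_scheme" and p :: nat and k :: nat where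
  one: "\<one>\<^bsub>truncated_algebra F G k\<^esub> \<in> G_span F G p k"
| element: "g \<in> carrier G \<Longrightarrow> truncated_class F G k (group_element g) \<in> G_span F G p k"
| mult: "X \<in> G_span F G p k \<Longrightarrow> Y \<in> G_span F G p k \<Longrightarrow>
    X \<otimes>\<^bsub>truncated_algebra F G k\<^esub> Y \<in> G_span F G p k"
| scale: "\<gamma> \<in> augmentation_ideal F G +>\<^bsub>group_algebra F G\<^esub> \<one>\<^bsub>group_algebra F G\<^esub> \<Longrightarrow> w \<in> F \<Longrightarrow>
    truncated_class F G k \<gamma> \<in> G_span F G p k \<Longrightarrow>
    truncated_class F G k (truncated_power F G p \<gamma> w) \<in> G_span F G p k"

definition galois_span :: "'k::field set \<Rightarrow> ('k \<Rightarrow> 'l::field) \<Rightarrow> nat \<Rightarrow> nat \<Rightarrow> (('l \<Rightarrow> 'l) \<Rightarrow> 'k) set set" where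
  "galois_span F emb p k = G_span F (galois_group emb) p k"

definition act :: "('k::field \<Rightarrow> 'l::field) \<Rightarrow> (('l \<Rightarrow> 'l) \<Rightarrow> 'k) \<Rightarrow> 'l \<Rightarrow> 'l" where
  "act emb a x = (\<Sum>\<sigma>\<in>carrier (galois_group emb). emb (a \<sigma>) * \<sigma> x)"


section \<open>Refined breaks: valuation criterion elements\<close>

definition vc_element :: "('l::field \<Rightarrow> ereal) \<Rightarrow> nat \<Rightarrow> nat \<Rightarrow> int \<Rightarrow> 'l \<Rightarrow> bool" where
  "vc_element vL p n b \<rho> \<longleftrightarrow>
     (\<exists>m::int. vL \<rho> = ereal (real_of_int m) \<and> [m = b] (mod int (p ^ n)))"

definition vc_index ::
    "'k::field set \<Rightarrow> ('l::field \<Rightarrow> ereal) \<Rightarrow> ('k \<Rightarrow> 'l) \<Rightarrow> 'l \<Rightarrow> (('l \<Rightarrow> 'l) \<Rightarrow> 'k) set \<Rightarrow> ereal" where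
  "vc_index F vL emb \<rho> X =
     (GREATEST y. \<exists>\<gamma>\<in>X. y = vL (act emb
        (\<gamma> \<ominus>\<^bsub>group_algebra F (galois_group emb)\<^esub> \<one>\<^bsub>group_algebra F (galois_group emb)\<^esub>) \<rho>))"

definition vc_set ::
    "'k::field set \<Rightarrow> ('l::field \<Rightarrow> ereal) \<Rightarrow> ('k \<Rightarrow> 'l) \<Rightarrow> nat \<Rightarrow> nat \<Rightarrow> 'l \<Rightarrow> ereal set" where
  "vc_set F vL emb p k \<rho> =
     {vc_index F vL emb \<rho> X - vL \<rho> | X.
        X \<in> galois_span F emb p k \<and> X \<noteq> \<one>\<^bsub>truncated_algebra F (galois_group emb) k\<^esub>}"

definition vc_breaks_defined ::
    "'k::field set \<Rightarrow> ('l::field \<Rightarrow> ereal) \<Rightarrow> ('k \<Rightarrow> 'l) \<Rightarrow> nat \<Rightarrow> nat \<Rightarrow> int \<Rightarrow> nat \<Rightarrow> bool" where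
  "vc_breaks_defined F vL emb p n b k \<longleftrightarrow>
     (\<forall>\<rho> \<rho>'. vc_element vL p n b \<rho> \<longrightarrow> vc_element vL p n b \<rho>' \<longrightarrow>
        vc_set F vL emb p k \<rho> = vc_set F vL emb p k \<rho>')"

definition vc_refined_breaks ::
    "'k::field set \<Rightarrow> ('l::field \<Rightarrow> ereal) \<Rightarrow> ('k \<Rightarrow> 'l) \<Rightarrow> nat \<Rightarrow> nat \<Rightarrow> int \<Rightarrow> nat \<Rightarrow> ereal set" where
  "vc_refined_breaks F vL emb p n b k =
     (THE B. \<forall>\<rho>. vc_element vL p n b \<rho> \<longrightarrow> vc_set F vL emb p k \<rho> = B)"


section \<open>Refined breaks: valuations of operators\<close>

definition operator_valuation ::
    "('l::field \<Rightarrow> ereal) \<Rightarrow> ('k::field \<Rightarrow> 'l) \<Rightarrow> (('l \<Rightarrow> 'l) \<Rightarrow> 'k) \<Rightarrow> ereal" where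
  "operator_valuation vL emb \<gamma> = (LEAST y. \<exists>x. x \<noteq> 0 \<and> y = vL (act emb \<gamma> x) - vL x)"

definition class_valuation ::
    "('l::field \<Rightarrow> ereal) \<Rightarrow> ('k::field \<Rightarrow> 'l) \<Rightarrow> (('l \<Rightarrow> 'l) \<Rightarrow> 'k) set \<Rightarrow> ereal" where
  "class_valuation vL emb X = (GREATEST y. \<exists>\<gamma>\<in>X. y = operator_valuation vL emb \<gamma>)"

definition ss_filtration ::
    "'k::field set \<Rightarrow> ('l::field \<Rightarrow> ereal) \<Rightarrow> ('k \<Rightarrow> 'l) \<Rightarrow> nat \<Rightarrow> nat \<Rightarrow> nat \<Rightarrow> (('l \<Rightarrow> 'l) \<Rightarrow> 'k) set set" where
  "ss_filtration F vL emb p k h =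
     {X \<in> galois_span F emb p k.
        class_valuation vL emb
          (X \<ominus>\<^bsub>truncated_algebra F (galois_group emb) k\<^esub> \<one>\<^bsub>truncated_algebra F (galois_group emb) k\<^esub>)
        \<ge> ereal (real h)}"

definition ss_refined_breaks ::
    "'k::field set \<Rightarrow> ('l::field \<Rightarrow> ereal) \<Rightarrow> ('k \<Rightarrow> 'l) \<Rightarrow> nat \<Rightarrow> nat \<Rightarrow> ereal set" where
  "ss_refined_breaks F vL emb p k =
     {ereal (real h) | h. ss_filtration F vL emb p k (h + 1) \<noteq> ss_filtration F vL emb p k h}"

end

theory Submission
  imports Defs "HOL-Computational_Algebra.Polynomial" "HOL-Computational_Algebra.Primes"
begin

text \<open>Suitable \<open>F\<close>-combinations \<open>Y 1, \<dots>, Y n\<close> of the Artin--Schreier generators, the last one corrected by a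
  polynomial in \<open>x 1\<close> over \<open>K\<close>, have \<open>v\<^sub>L (Y j) = - p\<^bsup>n-j\<^esup> b\<close>. Since \<open>p\<close> does not divide \<open>b\<close>, the monomials in the \<open>Y j\<close>
  with exponents below \<open>p\<close> have distinct valuations modulo \<open>p\<^sup>n\<close>, so they form a basis of \<open>L/K\<close> in which valuations
  can be read off. Lagrange interpolation produces, for every \<open>w \<in> F\<^sup>n\<close>, an element \<open>\<gamma>\<^sub>w\<close> of \<open>F[G]\<close> that acts on this
  basis almost as the translation by \<open>w\<close>, and the classes of the \<open>\<gamma>\<^sub>w\<close> are the \<open>F\<close>-span of \<open>G\<close> in
  \<open>(1 + A)/(1 + A\<^sup>k)\<close> because \<open>k \<le> p\<close>. The operator \<open>\<gamma>\<^sub>w - 1\<close> raises every valuation by at least an amount \<open>t\<^sub>w\<close>, and the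
  valuation of a valuation criterion element by exactly \<open>t\<^sub>w\<close>. No modification of \<open>\<gamma>\<^sub>w\<close> by an element of \<open>A\<^sup>2\<close> improves
  this on a valuation criterion element. Hence both kinds of refined breaks are the numbers \<open>t\<^sub>w\<close>, \<open>w \<noteq> 0\<close>.\<close>

section \<open>Interpolation in characteristic \<open>p\<close>\<close>

text \<open>The assumption on the \<epsilon> i enters through powers. Raising a combination of the
  \<open>x i\<close> to the power \<open>p^j\<close> produces \<open>\<epsilon> i ^ (p^l)\<close>
  for \<open>l < j\<close>, and the assumption keeps these above \<open>- b\<close> for
  \<open>l \<le> n - 2\<close>. The combinations with \<open>j < n\<close> therefore behave as if
  the \<epsilon> i were absent, while the last one does not: this is the obstacle. A polynomial in
  \<open>x 1\<close> absorbs the bad part, at the price that a Galois element moves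
  \<open>Y n\<close> by its linear form plus \<kappa> of its first coordinate. Hence coordinate
  \<open>1\<close> cannot be interpolated away, the threshold for \<open>j = 1\<close> is a minimum,
  and optimality needs a second argument. That argument lives on
  \<open>k0 > p^(n-1) * b - p * b\<close>, which is what the assumption yields: applying \<sigma> -
  1 another \<open>p - 2\<close> times raises a gain of \<open>k0 + b\<close> to
  \<open>k0 + (p - 1) * b\<close>, beyond the gain \<open>(p^(n-1) - 1) * b\<close> of the trace,
  which is the largest possible.\<close>

lemma of_nat_inj_on_char:
  fixes m m' :: nat
  assumes "CHAR('a::idom) = p" "m < p" "m' < p" "(of_nat m :: 'a) = of_nat m'"
  shows "m = m'"
proof -
  have "[m = m'] (mod p)" using assms(1,4) of_nat_eq_iff_cong_CHAR by blast
  thus ?thesis using assms(2,3) by (simp add: cong_def)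
qed

lemma of_nat_power_char:
  assumes "prime p" "CHAR('a::idom) = p"
  shows "(of_nat m :: 'a) ^ p = of_nat m"
proof (induction m)
  case 0
  show ?case using prime_gt_0_nat[OF assms(1)] by simp
next
  case (Suc m)
  have "(of_nat (Suc m) :: 'a) ^ p = (1 + of_nat m) ^ p" by simp
  also have "\<dots> = 1 ^ p + of_nat m ^ p"
    by (rule freshmans_dream) (use assms in auto)
  finally show ?case using Suc by simp
qed

text \<open>\<open>X^p - X\<close> has at most \<open>p\<close> roots, and the \<open>p\<close>
  residues are already roots. This recognises prime field elements, both among differences of
  Artin-Schreier roots and in \<open>moore\<close>.\<close>

lemma power_char_eq_self_imp_of_nat:
  assumes "prime p" "CHAR('a::idom) = p" "(x::'a) ^ p = x"
  shows "\<exists>m<p. x = of_nat m"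
proof (rule ccontr)
  assume "\<not> ?thesis"
  hence x: "x \<notin> of_nat ` {..<p}" by auto
  have p1: "p > 1" using prime_gt_1_nat[OF assms(1)] .
  define q :: "'a poly" where "q = monom 1 p - monom 1 1"
  have q0: "q \<noteq> 0"
  proof
    assume "q = 0"
    hence "coeff q p = 0" by simp
    thus False using p1 by (simp add: q_def)
  qed
  have "degree q \<le> p"
    unfolding q_def by (rule degree_diff_le) (use p1 in \<open>auto simp: degree_monom_eq\<close>)
  hence "card {y. poly q y = 0} \<le> p" using card_poly_roots_bound[OF q0] by simp
  moreover have "insert x (of_nat ` {..<p}) \<subseteq> {y. poly q y = 0}"
    using of_nat_power_char[OF assms(1,2)] assms(3) by (auto simp: q_def poly_monom)
  hence "card (insert x (of_nat ` {..<p})) \<le> card {y. poly q y = 0}"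
    by (intro card_mono poly_roots_finite q0)
  moreover have "card (of_nat ` {..<p} :: 'a set) = p"
    by (subst card_image) (auto intro!: inj_onI dest: of_nat_inj_on_char[OF assms(2)])
  hence "card (insert x (of_nat ` {..<p})) = Suc p" using x by simp
  ultimately show False by simp
qed

text \<open>On \<open>\<bbbF>\<^sub>p\<close> the polynomial \<open>1 - z\<^bsup>p-1\<^esup>\<close> is the indicator of \<open>0\<close>, so its translates by \<open>\<bbbF>\<^sub>p\<close> are the
  Lagrange basis polynomials of degree \<open>p - 1\<close>.\<close>

definition ell :: "nat \<Rightarrow> 'a::comm_ring_1 \<Rightarrow> 'a" where
  "ell p z = 1 - z ^ (p - 1)"

lemma ell_of_nat:
  assumes "prime p" "CHAR('a::idom) = p" "m < p" "m' < p"
  shows "ell p (of_nat m - of_nat m' :: 'a) = (if m = m' then 1 else 0)"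
proof (cases "m = m'")
  case True
  thus ?thesis using prime_gt_1_nat[OF assms(1)] by (simp add: ell_def zero_power)
next
  case False
  define y :: 'a where "y = of_nat m - of_nat m'"
  have y0: "y \<noteq> 0"
    using False of_nat_inj_on_char[OF assms(2,3,4)] by (auto simp: y_def)
  have "(y + of_nat m') ^ p = y ^ p + of_nat m' ^ p"
    by (rule freshmans_dream) (use assms in auto)
  hence "y ^ p = y"
    using of_nat_power_char[OF assms(1,2), of m] of_nat_power_char[OF assms(1,2), of m']
    by (simp add: y_def eq_diff_eq)
  moreover have "y ^ p = y * y ^ (p - 1)"
    using prime_gt_0_nat[OF assms(1)] by (simp flip: power_Suc)
  ultimately have "y ^ (p - 1) = 1" using y0 by simp
  thus ?thesis using False by (simp add: ell_def y_def)
qed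

lemma ell_0: "prime p \<Longrightarrow> ell p 0 = 1"
  using prime_gt_1_nat[of p] by (simp add: ell_def zero_power)

text \<open>Both sides have degree below \<open>p\<close> and agree at the \<open>p\<close> nodes.
  The nodes form a translate of the prime field by an arbitrary \<open>r\<close>, because later the
  node of one coordinate is displaced by the earlier coordinates.\<close>

lemma lagrange_poly:
  fixes g :: "'a::idom poly" and r :: 'a
  assumes "prime p" "CHAR('a) = p" "degree g < p"
  shows "(\<Sum>m<p. smult (poly g (r + of_nat m)) (1 - [:- (r + of_nat m), 1:] ^ (p - 1))) = g"
proof (rule poly_eqI_degree[where A = "(\<lambda>m. r + of_nat m) ` {..<p}"])
  have inj: "inj_on (\<lambda>m. r + of_nat m) {..<p}"
    by (auto intro!: inj_onI dest: of_nat_inj_on_char[OF assms(2)])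
  have c: "card ((\<lambda>m. r + of_nat m) ` {..<p}) = p" using inj by (simp add: card_image)
  show "degree g < card ((\<lambda>m. r + of_nat m) ` {..<p})" using assms(3) c by simp
  have "degree (smult (poly g (r + of_nat m)) (1 - [:- (r + of_nat m), 1:] ^ (p - 1))) \<le> p - 1" for m
  proof -
    have "degree (1 - [:- (r + of_nat m), 1:] ^ (p - 1)) \<le> p - 1"
      by (rule degree_diff_le) (auto simp: degree_linear_power)
    thus ?thesis using degree_smult_le le_trans by blast
  qed
  hence "degree (\<Sum>m<p. smult (poly g (r + of_nat m)) (1 - [:- (r + of_nat m), 1:] ^ (p - 1))) \<le> p - 1"
    by (intro degree_sum_le) auto
  thus "degree (\<Sum>m<p. smult (poly g (r + of_nat m)) (1 - [:- (r + of_nat m), 1:] ^ (p - 1)))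
    < card ((\<lambda>m. r + of_nat m) ` {..<p})"
    using c prime_gt_0_nat[OF assms(1)] by linarith
next
  fix x assume "x \<in> (\<lambda>m. r + of_nat m) ` {..<p}"
  then obtain m' where m': "m' < p" "x = r + of_nat m'" by auto
  have "poly (\<Sum>m<p. smult (poly g (r + of_nat m)) (1 - [:- (r + of_nat m), 1:] ^ (p - 1))) x
     = (\<Sum>m<p. poly g (r + of_nat m) * ell p (of_nat m' - of_nat m))"
    by (simp add: poly_sum ell_def m' poly_power)
  also have "\<dots> = (\<Sum>m<p. if m = m' then poly g (r + of_nat m) else 0)"
    by (intro sum.cong refl) (use m' in \<open>auto simp: ell_of_nat[OF assms(1,2)] eq_commute\<close>)
  also have "\<dots> = poly g x" using m' by simp
  finally show "poly (\<Sum>m<p. smult (poly g (r + of_nat m)) (1 - [:- (r + of_nat m), 1:] ^ (p - 1))) x = poly g x" .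
qed

lemma lagrange:
  fixes g :: "'a::idom poly"
  assumes "prime p" "CHAR('a) = p" "degree g < p"
  shows "(\<Sum>m<p. ell p (w - (r + of_nat m)) * poly g (r + of_nat m)) = poly g w"
proof -
  have "poly g w = poly (\<Sum>m<p. smult (poly g (r + of_nat m)) (1 - [:- (r + of_nat m), 1:] ^ (p - 1))) w"
    by (simp only: lagrange_poly[OF assms])
  also have "\<dots> = (\<Sum>m<p. ell p (w - (r + of_nat m)) * poly g (r + of_nat m))"
    by (simp add: poly_sum ell_def poly_power algebra_simps)
  finally show ?thesis by simp
qed

text \<open>Compare coefficients of \<open>X^(p-1)\<close> in \<open>lagrange_poly\<close>: each
  basis polynomial has leading coefficient -1. Applied to powers, this computes traces of
  monomials.\<close>

lemma sum_poly_prime_field: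
  fixes g :: "'a::idom poly"
  assumes "prime p" "CHAR('a) = p" "degree g < p"
  shows "(\<Sum>m<p. poly g (r + of_nat m)) = - coeff g (p - 1)"
proof -
  have p1: "p > 1" using prime_gt_1_nat[OF assms(1)] .
  have *: "coeff (1 - [:- (r + of_nat m), 1:] ^ (p - 1)) (p - 1) = -1" for m
    using p1 lead_coeff_power[of "[:- (r + of_nat m), 1:]" "p - 1"]
    by (simp add: degree_linear_power coeff_1)
  have "coeff g (p - 1) = coeff (\<Sum>m<p. smult (poly g (r + of_nat m)) (1 - [:- (r + of_nat m), 1:] ^ (p - 1))) (p - 1)"
    by (simp only: lagrange_poly[OF assms])
  also have "\<dots> = (\<Sum>m<p. poly g (r + of_nat m) * (-1))"
    unfolding coeff_sum coeff_smult * ..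
  also have "\<dots> = - (\<Sum>m<p. poly g (r + of_nat m))" by (simp add: sum_negf)
  finally show ?thesis by simp
qed

lemma lagrange_power:
  fixes c :: "'a::idom"
  assumes "prime p" "CHAR('a) = p" "a < p"
  shows "(\<Sum>m<p. ell p (w - (r + of_nat m)) * (c + (r + of_nat m)) ^ a) = (c + w) ^ a"
  using lagrange[OF assms(1,2), of "[:c, 1:] ^ a" w r] assms(3)
  by (simp add: degree_linear_power poly_power)

lemma sum_ell: "prime p \<Longrightarrow> CHAR('a::idom) = p \<Longrightarrow> (\<Sum>m<p. ell p (w - of_nat m)) = (1::'a)"
  using lagrange_power[of p 0 w 0 0] prime_gt_0_nat[of p] by simp

lemma sum_power_prime_field:
  fixes c :: "'a::idom"
  assumes "prime p" "CHAR('a) = p" "a < p"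
  shows "(\<Sum>m<p. (c + of_nat m) ^ a) = (if a = p - 1 then -1 else 0)"
proof -
  have "(\<Sum>m<p. (c + of_nat m) ^ a) = - coeff ([:c, 1:] ^ a) (p - 1)"
    using sum_poly_prime_field[OF assms(1,2), of "[:c, 1:] ^ a" 0] assms(3)
    by (simp add: degree_linear_power poly_power)
  moreover have "coeff ([:c, 1:] ^ a) (p - 1) = (if a = p - 1 then 1 else 0)"
  proof (cases "a = p - 1")
    case True
    thus ?thesis using lead_coeff_power[of "[:c, 1:]" a] by (simp add: degree_linear_power)
  next
    case False
    thus ?thesis using assms(3) by (simp add: coeff_eq_0 degree_linear_power)
  qed
  ultimately show ?thesis by simp
qed

section \<open>Forward differences and Newton interpolation\<close>

fun fdiff :: "(nat \<Rightarrow> 'a::ab_group_add) \<Rightarrow> nat \<Rightarrow> nat \<Rightarrow> 'a" where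
  "fdiff h 0 m = h m"
| "fdiff h (Suc i) m = fdiff h i (Suc m) - fdiff h i m"

lemma newton_nat:
  fixes h :: "nat \<Rightarrow> 'a::comm_ring_1"
  shows "fdiff h j (m0 + m) = (\<Sum>i\<le>m. of_nat (m choose i) * fdiff h (j + i) m0)"
proof (induction m arbitrary: j)
  case (Suc m)
  have "fdiff h j (m0 + Suc m) = fdiff h j (m0 + m) + fdiff h (Suc j) (m0 + m)" by simp
  also have "\<dots> = (\<Sum>i\<le>m. of_nat (m choose i) * fdiff h (j + i) m0)
      + (\<Sum>i\<le>m. of_nat (m choose i) * fdiff h (j + Suc i) m0)"
    by (simp only: Suc) simp
  also have "(\<Sum>i\<le>m. of_nat (m choose i) * fdiff h (j + i) m0)
      = (\<Sum>i\<le>Suc m. of_nat (m choose i) * fdiff h (j + i) m0)"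
    by (simp add: binomial_eq_0)
  also have "\<dots> = fdiff h j m0 + (\<Sum>i\<le>m. of_nat (m choose Suc i) * fdiff h (j + Suc i) m0)"
    by (subst sum.atMost_Suc_shift) simp
  also have "\<dots> + (\<Sum>i\<le>m. of_nat (m choose i) * fdiff h (j + Suc i) m0)
      = fdiff h j m0 + (\<Sum>i\<le>m. of_nat (Suc m choose Suc i) * fdiff h (j + Suc i) m0)"
    by (simp add: sum.distrib[symmetric] algebra_simps)
  also have "\<dots> = (\<Sum>i\<le>Suc m. of_nat (Suc m choose i) * fdiff h (j + i) m0)"
    by (subst sum.atMost_Suc_shift) simp
  finally show ?case .
qed simp

text \<open>With \<open>E\<close> the shift, \<open>(E - 1)^p = E^p - 1\<close> in characteristic
  \<open>p\<close>, because the inner binomial coefficients vanish. This is the form in which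
  \<open>(\<sigma> - 1)^p = 0\<close> is used.\<close>

lemma fdiff_periodic:
  fixes h :: "nat \<Rightarrow> 'a::comm_ring_1"
  assumes "prime p" "CHAR('a) = p" "\<And>m. h (m + p) = h m"
  shows "fdiff h p m = 0"
proof -
  have p0: "p > 0" using prime_gt_0_nat[OF assms(1)] .
  have "h (m + p) = (\<Sum>i\<le>p. of_nat (p choose i) * fdiff h i m)"
    using newton_nat[of h 0 m p] by simp
  also have "\<dots> = (\<Sum>i\<in>{0,p}. of_nat (p choose i) * fdiff h i m)"
  proof (rule sum.mono_neutral_right)
    show "\<forall>i\<in>{..p} - {0, p}. of_nat (p choose i) * fdiff h i m = 0"
    proof
      fix i assume "i \<in> {..p} - {0, p}"
      hence "p dvd (p choose i)" using assms(1) by (intro dvd_choose_prime) auto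
      hence "(of_nat (p choose i) :: 'a) = 0" using assms(2) of_nat_eq_0_iff_char_dvd by blast
      thus "of_nat (p choose i) * fdiff h i m = 0" by simp
    qed
  qed auto
  also have "\<dots> = h m + fdiff h p m" using p0 by simp
  finally show ?thesis using assms(3) by simp
qed

text \<open>Stated without division, so that it holds in every commutative ring; the quotient is
  taken only for \<open>i < p\<close>, where the factorial is invertible.\<close>

lemma of_nat_fact_binomial:
  "(of_nat (fact i) * of_nat (m choose i) :: 'a::comm_ring_1) = (\<Prod>j<i. of_nat m - of_nat j)"
proof (induction i)
  case (Suc i)
  have "Suc i * (m choose Suc i) = (m - i) * (m choose i)"
  proof (cases m)
    case (Suc m')
    thus ?thesis using binomial_absorb_comp[of m i] binomial_absorption[of i m] by simp
  qed simp
  hence "fact (Suc i) * (m choose Suc i) = (m - i) * (fact i * (m choose i))"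
    by (simp only: fact_Suc of_nat_id ac_simps)
  hence "(of_nat (fact (Suc i)) * of_nat (m choose Suc i) :: 'a)
      = of_nat (m - i) * (of_nat (fact i) * of_nat (m choose i))"
    by (metis of_nat_mult)
  also have "\<dots> = (of_nat m - of_nat i) * (of_nat (fact i) * of_nat (m choose i))"
    by (cases "i \<le> m") (simp_all add: of_nat_diff binomial_eq_0)
  finally show ?case by (simp add: Suc mult.commute)
qed simp

lemma of_nat_fact_nonzero:
  assumes "prime p" "CHAR('a::idom) = p" "i < p"
  shows "(of_nat (fact i) :: 'a) \<noteq> 0"
proof
  assume "(of_nat (fact i) :: 'a) = 0"
  hence "p dvd fact i" using assms(2) of_nat_eq_0_iff_char_dvd by blast
  thus False using assms(1,3) prime_dvd_fact_iff by auto
qed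

lemma field_binomial_of_nat:
  assumes "prime p" "CHAR('a::field) = p" "i < p"
  shows "field_binomial (of_nat m :: 'a) i = of_nat (m choose i)"
  unfolding field_binomial_def of_nat_fact_binomial[symmetric]
  using of_nat_fact_nonzero[OF assms] by simp

definition binomial_poly :: "nat \<Rightarrow> 'a::field poly" where
  "binomial_poly i = smult (inverse (of_nat (fact i))) (\<Prod>j<i. [:- of_nat j, 1:])"

lemma poly_binomial_poly: "poly (binomial_poly i) w = field_binomial w i"
  by (simp add: binomial_poly_def field_binomial_def poly_prod divide_inverse mult.commute)

lemma degree_binomial_poly: "degree (binomial_poly i :: 'a::field poly) \<le> i"
proof -
  have "degree (\<Prod>j<i. [:- of_nat j, 1 :: 'a:]) \<le> sum (degree \<circ> (\<lambda>j. [:- of_nat j, 1 :: 'a:])) {..<i}"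
    by (rule degree_prod_sum_le) simp
  also have "\<dots> = i" by simp
  finally show ?thesis unfolding binomial_poly_def using degree_smult_le le_trans by blast
qed

text \<open>Truncated powers are Newton series while the elements \<open>gam w\<close> are Lagrange
  sums; this lemma compares the two. Values of \<open>h\<close> at \<open>0, ..., p - 1\<close>
  suffice, since the differences involved see no others.\<close>

lemma newton_interpolation:
  fixes g :: "'a::field poly"
  assumes "prime p" "CHAR('a) = p" "degree g < p" "\<And>m. m < p \<Longrightarrow> h m = poly g (of_nat m)"
  shows "(\<Sum>i<p. field_binomial w i * fdiff h i 0) = poly g w"
proof -
  define q where "q = (\<Sum>i<p. smult (fdiff h i 0) (binomial_poly i))"
  have p0: "p > 0" using prime_gt_0_nat[OF assms(1)] .
  have "q = g"
  proof (rule poly_eqI_degree[where A = "of_nat ` {..<p}"])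
    have c: "card (of_nat ` {..<p} :: 'a set) = p"
      by (subst card_image) (auto intro!: inj_onI dest: of_nat_inj_on_char[OF assms(2)])
    show "degree g < card (of_nat ` {..<p} :: 'a set)" using c assms(3) by simp
    have "degree q \<le> p - 1"
      unfolding q_def
    proof (rule degree_sum_le)
      fix i assume "i \<in> {..<p}"
      hence "i \<le> p - 1" by auto
      thus "degree (smult (fdiff h i 0) (binomial_poly i)) \<le> p - 1"
        using degree_smult_le degree_binomial_poly le_trans by metis
    qed simp
    thus "degree q < card (of_nat ` {..<p} :: 'a set)" using c p0 by linarith
  next
    fix x :: 'a assume "x \<in> of_nat ` {..<p}"
    then obtain m where m: "m < p" "x = of_nat m" by auto
    have "poly q x = (\<Sum>i<p. fdiff h i 0 * of_nat (m choose i))"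
      unfolding q_def poly_sum using field_binomial_of_nat[OF assms(1,2)]
      by (intro sum.cong) (simp_all add: poly_binomial_poly m)
    also have "\<dots> = (\<Sum>i\<le>m. fdiff h i 0 * of_nat (m choose i))"
      by (rule sum.mono_neutral_right) (use m in \<open>auto simp: binomial_eq_0\<close>)
    also have "\<dots> = h m" using newton_nat[of h 0 0 m] by (simp add: mult.commute)
    finally show "poly q x = poly g x" using assms(4) m by simp
  qed
  hence "poly g w = poly q w" by simp
  also have "\<dots> = (\<Sum>i<p. field_binomial w i * fdiff h i 0)"
    by (simp add: q_def poly_sum poly_binomial_poly mult.commute)
  finally show ?thesis by simp
qed

section \<open>Discrete valuations\<close>

text \<open>Integer bounds keep \<open>ereal\<close> arithmetic out of the estimates. The element
  \<open>0\<close> satisfies every \<open>vge\<close>, so zero terms of a sum need no case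
  distinction.\<close>

definition vge :: "('a \<Rightarrow> ereal) \<Rightarrow> 'a \<Rightarrow> int \<Rightarrow> bool" where
  "vge v x m \<longleftrightarrow> v x \<ge> ereal (real_of_int m)"

definition veq :: "('a \<Rightarrow> ereal) \<Rightarrow> 'a \<Rightarrow> int \<Rightarrow> bool" where
  "veq v x m \<longleftrightarrow> v x = ereal (real_of_int m)"

locale nval =
  fixes v :: "'a::field \<Rightarrow> ereal"
  assumes nv: "normalized_valuation v"
begin

lemma v_infty: "v x = \<infinity> \<longleftrightarrow> x = 0"
  and v_mult: "v (x * y) = v x + v y"
  and v_add: "min (v x) (v y) \<le> v (x + y)"
  and v_range: "v ` (UNIV - {0}) = range (\<lambda>m::int. ereal (real_of_int m))"
  using nv unfolding normalized_valuation_def by auto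

lemma veq_ex: "x \<noteq> 0 \<Longrightarrow> \<exists>m. veq v x m"
  using v_range unfolding veq_def by (metis (no_types, lifting) DiffI UNIV_I image_eqI imageE singletonD)

lemma veq_surj: "\<exists>x. veq v x m"
  using v_range unfolding veq_def by (metis (no_types, lifting) imageE rangeI)

lemma veq_unique: "veq v x m \<Longrightarrow> veq v x k \<Longrightarrow> m = k"
  unfolding veq_def by simp

lemma veq_nz: "veq v x m \<Longrightarrow> x \<noteq> 0"
  using v_infty[of x] unfolding veq_def by auto

lemma vge_0 [simp]: "vge v 0 m"
  using v_infty[of 0] unfolding vge_def by simp

lemma vge_veq_iff: "veq v x m \<Longrightarrow> vge v x k \<longleftrightarrow> k \<le> m"
  unfolding veq_def vge_def by simp

lemma veq_vge: "veq v x m \<Longrightarrow> k \<le> m \<Longrightarrow> vge v x k"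
  by (simp add: vge_veq_iff)

lemma vge_iff: "vge v x m \<longleftrightarrow> x = 0 \<or> (\<exists>k\<ge>m. veq v x k)"
  using veq_ex[of x] vge_veq_iff[of x] by auto

lemma vge_mono: "vge v x m \<Longrightarrow> k \<le> m \<Longrightarrow> vge v x k"
  unfolding vge_iff by force

lemma vge_cases: "vge v x m \<Longrightarrow> veq v x m \<or> vge v x (m + 1)"
  unfolding vge_iff by (metis add.commute linorder_not_less order_antisym zless_add1_eq add1_zle_eq)

lemma veq_iff: "veq v x m \<longleftrightarrow> vge v x m \<and> \<not> vge v x (m + 1)"
  using vge_cases[of x m] vge_veq_iff[of x m] by force

lemma veq_mult: "veq v x m \<Longrightarrow> veq v y k \<Longrightarrow> veq v (x * y) (m + k)"
  unfolding veq_def v_mult by simp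

lemma veq_one: "veq v 1 0"
proof -
  obtain m where "veq v 1 m" using veq_ex[of 1] by auto
  thus ?thesis using veq_mult[of 1 m 1 m] veq_unique[of 1 m "m + m"] by simp
qed

lemma veq_uminus: "veq v x m \<Longrightarrow> veq v (- x) m"
proof -
  assume x: "veq v x m"
  obtain k where k: "veq v (-1) k" using veq_ex[of "-1"] by auto
  have "veq v 1 (k + k)" using veq_mult[OF k k] by simp
  hence "k + k = 0" using veq_one veq_unique by blast
  hence "k = 0" by simp
  thus ?thesis using veq_mult[OF k x] by simp
qed

lemma veq_inverse: "veq v x m \<Longrightarrow> veq v (inverse x) (- m)"
proof -
  assume x: "veq v x m"
  obtain k where k: "veq v (inverse x) k" using veq_ex[of "inverse x"] veq_nz[OF x] by auto
  have "veq v 1 (m + k)" using veq_mult[OF x k] veq_nz[OF x] by simp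
  hence "m + k = 0" using veq_one veq_unique by blast
  hence "k = - m" by simp
  thus ?thesis using k by simp
qed

lemma veq_divide: "veq v x m \<Longrightarrow> veq v y k \<Longrightarrow> veq v (x / y) (m - k)"
  using veq_mult[of x m "inverse y" "- k"] veq_inverse[of y k] by (simp add: divide_inverse)

lemma veq_power: "veq v x m \<Longrightarrow> veq v (x ^ j) (int j * m)"
proof (induction j)
  case (Suc j)
  thus ?case using veq_mult[of x m "x ^ j" "int j * m"] by (simp add: algebra_simps)
qed (simp add: veq_one)

lemma vge_add: "vge v x m \<Longrightarrow> vge v y m \<Longrightarrow> vge v (x + y) m"
  using v_add[of x y] unfolding vge_def by (meson order_trans min.boundedI)

lemma vge_uminus: "vge v x m \<Longrightarrow> vge v (- x) m"
  using veq_uminus[of x] unfolding vge_iff by fastforce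

lemma vge_diff: "vge v x m \<Longrightarrow> vge v y m \<Longrightarrow> vge v (x - y) m"
  using vge_add[of x m "- y"] vge_uminus[of y m] by simp

lemma vge_mult: "vge v x m \<Longrightarrow> vge v y k \<Longrightarrow> vge v (x * y) (m + k)"
  using veq_mult[of x _ y] unfolding vge_iff by (metis add_mono mult_eq_0_iff)

lemma vge_sum: "(\<And>i. i \<in> I \<Longrightarrow> vge v (f i) m) \<Longrightarrow> vge v (sum f I) m"
  by (induction I rule: infinite_finite_induct) (auto intro: vge_add)

lemma vge_one: "vge v 1 0"
  using veq_one by (simp add: veq_vge)

lemma vge_power: "vge v x m \<Longrightarrow> vge v (x ^ j) (int j * m)"
proof (induction j)
  case (Suc j)
  thus ?case using vge_mult[of x m "x ^ j" "int j * m"] by (simp add: algebra_simps)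
qed (simp add: vge_one)

lemma veq_prod: "finite I \<Longrightarrow> (\<And>i. i \<in> I \<Longrightarrow> veq v (f i) (d i)) \<Longrightarrow> veq v (prod f I) (sum d I)"
  by (induction I rule: finite_induct) (auto intro: veq_one veq_mult)

lemma vge_of_nat: "vge v (of_nat m) 0"
  by (induction m) (auto intro: vge_add vge_one)

lemma veq_add: "veq v x m \<Longrightarrow> vge v y (m + 1) \<Longrightarrow> veq v (x + y) m"
  unfolding veq_iff[of _ m]
  by (metis add_diff_cancel_right' vge_add vge_diff vge_mono le_add_same_cancel1 zero_le_one)

lemma veq_add': "vge v x (m + 1) \<Longrightarrow> veq v y m \<Longrightarrow> veq v (x + y) m"
  using veq_add[of y m x] by (simp add: add.commute)

lemma vge_divide: "vge v x m \<Longrightarrow> veq v y k \<Longrightarrow> vge v (x / y) (m - k)"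
  using vge_mult[of x m "inverse y" "- k"] veq_inverse[of y k]
  by (simp add: divide_inverse veq_vge)

text \<open>One nonzero summand has strictly smallest valuation, so nothing can cancel it. Zero
  summands have no integer valuation, hence the restriction of injectivity to the nonzero
  ones.\<close>

lemma sum_distinct:
  assumes fin: "finite I"
    and y: "\<And>i. i \<in> I \<Longrightarrow> y i \<noteq> 0 \<Longrightarrow> veq v (y i) (d i)"
    and inj: "inj_on d {i \<in> I. y i \<noteq> 0}"
    and nz: "\<exists>i\<in>I. y i \<noteq> 0"
  shows "\<exists>i0\<in>I. veq v (y i0) (d i0) \<and> (\<forall>i\<in>I - {i0}. vge v (y i) (d i0 + 1)) \<and> veq v (sum y I) (d i0)"
proof -
  define J where "J = {i \<in> I. y i \<noteq> 0}"
  have J: "finite J" "J \<noteq> {}" using fin nz by (auto simp: J_def)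
  define i0 where "i0 = arg_min_on d J"
  have i0: "i0 \<in> J" "\<And>i. i \<in> J \<Longrightarrow> d i0 \<le> d i"
    unfolding i0_def using arg_min_if_finite[OF J, of d] arg_min_least[OF J, of _ d] by auto
  have v0: "veq v (y i0) (d i0)" using i0 y by (auto simp: J_def)
  have rest: "vge v (y i) (d i0 + 1)" if "i \<in> I - {i0}" for i
  proof (cases "y i = 0")
    case False
    hence iJ: "i \<in> J" using that by (auto simp: J_def)
    hence "d i \<noteq> d i0" using inj that i0(1) by (auto simp: J_def inj_on_def)
    hence "d i0 + 1 \<le> d i" using i0(2)[OF iJ] by simp
    thus ?thesis using y[of i] that False by (auto intro: veq_vge)
  qed simp
  have "sum y I = y i0 + sum y (I - {i0})"
    using i0(1) fin by (simp add: J_def sum.remove)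
  moreover have "vge v (sum y (I - {i0})) (d i0 + 1)" by (rule vge_sum) (rule rest)
  ultimately have "veq v (sum y I) (d i0)" using veq_add[OF v0] by simp
  thus ?thesis using i0(1) v0 rest by (auto simp: J_def)
qed

text \<open>First-order expansion: multiplying two such expansions produces only terms with two
  factors of valuation at least \<open>m\<close>, and \<open>m \<ge> 0\<close> keeps the remaining
  factors integral.\<close>

lemma prod_one_plus:
  assumes fin: "finite I" and u: "\<And>i. i \<in> I \<Longrightarrow> vge v (u i) m" and m: "m \<ge> 0"
  shows "vge v ((\<Prod>i\<in>I. (1 + u i) ^ a i) - 1 - (\<Sum>i\<in>I. of_nat (a i) * u i)) (2 * m)"
proof -
  have pow: "vge v ((1 + x) ^ j - 1 - of_nat j * x) (2 * m)" if x: "vge v x m" for x :: 'a and j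
  proof (induction j)
    case (Suc j)
    have "(1 + x) ^ Suc j - 1 - of_nat (Suc j) * x
        = ((1 + x) ^ j - 1 - of_nat j * x) * (1 + x) + of_nat j * (x * x)"
      by (simp add: algebra_simps)
    moreover have "vge v (((1 + x) ^ j - 1 - of_nat j * x) * (1 + x)) (2 * m)"
      using vge_mult[OF Suc, of "1 + x" 0] vge_add[OF vge_one, of x] vge_mono[OF x m] by simp
    moreover have "vge v (of_nat j * (x * x)) (2 * m)"
      using vge_mult[OF vge_of_nat vge_mult[OF x x], of j] by simp
    ultimately show ?case using vge_add by presburger
  qed simp
  show ?thesis using fin u
  proof (induction I rule: finite_induct)
    case (insert i I)
    define P where "P = (\<Prod>i\<in>I. (1 + u i) ^ a i)"
    define S where "S = (\<Sum>i\<in>I. of_nat (a i) * u i)"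
    define Q where "Q = (1 + u i) ^ a i"
    have S: "vge v S m"
      unfolding S_def by (rule vge_sum) (use insert.prems vge_mult[OF vge_of_nat, of _ m] in force)
    have ih: "vge v (P - 1 - S) (2 * m)" using insert by (simp add: P_def S_def)
    have Q: "vge v (Q - 1 - of_nat (a i) * u i) (2 * m)"
      unfolding Q_def by (rule pow) (use insert.prems in auto)
    have T: "vge v (of_nat (a i) * u i) m"
      using vge_mult[OF vge_of_nat, of "u i" m "a i"] insert.prems by simp
    have P1: "vge v (P - 1) m"
    proof -
      have "P - 1 = (P - 1 - S) + S" by simp
      thus ?thesis using vge_add[OF vge_mono[OF ih] S] m by simp
    qed
    have "vge v (of_nat (a i) * u i * (P - 1)) (2 * m)" using vge_mult[OF T P1] by simp
    moreover have "vge v ((Q - 1 - of_nat (a i) * u i) * P) (2 * m)"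
    proof -
      have "vge v P 0" using vge_add[OF vge_mono[OF P1 m] vge_one] by simp
      thus ?thesis using vge_mult[OF Q] by fastforce
    qed
    ultimately have "vge v ((P - 1 - S) + of_nat (a i) * u i * (P - 1)
        + (Q - 1 - of_nat (a i) * u i) * P) (2 * m)"
      using ih vge_add by blast
    moreover have "(P - 1 - S) + of_nat (a i) * u i * (P - 1) + (Q - 1 - of_nat (a i) * u i) * P
        = Q * P - 1 - (of_nat (a i) * u i + S)" by (simp add: algebra_simps)
    ultimately have "vge v (Q * P - 1 - (of_nat (a i) * u i + S)) (2 * m)" by simp
    thus ?case using insert.hyps by (simp add: P_def Q_def S_def)
  qed simp
qed

lemma power_one_plus:
  assumes "vge v x m" "m \<ge> 0"
  shows "vge v ((1 + x) ^ j - 1 - of_nat j * x) (2 * m)"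
  using prod_one_plus[of "{()}" "\<lambda>_. x" m "\<lambda>_. j"] assms by simp

end

section \<open>Field embeddings and totally ramified extensions\<close>

locale femb =
  fixes e :: "'k::field \<Rightarrow> 'l::field"
  assumes fe: "field_embedding e"
begin

lemma e1 [simp]: "e 1 = 1" and e_add: "e (x + y) = e x + e y" and e_mult: "e (x * y) = e x * e y"
  using fe unfolding field_embedding_def by auto

lemma e0 [simp]: "e 0 = 0"
proof -
  have "e 0 + e 0 = e 0 + 0" using e_add[of 0 0] by simp
  thus ?thesis by (simp only: add_left_cancel)
qed

lemma e_minus: "e (- x) = - e x" using e_add[of x "- x"] by (simp add: eq_neg_iff_add_eq_0 add.commute)

lemma e_diff: "e (x - y) = e x - e y" using e_add[of x "- y"] by (simp add: e_minus)

lemma e_sum: "e (sum f A) = (\<Sum>i\<in>A. e (f i))"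
  by (induction A rule: infinite_finite_induct) (auto simp: e_add)

lemma e_prod: "e (prod f A) = (\<Prod>i\<in>A. e (f i))"
  by (induction A rule: infinite_finite_induct) (auto simp: e_mult)

lemma e_power: "e (x ^ m) = e x ^ m" by (induction m) (auto simp: e_mult)

lemma e_of_nat [simp]: "e (of_nat m) = of_nat m" by (induction m) (auto simp: e_add)

lemma e_eq_0_iff [simp]: "e x = 0 \<longleftrightarrow> x = 0"
proof
  assume "e x = 0"
  hence "e (x * inverse x) = 0" by (simp add: e_mult)
  thus "x = 0" by (cases "x = 0") auto
qed simp

lemma e_inj: "e x = e y \<longleftrightarrow> x = y" using e_eq_0_iff[of "x - y"] by (simp add: e_diff)

lemma e_inverse: "e (inverse x) = inverse (e x)"
proof (cases "x = 0")
  case False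
  hence "e x * e (inverse x) = 1" by (simp flip: e_mult)
  thus ?thesis by (metis inverse_unique)
qed simp

lemma e_char: "CHAR('l) = CHAR('k)"
proof (rule CHAR_eqI)
  show "of_nat CHAR('k) = (0::'l)" unfolding e_of_nat[symmetric] e_eq_0_iff by simp
  fix m assume "of_nat m = (0::'l)"
  thus "CHAR('k) dvd m" unfolding e_of_nat[symmetric] e_eq_0_iff by (simp add: of_nat_eq_0_iff_char_dvd)
qed

lemma e_ell: "e (ell p z) = ell p (e z)" by (simp add: ell_def e_diff e_power)

end

lemma field_embedding_id: "field_embedding (\<lambda>x. x)" "field_embedding id"
  by (simp_all add: field_embedding_def)

locale tot_ram = K: nval vK + L: nval vL + femb emb
  for vK :: "'k::field \<Rightarrow> ereal" and vL :: "'l::field \<Rightarrow> ereal" and emb :: "'k \<Rightarrow> 'l" +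
  fixes N :: nat
  assumes tr: "totally_ramified vK vL emb" and N_def: "N = ext_degree emb"
begin

lemma v_emb: "vL (emb c) = ereal (real N) * vK c"
  using tr N_def unfolding totally_ramified_def by simp

lemma N_pos: "N > 0"
proof (rule ccontr)
  assume "\<not> N > 0"
  thus False using v_emb[of 0] L.v_infty[of 0] K.v_infty[of 0] by simp
qed

lemma veq_emb: "veq vK c m \<Longrightarrow> veq vL (emb c) (int N * m)"
  unfolding veq_def v_emb by simp

lemma vge_emb_iff: "vge vL (emb c) (int N * m) \<longleftrightarrow> vge vK c m"
proof (cases "c = 0")
  case False
  then obtain k where k: "veq vK c k" using K.veq_ex by blast
  show ?thesis using L.vge_veq_iff[OF veq_emb[OF k]] K.vge_veq_iff[OF k] N_pos by simp
qed simp

lemma vge_emb: "vge vK c m \<Longrightarrow> vge vL (emb c) (int N * m)" using vge_emb_iff by blast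

lemma vge_emb0: "vge vK c 0 \<Longrightarrow> vge vL (emb c) 0" using vge_emb[of c 0] by simp

text \<open>Nonzero elements of \<open>K\<close> have valuation divisible by \<open>N\<close> in
  \<open>L\<close>, so distinct residues of the \<open>d i\<close> modulo \<open>N\<close> exclude
  cancellation in \<open>K\<close>-linear combinations. The size \<open>N\<close> of the index set
  then makes the family a basis.\<close>

definition valbasis :: "'i set \<Rightarrow> ('i \<Rightarrow> 'l) \<Rightarrow> ('i \<Rightarrow> int) \<Rightarrow> bool" where
  "valbasis I f d \<longleftrightarrow> finite I \<and> card I = N \<and> (\<forall>i\<in>I. veq vL (f i) (d i)) \<and> inj_on (\<lambda>i. d i mod int N) I"

lemma valbasis_term:
  assumes "veq vL (f i) (d i)" "emb c * f i \<noteq> 0"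
  shows "\<exists>m. veq vL (emb c * f i) m \<and> m mod int N = d i mod int N"
proof -
  obtain k where k: "veq vK c k" using K.veq_ex[of c] assms(2) by auto
  show ?thesis using L.veq_mult[OF veq_emb[OF k] assms(1)] by (intro exI[of _ "int N * k + d i"]) auto
qed

lemma valbasis_sum:
  assumes vb: "valbasis I f d" and nz: "\<exists>i\<in>I. c i \<noteq> 0"
  shows "\<exists>i0\<in>I. \<exists>m. veq vL (emb (c i0) * f i0) m \<and> (\<forall>i\<in>I - {i0}. vge vL (emb (c i) * f i) (m + 1)) \<and>
      veq vL (\<Sum>i\<in>I. emb (c i) * f i) m \<and> m mod int N = d i0 mod int N"
proof -
  define y where "y i = emb (c i) * f i" for i
  define D where "D i = (SOME m. veq vL (y i) m \<and> m mod int N = d i mod int N)" for i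
  have fnz: "f i \<noteq> 0" if "i \<in> I" for i using vb that L.veq_nz by (auto simp: valbasis_def)
  have D: "veq vL (y i) (D i) \<and> D i mod int N = d i mod int N" if "i \<in> I" "y i \<noteq> 0" for i
    unfolding D_def by (rule someI_ex) (use valbasis_term[of f i d] vb that in \<open>auto simp: valbasis_def y_def\<close>)
  have "\<exists>i0\<in>I. veq vL (y i0) (D i0) \<and> (\<forall>i\<in>I - {i0}. vge vL (y i) (D i0 + 1)) \<and> veq vL (sum y I) (D i0)"
  proof (rule L.sum_distinct)
    show "finite I" using vb by (simp add: valbasis_def)
    show "inj_on D {i \<in> I. y i \<noteq> 0}"
    proof (rule inj_onI)
      fix i j assume ij: "i \<in> {i \<in> I. y i \<noteq> 0}" "j \<in> {i \<in> I. y i \<noteq> 0}" "D i = D j"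
      hence "d i mod int N = d j mod int N" using D[of i] D[of j] by simp
      thus "i = j" using vb ij by (auto simp: valbasis_def dest: inj_onD)
    qed
    show "\<exists>i\<in>I. y i \<noteq> 0" using nz fnz by (auto simp: y_def)
  qed (use D in auto)
  then obtain i0 where i0: "i0 \<in> I" "veq vL (y i0) (D i0)" "\<forall>i\<in>I - {i0}. vge vL (y i) (D i0 + 1)"
    "veq vL (sum y I) (D i0)" by blast
  moreover have "D i0 mod int N = d i0 mod int N" using D i0 L.veq_nz by blast
  ultimately show ?thesis unfolding y_def by blast
qed

lemma valbasis_veq:
  assumes vb: "valbasis I f d" and v: "veq vL (\<Sum>i\<in>I. emb (c i) * f i) m"
  shows "\<exists>i0\<in>I. veq vL (emb (c i0) * f i0) m \<and> (\<forall>i\<in>I - {i0}. vge vL (emb (c i) * f i) (m + 1)) \<and>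
      m mod int N = d i0 mod int N"
proof -
  have "\<exists>i\<in>I. c i \<noteq> 0"
  proof (rule ccontr)
    assume "\<not> ?thesis"
    hence "(\<Sum>i\<in>I. emb (c i) * f i) = 0" by (intro sum.neutral) auto
    thus False using v L.veq_nz by blast
  qed
  from valbasis_sum[where c = c, OF vb this] show ?thesis using v L.veq_unique by blast
qed

lemma valbasis_vge:
  assumes vb: "valbasis I f d" and v: "vge vL (\<Sum>i\<in>I. emb (c i) * f i) m" and i: "i \<in> I"
  shows "vge vL (emb (c i) * f i) m"
proof (cases "\<exists>i\<in>I. c i \<noteq> 0")
  case True
  from valbasis_sum[where c = c, OF vb this] obtain i0 k where i0: "i0 \<in> I" "veq vL (emb (c i0) * f i0) k"
    "\<forall>i\<in>I - {i0}. vge vL (emb (c i) * f i) (k + 1)" "veq vL (\<Sum>i\<in>I. emb (c i) * f i) k" by blast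
  have "m \<le> k" using v L.vge_veq_iff[OF i0(4)] by simp
  thus ?thesis using i0 i by (cases "i = i0") (auto intro: L.veq_vge L.vge_mono)
qed (use i in auto)

text \<open>Absence of cancellation is linear independence, and \<open>N\<close> independent vectors
  span a space of dimension \<open>N\<close>.\<close>

lemma valbasis_expand:
  assumes vb: "valbasis I f d"
  shows "\<exists>c. x = (\<Sum>i\<in>I. emb (c i) * f i)"
proof -
  obtain B where fd: "finite_dimensional_vector_space (\<lambda>c x. emb c * x) B"
    using tr unfolding totally_ramified_def finite_extension_def by blast
  interpret V: finite_dimensional_vector_space "\<lambda>c x. emb c * x" B by (rule fd)
  have fin: "finite I" using vb by (simp add: valbasis_def)
  have dist: "inj_on f I"
    using vb unfolding valbasis_def inj_on_def by (metis L.veq_unique)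
  have zero: "c i = 0" if "(\<Sum>i\<in>I. emb (c i) * f i) = 0" "i \<in> I" for c i
    using valbasis_sum[where c = c, OF vb] that L.veq_nz by fastforce
  have ind: "\<not> V.dependent (f ` I)"
    unfolding V.dependent_finite[OF finite_imageI[OF fin]]
  proof
    assume "\<exists>u. (\<exists>v\<in>f ` I. u v \<noteq> 0) \<and> (\<Sum>v\<in>f ` I. emb (u v) * v) = 0"
    then obtain u where u: "\<exists>v\<in>f ` I. u v \<noteq> 0" "(\<Sum>v\<in>f ` I. emb (u v) * v) = 0" by blast
    have "(\<Sum>i\<in>I. emb (u (f i)) * f i) = 0" using u(2) by (simp add: sum.reindex[OF dist])
    thus False using zero[of "\<lambda>i. u (f i)"] u(1) by auto
  qed
  have "UNIV \<subseteq> V.span (f ` I)"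
  proof (rule V.card_ge_dim_independent[OF _ ind])
    have "card (f ` I) = N" using vb card_image[OF dist] by (simp only: valbasis_def)
    moreover have "V.dim UNIV = N" using N_def by (simp only: ext_degree_def)
    ultimately show "V.dim UNIV \<le> card (f ` I)" by simp
  qed simp
  hence "x \<in> V.span (f ` I)" by blast
  then obtain u where "x = (\<Sum>v\<in>f ` I. emb (u v) * v)"
    unfolding V.span_finite[OF finite_imageI[OF fin]] by auto
  hence "x = (\<Sum>i\<in>I. emb (u (f i)) * f i)" by (simp add: sum.reindex[OF dist])
  thus ?thesis by (rule exI[where x = "\<lambda>i. u (f i)"])
qed

lemma uniformizer_expand:
  assumes "veq vL \<pi> 1"
  shows "valbasis {..<N} (\<lambda>i. \<pi> ^ i) int"
  unfolding valbasis_def using L.veq_power[OF assms] by (auto simp: inj_on_def)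

end

locale subfld =
  fixes S :: "'a::field set"
  assumes sf: "is_subfield S"
begin

lemma S_1 [simp, intro]: "1 \<in> S" and S_diff [intro]: "x \<in> S \<Longrightarrow> y \<in> S \<Longrightarrow> x - y \<in> S"
  and S_mult [intro]: "x \<in> S \<Longrightarrow> y \<in> S \<Longrightarrow> x * y \<in> S" and S_inverse [intro]: "x \<in> S \<Longrightarrow> inverse x \<in> S"
  using sf unfolding is_subfield_def by auto

lemma S_0 [simp, intro]: "0 \<in> S" using S_diff[of 1 1] by simp

lemma S_uminus [intro]: "x \<in> S \<Longrightarrow> - x \<in> S" using S_diff[of 0 x] by simp

lemma S_add [intro]: "x \<in> S \<Longrightarrow> y \<in> S \<Longrightarrow> x + y \<in> S" using S_diff[of x "- y"] by auto

lemma S_sum [intro]: "(\<And>i. i \<in> A \<Longrightarrow> f i \<in> S) \<Longrightarrow> sum f A \<in> S"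
  by (induction A rule: infinite_finite_induct) auto

lemma S_prod [intro]: "(\<And>i. i \<in> A \<Longrightarrow> f i \<in> S) \<Longrightarrow> prod f A \<in> S"
  by (induction A rule: infinite_finite_induct) auto

lemma S_power [intro]: "x \<in> S \<Longrightarrow> x ^ m \<in> S" by (induction m) auto

lemma S_of_nat [simp, intro]: "of_nat m \<in> S" by (induction m) auto

lemma S_divide [intro]: "x \<in> S \<Longrightarrow> y \<in> S \<Longrightarrow> x / y \<in> S" by (auto simp: divide_inverse)

lemma S_ell [intro]: "x \<in> S \<Longrightarrow> ell p x \<in> S" by (auto simp: ell_def)

lemma S_field_binomial [intro]: "x \<in> S \<Longrightarrow> field_binomial x i \<in> S"
  unfolding field_binomial_def by (auto simp del: of_nat_fact)

end

section \<open>Ramification\<close>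

locale ram = tot_ram vK vL emb N + F: subfld F
  for vK :: "'k::field \<Rightarrow> ereal" and vL :: "'l::field \<Rightarrow> ereal" and emb N F +
  fixes p :: nat and b :: int
  assumes prime: "prime p" and char: "CHAR('k) = p"
    and coeff: "coefficient_field vK F"
    and gal: "galois_extension emb"
    and b_pos: "b > 0" and brk: "ramification_breaks vL emb = {b}"
begin

lemma charL: "CHAR('l) = p" using e_char char by simp

lemma p_gt1: "p > 1" using prime_gt_1_nat[OF prime] .

lemma p_ge2: "p \<ge> 2" using prime_ge_2_nat[OF prime] .

lemma p_pos: "p > 0" using p_gt1 by simp

abbreviation GG where "GG \<equiv> carrier (galois_group emb)"

lemma GG_iff: "\<sigma> \<in> GG \<longleftrightarrow> field_embedding \<sigma> \<and> bij \<sigma> \<and> (\<forall>c. \<sigma> (emb c) = emb c)"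
  by (simp add: galois_group_def)

lemma GG_femb: "\<sigma> \<in> GG \<Longrightarrow> femb \<sigma>" by (simp add: GG_iff femb_def)

lemma GG_emb [simp]: "\<sigma> \<in> GG \<Longrightarrow> \<sigma> (emb c) = emb c" by (simp add: GG_iff)

lemma GG_id: "id \<in> GG" by (auto simp: GG_iff field_embedding_def)

lemma GG_comp: "\<sigma> \<in> GG \<Longrightarrow> \<tau> \<in> GG \<Longrightarrow> \<sigma> \<circ> \<tau> \<in> GG"
  by (auto simp: GG_iff field_embedding_def intro: bij_comp)

lemma GG_inv:
  assumes "\<sigma> \<in> GG"
  shows "inv_into UNIV \<sigma> \<in> GG" "\<sigma> \<circ> inv_into UNIV \<sigma> = id" "inv_into UNIV \<sigma> \<circ> \<sigma> = id"
proof -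
  interpret s: femb \<sigma> by (rule GG_femb[OF assms])
  define \<tau> where "\<tau> = inv_into UNIV \<sigma>"
  have bij: "bij \<sigma>" using assms by (simp add: GG_iff)
  have 1: "\<sigma> (\<tau> x) = x" for x unfolding \<tau>_def by (rule surj_f_inv_f) (use bij bij_is_surj in blast)
  have 2: "\<tau> (\<sigma> x) = x" for x unfolding \<tau>_def by (rule inv_f_f) (use bij bij_is_inj in blast)
  have "\<tau> (emb c) = emb c" for c using 2[of "emb c"] assms by simp
  moreover have "bij \<tau>" unfolding \<tau>_def by (rule bij_imp_bij_inv[OF bij])
  moreover have "field_embedding \<tau>"
    unfolding field_embedding_def by (metis 1 2 s.e1 s.e_add s.e_mult)
  ultimately show "inv_into UNIV \<sigma> \<in> GG" by (simp add: GG_iff \<tau>_def)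
  show "\<sigma> \<circ> inv_into UNIV \<sigma> = id" "inv_into UNIV \<sigma> \<circ> \<sigma> = id"
    using 1 2 by (auto simp: \<tau>_def)
qed

lemma fixed_field: "(\<And>\<sigma>. \<sigma> \<in> GG \<Longrightarrow> \<sigma> x = x) \<Longrightarrow> x \<in> range emb"
  using gal unfolding galois_extension_def by blast

lemma F_vge: "a \<in> F \<Longrightarrow> vge vK a 0"
  using coeff unfolding coefficient_field_def vge_def by (auto simp: zero_ereal_def)

lemma F_veq: "a \<in> F \<Longrightarrow> a \<noteq> 0 \<Longrightarrow> veq vK a 0"
proof -
  assume a: "a \<in> F" "a \<noteq> 0"
  obtain m where m: "veq vK a m" using K.veq_ex a by blast
  have "0 \<le> m" using K.vge_veq_iff[OF m] F_vge[OF a(1)] by blast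
  moreover have "0 \<le> - m" using K.vge_veq_iff[OF K.veq_inverse[OF m]] F_vge[of "inverse a"] a by blast
  ultimately show ?thesis using m by simp
qed

lemma F_vgeL: "a \<in> F \<Longrightarrow> vge vL (emb a) 0" using vge_emb0 F_vge by blast

lemma F_veqL: "a \<in> F \<Longrightarrow> a \<noteq> 0 \<Longrightarrow> veq vL (emb a) 0" using veq_emb[OF F_veq] by fastforce

lemma residueK: "vge vK x 0 \<Longrightarrow> \<exists>a\<in>F. vge vK (x - a) 1"
proof -
  assume "vge vK x 0"
  hence "vK x \<ge> 0" by (simp add: vge_def zero_ereal_def)
  hence "\<exists>!a. a \<in> F \<and> vK (x - a) > 0" using coeff unfolding coefficient_field_def by blast
  then obtain a where a: "a \<in> F" "vK (x - a) > 0" by blast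
  have "vge vK (x - a) 1"
  proof (cases "x - a = 0")
    case False
    then obtain m where m: "veq vK (x - a) m" using K.veq_ex by blast
    hence "m > 0" using a(2) by (simp add: veq_def)
    thus ?thesis using m by (auto intro: K.veq_vge)
  next
    case True
    show ?thesis unfolding True by simp
  qed
  thus ?thesis using a by blast
qed

text \<open>Total ramification leaves the residue field unchanged: in the expansion by powers of a
  uniformizer only the constant term can have valuation \<open>0\<close>, since the valuation of the
  term of index \<open>i\<close> is congruent to \<open>i\<close> modulo \<open>N\<close>.\<close>

lemma residueL: "vge vL x 0 \<Longrightarrow> \<exists>a\<in>F. vge vL (x - emb a) 1"
proof -
  assume x: "vge vL x 0"
  obtain \<pi> where pi: "veq vL \<pi> 1" using L.veq_surj by blast
  note vb = uniformizer_expand[OF pi]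
  obtain c where c: "x = (\<Sum>i\<in>{..<N}. emb (c i) * \<pi> ^ i)" using valbasis_expand[OF vb] by blast
  have t: "vge vL (emb (c i) * \<pi> ^ i) 0" if "i < N" for i
    using valbasis_vge[OF vb, of c 0 i] x c that by simp
  have "vge vK (c 0) 0" using t[of 0] N_pos vge_emb_iff[of "c 0" 0] by simp
  then obtain a where a: "a \<in> F" "vge vK (c 0 - a) 1" using residueK by blast
  have "vge vL (emb (c 0) - emb a) 1"
    using L.vge_mono[OF vge_emb[OF a(2)], of 1] N_pos by (simp add: e_diff)
  moreover have "vge vL (emb (c i) * \<pi> ^ i) 1" if i: "i \<in> {..<N} - {0}" for i
  proof (cases "emb (c i) * \<pi> ^ i = 0")
    case False
    have "veq vL (\<pi> ^ i) (int i)" using L.veq_power[OF pi, of i] by simp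
    from valbasis_term[where d = int and f = "\<lambda>i. \<pi> ^ i", OF this False]
    obtain m where m: "veq vL (emb (c i) * \<pi> ^ i) m" "m mod int N = int i mod int N" by blast
    have "0 \<le> m" using t[of i] i L.vge_veq_iff[OF m(1)] by simp
    moreover have "m \<noteq> 0" using m(2) i by auto
    ultimately show ?thesis using L.vge_veq_iff[OF m(1)] by simp
  next
    case True
    show ?thesis unfolding True by simp
  qed
  hence "vge vL (\<Sum>i\<in>{..<N} - {0}. emb (c i) * \<pi> ^ i) 1" by (rule L.vge_sum)
  ultimately have "vge vL ((emb (c 0) - emb a) + (\<Sum>i\<in>{..<N} - {0}. emb (c i) * \<pi> ^ i)) 1"
    by (rule L.vge_add)
  moreover have "x = emb (c 0) + (\<Sum>i\<in>{..<N} - {0}. emb (c i) * \<pi> ^ i)"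
    unfolding c by (subst sum.remove[of _ 0]) (use N_pos in auto)
  ultimately have "vge vL (x - emb a) 1" by (simp add: algebra_simps)
  thus ?thesis using a by blast
qed

text \<open>A power trick: by the expansion in powers of \<pi>, applying \<sigma> lowers valuations
  by at most a fixed amount \<open>C\<close>. For \<open>x ^ j\<close> the loss is still at most
  \<open>C\<close>, whereas a true loss would grow with \<open>j\<close>.\<close>

lemma GG_vge: assumes s: "\<sigma> \<in> GG" and x: "vge vL x m" shows "vge vL (\<sigma> x) m"
proof -
  interpret s: femb \<sigma> by (rule GG_femb[OF s])
  obtain \<pi> where pi: "veq vL \<pi> 1" using L.veq_surj by blast
  note vb = uniformizer_expand[OF pi]
  have "\<sigma> \<pi> \<noteq> 0" using L.veq_nz[OF pi] by simp
  then obtain u where u: "veq vL (\<sigma> \<pi>) u" using L.veq_ex by blast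
  \<comment> \<open>The part \<open>N * \<bar>u\<bar>\<close> pays for the unknown valuation
    \<open>u\<close> of \<open>\<sigma> \<pi>\<close>, the extra \<open>N\<close> for the exponents
    \<open>i < N\<close>.\<close>
  define C where "C = int N * (1 + \<bar>u\<bar>)"
  have C0: "C \<ge> 0" unfolding C_def by simp
  have bound: "vge vL (\<sigma> x) (m - C)" if x: "vge vL x m" for x m
  proof -
    obtain c where c: "x = (\<Sum>i\<in>{..<N}. emb (c i) * \<pi> ^ i)" using valbasis_expand[OF vb] by blast
    have "\<sigma> x = (\<Sum>i\<in>{..<N}. emb (c i) * (\<sigma> \<pi>) ^ i)"
      unfolding c using s by (simp add: s.e_sum s.e_mult s.e_power)
    moreover have "vge vL (emb (c i) * (\<sigma> \<pi>) ^ i) (m - C)" if i: "i \<in> {..<N}" for i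
    proof (cases "c i = 0")
      case False
      then obtain k where k: "veq vK (c i) k" using K.veq_ex by blast
      have "veq vL (emb (c i) * \<pi> ^ i) (int N * k + int i)"
        using L.veq_mult[OF veq_emb[OF k] L.veq_power[OF pi]] by simp
      moreover have "vge vL (emb (c i) * \<pi> ^ i) m"
        using valbasis_vge[OF vb, of c m i] x c i by simp
      ultimately have m: "m \<le> int N * k + int i" using L.vge_veq_iff by blast
      have "int i \<le> int N" using i by simp
      moreover have "int i * (- u) \<le> int N * \<bar>u\<bar>"
      proof -
        have "int i * (- u) \<le> int i * \<bar>u\<bar>" by (intro mult_left_mono) auto
        also have "\<dots> \<le> int N * \<bar>u\<bar>" using i by (intro mult_right_mono) auto
        finally show ?thesis .
      qed
      ultimately have "m - C \<le> int N * k + int i * u" using m by (simp add: C_def algebra_simps)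
      moreover have "veq vL (emb (c i) * \<sigma> \<pi> ^ i) (int N * k + int i * u)"
        using L.veq_mult[OF veq_emb[OF k] L.veq_power[OF u]] by simp
      ultimately show ?thesis by (rule L.veq_vge[rotated])
    qed simp
    ultimately show ?thesis by (simp only: L.vge_sum)
  qed
  show ?thesis
  proof (cases "x = 0")
    case False
    then obtain m' k where m': "veq vL x m'" and k: "veq vL (\<sigma> x) k"
      using L.veq_ex[of x] L.veq_ex[of "\<sigma> x"] by auto
    have mm: "m \<le> m'" using x L.vge_veq_iff[OF m'] by simp
    have "m' \<le> k"
    proof (rule ccontr)
      assume "\<not> m' \<le> k"
      define j where "j = nat (C + 1)"
      have j: "int j = C + 1" using C0 by (simp add: j_def)
      have "vge vL (\<sigma> (x ^ j)) (int j * m' - C)" by (rule bound[OF L.veq_vge[OF L.veq_power[OF m']]]) simp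
      hence "int j * m' - C \<le> int j * k" using L.vge_veq_iff[OF L.veq_power[OF k]] by (simp add: s.e_power)
      hence "int j * (m' - k) \<le> C" by (simp add: algebra_simps)
      moreover have "int j * 1 \<le> int j * (m' - k)" using \<open>\<not> m' \<le> k\<close> by (intro mult_left_mono) auto
      ultimately show False using j by simp
    qed
    thus ?thesis using k mm by (auto intro: L.veq_vge)
  qed simp
qed

lemma GG_veq: assumes s: "\<sigma> \<in> GG" and x: "veq vL x m" shows "veq vL (\<sigma> x) m"
proof -
  interpret s: femb \<sigma> by (rule GG_femb[OF s])
  have "\<sigma> x \<noteq> 0" using L.veq_nz[OF x] by simp
  then obtain k where k: "veq vL (\<sigma> x) k" using L.veq_ex by blast
  have "m \<le> k" using GG_vge[OF s L.veq_vge[OF x]] L.vge_veq_iff[OF k] by blast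
  moreover have "- m \<le> - k"
    using GG_vge[OF s L.veq_vge[OF L.veq_inverse[OF x] order_refl]] L.vge_veq_iff[OF L.veq_inverse[OF k]]
    unfolding s.e_inverse by blast
  ultimately show ?thesis using k by simp
qed

lemma ram_group_iff: "\<sigma> \<in> ramification_group vL emb i \<longleftrightarrow>
   \<sigma> \<in> GG \<and> (\<forall>x. vge vL x 0 \<longrightarrow> vge vL (\<sigma> x - x) (i + 1))"
  unfolding ramification_group_def vge_def by (simp add: zero_ereal_def)

lemma ram_group_b: "ramification_group vL emb b = GG"
proof -
  have "ramification_group vL emb (-1 + int j) = GG" if "int j \<le> b + 1" for j
    using that
  proof (induction j)
    case 0
    show ?case using GG_vge L.vge_diff by (auto simp: ram_group_iff)
  next
    case (Suc j)
    have "-1 + int j \<notin> ramification_breaks vL emb" using brk Suc by auto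
    hence "ramification_group vL emb (-1 + int j + 1) = ramification_group vL emb (-1 + int j)"
      unfolding ramification_breaks_def by simp
    thus ?case using Suc by (simp add: algebra_simps)
  qed
  from this[of "nat (b + 1)"] show ?thesis using b_pos by simp
qed

lemma ram_group_gt: "i \<ge> b + 1 \<Longrightarrow> ramification_group vL emb i = ramification_group vL emb (b + 1)"
proof (induction i rule: int_ge_induct)
  case (step i)
  have "i \<notin> ramification_breaks vL emb" using brk step by auto
  thus ?case using step b_pos unfolding ramification_breaks_def by simp
qed simp

lemma GG_break: "\<sigma> \<in> GG \<Longrightarrow> vge vL x 0 \<Longrightarrow> vge vL (\<sigma> x - x) (b + 1)"
  using ram_group_b ram_group_iff by blast

text \<open>Here \<open>\<sigma> \<pi> = \<pi> * (1 + u)\<close> with \<open>u\<close> of valuation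
  \<open>t\<close>, so \<sigma> multiplies \<open>\<pi> ^ j\<close> by
  \<open>1 + j * u + ...\<close>, and the linear term survives unless \<open>p\<close> divides
  \<open>j\<close>. Negative valuations are reached through inverses.\<close>

lemma shift_pow:
  assumes s: "\<sigma> \<in> GG" and pi: "veq vL \<pi> 1" and t: "veq vL (\<sigma> \<pi> - \<pi>) (t + 1)" "t \<ge> 1"
  shows "\<exists>y. veq vL y m \<and> vge vL (\<sigma> y - y) (m + t) \<and> (\<not> int p dvd m \<longrightarrow> veq vL (\<sigma> y - y) (m + t))"
proof -
  interpret s: femb \<sigma> by (rule GG_femb[OF s])
  have pi0: "\<pi> \<noteq> 0" using L.veq_nz[OF pi] .
  define u where "u = (\<sigma> \<pi> - \<pi>) / \<pi>"
  have u: "veq vL u t" using L.veq_divide[OF t(1) pi] by (simp add: u_def)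
  have spi: "\<sigma> \<pi> = \<pi> * (1 + u)" using pi0 by (simp add: u_def field_simps)
  have pos: "vge vL (\<sigma> (\<pi> ^ j) - \<pi> ^ j) (int j + t) \<and>
    (\<not> p dvd j \<longrightarrow> veq vL (\<sigma> (\<pi> ^ j) - \<pi> ^ j) (int j + t))" for j
  proof -
    have e: "\<sigma> (\<pi> ^ j) - \<pi> ^ j = \<pi> ^ j * ((1 + u) ^ j - 1)"
      unfolding s.e_power spi power_mult_distrib by (simp add: right_diff_distrib)
    have "vge vL ((1 + u) ^ j - 1 - of_nat j * u) (2 * t)"
      using L.power_one_plus[OF L.veq_vge[OF u]] t(2) by simp
    hence w: "vge vL ((1 + u) ^ j - 1 - of_nat j * u) (t + 1)" using t(2) by (auto elim: L.vge_mono)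
    have pj: "veq vL (\<pi> ^ j) (int j)" using L.veq_power[OF pi, of j] by simp
    have ju: "vge vL (of_nat j * u) t" using L.vge_mult[OF L.vge_of_nat L.veq_vge[OF u order_refl]] by simp
    have "vge vL ((1 + u) ^ j - 1 - of_nat j * u + of_nat j * u) t"
      by (rule L.vge_add[OF L.vge_mono[OF w] ju]) simp
    hence 1: "vge vL ((1 + u) ^ j - 1) t" by simp
    have 2: "veq vL ((1 + u) ^ j - 1) t" if "\<not> p dvd j"
    proof -
      have j0: "j \<noteq> 0" using that by (metis dvd_0_right)
      have "(of_nat j :: 'k) \<noteq> 0" using that char by (simp add: of_nat_eq_0_iff_char_dvd)
      hence "veq vL (emb (of_nat j)) 0" by (intro F_veqL) auto
      hence "veq vL (of_nat j * u) t" using L.veq_mult[of _ 0 u t] u by simp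
      from L.veq_add'[OF w this] show ?thesis by simp
    qed
    show ?thesis unfolding e using L.vge_mult[OF L.veq_vge[OF pj order_refl] 1] L.veq_mult[OF pj 2] by blast
  qed
  show ?thesis
  proof (cases "m \<ge> 0")
    case True
    have "veq vL (\<pi> ^ nat m) m" using L.veq_power[OF pi, of "nat m"] True by simp
    moreover have "p dvd nat m \<longleftrightarrow> int p dvd m" using True by (metis int_nat_eq int_dvd_int_iff)
    ultimately show ?thesis using pos[of "nat m"] True by (intro exI[of _ "\<pi> ^ nat m"]) auto
  next
    case False
    define j where "j = nat (- m)"
    have j: "int j = - m" using False by (simp add: j_def)
    define z where "z = \<pi> ^ j"
    have z: "veq vL z (- m)" using L.veq_power[OF pi, of j] j by (simp add: z_def)
    have z0: "z \<noteq> 0" using L.veq_nz[OF z] .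
    have sz: "veq vL (\<sigma> z) (- m)" using GG_veq[OF s z] .
    have zz: "veq vL (z * \<sigma> z) (- m + - m)" using L.veq_mult[OF z sz] .
    have e: "\<sigma> (inverse z) - inverse z = (- (\<sigma> z - z)) / (z * \<sigma> z)"
      unfolding s.e_inverse using z0 L.veq_nz[OF sz] by (simp add: divide_simps)
    have d: "int p dvd m \<longleftrightarrow> p dvd j" using j by (metis dvd_minus_iff int_dvd_int_iff)
    have "vge vL (\<sigma> (inverse z) - inverse z) (m + t)"
      unfolding e using L.vge_divide[OF L.vge_uminus zz, of "\<sigma> z - z" "-m + t"] pos[of j] j
      by (simp add: z_def algebra_simps)
    moreover have "\<not> int p dvd m \<longrightarrow> veq vL (\<sigma> (inverse z) - inverse z) (m + t)"
      unfolding e d using L.veq_divide[OF L.veq_uminus zz, of "\<sigma> z - z" "-m + t"] pos[of j] j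
      by (simp add: z_def algebra_simps)
    ultimately show ?thesis using L.veq_inverse[OF z] by (intro exI[of _ "inverse z"]) auto
  qed
qed

lemma leading_coeff:
  assumes "veq vL y m" "vge vL x m"
  shows "\<exists>a\<in>F. vge vL (x - emb a * y) (m + 1)"
proof -
  have "vge vL (x / y) 0" using L.vge_divide[OF assms(2,1)] by simp
  then obtain a where a: "a \<in> F" "vge vL (x / y - emb a) 1" using residueL by blast
  have "x - emb a * y = y * (x / y - emb a)" using L.veq_nz[OF assms(1)] by (simp add: field_simps)
  hence "vge vL (x - emb a * y) (m + 1)" using L.vge_mult[OF L.veq_vge[OF assms(1) order_refl] a(2)] by simp
  thus ?thesis using a(1) by blast
qed

text \<open>Approximate \<open>x\<close> by elements from \<open>shift_pow\<close> with digits in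
  \<open>F\<close>, which \<sigma> fixes. A remainder of valuation at least \<open>m + t\<close> is
  handled by the invariance of the valuation alone, so finitely many digits are enough.\<close>

lemma shift_general:
  assumes s: "\<sigma> \<in> GG" and pi: "veq vL \<pi> 1" and t: "veq vL (\<sigma> \<pi> - \<pi>) (t + 1)" "t \<ge> 1"
    and x: "vge vL x m"
  shows "vge vL (\<sigma> x - x) (m + t)"
proof -
  interpret s: femb \<sigma> by (rule GG_femb[OF s])
  have approx: "\<exists>y. vge vL (x - y) (m + int j) \<and> vge vL (\<sigma> y - y) (m + t)" for j
  proof (induction j)
    case 0
    show ?case using x by (intro exI[of _ 0]) simp
  next
    case (Suc j)
    then obtain y where y: "vge vL (x - y) (m + int j)" "vge vL (\<sigma> y - y) (m + t)" by blast
    obtain z where z: "veq vL z (m + int j)" "vge vL (\<sigma> z - z) (m + int j + t)"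
      using shift_pow[OF s pi t] by blast
    obtain a where a: "a \<in> F" "vge vL (x - y - emb a * z) (m + int j + 1)"
      using leading_coeff[OF z(1) y(1)] by blast
    have "\<sigma> (emb a * z) - emb a * z = emb a * (\<sigma> z - z)" using s by (simp add: s.e_mult algebra_simps)
    moreover have "vge vL (emb a * (\<sigma> z - z)) (m + t)"
      using L.vge_mult[OF F_vgeL[OF a(1)] z(2)] by (auto elim: L.vge_mono)
    ultimately have "vge vL (\<sigma> (y + emb a * z) - (y + emb a * z)) (m + t)"
      using L.vge_add[OF y(2), of "emb a * (\<sigma> z - z)"] by (simp add: s.e_add algebra_simps)
    moreover have "vge vL (x - (y + emb a * z)) (m + int (Suc j))" using a(2) by (simp add: algebra_simps)
    ultimately show ?case by blast
  qed
  obtain y where y: "vge vL (x - y) (m + int (nat t))" "vge vL (\<sigma> y - y) (m + t)" using approx by blast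
  have xy: "vge vL (x - y) (m + t)" using y(1) t(2) by simp
  have "\<sigma> x - x = (\<sigma> (x - y) - (x - y)) + (\<sigma> y - y)" by (simp add: s.e_diff)
  thus ?thesis using L.vge_add[OF L.vge_diff[OF GG_vge[OF s xy] xy] y(2)] by (simp only:)
qed

text \<open>A single break says that the ramification groups are constant above \<open>b\<close>,
  not yet that they are trivial there. But an element of the group of index \<open>b + 1\<close>
  would lie in all later ones, while \<open>\<sigma> \<pi> - \<pi>\<close> is nonzero and has a
  finite valuation.\<close>

lemma uniformizer_shift:
  assumes s: "\<sigma> \<in> GG" "\<sigma> \<noteq> id" and pi: "veq vL \<pi> 1"
  shows "veq vL (\<sigma> \<pi> - \<pi>) (b + 1)"
proof -
  interpret s: femb \<sigma> by (rule GG_femb[OF s(1)])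
  note vb = uniformizer_expand[OF pi]
  have "\<sigma> \<pi> \<noteq> \<pi>"
  proof
    assume eq: "\<sigma> \<pi> = \<pi>"
    have "\<sigma> x = x" for x
    proof -
      obtain c where c: "x = (\<Sum>i\<in>{..<N}. emb (c i) * \<pi> ^ i)" using valbasis_expand[OF vb] by blast
      show ?thesis unfolding c using s by (simp add: s.e_sum s.e_mult s.e_power eq)
    qed
    thus False using s(2) by auto
  qed
  then obtain k where k: "veq vL (\<sigma> \<pi> - \<pi>) k" using L.veq_ex[of "\<sigma> \<pi> - \<pi>"] by auto
  define t where "t = k - 1"
  have k: "veq vL (\<sigma> \<pi> - \<pi>) (t + 1)" using k by (simp add: t_def)
  have "b + 1 \<le> t + 1"
    using GG_break[OF s(1) L.veq_vge[OF pi]] L.vge_veq_iff[OF k] by simp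
  hence tb: "t \<ge> b" by simp
  have "t < b + 1"
  proof (rule ccontr)
    assume "\<not> t < b + 1"
    hence t: "t \<ge> b + 1" by simp
    \<comment> \<open>Removing the residue digit, which \<sigma> fixes, leaves valuation at least
      \<open>1\<close>; this supplies the second \<open>+ 1\<close>.\<close>
    have "vge vL (\<sigma> x - x) (b + 1 + 1)" if x: "vge vL x 0" for x
    proof -
      obtain a where a: "vge vL (x - emb a) 1" using residueL[OF x] by blast
      have e: "\<sigma> x - x = \<sigma> (x - emb a) - (x - emb a)" using s by (simp add: s.e_diff)
      have "vge vL (\<sigma> (x - emb a) - (x - emb a)) (1 + t)"
        by (rule shift_general[OF s(1) pi k _ a]) (use t b_pos in auto)
      thus ?thesis unfolding e using t by (elim L.vge_mono) simp
    qed
    hence "\<sigma> \<in> ramification_group vL emb (b + 1)" using s(1) by (simp add: ram_group_iff)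
    hence "\<sigma> \<in> ramification_group vL emb (t + 1)" using ram_group_gt[of "t + 1"] t by simp
    hence "vge vL (\<sigma> \<pi> - \<pi>) (t + 1 + 1)" using L.veq_vge[OF pi] by (simp add: ram_group_iff)
    thus False using L.vge_veq_iff[OF k] by simp
  qed
  thus ?thesis using k tb by simp
qed

lemma shift_vge: assumes s: "\<sigma> \<in> GG" and x: "vge vL x m" shows "vge vL (\<sigma> x - x) (m + b)"
proof (cases "\<sigma> = id")
  case False
  obtain \<pi> where pi: "veq vL \<pi> 1" using L.veq_surj by blast
  show ?thesis
    by (rule shift_general[OF s pi uniformizer_shift[OF s False pi] _ x]) (use b_pos in simp)
qed simp

text \<open>To leading order \<open>x\<close> is a multiple of an element whose shift is exactly
  \<open>b\<close>; the rest starts higher and moves up by at least \<open>b\<close>.\<close>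

lemma shift_veq:
  assumes s: "\<sigma> \<in> GG" "\<sigma> \<noteq> id" and x: "veq vL x m" and m: "\<not> int p dvd m"
  shows "veq vL (\<sigma> x - x) (m + b)"
proof -
  interpret s: femb \<sigma> by (rule GG_femb[OF s(1)])
  obtain \<pi> where pi: "veq vL \<pi> 1" using L.veq_surj by blast
  obtain y where y: "veq vL y m" "veq vL (\<sigma> y - y) (m + b)"
    using shift_pow[OF s(1) pi uniformizer_shift[OF s pi], of m] b_pos m by auto
  obtain a where a: "a \<in> F" "vge vL (x - emb a * y) (m + 1)" using leading_coeff[OF y(1)] L.veq_vge[OF x] by blast
  have "a \<noteq> 0"
  proof
    assume "a = 0"
    thus False using a(2) L.vge_veq_iff[OF x] by simp
  qed
  hence "veq vL (emb a * (\<sigma> y - y)) (m + b)" using L.veq_mult[OF F_veqL[OF a(1)] y(2)] by simp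
  moreover have "vge vL (\<sigma> (x - emb a * y) - (x - emb a * y)) (m + b + 1)"
    using shift_vge[OF s(1) a(2)] by (simp add: algebra_simps)
  ultimately have "veq vL (emb a * (\<sigma> y - y) + (\<sigma> (x - emb a * y) - (x - emb a * y))) (m + b)"
    by (rule L.veq_add)
  moreover have "emb a * (\<sigma> y - y) + (\<sigma> (x - emb a * y) - (x - emb a * y)) = \<sigma> x - x"
    using s by (simp add: s.e_diff s.e_mult algebra_simps)
  ultimately show ?thesis by simp
qed

text \<open>If \<open>p\<close> divided \<open>b\<close>, the valuations \<open>1 + i * b\<close> of
  the iterates \<open>(\<sigma> - 1)^i \<pi>\<close> would all be prime to \<open>p\<close>, so no
  iterate could vanish, contrary to \<open>(\<sigma> - 1)^p = \<sigma>^p - 1 = 0\<close>.\<close>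

lemma p_not_dvd_break:
  assumes s: "\<sigma> \<in> GG" "\<sigma> \<noteq> id" "\<sigma> ^^ p = id"
  shows "\<not> int p dvd b"
proof
  assume dvd: "int p dvd b"
  interpret s: femb \<sigma> by (rule GG_femb[OF s(1)])
  obtain \<pi> where pi: "veq vL \<pi> 1" using L.veq_surj by blast
  define h where "h m = (\<sigma> ^^ m) \<pi>" for m
  have "fdiff h p 0 = 0"
    by (rule fdiff_periodic[OF prime charL]) (simp add: h_def funpow_add s(3))
  moreover have step: "fdiff h (Suc i) m = \<sigma> (fdiff h i m) - fdiff h i m" for i m
  proof -
    have "fdiff h i (Suc m) = \<sigma> (fdiff h i m)" for m
      by (induction i arbitrary: m) (auto simp: h_def s.e_diff)
    thus ?thesis by simp
  qed
  have "veq vL (fdiff h i 0) (1 + int i * b)" for i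
  proof (induction i)
    case 0
    show ?case using pi by (simp add: h_def)
  next
    case (Suc i)
    have "\<not> int p dvd 1 + int i * b"
      using dvd p_gt1 by (metis dvd_add_left_iff dvd_mult int_dvd_int_iff nat_dvd_1_iff_1 of_nat_1 less_irrefl)
    hence "veq vL (fdiff h (Suc i) 0) (1 + int i * b + b)"
      using shift_veq[OF s(1,2) Suc] unfolding step by blast
    thus ?case by (simp add: algebra_simps)
  qed
  hence "fdiff h p 0 \<noteq> 0" using L.veq_nz by blast
  ultimately show False by simp
qed

end

section \<open>Artin--Schreier generators\<close>

text \<open>\<open>eps_strong\<close> is the bound \<open>- b / p^(n-2)\<close> with its denominator
  cleared; the guard \<open>n \<ge> 2\<close> keeps natural subtraction from changing the meaning.
  The equality \<open>N = p ^ n\<close> is not built in: it falls out of the valuation of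
  \<open>Y n\<close>.\<close>

locale artin_schreier = ram vK vL emb N F p b
  for vK :: "'k::field \<Rightarrow> ereal" and vL :: "'l::field \<Rightarrow> ereal" and emb N F p b +
  fixes n :: nat and \<beta> :: 'k and \<omega> \<epsilon> :: "nat \<Rightarrow> 'k" and x :: "nat \<Rightarrow> 'l"
  assumes card_GG: "card GG = p ^ n"
    and perfect: "perfect_subfield F"
    and beta: "veq vK \<beta> (- b)"
    and omega: "\<And>i. i \<in> {1..n} \<Longrightarrow> \<omega> i \<in> F"
    and indep: "prime_field_independent p n \<omega>"
    and eps: "\<And>i. i \<in> {1..n} \<Longrightarrow> vge vK (\<epsilon> i) (- b + 1)"
    and eps_strong: "\<And>i. n \<ge> 2 \<Longrightarrow> i \<in> {1..n} \<Longrightarrow> vge vK (\<epsilon> i ^ (p ^ (n - 2))) (- b + 1)"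
    and x_eq: "\<And>i. i \<in> {1..n} \<Longrightarrow> x i ^ p - x i = emb (\<omega> i ^ (p ^ n) * \<beta> + \<epsilon> i)"
    and adj: "adjoin emb (x ` {1..n}) = UNIV"
begin

definition f :: "nat \<Rightarrow> 'k" where "f i = \<omega> i ^ (p ^ n) * \<beta> + \<epsilon> i"

lemma x_pow: "i \<in> {1..n} \<Longrightarrow> x i ^ p = x i + emb (f i)"
  using x_eq[of i] by (simp add: f_def diff_eq_eq add.commute)

lemma fin_GG: "finite GG"
  by (rule card_ge_0_finite) (simp add: card_GG p_pos)

lemma n_pos: "n \<ge> 1"
proof (rule ccontr)
  assume "\<not> n \<ge> 1"
  hence "card GG = 1" using card_GG by simp
  then obtain s where "GG = {s}" by (rule card_1_singletonE)
  hence "GG = {id}" using GG_id by simp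
  hence "\<sigma> \<in> ramification_group vL emb i \<longleftrightarrow> \<sigma> \<in> GG" for \<sigma> i
    unfolding ram_group_iff by (cases "\<sigma> = id") simp_all
  hence "ramification_group vL emb i = GG" for i by blast
  hence "ramification_breaks vL emb = {}" by (simp add: ramification_breaks_def)
  thus False using brk by simp
qed

text \<open>Serves twice: as coordinates of Galois elements and as exponents of reduced
  monomials.\<close>

definition Tup :: "(nat \<Rightarrow> nat) set" where "Tup = PiE {1..n} (\<lambda>_. {..<p})"

lemma fin_Tup: "finite Tup" unfolding Tup_def by (rule finite_PiE) auto

lemma card_Tup: "card Tup = p ^ n" unfolding Tup_def by (simp add: card_PiE)

lemma GG_eqI:
  assumes "\<sigma> \<in> GG" "\<tau> \<in> GG" "\<And>i. i \<in> {1..n} \<Longrightarrow> \<sigma> (x i) = \<tau> (x i)"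
  shows "\<sigma> = \<tau>"
proof
  fix y
  interpret s: femb \<sigma> by (rule GG_femb[OF assms(1)])
  interpret t: femb \<tau> by (rule GG_femb[OF assms(2)])
  define S where "S = {y. \<sigma> y = \<tau> y}"
  have "is_subfield S" unfolding is_subfield_def S_def
    by (auto simp: s.e_diff t.e_diff s.e_mult t.e_mult s.e_inverse t.e_inverse)
  moreover have "range emb \<subseteq> S" "x ` {1..n} \<subseteq> S" using assms by (auto simp: S_def)
  ultimately have "adjoin emb (x ` {1..n}) \<subseteq> S" unfolding adjoin_def by blast
  thus "\<sigma> y = \<tau> y" using adj by (auto simp: S_def)
qed

text \<open>Two roots of the same Artin-Schreier equation differ by a root of
  \<open>X^p - X\<close>.\<close>

lemma GG_x: assumes "\<sigma> \<in> GG" "i \<in> {1..n}" shows "\<exists>m<p. \<sigma> (x i) = x i + of_nat m"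
proof -
  interpret s: femb \<sigma> by (rule GG_femb[OF assms(1)])
  define y where "y = \<sigma> (x i) - x i"
  have sx: "\<sigma> (x i) = x i + y" by (simp add: y_def)
  have "\<sigma> (x i) ^ p = \<sigma> (x i) + emb (f i)"
    using x_pow[OF assms(2)] assms(1) by (metis s.e_power s.e_add GG_emb)
  moreover have "(x i + y) ^ p = x i ^ p + y ^ p" by (rule freshmans_dream) (use charL prime in auto)
  ultimately have "y ^ p = y" using x_pow[OF assms(2)] by (simp add: sx)
  then obtain m where "m < p" "y = of_nat m" using power_char_eq_self_imp_of_nat[OF prime charL] by blast
  thus ?thesis using sx by auto
qed

definition tup :: "('l \<Rightarrow> 'l) \<Rightarrow> nat \<Rightarrow> nat" where
  "tup \<sigma> = (\<lambda>i\<in>{1..n}. SOME m. m < p \<and> \<sigma> (x i) = x i + of_nat m)"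

lemma tup: assumes "\<sigma> \<in> GG" "i \<in> {1..n}" shows "tup \<sigma> i < p" "\<sigma> (x i) = x i + of_nat (tup \<sigma> i)"
  using someI_ex[OF GG_x[OF assms, unfolded Bex_def]] assms(2) by (auto simp: tup_def)

lemma tup_in: "\<sigma> \<in> GG \<Longrightarrow> tup \<sigma> \<in> Tup"
  using tup by (auto simp: Tup_def PiE_iff extensional_def tup_def)

lemma tup_bij: "bij_betw tup GG Tup"
proof -
  have inj: "inj_on tup GG"
    by (rule inj_onI, rule GG_eqI) (auto simp: tup)
  have "tup ` GG \<subseteq> Tup" using tup_in by blast
  moreover have "card (tup ` GG) = card Tup" using inj card_GG card_Tup by (simp add: card_image)
  ultimately have "tup ` GG = Tup" using fin_Tup card_subset_eq by blast
  thus ?thesis using inj by (simp add: bij_betw_def)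
qed

lemma GG_pow_p: assumes "\<sigma> \<in> GG" shows "\<sigma> ^^ p = id"
proof -
  interpret s: femb \<sigma> by (rule GG_femb[OF assms])
  have "(\<sigma> ^^ j) \<in> GG" for j using GG_id GG_comp[OF assms] by (induction j) auto
  moreover have "(\<sigma> ^^ j) (x i) = x i + of_nat j * of_nat (tup \<sigma> i)" if "i \<in> {1..n}" for i j
    by (induction j) (use that assms tup in \<open>auto simp: s.e_add s.e_mult algebra_simps\<close>)
  hence "(\<sigma> ^^ p) (x i) = id (x i)" if "i \<in> {1..n}" for i
    using that charL of_nat_CHAR[where 'a = 'l] by simp
  ultimately show ?thesis using GG_eqI[of "\<sigma> ^^ p" id] GG_id by blast
qed

lemma p_not_dvd_b: "\<not> int p dvd b"
proof -
  have "card GG > 1" unfolding card_GG using p_gt1 n_pos by (intro one_less_power) auto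
  hence "GG \<noteq> {id}" by auto
  then obtain \<sigma> where "\<sigma> \<in> GG" "\<sigma> \<noteq> id" using GG_id by blast
  thus ?thesis using p_not_dvd_break GG_pow_p by blast
qed

definition mon :: "(nat \<Rightarrow> nat) \<Rightarrow> 'l" where "mon \<alpha> = (\<Prod>i\<in>{1..n}. x i ^ \<alpha> i)"

lemma mon_upd: "i \<in> {1..n} \<Longrightarrow> mon (\<alpha>(i := k)) = x i ^ k * (\<Prod>i\<in>{1..n} - {i}. x i ^ \<alpha> i)"
  unfolding mon_def by (subst prod.remove[of _ i]) (auto intro!: prod.cong)

text \<open>The \<open>K\<close>-span of the \<open>p ^ n\<close> reduced monomials is already a
  field containing all \<open>x i\<close>: products are reduced by the Artin-Schreier equations, and
  inverses come from norms. The opposite inequality is obtained in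
  \<open>degree_and_valuation\<close>.\<close>

lemma N_le: "N \<le> p ^ n"
proof -
  obtain B where fd: "finite_dimensional_vector_space (\<lambda>c x. emb c * x) B"
    using tr unfolding totally_ramified_def finite_extension_def by blast
  interpret V: finite_dimensional_vector_space "\<lambda>c x. emb c * x" B by (rule fd)
  define S where "S = V.span (mon ` Tup)"
  have S_add: "y \<in> S \<Longrightarrow> z \<in> S \<Longrightarrow> y + z \<in> S" for y z unfolding S_def by (rule V.span_add)
  have S_scale: "y \<in> S \<Longrightarrow> emb c * y \<in> S" for y c unfolding S_def by (rule V.span_scale)
  have S_mon: "\<alpha> \<in> Tup \<Longrightarrow> mon \<alpha> \<in> S" for \<alpha> unfolding S_def by (rule V.span_base) blast
  have S_induct [consumes 1, case_names zero step]: "P y" if "y \<in> S" "P 0" "\<And>c \<alpha> y. \<alpha> \<in> Tup \<Longrightarrow> P y \<Longrightarrow> P (emb c * mon \<alpha> + y)" for P y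
    using that(1) unfolding S_def
    by (induction rule: V.span_induct_alt) (use that(2,3) in auto)
  have S_0: "0 \<in> S" unfolding S_def by (rule V.span_zero)
  have S_x: "x i * y \<in> S" if i: "i \<in> {1..n}" and y: "y \<in> S" for i y
    using y
  proof (induction y rule: S_induct)
    case (step c \<alpha> y)
    have "x i * mon \<alpha> \<in> S"
    proof (cases "Suc (\<alpha> i) < p")
      case True
      have "x i * mon \<alpha> = mon (\<alpha>(i := Suc (\<alpha> i)))"
        using mon_upd[OF i, of \<alpha> "\<alpha> i"] mon_upd[OF i, of \<alpha> "Suc (\<alpha> i)"] by simp
      moreover have "\<alpha>(i := Suc (\<alpha> i)) \<in> Tup" using step i True by (auto simp: Tup_def PiE_iff extensional_def)
      ultimately show ?thesis using S_mon by simp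
    next
      case False
      have "\<alpha> i < p" using step(1) i by (auto simp: Tup_def PiE_iff)
      hence p: "p = Suc (\<alpha> i)" using False by simp
      \<comment> \<open>The exponent of \<open>x i\<close> would become \<open>p\<close>; the
        equation for \<open>x i ^ p\<close> replaces it by the exponents \<open>1\<close> and
        \<open>0\<close>.\<close>
      define Q where "Q = (\<Prod>i\<in>{1..n} - {i}. x i ^ \<alpha> i)"
      have "x i * mon \<alpha> = x i ^ p * Q"
        using mon_upd[OF i, of \<alpha> "\<alpha> i"] by (simp add: p Q_def)
      also have "\<dots> = x i ^ 1 * Q + emb (f i) * (x i ^ 0 * Q)"
        unfolding x_pow[OF i] by (simp add: algebra_simps)
      also have "\<dots> = mon (\<alpha>(i := 1)) + emb (f i) * mon (\<alpha>(i := 0))"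
        unfolding mon_upd[OF i] Q_def ..
      finally show ?thesis
        using step(1) i p_gt1 S_mon S_add S_scale by (simp add: Tup_def PiE_iff extensional_def)
    qed
    from S_add[OF S_scale[OF this] step(2)] have "emb c * (x i * mon \<alpha>) + x i * y \<in> S" .
    thus ?case by (simp add: algebra_simps)
  qed (use S_0 in simp)
  have S_xpow: "x i ^ k * y \<in> S" if "i \<in> {1..n}" "y \<in> S" for i k y
  proof (induction k)
    case (Suc k)
    show ?case using S_x[OF that(1) Suc] by (simp only: power_Suc mult.assoc)
  qed (use that in simp)
  have S_monmult: "mon \<alpha> * y \<in> S" if "y \<in> S" for \<alpha> y
  proof -
    have "(\<Prod>i\<in>J. x i ^ \<alpha> i) * y \<in> S" if "finite J" "J \<subseteq> {1..n}" for J
      using that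
    proof (induction J rule: finite_induct)
      case (insert i J)
      hence "x i ^ \<alpha> i * ((\<Prod>i\<in>J. x i ^ \<alpha> i) * y) \<in> S" by (intro S_xpow) auto
      thus ?case using insert.hyps by (simp add: mult.assoc)
    qed (use \<open>y \<in> S\<close> in simp)
    thus ?thesis by (simp add: mon_def)
  qed
  have S_mult: "z * y \<in> S" if "z \<in> S" "y \<in> S" for y z
    using that(1)
  proof (induction z rule: S_induct)
    case (step c \<alpha> z)
    from S_add[OF S_scale[OF S_monmult[OF that(2)]] step(2)] have "emb c * (mon \<alpha> * y) + z * y \<in> S" .
    thus ?case by (simp add: algebra_simps)
  qed (use S_0 in simp)
  have S_1: "1 \<in> S"
  proof -
    have "mon (\<lambda>i\<in>{1..n}. 0) = 1" by (simp add: mon_def)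
    moreover have "(\<lambda>i\<in>{1..n}. 0) \<in> Tup" using p_pos by (auto simp: Tup_def)
    ultimately show ?thesis using S_mon by metis
  qed
  have S_emb: "emb c \<in> S" for c using S_scale[OF S_1, of c] by simp
  have S_xi: "x i \<in> S" if "i \<in> {1..n}" for i using S_x[OF that S_1] by simp
  have S_pow: "y ^ k \<in> S" if "y \<in> S" for y k by (induction k) (use that S_1 S_mult in auto)
  have S_prod: "prod g A \<in> S" if "\<And>a. a \<in> A \<Longrightarrow> g a \<in> S" for g :: "'z \<Rightarrow> 'l" and A
    using that by (induction A rule: infinite_finite_induct) (auto intro: S_1 S_mult)
  have S_GG: "\<sigma> y \<in> S" if s: "\<sigma> \<in> GG" and y: "y \<in> S" for \<sigma> y
  proof -
    interpret s: femb \<sigma> by (rule GG_femb[OF s])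
    show ?thesis using y
    proof (induction y rule: S_induct)
      case (step c \<alpha> y)
      have "\<sigma> (mon \<alpha>) = (\<Prod>i\<in>{1..n}. \<sigma> (x i) ^ \<alpha> i)" by (simp add: mon_def s.e_prod s.e_power)
      moreover have "\<sigma> (x i) \<in> S" if "i \<in> {1..n}" for i
      proof -
        have e: "\<sigma> (x i) = x i + emb (of_nat (tup \<sigma> i))" using tup[OF s that] by simp
        show ?thesis unfolding e by (rule S_add[OF S_xi[OF that] S_emb])
      qed
      hence "(\<Prod>i\<in>{1..n}. \<sigma> (x i) ^ \<alpha> i) \<in> S" by (intro S_prod S_pow)
      ultimately show ?case using step s by (simp add: s.e_add s.e_mult S_add S_scale)
    qed (use S_0 in simp)
  qed
  have S_inv: "inverse y \<in> S" if y: "y \<in> S" for y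
  proof (cases "y = 0")
    case False
    \<comment> \<open>The norm of \<open>y\<close>: it is fixed by the group, hence lies in
      \<open>K\<close>, and the product of its other factors lies in \<open>S\<close>.\<close>
    define P where "P = (\<Prod>\<sigma>\<in>GG. \<sigma> y)"
    have "\<tau> P = P" if t: "\<tau> \<in> GG" for \<tau>
    proof -
      interpret t: femb \<tau> by (rule GG_femb[OF t])
      have inj: "inj_on (\<lambda>\<sigma>. \<tau> \<circ> \<sigma>) GG"
        by (rule inj_onI) (metis GG_inv(3)[OF t] comp_assoc id_comp)
      have "(\<lambda>\<sigma>. \<tau> \<circ> \<sigma>) ` GG \<subseteq> GG" using t GG_comp by blast
      hence "(\<lambda>\<sigma>. \<tau> \<circ> \<sigma>) ` GG = GG" by (rule card_subset_eq[OF fin_GG _ card_image[OF inj]])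
      hence "P = (\<Prod>\<sigma>\<in>GG. (\<tau> \<circ> \<sigma>) y)"
        unfolding P_def using prod.reindex[OF inj, of "\<lambda>\<sigma>. \<sigma> y"] by simp
      also have "\<dots> = \<tau> P" by (simp add: P_def t.e_prod)
      finally show ?thesis by simp
    qed
    then obtain c where c: "P = emb c" using fixed_field[of P] by blast
    have "\<sigma> y \<noteq> 0" if "\<sigma> \<in> GG" for \<sigma>
      using femb.e_eq_0_iff[OF GG_femb[OF that]] False by simp
    hence P0: "P \<noteq> 0" unfolding P_def using fin_GG by simp
    define Q where "Q = (\<Prod>\<sigma>\<in>GG - {id}. \<sigma> y)"
    have "P = y * Q" unfolding P_def Q_def using prod.remove[OF fin_GG GG_id, of "\<lambda>\<sigma>. \<sigma> y"] by simp
    hence "inverse y = inverse P * Q" using P0 by (auto simp: divide_simps)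
    hence "inverse y = emb (inverse c) * Q" by (simp only: c e_inverse)
    moreover have "Q \<in> S" unfolding Q_def by (rule S_prod) (use S_GG y in auto)
    ultimately show ?thesis using S_scale by simp
  qed (use S_0 in simp)
  have "is_subfield S" unfolding is_subfield_def
  proof (intro conjI ballI S_1 S_inv S_mult)
    fix y z assume yz: "y \<in> S" "z \<in> S"
    from S_add[OF yz(1) S_scale[OF yz(2)]] have "y + emb (-1) * z \<in> S" .
    thus "y - z \<in> S" by (simp add: e_minus)
  qed
  moreover have "range emb \<subseteq> S" "x ` {1..n} \<subseteq> S" using S_emb S_xi by auto
  ultimately have "adjoin emb (x ` {1..n}) \<subseteq> S" unfolding adjoin_def by blast
  hence "UNIV \<subseteq> S" using adj by simp
  hence "V.dim UNIV \<le> card (mon ` Tup)"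
    unfolding S_def by (rule V.dim_le_card) (use fin_Tup in simp)
  also have "\<dots> \<le> p ^ n" using card_image_le[OF fin_Tup] card_Tup by metis
  finally show ?thesis by (simp add: N_def ext_degree_def)
qed

end

text \<open>Gaussian elimination inside a subfield: the combinations of the \<open>x i\<close> must
  have coefficients in \<open>F\<close>, so that these have valuation \<open>0\<close> or
  vanish.\<close>

lemma (in subfld) homogeneous_solution:
  assumes "finite I" "card I > m" "\<And>s i. s < m \<Longrightarrow> i \<in> I \<Longrightarrow> A s i \<in> S"
  shows "\<exists>a. (\<forall>i. a i \<in> S) \<and> (\<exists>i\<in>I. a i \<noteq> 0) \<and> (\<forall>s<m. (\<Sum>i\<in>I. a i * A s i) = 0)"
  using assms
proof (induction m arbitrary: I A)
  case 0
  then obtain i where "i \<in> I" by fastforce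
  thus ?case by (intro exI[of _ "\<lambda>_. 1"]) auto
next
  case (Suc m)
  show ?case
  proof (cases "\<exists>i0\<in>I. A m i0 \<noteq> 0")
    case False
    from Suc.IH[of I A] Suc.prems obtain a where
      a: "\<forall>i. a i \<in> S" "\<exists>i\<in>I. a i \<noteq> 0" "\<forall>s<m. (\<Sum>i\<in>I. a i * A s i) = 0" by auto
    moreover have "(\<Sum>i\<in>I. a i * A m i) = 0" using False by (intro sum.neutral) auto
    ultimately show ?thesis by (auto simp: less_Suc_eq)
  next
    case True
    then obtain i0 where i0: "i0 \<in> I" "A m i0 \<noteq> 0" by blast
    \<comment> \<open>Equation \<open>m\<close> is solved for the unknown \<open>i0\<close>, which
      is substituted into the others.\<close>
    define B where "B s i = A s i - A s i0 * (A m i / A m i0)" for s i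
    have "\<exists>a. (\<forall>i. a i \<in> S) \<and> (\<exists>i\<in>I - {i0}. a i \<noteq> 0) \<and> (\<forall>s<m. (\<Sum>i\<in>I - {i0}. a i * B s i) = 0)"
    proof (rule Suc.IH)
      show "finite (I - {i0})" "card (I - {i0}) > m" using Suc.prems i0 by auto
      show "B s i \<in> S" if "s < m" "i \<in> I - {i0}" for s i
        unfolding B_def using that Suc.prems(3) i0 by (intro S_diff S_mult S_divide) auto
    qed
    then obtain a where a: "\<forall>i. a i \<in> S" "\<exists>i\<in>I - {i0}. a i \<noteq> 0"
      "\<forall>s<m. (\<Sum>i\<in>I - {i0}. a i * B s i) = 0" by blast
    define c where "c = - (\<Sum>i\<in>I - {i0}. a i * (A m i / A m i0))"
    define a' where "a' = a(i0 := c)"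
    have sum: "(\<Sum>i\<in>I. a' i * A s i) = c * A s i0 + (\<Sum>i\<in>I - {i0}. a i * A s i)" for s
    proof -
      have "(\<Sum>i\<in>I - {i0}. a' i * A s i) = (\<Sum>i\<in>I - {i0}. a i * A s i)"
        by (rule sum.cong) (auto simp: a'_def)
      thus ?thesis using sum.remove[OF Suc.prems(1) i0(1), of "\<lambda>i. a' i * A s i"] by (simp add: a'_def)
    qed
    have cS: "c \<in> S" unfolding c_def using Suc.prems(3) i0 a(1) by (intro S_uminus S_sum S_mult S_divide) auto
    have B: "(\<Sum>i\<in>I - {i0}. a i * B s i) = (\<Sum>i\<in>I - {i0}. a i * A s i) + c * A s i0" for s
      unfolding B_def c_def
      by (simp add: algebra_simps sum_subtractf sum_distrib_left)
    have "(\<Sum>i\<in>I. a' i * A s i) = 0" if "s < Suc m" for s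
    proof (cases "s = m")
      case True
      have "c * A m i0 = - (\<Sum>i\<in>I - {i0}. a i * A m i)"
        unfolding c_def using i0(2) by (simp add: sum_distrib_right)
      thus ?thesis unfolding sum True by simp
    next
      case False
      thus ?thesis using a(3) that B[of s] unfolding sum by (auto simp: add.commute)
    qed
    moreover have "\<forall>i. a' i \<in> S" using a(1) cS by (simp add: a'_def)
    moreover have "\<exists>i\<in>I. a' i \<noteq> 0" using a(2) by (auto simp: a'_def)
    ultimately show ?thesis by blast
  qed
qed

context artin_schreier
begin

lemma frob_sum: "sum g A ^ (p ^ r) = (\<Sum>i\<in>A. g i ^ (p ^ r))" for g :: "'z \<Rightarrow> 'k"
  by (rule freshmans_dream_sum') (use prime char in auto)

lemma frobL_sum: "sum g A ^ (p ^ r) = (\<Sum>i\<in>A. g i ^ (p ^ r))" for g :: "'z \<Rightarrow> 'l"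
  by (rule freshmans_dream_sum') (use prime charL in auto)

lemma frob_add: "(y + z) ^ (p ^ r) = y ^ (p ^ r) + z ^ (p ^ r)" for y z :: 'k
  by (rule freshmans_dream') (use prime char in auto)

lemma frobL_add: "(y + z) ^ (p ^ r) = y ^ (p ^ r) + z ^ (p ^ r)" for y z :: 'l
  by (rule freshmans_dream') (use prime charL in auto)

lemma frobL_diff: "(y - z) ^ (p ^ r) = y ^ (p ^ r) - z ^ (p ^ r)" for y z :: 'l
  using frobL_add[of "y - z" z r] by (simp add: eq_diff_eq)

text \<open>Nonvanishing of the Moore determinant. With the last coefficient normalised to
  \<open>1\<close>, the Frobenius of relation \<open>s\<close> minus relation \<open>s + 1\<close>
  is a shorter relation among the \<open>\<nu> i ^ p\<close> with coefficients
  \<open>a' i ^ p - a' i\<close>. By induction these vanish, so the \<open>a' i\<close> lie in the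
  prime field, and the relation for \<open>s = 0\<close> contradicts independence.\<close>

lemma moore:
  assumes "\<And>c :: nat \<Rightarrow> nat. (\<Sum>i=1..m. of_nat (c i) * \<nu> i) = 0 \<Longrightarrow> \<forall>i\<in>{1..m}. p dvd c i"
    and "\<And>s. s < m \<Longrightarrow> (\<Sum>i=1..m. a i * \<nu> i ^ (p ^ s)) = 0"
    and "i \<in> {1..m}"
  shows "a i = (0::'k)"
  using assms
proof (induction m arbitrary: \<nu> a i)
  case (Suc m)
  have ind': "\<forall>i\<in>{1..m}. p dvd c i" if "(\<Sum>i=1..m. of_nat (c i) * \<nu> i) = 0" for c :: "nat \<Rightarrow> nat"
  proof -
    have "(\<Sum>i=1..Suc m. of_nat ((c(Suc m := 0)) i) * \<nu> i) = (\<Sum>i=1..m. of_nat (c i) * \<nu> i)"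
    proof -
      have "(\<Sum>i=1..m. of_nat ((c(Suc m := 0)) i) * \<nu> i) = (\<Sum>i=1..m. of_nat (c i) * \<nu> i)"
        by (rule sum.cong) auto
      thus ?thesis by simp
    qed
    hence "\<forall>i\<in>{1..Suc m}. p dvd (c(Suc m := 0)) i" using Suc.prems(1)[of "c(Suc m := 0)"] that by simp
    thus ?thesis by force
  qed
  show ?case
  proof (cases "a (Suc m) = 0")
    case True
    have "a i = 0" if "i \<in> {1..m}" for i
    proof (rule Suc.IH[OF ind' _ that])
      fix s assume "s < m"
      thus "(\<Sum>i = 1..m. a i * \<nu> i ^ p ^ s) = 0" using Suc.prems(2)[of s] True by simp
    qed
    thus ?thesis using Suc.prems(3) True by (cases "i = Suc m") auto
  next
    case False
    define a' where "a' i = a i / a (Suc m)" for i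
    have a'1: "a' (Suc m) = 1" using False by (simp add: a'_def)
    have a': "(\<Sum>i=1..Suc m. a' i * \<nu> i ^ (p ^ s)) = 0" if "s < Suc m" for s
      using Suc.prems(2)[OF that] unfolding a'_def
      by (simp add: sum_divide_distrib[symmetric] del: sum.cl_ivl_Suc)
    have ind2: "\<forall>i\<in>{1..m}. p dvd c i" if "(\<Sum>i=1..m. of_nat (c i) * \<nu> i ^ p) = 0" for c :: "nat \<Rightarrow> nat"
    proof -
      have "(\<Sum>i=1..m. of_nat (c i) * \<nu> i) ^ p = (\<Sum>i=1..m. (of_nat (c i) * \<nu> i) ^ p)"
        using frob_sum[of _ _ 1] by simp
      also have "\<dots> = 0" using that by (simp add: power_mult_distrib of_nat_power_char[OF prime char])
      finally show ?thesis using ind' by simp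
    qed
    have zero: "a' i ^ p - a' i = 0" if "i \<in> {1..m}" for i
    proof (rule Suc.IH[OF ind2 _ that])
      fix s assume s: "s < m"
      have "(\<Sum>i=1..Suc m. a' i * \<nu> i ^ (p ^ s)) ^ p = (\<Sum>i=1..Suc m. a' i ^ p * \<nu> i ^ (p ^ Suc s))"
      proof -
        have "(a' i * \<nu> i ^ (p ^ s)) ^ p = a' i ^ p * \<nu> i ^ (p ^ Suc s)" for i
          by (simp only: power_mult_distrib power_mult[symmetric] power_Suc2)
        thus ?thesis using frob_sum[of "\<lambda>i. a' i * \<nu> i ^ (p ^ s)" "{1..Suc m}" 1]
          by (simp del: sum.cl_ivl_Suc)
      qed
      hence "(\<Sum>i=1..Suc m. a' i ^ p * \<nu> i ^ (p ^ Suc s)) = 0" using a'[of s] s p_pos by (simp add: zero_power del: sum.cl_ivl_Suc)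
      moreover have "(\<Sum>i=1..Suc m. a' i * \<nu> i ^ (p ^ Suc s)) = 0" using a'[of "Suc s"] s by simp
      ultimately have "(\<Sum>i=1..Suc m. (a' i ^ p - a' i) * \<nu> i ^ (p ^ Suc s)) = 0"
        by (simp add: left_diff_distrib sum_subtractf del: sum.cl_ivl_Suc)
      thus "(\<Sum>i = 1..m. (a' i ^ p - a' i) * (\<nu> i ^ p) ^ p ^ s) = 0"
        by (simp add: a'1 power_mult[symmetric])
    qed
    hence "\<forall>i\<in>{1..m}. \<exists>k. a' i = of_nat k"
      using power_char_eq_self_imp_of_nat[OF prime char] by (metis eq_iff_diff_eq_0)
    then obtain c where c: "\<And>i. i \<in> {1..m} \<Longrightarrow> a' i = of_nat (c i)" by metis
    define c' where "c' = c(Suc m := 1)"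
    have "(\<Sum>i=1..Suc m. of_nat (c' i) * \<nu> i) = (\<Sum>i=1..Suc m. a' i * \<nu> i)"
      by (intro sum.cong) (use c a'1 in \<open>auto simp: c'_def\<close>)
    also have "\<dots> = 0" using a'[of 0] by simp
    finally have "\<forall>i\<in>{1..Suc m}. p dvd c' i" by (rule Suc.prems(1))
    hence "p dvd c' (Suc m)" by simp
    hence False using p_gt1 by (simp add: c'_def)
    thus ?thesis ..
  qed
qed simp

text \<open>Up to a Frobenius twist, the coefficients of the powers of \<beta> when a combination of
  the \<open>x i\<close> is raised to a power of \<open>p\<close>.\<close>

definition M :: "nat \<Rightarrow> (nat \<Rightarrow> 'k) \<Rightarrow> 'k" where "M t a = (\<Sum>i=1..n. a i * \<omega> i ^ (p ^ t))"

lemma M_inj: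
  assumes j: "j \<le> n" and jm: "r + j \<le> n" and M: "\<And>t. r \<le> t \<Longrightarrow> t < r + j \<Longrightarrow> M t a = 0"
    and supp: "\<And>i. i \<in> {1..n} \<Longrightarrow> i > j \<Longrightarrow> a i = 0" and i: "i \<in> {1..j}"
  shows "a i = 0"
proof (rule moore[where \<nu> = "\<lambda>i. \<omega> i ^ (p ^ r)", OF _ _ i])
  fix c :: "nat \<Rightarrow> nat" assume c: "(\<Sum>i = 1..j. of_nat (c i) * \<omega> i ^ p ^ r) = 0"
  have ofn: "of_nat k ^ (p ^ r) = (of_nat k :: 'k)" for k
    by (induction r) (simp_all add: power_mult of_nat_power_char[OF prime char])
  have "(\<Sum>i=1..j. of_nat (c i) * \<omega> i) ^ (p ^ r) = 0"
    unfolding frob_sum power_mult_distrib ofn by (rule c)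
  hence "(\<Sum>i=1..j. of_nat (c i) * \<omega> i) = 0" by simp
  moreover have "(\<Sum>i=1..n. of_int (if i \<le> j then int (c i) else 0) * \<omega> i) = (\<Sum>i=1..j. of_nat (c i) * \<omega> i)"
    by (rule sum.mono_neutral_cong_right) (use j in auto)
  ultimately have "\<forall>i\<in>{1..n}. int p dvd (if i \<le> j then int (c i) else 0)"
    using indep unfolding prime_field_independent_def by metis
  thus "\<forall>i\<in>{1..j}. p dvd c i"
  proof (intro ballI)
    fix i assume i: "i \<in> {1..j}"
    hence "i \<in> {1..n}" using j by simp
    from bspec[OF \<open>\<forall>i\<in>{1..n}. int p dvd (if i \<le> j then int (c i) else 0)\<close> this] i
    show "p dvd c i" by simp
  qed
next
  fix s assume s: "s < j"
  have "(\<Sum>i=1..n. a i * \<omega> i ^ (p ^ (r + s))) = (\<Sum>i=1..j. a i * \<omega> i ^ (p ^ (r + s)))"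
    by (rule sum.mono_neutral_right) (use j supp in auto)
  thus "(\<Sum>i = 1..j. a i * (\<omega> i ^ p ^ r) ^ p ^ s) = 0"
    using M[of "r + s"] s unfolding M_def by (simp add: power_mult[symmetric] power_add)
qed

text \<open>There are \<open>j - 1\<close> equations for \<open>j\<close> unknowns. With
  \<open>a j = 0\<close>, or with the further equation \<open>M (n - j) a = 0\<close>, the system
  would be square and \<open>M_inj\<close> would force the zero solution. So \<open>a j\<close> can
  be scaled to \<open>1\<close>, and \<open>M (n - j) a\<close> survives.\<close>

lemma coeff_ex:
  assumes j: "j \<in> {1..n}"
  shows "\<exists>a. (\<forall>i. a i \<in> F) \<and> (\<forall>i>j. a i = 0) \<and> a j = 1 \<and> (\<forall>t. n - j < t \<longrightarrow> t < n \<longrightarrow> M t a = 0) \<and> M (n - j) a \<noteq> 0"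
proof -
  have "\<exists>a. (\<forall>i. a i \<in> F) \<and> (\<exists>i\<in>{1..j}. a i \<noteq> 0) \<and> (\<forall>s<j - 1. (\<Sum>i\<in>{1..j}. a i * \<omega> i ^ (p ^ (n - j + 1 + s))) = 0)"
    by (rule F.homogeneous_solution) (use j omega in auto)
  then obtain a where a: "\<forall>i. a i \<in> F" "\<exists>i\<in>{1..j}. a i \<noteq> 0"
    "\<forall>s<j - 1. (\<Sum>i\<in>{1..j}. a i * \<omega> i ^ (p ^ (n - j + 1 + s))) = 0" by blast
  define a1 where "a1 i = (if i \<le> j then a i else 0)" for i
  have M1: "M t a1 = (\<Sum>i\<in>{1..j}. a i * \<omega> i ^ (p ^ t))" for t
    unfolding M_def a1_def by (rule sum.mono_neutral_cong_right) (use j in auto)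
  have M0: "M t a1 = 0" if "n - j < t" "t < n" for t
    using a(3)[rule_format, of "t - (n - j + 1)"] that j unfolding M1 by auto
  have aj: "a j \<noteq> 0"
  proof
    assume "a j = 0"
    have "a1 i = 0" if "i \<in> {1..j-1}" for i
    proof (rule M_inj[where j = "j - 1" and r = "n - j + 1", OF _ _ _ _ that])
      show "a1 i = 0" if "i \<in> {1..n}" "i > j - 1" for i
        using that \<open>a j = 0\<close> by (cases "i = j") (auto simp: a1_def)
    qed (use j M0 in auto)
    moreover have "a1 j = 0" using \<open>a j = 0\<close> by (simp add: a1_def)
    ultimately have "a1 i = 0" if "i \<in> {1..j}" for i using that by (cases "i = j") auto
    thus False using a(2) by (auto simp: a1_def)
  qed
  define a2 where "a2 i = a1 i / a j" for i
  have M2: "M t a2 = M t a1 / a j" for t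
    unfolding M_def a2_def by (simp add: sum_divide_distrib)
  have "M (n - j) a2 \<noteq> 0"
  proof
    assume z: "M (n - j) a2 = 0"
    have "a2 j = 0"
    proof (rule M_inj[where j = j and r = "n - j"])
      show "M t a2 = 0" if "n - j \<le> t" "t < n - j + j" for t
        using that M0[of t] z j by (cases "t = n - j") (auto simp: M2)
    qed (use j in \<open>auto simp: a2_def a1_def\<close>)
    thus False using aj by (simp add: a2_def a1_def)
  qed
  moreover have "a2 i \<in> F" for i using a(1) by (auto simp: a2_def a1_def intro!: F.S_divide)
  ultimately show ?thesis
    using aj M0 by (intro exI[of _ a2]) (auto simp: M2, auto simp: a2_def a1_def)
qed

definition XX :: "(nat \<Rightarrow> 'k) \<Rightarrow> 'l" where "XX a = (\<Sum>i=1..n. emb (a i) * x i)"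

lemma x_pow_pow: "i \<in> {1..n} \<Longrightarrow> x i ^ (p ^ j) = x i + (\<Sum>l<j. emb (f i ^ (p ^ l)))"
proof (induction j)
  case (Suc j)
  have "x i ^ (p ^ Suc j) = (x i ^ (p ^ j)) ^ (p ^ 1)" by (simp add: power_mult[symmetric] mult.commute)
  also have "\<dots> = x i ^ p + (\<Sum>l<j. emb (f i ^ (p ^ Suc l)))"
    unfolding Suc.IH[OF Suc.prems] frobL_add frobL_sum
    by (simp add: e_power[symmetric] power_mult[symmetric] mult.commute)
  also have "\<dots> = x i + (\<Sum>l<Suc j. emb (f i ^ (p ^ l)))"
    unfolding x_pow[OF Suc.prems] sum.lessThan_Suc_shift by simp
  finally show ?case .
qed simp

text \<open>Where \<open>y\<close> has negative valuation, \<open>y ^ p\<close> dominates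
  \<open>y\<close> and has the valuation of \<open>z\<close>; otherwise \<open>m \<le> 0\<close> is
  enough.\<close>

lemma as_vge:
  assumes y: "y ^ p - y = (z::'l)" and z: "vge vL z m" and m: "m \<le> 0"
  shows "vge vL (y ^ p) m"
proof (cases "y = 0 \<or> vge vL y 0")
  case True
  hence "vge vL y 0" by auto
  from L.vge_power[OF this, of p] show ?thesis using m by (auto elim: L.vge_mono)
next
  case False
  then obtain k where k: "veq vL y k" using L.veq_ex by blast
  have k0: "k < 0" using False L.vge_veq_iff[OF k] by auto
  have "int p * k < 1 * k" using k0 p_gt1 by (intro mult_strict_right_mono_neg) auto
  hence "veq vL (y ^ p + (- y)) (int p * k)"
    using L.veq_add[OF L.veq_power[OF k], of "- y" p] L.veq_vge[OF L.veq_uminus[OF k]] by simp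
  hence "veq vL z (int p * k)" using y by simp
  hence "m \<le> int p * k" using z L.vge_veq_iff by blast
  thus ?thesis using L.veq_power[OF k] by (auto intro: L.veq_vge)
qed

text \<open>The \<open>p\<close>-th root of a negative valuation gains at least \<open>1\<close>,
  which is all that the strict comparisons ask for.\<close>

lemma vge_root:
  assumes "vge vL (y ^ p) m" "m < 0" shows "vge vL y (m + 1)"
proof (cases "y = 0")
  case False
  then obtain k where k: "veq vL y k" using L.veq_ex by blast
  have mk: "m \<le> int p * k" using assms(1) L.vge_veq_iff[OF L.veq_power[OF k]] by blast
  have "m + 1 \<le> k"
  proof (rule ccontr)
    assume "\<not> m + 1 \<le> k"
    hence km: "k \<le> m" by simp
    hence "int p * k \<le> int p * m" using p_pos by simp
    also have "\<dots> < 1 * m" using assms(2) p_gt1 by (intro mult_strict_right_mono_neg) auto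
    finally show False using mk by simp
  qed
  thus ?thesis using k by (auto intro: L.veq_vge)
qed simp

lemma as_veq:
  assumes y: "y ^ p - y = (z::'l)" and z: "veq vL z m" and m: "m < 0"
  shows "veq vL (y ^ p) m"
proof -
  have "vge vL y (m + 1)" using as_vge[OF y L.veq_vge[OF z]] m vge_root by simp
  from L.veq_add[OF z this] show ?thesis using y by (simp add: diff_eq_eq)
qed

lemma bN_pos: "0 < b * int N" using b_pos N_pos by simp

lemma f_vge: "i \<in> {1..n} \<Longrightarrow> vge vK (f i) (- b)"
  unfolding f_def using K.vge_mult[OF F_vge[OF F.S_power[OF omega]] K.veq_vge[OF beta order_refl], of i "p ^ n"]
    K.vge_mono[OF eps, of i "- b"] by (intro K.vge_add) auto

lemma x_vge_pow: "i \<in> {1..n} \<Longrightarrow> vge vL (x i ^ p) (- b * int N)"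
proof -
  assume i: "i \<in> {1..n}"
  have "x i ^ p - x i = emb (f i)" using x_pow[OF i] by simp
  moreover have "vge vL (emb (f i)) (- b * int N)" using vge_emb[OF f_vge[OF i]] by (simp add: mult.commute)
  ultimately show ?thesis using bN_pos by (intro as_vge) auto
qed

lemma x_vge: "i \<in> {1..n} \<Longrightarrow> vge vL (x i) (- b * int N + 1)"
  using vge_root[OF x_vge_pow] bN_pos by simp

lemma eps_pow:
  assumes "i \<in> {1..n}" "n \<ge> 2" "l \<le> n - 2"
  shows "vge vK (\<epsilon> i ^ (p ^ l)) (- b + 1)"
proof (cases "vge vK (\<epsilon> i) 0")
  case True
  from K.vge_power[OF this, of "p ^ l"] show ?thesis using b_pos by (auto elim: K.vge_mono)
next
  case False
  hence "\<epsilon> i \<noteq> 0" by auto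
  then obtain k where k: "veq vK (\<epsilon> i) k" using K.veq_ex by blast
  have k0: "k < 0" using False K.vge_veq_iff[OF k] by auto
  have "- b + 1 \<le> int (p ^ (n - 2)) * k"
    using eps_strong[OF assms(2,1)] K.vge_veq_iff[OF K.veq_power[OF k]] by blast
  also have "\<dots> \<le> int (p ^ l) * k"
    using k0 assms(3) p_pos by (intro mult_right_mono_neg) (auto intro: power_increasing)
  finally show ?thesis using K.veq_power[OF k, of "p ^ l"] by (auto intro: K.veq_vge)
qed

text \<open>After \<open>j\<close> iterations of the Artin-Schreier equation,
  \<open>\<beta> ^ (p ^ l)\<close> carries the coefficient \<open>M (n + l - j) a ^ (p ^ j)\<close>,
  which vanishes for \<open>0 < l < j\<close>. Only \<beta> itself remains. The error terms
  \<open>\<epsilon> i ^ (p ^ l)\<close> have \<open>l \<le> n - 2\<close> because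
  \<open>j < n\<close>.\<close>

lemma XX_pow:
  assumes a: "\<And>i. a i \<in> F" and j: "1 \<le> j" "j < n" and M: "\<And>t. n - j < t \<Longrightarrow> t < n \<Longrightarrow> M t a = 0"
  shows "vge vL (XX a ^ (p ^ j) - emb (M (n - j) a ^ (p ^ j) * \<beta>)) (- b * int N + 1)"
proof -
  have fl: "f i ^ (p ^ l) = \<omega> i ^ (p ^ (n + l)) * \<beta> ^ (p ^ l) + \<epsilon> i ^ (p ^ l)" for i l
    unfolding f_def frob_add by (simp add: power_mult_distrib power_mult[symmetric] power_add)
  have Ml: "(\<Sum>i=1..n. a i ^ (p ^ j) * \<omega> i ^ (p ^ (n + l))) = M (n + l - j) a ^ (p ^ j)" for l
  proof -
    have "(a i * \<omega> i ^ (p ^ (n + l - j))) ^ (p ^ j) = a i ^ (p ^ j) * \<omega> i ^ (p ^ (n + l))" for i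
      using j by (simp add: power_mult_distrib power_mult[symmetric] power_add[symmetric])
    thus ?thesis unfolding M_def frob_sum by simp
  qed
  have "XX a ^ (p ^ j) = (\<Sum>i=1..n. emb (a i ^ (p ^ j)) * (x i + (\<Sum>l<j. emb (f i ^ (p ^ l)))))"
    unfolding XX_def frobL_sum by (intro sum.cong) (simp_all add: power_mult_distrib e_power x_pow_pow)
  also have "\<dots> = (\<Sum>i=1..n. emb (a i ^ (p ^ j)) * x i) + emb (\<Sum>i=1..n. \<Sum>l<j. a i ^ (p ^ j) * f i ^ (p ^ l))"
    by (simp add: e_sum e_mult distrib_left sum.distrib sum_distrib_left)
  also have "(\<Sum>i=1..n. \<Sum>l<j. a i ^ (p ^ j) * f i ^ (p ^ l))
     = (\<Sum>l<j. \<beta> ^ (p ^ l) * (\<Sum>i=1..n. a i ^ (p ^ j) * \<omega> i ^ (p ^ (n + l))))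
       + (\<Sum>l<j. \<Sum>i=1..n. a i ^ (p ^ j) * \<epsilon> i ^ (p ^ l))"
    by (subst sum.swap) (simp add: fl distrib_left sum.distrib sum_distrib_left mult_ac)
  also have "(\<Sum>l<j. \<beta> ^ (p ^ l) * (\<Sum>i=1..n. a i ^ (p ^ j) * \<omega> i ^ (p ^ (n + l))))
     = (\<Sum>l<j. if l = 0 then M (n - j) a ^ (p ^ j) * \<beta> else 0)"
  proof (intro sum.cong refl)
    fix l assume "l \<in> {..<j}"
    thus "\<beta> ^ (p ^ l) * (\<Sum>i=1..n. a i ^ (p ^ j) * \<omega> i ^ (p ^ (n + l)))
      = (if l = 0 then M (n - j) a ^ (p ^ j) * \<beta> else 0)"
      unfolding Ml using M[of "n + l - j"] j p_pos by (cases "l = 0") auto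
  qed
  also have "\<dots> = M (n - j) a ^ (p ^ j) * \<beta>" using j by simp
  finally have eq: "XX a ^ (p ^ j) - emb (M (n - j) a ^ (p ^ j) * \<beta>)
     = (\<Sum>i=1..n. emb (a i ^ (p ^ j)) * x i) + emb (\<Sum>l<j. \<Sum>i=1..n. a i ^ (p ^ j) * \<epsilon> i ^ (p ^ l))"
    by (simp add: e_add)
  have "vge vL (\<Sum>i=1..n. emb (a i ^ (p ^ j)) * x i) (- b * int N + 1)"
    using L.vge_mult[OF F_vgeL[OF F.S_power[OF a]] x_vge] by (intro L.vge_sum) simp
  moreover have "vge vK (\<Sum>l<j. \<Sum>i=1..n. a i ^ (p ^ j) * \<epsilon> i ^ (p ^ l)) (- b + 1)"
    using K.vge_mult[OF F_vge[OF F.S_power[OF a]] eps_pow] j by (intro K.vge_sum) simp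
  hence "vge vL (emb (\<Sum>l<j. \<Sum>i=1..n. a i ^ (p ^ j) * \<epsilon> i ^ (p ^ l))) (- b * int N + 1)"
    by (rule L.vge_mono[OF vge_emb]) (use N_pos in \<open>simp add: algebra_simps\<close>)
  ultimately show ?thesis unfolding eq by (rule L.vge_add)
qed

lemma Mbeta: "(\<And>i. a i \<in> F) \<Longrightarrow> M t a \<in> F" unfolding M_def using omega by (intro F.S_sum F.S_mult F.S_power) auto

lemma XX_vge:
  assumes a: "\<And>i. a i \<in> F" and j: "1 \<le> j" "j < n" and M: "\<And>t. n - j < t \<Longrightarrow> t < n \<Longrightarrow> M t a = 0"
  shows "vge vL (XX a ^ (p ^ j)) (- b * int N)"
proof -
  have "vge vK (M (n - j) a ^ (p ^ j) * \<beta>) (- b)"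
    using K.vge_mult[OF F_vge[OF F.S_power[OF Mbeta[OF a]]] K.veq_vge[OF beta order_refl]] by simp
  from vge_emb[OF this] have "vge vL (emb (M (n - j) a ^ (p ^ j) * \<beta>)) (- b * int N)" by (simp only: mult.commute)
  from L.vge_add[OF L.vge_mono[OF XX_pow[OF a j M]] this] show ?thesis by simp
qed

lemma XX_veq:
  assumes a: "\<And>i. a i \<in> F" and j: "1 \<le> j" "j < n" and M: "\<And>t. n - j < t \<Longrightarrow> t < n \<Longrightarrow> M t a = 0"
    and nz: "M (n - j) a \<noteq> 0"
  shows "veq vL (XX a ^ (p ^ j)) (- b * int N)"
proof -
  have "veq vK (M (n - j) a ^ (p ^ j) * \<beta>) (- b)"
    using K.veq_mult[OF F_veq[OF F.S_power[OF Mbeta[OF a]]] beta] nz by simp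
  from veq_emb[OF this] have "veq vL (emb (M (n - j) a ^ (p ^ j) * \<beta>)) (- b * int N)" by (simp only: mult.commute)
  from L.veq_add[OF this XX_pow[OF a j M]] show ?thesis by simp
qed

end

section \<open>Correction of the last combination by a polynomial in \<open>x 1\<close>\<close>

context artin_schreier
begin

lemma one_in: "1 \<in> {1..n}" using n_pos by simp

lemma omega1: "\<omega> 1 \<noteq> 0"
proof
  assume "\<omega> 1 = 0"
  hence "(\<Sum>i=1..n. of_int (if i = 1 then 1 else 0 :: int) * \<omega> i) = 0" by (intro sum.neutral) auto
  hence "\<forall>i\<in>{1..n}. int p dvd (if i = 1 then 1 else 0)"
    using indep[unfolded prime_field_independent_def, rule_format, of "\<lambda>i. if i = 1 then 1 else 0"] by simp
  from bspec[OF this one_in] have "int p dvd 1" by simp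
  thus False using p_gt1 by simp
qed

lemma f1_veq: "veq vK (f 1) (- b)"
  unfolding f_def
  using K.veq_add[OF K.veq_mult[OF F_veq[OF F.S_power[OF omega[OF one_in]]] beta] , of "p ^ n" "\<epsilon> 1"]
    omega1 eps[OF one_in] by simp

lemma x1_pow_veq: "veq vL (x 1 ^ p) (- b * int N)"
proof -
  have "x 1 ^ p - x 1 = emb (f 1)" using x_pow[OF one_in] by simp
  moreover have "veq vL (emb (f 1)) (- b * int N)" using veq_emb[OF f1_veq] by (simp add: mult.commute)
  ultimately show ?thesis using bN_pos by (intro as_veq) auto
qed

lemma x1_val: "\<exists>v1. veq vL (x 1) v1 \<and> int p * v1 = - b * int N"
proof -
  have "x 1 \<noteq> 0" using L.veq_nz[OF x1_pow_veq] p_pos by auto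
  then obtain v1 where v1: "veq vL (x 1) v1" using L.veq_ex by blast
  thus ?thesis using L.veq_unique[OF L.veq_power[OF v1] x1_pow_veq] by blast
qed

lemma solve_mod: "\<exists>i<p. int p dvd m + b * int i"
proof -
  have "coprime b (int p)"
    using p_not_dvd_b prime prime_imp_coprime[of "int p" b] by (simp add: coprime_commute)
  then obtain y where y: "[b * y = 1] (mod int p)" using cong_solve_coprime_int by blast
  define i where "i = nat ((- m * y) mod int p)"
  have i: "int i = (- m * y) mod int p" using p_pos by (simp add: i_def)
  have "int i < int p" unfolding i using p_pos by simp
  hence ip: "i < p" by simp
  have "[b * int i = b * (- m * y)] (mod int p)"
    unfolding i by (intro cong_mult cong_refl) (simp add: cong_def)
  also have "b * (- m * y) = (- m) * (b * y)" by (simp add: algebra_simps)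
  also have "[\<dots> = (- m) * 1] (mod int p)" by (intro cong_mult cong_refl y)
  finally have "int p dvd b * int i - (- m)" by (simp add: cong_iff_dvd_diff)
  thus ?thesis using ip by (auto simp: add.commute)
qed

text \<open>Since \<open>p\<close> does not divide \<open>b\<close>, every valuation is attained by some \<open>g\<^sup>p f\<^sub>1\<^sup>i\<close> with \<open>i < p\<close>; leading terms
  are removed one after the other.\<close>

lemma pth_power_expansion:
  assumes "vge vK E e"
  shows "\<exists>c. (\<forall>i<p. vge vK (c i ^ p * f 1 ^ i) e) \<and> vge vK (E - (\<Sum>i<p. c i ^ p * f 1 ^ i)) (e + int j)"
proof (induction j)
  case 0
  show ?case using assms p_pos by (intro exI[of _ "\<lambda>_. 0"]) (simp add: zero_power)
next
  case (Suc j)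
  then obtain c where c: "\<forall>i<p. vge vK (c i ^ p * f 1 ^ i) e"
    "vge vK (E - (\<Sum>i<p. c i ^ p * f 1 ^ i)) (e + int j)" by blast
  define E' where "E' = E - (\<Sum>i<p. c i ^ p * f 1 ^ i)"
  obtain i k where i: "i < p" and k: "e + int j + b * int i = int p * k"
    using solve_mod[of "e + int j"] by (auto elim: dvdE)
  obtain g where g: "veq vK g k" using K.veq_surj by blast
  define y where "y = g ^ p * f 1 ^ i"
  have y: "veq vK y (e + int j)"
  proof -
    have "int p * k + int i * (- b) = e + int j" using k by (simp add: mult.commute[of b])
    thus ?thesis using K.veq_mult[OF K.veq_power[OF g, of p] K.veq_power[OF f1_veq, of i]]
      by (simp only: y_def)
  qed
  have "vge vK (E' / y) 0" using K.vge_divide[OF c(2) y] by (simp add: E'_def)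
  then obtain a where a: "a \<in> F" "vge vK (E' / y - a) 1" using residueK by blast
  \<comment> \<open>Perfectness makes the leading digit a \<open>p\<close>-th power, so that it can
    be merged into \<open>c i\<close> by additivity of Frobenius.\<close>
  obtain a0 where a0: "a0 \<in> F" "a0 ^ p = a"
    using perfect a(1) char p_pos unfolding perfect_subfield_def by auto
  have "E' - a * y = y * (E' / y - a)" using K.veq_nz[OF y] by (simp add: field_simps)
  hence Ey: "vge vK (E' - a * y) (e + int j + 1)" using K.vge_mult[OF K.veq_vge[OF y order_refl] a(2)] by simp
  define c' where "c' = c(i := c i + a0 * g)"
  have pw: "c' l ^ p * f 1 ^ l = c l ^ p * f 1 ^ l + (if l = i then a * y else 0)" for l
  proof (cases "l = i")
    case True
    have "(c i + a0 * g) ^ p = c i ^ p + (a0 * g) ^ p" by (rule freshmans_dream) (use char prime in auto)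
    thus ?thesis using True a0(2) by (simp add: c'_def y_def power_mult_distrib algebra_simps)
  qed (simp add: c'_def)
  have "vge vK (a * y) e" using K.vge_mult[OF F_vge[OF a(1)] K.veq_vge[OF y, of e]] by simp
  hence "vge vK (c' l ^ p * f 1 ^ l) e" if "l < p" for l
    unfolding pw using c(1) that by (auto intro: K.vge_add)
  moreover have "(\<Sum>l<p. c' l ^ p * f 1 ^ l) = (\<Sum>l<p. c l ^ p * f 1 ^ l) + a * y"
    unfolding pw using i by (simp add: sum.distrib)
  hence "E - (\<Sum>l<p. c' l ^ p * f 1 ^ l) = E' - a * y" by (simp add: E'_def)
  moreover have "e + int j + 1 = e + int (Suc j)" by simp
  hence "vge vK (E' - a * y) (e + int (Suc j))" using Ey by (simp only:)
  ultimately show ?case by (intro exI[of _ c']) simp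
qed

lemma M_frob: "t \<ge> 1 \<Longrightarrow> M t (\<lambda>i. a i ^ p) = M (t - 1) a ^ p"
proof -
  assume t: "t \<ge> 1"
  have "(a i * \<omega> i ^ (p ^ (t - 1))) ^ p = a i ^ p * \<omega> i ^ (p ^ t)" for i
    using t by (simp add: power_mult_distrib power_mult[symmetric] power_Suc2[symmetric])
  thus ?thesis using frob_sum[of "\<lambda>i. a i * \<omega> i ^ (p ^ (t - 1))" "{1..n}" 1] unfolding M_def by simp
qed

lemma XX_p: "XX a ^ p = XX (\<lambda>i. a i ^ p) + emb (\<Sum>i=1..n. a i ^ p * f i)"
proof -
  have "XX a ^ p = (\<Sum>i=1..n. (emb (a i) * x i) ^ p)" 
    unfolding XX_def using frobL_sum[of "\<lambda>i. emb (a i) * x i" "{1..n}" 1] by simp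
  also have "\<dots> = (\<Sum>i=1..n. emb (a i ^ p) * x i + emb (a i ^ p * f i))"
    by (intro sum.cong refl) (simp add: power_mult_distrib e_power e_mult x_pow distrib_left)
  finally show ?thesis by (simp add: XX_def sum.distrib e_sum)
qed

text \<open>The powers \<open>\<epsilon> i ^ (p ^ (n - 1))\<close> of the last combination are out
  of control. In its Artin-Schreier equation the multiple of \<beta> vanishes, and the harmful term
  is \<open>E = \<Sum> a i ^ p * \<epsilon> i\<close>. Write \<open>E\<close> as
  \<open>\<Sum> c i ^ p * f 1 ^ i\<close> modulo integral elements; since \<open>f 1\<close> equals
  \<open>x 1 ^ p\<close> up to the smaller \<open>x 1\<close>, this is nearly the
  \<open>p\<close>-th power of \<open>\<eta> = \<Sum> c i * x 1 ^ i\<close>, and subtracting \<eta>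
  removes \<open>E\<close>. The second conclusion records the size of the \<open>c i\<close>, from
  which the bound on \<kappa> follows.\<close>

lemma Y_top_ex:
  assumes n2: "n \<ge> 2" and a: "\<And>i. a i \<in> F" and M0: "\<And>t. 0 < t \<Longrightarrow> t < n \<Longrightarrow> M t a = 0"
  shows "\<exists>c. vge vL ((XX a - (\<Sum>i<p. emb (c i) * x 1 ^ i)) ^ (p ^ n)) (- b * int N) \<and>
    (\<forall>i k. i < p \<longrightarrow> veq vK (c i) k \<longrightarrow> - b + 1 \<le> int (p ^ (n - 2)) * (int p * k - b * int i))"
proof -
  define r where "r = int (p ^ (n - 2))"
  have r1: "r \<ge> 1" using p_pos by (simp add: r_def Suc_le_eq)
  define q where "q = p ^ (n - 1)"
  have n2': "n - 1 = Suc (n - 2)" "n = Suc (n - 1)" using n2 by auto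
  have qr: "int q = r * int p" unfolding q_def r_def n2'(1) by simp
  have qp: "q * p = p ^ n" unfolding q_def by (subst (2) n2'(2)) simp
  define E where "E = (\<Sum>i=1..n. a i ^ p * \<epsilon> i)"
  have "vge vK (E ^ (p ^ (n - 2))) (- b + 1)"
    unfolding E_def frob_sum power_mult_distrib
    using K.vge_mult[OF F_vge[OF F.S_power[OF F.S_power[OF a]]] eps_strong[OF n2]] by (intro K.vge_sum) simp
  hence "\<exists>e. vge vK E e \<and> - b + 1 \<le> r * e"
  proof (cases "E = 0")
    case False
    assume v: "vge vK (E ^ (p ^ (n - 2))) (- b + 1)"
    obtain k where k: "veq vK E k" using K.veq_ex False by blast
    show ?thesis using v K.vge_veq_iff[OF K.veq_power[OF k]] k by (auto simp: r_def intro: K.veq_vge)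
  qed (use b_pos in \<open>auto intro: exI[of _ 0]\<close>)
  then obtain e0 where e0: "vge vK E e0" "- b + 1 \<le> r * e0" by blast
  \<comment> \<open>Capped at \<open>0\<close>, so that an expansion of length \<open>- e\<close> is
    accurate up to integral elements.\<close>
  define e where "e = min e0 0"
  have e: "vge vK E e" "- b + 1 \<le> r * e" "e \<le> 0"
    using e0 b_pos by (auto simp: e_def min_def elim: K.vge_mono)
  obtain c where c: "\<forall>i<p. vge vK (c i ^ p * f 1 ^ i) e"
    "vge vK (E - (\<Sum>i<p. c i ^ p * f 1 ^ i)) (e + int (nat (- e)))"
    using pth_power_expansion[OF e(1)] by blast
  obtain v1 where v1: "veq vL (x 1) v1" "int p * v1 = - b * int N" using x1_val by blast
  have ck: "e \<le> int p * k - b * int i" if "i < p" "veq vK (c i) k" for i k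
  proof -
    have "vge vK (c i ^ p * f 1 ^ i) e" using c(1) that(1) by blast
    hence "e \<le> int p * k + int i * (- b)"
      using K.vge_veq_iff[OF K.veq_mult[OF K.veq_power[OF that(2), of p] K.veq_power[OF f1_veq, of i]]] by blast
    thus ?thesis by (simp add: mult.commute)
  qed
  have ck': "- b + 1 \<le> r * (int p * k - b * int i)" if "i < p" "veq vK (c i) k" for i k
    using e(2) mult_left_mono[OF ck[OF that], of r] r1 by linarith
  define \<eta> where "\<eta> = (\<Sum>i<p. emb (c i) * x 1 ^ i)"
  have bN_le: "- b * int N \<le> (- b + 1) * int N" by (intro mult_right_mono) auto
  have eta: "vge vL (\<eta> ^ q) (- b * int N)"
    unfolding \<eta>_def q_def frobL_sum
  proof (rule L.vge_sum)
    fix i assume i: "i \<in> {..<p}"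
    show "vge vL ((emb (c i) * x 1 ^ i) ^ p ^ (n - 1)) (- b * int N)"
    proof (cases "c i = 0")
      case False
      then obtain k where k: "veq vK (c i) k" using K.veq_ex by blast
      have T: "veq vL (emb (c i) * x 1 ^ i) (int N * k + int i * v1)"
        by (rule L.veq_mult[OF veq_emb[OF k] L.veq_power[OF v1(1)]])
      have "int q * (int N * k + int i * v1) = r * (int N * (int p * k) + int i * (int p * v1))"
        by (simp add: qr algebra_simps)
      also have "\<dots> = (r * (int p * k - b * int i)) * int N" unfolding v1(2) by (simp add: algebra_simps)
      also have "\<dots> \<ge> (- b + 1) * int N" by (rule mult_right_mono[OF ck']) (use i k in auto)
      finally have "- b * int N \<le> int q * (int N * k + int i * v1)" using bN_le by linarith
      thus ?thesis using L.veq_power[OF T, of q] by (auto simp: q_def intro: L.veq_vge)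
    qed (use p_pos in \<open>simp add: zero_power\<close>)
  qed
  define w where "w = v1 + b * int N"
  have pw: "int p * w = (int p - 1) * (b * int N)"
    unfolding w_def distrib_left v1(2) by (simp add: algebra_simps)
  have w0: "w \<ge> 0"
  proof -
    have "0 \<le> int p * w" unfolding pw using bN_pos p_gt1 by simp
    thus ?thesis using p_pos by (simp add: zero_le_mult_iff)
  qed
  have f1L: "veq vL (emb (f 1)) (- b * int N)" using veq_emb[OF f1_veq] by (simp add: mult.commute)
  \<comment> \<open>\<open>x 1 ^ p = f 1 * (1 + u)\<close>: the relative error of replacing
    \<open>f 1\<close> by \<open>x 1 ^ p\<close>.\<close>
  define u where "u = x 1 / emb (f 1)"
  have u: "veq vL u w" using L.veq_divide[OF v1(1) f1L] by (simp add: u_def w_def)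
  have f10: "emb (f 1) \<noteq> 0" using L.veq_nz[OF f1L] .
  have etap: "emb E - \<eta> ^ p = emb (E - (\<Sum>i<p. c i ^ p * f 1 ^ i))
      - (\<Sum>i<p. emb (c i ^ p * f 1 ^ i) * ((1 + u) ^ i - 1))"
  proof -
    have "\<eta> ^ p = (\<Sum>i<p. (emb (c i) * x 1 ^ i) ^ p)" 
      unfolding \<eta>_def using frobL_sum[of "\<lambda>i. emb (c i) * x 1 ^ i" "{..<p}" 1] by simp
    also have "\<dots> = (\<Sum>i<p. emb (c i ^ p * f 1 ^ i) * (1 + u) ^ i)"
    proof (intro sum.cong refl)
      fix i
      have "x 1 ^ p = emb (f 1) * (1 + u)"
        using f10 x_pow[OF one_in] by (simp add: u_def field_simps)
      hence "(x 1 ^ i) ^ p = emb (f 1) ^ i * (1 + u) ^ i"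
        by (simp add: power_mult[symmetric] mult.commute[of i] power_mult power_mult_distrib[symmetric])
      thus "(emb (c i) * x 1 ^ i) ^ p = emb (c i ^ p * f 1 ^ i) * (1 + u) ^ i"
        by (simp add: power_mult_distrib e_mult e_power mult.assoc)
    qed
    finally show ?thesis by (simp add: e_diff e_sum right_diff_distrib sum_subtractf)
  qed
  define D0 where "D0 = emb (E - (\<Sum>i<p. c i ^ p * f 1 ^ i))"
  define D1 where "D1 = (\<Sum>i<p. emb (c i ^ p * f 1 ^ i) * ((1 + u) ^ i - 1))"
  have D0: "vge vL D0 0" using vge_emb[OF c(2)] e(3) by (simp add: D0_def)
  have D1: "vge vL D1 (int N * e + w)"
    unfolding D1_def
  proof (rule L.vge_sum)
    fix i assume i: "i \<in> {..<p}"
    have "vge vL ((1 + u) ^ i - 1 - of_nat i * u) w"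
      using L.power_one_plus[OF L.veq_vge[OF u order_refl] w0, of i] w0 by (auto elim: L.vge_mono)
    moreover have "vge vL (of_nat i * u) w" using L.vge_mult[OF L.vge_of_nat L.veq_vge[OF u order_refl]] by simp
    ultimately have "vge vL ((1 + u) ^ i - 1 - of_nat i * u + of_nat i * u) w" by (rule L.vge_add)
    hence "vge vL ((1 + u) ^ i - 1) w" by simp
    thus "vge vL (emb (c i ^ p * f 1 ^ i) * ((1 + u) ^ i - 1)) (int N * e + w)"
      by (rule L.vge_mult[OF vge_emb, rotated]) (use c(1) i in auto)
  qed
  have D0q: "vge vL (D0 ^ q) (- b * int N)" using L.vge_power[OF D0, of q] bN_pos by (auto elim: L.vge_mono)
  \<comment> \<open>The gain \<open>w\<close> repairs the loss from \<open>e\<close>: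
    \<open>p * N * (1 - b) + (p - 1) * b * N = p * N - b * N\<close>.\<close>
  have D1q: "vge vL (D1 ^ q) (- b * int N)"
  proof -
    have "int q * (int N * e + w) = int p * int N * (r * e) + r * (int p * w)"
      by (simp add: qr algebra_simps)
    also have "\<dots> \<ge> int p * int N * (- b + 1) + 1 * ((int p - 1) * (b * int N))"
    proof (rule add_mono)
      show "int p * int N * (- b + 1) \<le> int p * int N * (r * e)" using e(2) by (intro mult_left_mono) auto
      show "1 * ((int p - 1) * (b * int N)) \<le> r * (int p * w)"
        unfolding pw using r1 bN_pos p_gt1 by (intro mult_right_mono) auto
    qed
    finally have "int p * int N - b * int N \<le> int q * (int N * e + w)" by (simp add: algebra_simps)
    hence "- b * int N \<le> int q * (int N * e + w)" by (smt (verit) mult_minus_left of_nat_0_le_iff zero_le_mult_iff)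
    thus ?thesis using L.vge_power[OF D1, of q] by (auto elim: L.vge_mono)
  qed
  \<comment> \<open>\<open>M t\<close> kills \<open>a\<close> for \<open>0 < t < n\<close> and its
    Frobenius twist for \<open>1 < t < n\<close>, so \<open>XX_vge\<close> applies with
    \<open>j = n - 1\<close>.\<close>
  define U where "U = XX (\<lambda>i. a i ^ p - a i)"
  have Uq: "vge vL (U ^ q) (- b * int N)"
    unfolding U_def q_def
  proof (rule XX_vge)
    show "a i ^ p - a i \<in> F" for i using a by auto
    show "1 \<le> n - 1" "n - 1 < n" using n2 by auto
    fix t assume t: "n - (n - 1) < t" "t < n"
    have "M t (\<lambda>i. a i ^ p - a i) = M t (\<lambda>i. a i ^ p) - M t a"
      by (simp add: M_def left_diff_distrib sum_subtractf)
    also have "\<dots> = 0" using t M0[of t] M0[of "t - 1"] p_pos n2 by (simp add: M_frob zero_power)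
    finally show "M t (\<lambda>i. a i ^ p - a i) = 0" .
  qed
  define Y where "Y = XX a - \<eta>"
  have Y: "Y ^ p - Y = U + (D0 - D1) + \<eta>"
  proof -
    have "Y ^ p = XX a ^ p - \<eta> ^ p" 
      unfolding Y_def using frobL_diff[of "XX a" \<eta> 1] by simp
    moreover have "(\<Sum>i=1..n. a i ^ p * f i) = \<beta> * M n (\<lambda>i. a i ^ p) + E"
      unfolding f_def E_def M_def by (simp add: algebra_simps sum.distrib sum_distrib_left)
    moreover have "M n (\<lambda>i. a i ^ p) = 0"
      using M_frob[of n a] M0[of "n - 1"] n2 p_pos by (simp add: zero_power)
    ultimately have "Y ^ p = XX (\<lambda>i. a i ^ p) + emb E - \<eta> ^ p" by (simp add: XX_p)
    moreover have "XX (\<lambda>i. a i ^ p) = U + XX a"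
      by (simp add: U_def XX_def e_diff left_diff_distrib sum_subtractf)
    moreover have "emb E - \<eta> ^ p = D0 - D1" unfolding etap D0_def D1_def ..
    ultimately have "Y ^ p = U + XX a + (D0 - D1)" by (simp add: add_diff_eq[symmetric])
    thus ?thesis by (simp add: Y_def)
  qed
  \<comment> \<open>The Artin-Schreier map commutes with \<open>q\<close>-th powers, and it is the
    \<open>q\<close>-th powers of the terms that have been bounded.\<close>
  have "vge vL (((Y ^ q) ^ p)) (- b * int N)"
  proof (rule as_vge)
    show "(Y ^ q) ^ p - Y ^ q = U ^ q + (D0 ^ q - D1 ^ q) + \<eta> ^ q"
    proof -
      have "(Y ^ q) ^ p - Y ^ q = (Y ^ p - Y) ^ q"
        unfolding q_def frobL_diff by (simp add: power_mult[symmetric] mult.commute)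
      thus ?thesis unfolding Y by (simp add: q_def frobL_diff frobL_add)
    qed
    show "vge vL (U ^ q + (D0 ^ q - D1 ^ q) + \<eta> ^ q) (- b * int N)"
      by (intro L.vge_add L.vge_diff Uq D0q D1q eta)
  qed (use bN_pos in simp)
  hence "vge vL (Y ^ (p ^ n)) (- b * int N)" by (simp add: power_mult[symmetric] qp)
  thus ?thesis using ck' unfolding Y_def \<eta>_def r_def by blast
qed

text \<open>\<open>Y\<close> moves by \<open>1\<close>, while every element moves up by at least
  \<open>b\<close>; hence \<open>Y\<close> has valuation at most \<open>- b\<close>. Against the
  lower bound \<open>- b * N / p ^ n\<close> this forces \<open>p ^ n \<le> N\<close>, and with
  \<open>N_le\<close> all inequalities become equalities.\<close>

lemma degree_and_valuation:
  assumes s: "\<sigma> \<in> GG" "\<sigma> Y = Y + 1" and v: "vge vL (Y ^ (p ^ n)) (- b * int N)"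
  shows "N = p ^ n \<and> veq vL Y (- b)"
proof -
  interpret s: femb \<sigma> by (rule GG_femb[OF s(1)])
  have "Y \<noteq> 0" using s(2) by auto
  then obtain y where y: "veq vL Y y" using L.veq_ex by blast
  have "vge vL (\<sigma> Y - Y) (y + b)" by (rule shift_vge[OF s(1) L.veq_vge[OF y order_refl]])
  hence "y + b \<le> 0" using L.vge_veq_iff[OF L.veq_one] s(2) by simp
  hence yb: "y \<le> - b" by simp
  have py: "- b * int N \<le> int (p ^ n) * y" using v L.vge_veq_iff[OF L.veq_power[OF y]] by blast
  also have "\<dots> \<le> int (p ^ n) * (- b)" using yb by (intro mult_left_mono) auto
  finally have "b * int (p ^ n) \<le> b * int N" by (simp add: mult.commute)
  hence "p ^ n \<le> N" using b_pos by (simp only: mult_le_cancel_left_pos of_nat_le_iff)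
  hence N: "N = p ^ n" using N_le by simp
  have "int (p ^ n) * (- b) \<le> int (p ^ n) * y" using py N by (simp add: mult.commute)
  moreover have "0 < int (p ^ n)" using p_pos by simp
  ultimately have "- b \<le> y" by (simp only: mult_le_cancel_left_pos)
  thus ?thesis using N yb y by (metis order_antisym)
qed

lemma XX_action:
  assumes "\<sigma> \<in> GG"
  shows "\<sigma> (XX a) = XX a + emb (\<Sum>i=1..n. a i * of_nat (tup \<sigma> i))"
proof -
  interpret s: femb \<sigma> by (rule GG_femb[OF assms])
  have "\<sigma> (XX a) = (\<Sum>i=1..n. emb (a i) * x i + emb (a i * of_nat (tup \<sigma> i)))"
    unfolding XX_def s.e_sum
    by (intro sum.cong refl) (use assms tup(2)[OF assms] in \<open>simp add: s.e_mult e_mult distrib_left\<close>)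
  thus ?thesis by (simp add: XX_def e_sum sum.distrib)
qed

text \<open>In the variable \<open>t\<close>, \<kappa> is a polynomial of degree below
  \<open>p\<close> with coefficients in \<open>L\<close>.\<close>

lemma kappa_interpolation:
  assumes "\<And>t. \<kappa> t = (\<Sum>i<p. emb (c i) * (x 1 ^ i - (x 1 + emb t) ^ i))"
  shows "(\<Sum>m<p. emb (ell p (t - of_nat m)) * \<kappa> (of_nat m)) = \<kappa> t"
proof -
  define g where "g = (\<Sum>i<p. smult (emb (c i)) ([:x 1 ^ i:] - [:x 1, 1:] ^ i))"
  have "degree g \<le> p - 1"
    unfolding g_def
  proof (rule degree_sum_le)
    fix i assume i: "i \<in> {..<p}"
    have "degree ([:x 1 ^ i:] - [:x 1, 1:] ^ i) \<le> i"
      by (rule degree_diff_le) (auto simp: degree_linear_power)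
    hence "degree (smult (emb (c i)) ([:x 1 ^ i:] - [:x 1, 1:] ^ i)) \<le> i"
      using degree_smult_le le_trans by blast
    thus "degree (smult (emb (c i)) ([:x 1 ^ i:] - [:x 1, 1:] ^ i)) \<le> p - 1" using i by simp
  qed simp
  hence "degree g < p" using p_pos by linarith
  from lagrange[OF prime charL this, of "emb t" 0]
  show ?thesis
    by (simp add: assms g_def poly_sum poly_power e_ell e_diff)
qed

text \<open>The summand of index \<open>i\<close> has leading term
  \<open>- i * t * c i * x 1 ^ (i - 1)\<close>, whose valuation \<open>d i\<close> does not depend
  on \<open>t \<noteq> 0\<close> in \<open>F\<close>. As \<open>p\<close> does not divide
  \<open>b\<close>, the \<open>d i\<close> are distinct for \<open>0 < i < p\<close>, so the least
  of them is the valuation of the sum.\<close>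

lemma kappa_valuation:
  assumes n2: "n \<ge> 2" and N: "N = p ^ n" and x1: "veq vL (x 1) (- (int (p ^ (n - 1)) * b))"
    and \<kappa>: "\<And>t. \<kappa> t = (\<Sum>i<p. emb (c i) * (x 1 ^ i - (x 1 + emb t) ^ i))"
    and c: "\<And>i k. i < p \<Longrightarrow> veq vK (c i) k \<Longrightarrow> - b + 1 \<le> int (p ^ (n - 2)) * (int p * k - b * int i)"
  shows "(\<forall>t\<in>F. \<kappa> t = 0) \<or> (\<exists>k0. int p dvd k0 \<and> k0 > int (p ^ (n - 1)) * b - int p * b \<and>
     (\<forall>t\<in>F - {0}. veq vL (\<kappa> t) k0))"
proof (cases "\<exists>i\<in>{1..<p}. c i \<noteq> 0")
  case False
  have "\<kappa> t = 0" for t unfolding \<kappa>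
  proof (intro sum.neutral ballI)
    fix i assume "i \<in> {..<p}"
    thus "emb (c i) * (x 1 ^ i - (x 1 + emb t) ^ i) = 0" using False by (cases "i = 0") auto
  qed
  thus ?thesis by blast
next
  case True
  define w where "w = int (p ^ (n - 1)) * b"
  have w0: "w > 0" using b_pos p_pos by (simp add: w_def)
  define kk where "kk i = (SOME k. veq vK (c i) k)" for i
  have kk: "veq vK (c i) (kk i)" if "c i \<noteq> 0" for i
    unfolding kk_def by (rule someI_ex) (use K.veq_ex that in blast)
  define d where "d i = int N * kk i - int i * w + w" for i
  define J where "J = {i \<in> {1..<p}. c i \<noteq> 0}"
  have n1: "p ^ n = p ^ (n - 1) * p" using n2 by (metis Suc_diff_1 less_le_trans pos2 power_Suc2)
  have n2p: "p ^ (n - 1) = p ^ (n - 2) * p" using n2 by (metis Suc_diff_Suc Suc_1 Suc_le_lessD power_Suc2 numeral_2_eq_2)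
  have inj: "inj_on d J"
  proof (rule inj_onI)
    fix i j assume ij: "i \<in> J" "j \<in> J" "d i = d j"
    have "int (p ^ (n - 1)) * (int p * (kk i - kk j)) = int (p ^ (n - 1)) * (b * (int i - int j))"
      using ij(3) unfolding d_def N n1 w_def by (simp add: algebra_simps)
    hence "int p * (kk i - kk j) = b * (int i - int j)" using p_pos by (simp del: of_nat_power)
    hence "int p dvd b * (int i - int j)" by (metis dvd_triv_left)
    hence "int p dvd int i - int j"
      using p_not_dvd_b prime by (simp add: prime_dvd_mult_iff)
    hence "[int i = int j] (mod int p)" by (simp add: cong_iff_dvd_diff)
    hence "int i mod int p = int j mod int p" by (simp add: cong_def)
    thus "i = j" using ij by (simp add: J_def)
  qed
  have main: "\<exists>i0\<in>J. veq vL (\<kappa> t) (d i0) \<and> (\<forall>i\<in>J. d i0 \<le> d i)" if t: "t \<in> F - {0}" for t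
  proof -
    define y where "y i = emb (c i) * (x 1 ^ i - (x 1 + emb t) ^ i)" for i
    define u where "u = emb t / x 1"
    have u: "veq vL u w" using L.veq_divide[OF F_veqL x1, of t] t by (simp add: u_def w_def)
    have x10: "x 1 \<noteq> 0" using L.veq_nz[OF x1] .
    have yv: "veq vL (y i) (d i)" if "i \<in> J" for i
    proof -
      have i: "0 < i" "i < p" "c i \<noteq> 0" using that by (auto simp: J_def)
      have "(of_nat i :: 'k) \<noteq> 0"
        using of_nat_inj_on_char[OF char i(2) p_pos] i(1) by auto
      hence "veq vL (of_nat i) 0" using F_veqL[of "of_nat i"] by simp
      hence "veq vL (of_nat i * u) w" using L.veq_mult u by fastforce
      moreover have "vge vL ((1 + u) ^ i - 1 - of_nat i * u) (w + 1)"
        using L.power_one_plus[OF L.veq_vge[OF u order_refl], of i] w0 by (auto elim: L.vge_mono)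
      ultimately have "veq vL (of_nat i * u + ((1 + u) ^ i - 1 - of_nat i * u)) w" by (rule L.veq_add)
      hence "veq vL (- ((1 + u) ^ i - 1)) w" by (intro L.veq_uminus) simp
      hence "veq vL (emb (c i) * x 1 ^ i * (- ((1 + u) ^ i - 1))) (d i)"
        using L.veq_mult[OF L.veq_mult[OF veq_emb[OF kk[OF i(3)]] L.veq_power[OF x1, of i]]]
        by (simp add: d_def w_def)
      moreover have "x 1 + emb t = x 1 * (1 + u)" using x10 by (simp add: u_def field_simps)
      hence "y i = emb (c i) * x 1 ^ i * (- ((1 + u) ^ i - 1))"
        unfolding y_def by (simp only: power_mult_distrib) (simp add: right_diff_distrib mult.assoc)
      ultimately show ?thesis by simp
    qed
    have y0: "y i = 0" if "i \<in> {..<p} - J" for i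
      using that by (cases "i = 0") (auto simp: J_def y_def)
    have "\<kappa> t = sum y {..<p}" by (simp add: \<kappa> y_def)
    also have "\<dots> = sum y J" by (rule sum.mono_neutral_right) (use y0 in \<open>auto simp: J_def\<close>)
    finally have ky: "\<kappa> t = sum y J" .
    have "\<exists>i0\<in>J. veq vL (y i0) (d i0) \<and> (\<forall>i\<in>J - {i0}. vge vL (y i) (d i0 + 1)) \<and> veq vL (sum y J) (d i0)"
    proof (rule L.sum_distinct)
      show "inj_on d {i \<in> J. y i \<noteq> 0}" by (rule inj_on_subset[OF inj]) auto
      from True obtain i where "i \<in> J" by (auto simp: J_def)
      thus "\<exists>i\<in>J. y i \<noteq> 0" using L.veq_nz[OF yv] by blast
    qed (use yv in \<open>auto simp: J_def\<close>)
    then obtain i0 where i0: "i0 \<in> J" "\<forall>i\<in>J - {i0}. vge vL (y i) (d i0 + 1)" "veq vL (sum y J) (d i0)" by blast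
    have "d i0 \<le> d i" if "i \<in> J" for i
    proof (cases "i = i0")
      case False
      hence "vge vL (y i) (d i0 + 1)" using i0(2) that by blast
      thus ?thesis using L.vge_veq_iff[OF yv[OF that]] by simp
    qed simp
    thus ?thesis using i0 ky by auto
  qed
  obtain i0 where i0: "i0 \<in> J" "\<forall>i\<in>J. d i0 \<le> d i" using main[of 1] by auto
  have "veq vL (\<kappa> t) (d i0)" if "t \<in> F - {0}" for t
    using main[OF that] i0 by (metis order_antisym)
  \<comment> \<open>Both \<open>N\<close> and \<open>w\<close> are multiples of \<open>p\<close>
    because \<open>n \<ge> 2\<close>.\<close>
  moreover have "int p dvd d i0"
    unfolding d_def N n1 w_def n2p by (simp add: algebra_simps)
  \<comment> \<open>\<open>d i0 - w\<close> is \<open>p\<close> times the quantity bounded in the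
    assumption on \<open>c\<close>.\<close>
  moreover have "d i0 > int (p ^ (n - 1)) * b - int p * b"
  proof -
    have "- b + 1 \<le> int (p ^ (n - 2)) * (int p * kk i0 - b * int i0)"
      using c[OF _ kk] i0 by (auto simp: J_def)
    hence "- b < int (p ^ (n - 2)) * (int p * kk i0 - b * int i0)" by linarith
    hence "int p * (- b) < int p * (int (p ^ (n - 2)) * (int p * kk i0 - b * int i0))"
      using p_pos by (simp only: mult_less_cancel_left_pos of_nat_0_less_iff)
    moreover have "int p * (int (p ^ (n - 2)) * (int p * kk i0 - b * int i0)) = d i0 - w"
      unfolding d_def N n1 w_def n2p by (simp add: algebra_simps)
    ultimately show ?thesis by (simp add: w_def)
  qed
  ultimately show ?thesis by blast
qed

text \<open>\<open>\<kappa>\<close> measures the failure of \<open>Y n\<close> to be translated by elements of \<open>F\<close>: it comes from subtracting from the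
  last combination of the \<open>x i\<close> a polynomial in \<open>x 1\<close> that improves its valuation to \<open>- b\<close>. The hypothesis on the
  \<open>\<epsilon> i\<close> bounds the valuation \<open>k0\<close> of \<open>\<kappa>\<close> from below.\<close>

theorem scaffold_exists:
  "\<exists>a Y \<kappa>. (\<forall>j\<in>{1..n}. \<forall>i. a j i \<in> F) \<and> (\<forall>j\<in>{1..n}. a j j = 1) \<and>
    (\<forall>\<sigma>\<in>GG. \<forall>j\<in>{1..n}. \<sigma> (Y j) = Y j + emb (\<Sum>i=1..j. a j i * of_nat (tup \<sigma> i))
        + (if j = n \<and> n \<ge> 2 then \<kappa> (of_nat (tup \<sigma> 1)) else 0)) \<and>
    (\<forall>j\<in>{1..n}. veq vL (Y j) (- (int (p ^ (n - j)) * b))) \<and> N = p ^ n \<and>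
    (\<forall>t. (\<Sum>m<p. emb (ell p (t - of_nat m)) * \<kappa> (of_nat m)) = \<kappa> t) \<and> \<kappa> 0 = 0 \<and>
    ((\<forall>t\<in>F. \<kappa> t = 0) \<or> n \<ge> 2 \<and> (\<exists>k0. int p dvd k0 \<and> k0 > int (p ^ (n - 1)) * b - int p * b \<and>
        (\<forall>t\<in>F - {0}. veq vL (\<kappa> t) k0)))"
proof -
  have "\<forall>j\<in>{1..n}. \<exists>a. (\<forall>i. a i \<in> F) \<and> (\<forall>i>j. a i = 0) \<and> a j = 1 \<and>
      (\<forall>t. n - j < t \<longrightarrow> t < n \<longrightarrow> M t a = 0) \<and> M (n - j) a \<noteq> 0"
    using coeff_ex by blast
  from bchoice[OF this] obtain a where a: "\<And>j i. j \<in> {1..n} \<Longrightarrow> a j i \<in> F"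
    "\<And>j i. j \<in> {1..n} \<Longrightarrow> i > j \<Longrightarrow> a j i = 0" "\<And>j. j \<in> {1..n} \<Longrightarrow> a j j = 1"
    "\<And>j t. j \<in> {1..n} \<Longrightarrow> n - j < t \<Longrightarrow> t < n \<Longrightarrow> M t (a j) = 0"
    "\<And>j. j \<in> {1..n} \<Longrightarrow> M (n - j) (a j) \<noteq> 0" by blast
  have nn: "n \<in> {1..n}" using n_pos by simp
  have "\<exists>c. vge vL ((XX (a n) - (\<Sum>i<p. emb (c i) * x 1 ^ i)) ^ (p ^ n)) (- b * int N) \<and>
    (\<forall>i k. i < p \<longrightarrow> veq vK (c i) k \<longrightarrow> - b + 1 \<le> int (p ^ (n - 2)) * (int p * k - b * int i)) \<and>
    (n = 1 \<longrightarrow> (\<forall>i. c i = 0))"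
  proof (cases "n \<ge> 2")
    case True
    show ?thesis using Y_top_ex[OF True a(1)[OF nn]] a(4)[OF nn] True by auto
  next
    case False
    \<comment> \<open>The single generator already has the wanted valuation; the correction is
      zero.\<close>
    hence n1: "n = 1" using n_pos by simp
    have "XX (a n) = x 1" unfolding XX_def using a(3)[OF nn] by (simp add: n1)
    thus ?thesis using L.veq_vge[OF x1_pow_veq order_refl] K.veq_nz
      by (intro exI[of _ "\<lambda>_. 0"]) (auto simp: n1)
  qed
  then obtain c where c: "vge vL ((XX (a n) - (\<Sum>i<p. emb (c i) * x 1 ^ i)) ^ (p ^ n)) (- b * int N)"
    "\<And>i k. i < p \<Longrightarrow> veq vK (c i) k \<Longrightarrow> - b + 1 \<le> int (p ^ (n - 2)) * (int p * k - b * int i)"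
    "n = 1 \<Longrightarrow> c i = 0" for i by blast
  define \<kappa> where "\<kappa> t = (\<Sum>i<p. emb (c i) * (x 1 ^ i - (x 1 + emb t) ^ i))" for t
  define \<eta> where "\<eta> = (\<Sum>i<p. emb (c i) * x 1 ^ i)"
  define Y where "Y j = (if j = n then XX (a n) - \<eta> else XX (a j))" for j
  have k0: "\<kappa> 0 = 0" by (simp add: \<kappa>_def)
  have k1: "\<kappa> t = 0" if "n = 1" for t using c(3)[OF that] by (simp add: \<kappa>_def)
  have S: "(\<Sum>i=1..n. a j i * of_nat (tup \<sigma> i)) = (\<Sum>i=1..j. a j i * of_nat (tup \<sigma> i))" if "j \<in> {1..n}" for j \<sigma>
    by (rule sum.mono_neutral_right) (use that a(2) in auto)
  have act: "\<sigma> (Y j) = Y j + emb (\<Sum>i=1..j. a j i * of_nat (tup \<sigma> i))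
        + (if j = n \<and> n \<ge> 2 then \<kappa> (of_nat (tup \<sigma> 1)) else 0)" if s: "\<sigma> \<in> GG" and j: "j \<in> {1..n}" for \<sigma> j
  proof -
    interpret s: femb \<sigma> by (rule GG_femb[OF s])
    show ?thesis
    proof (cases "j = n")
      case True
      have "\<sigma> \<eta> = (\<Sum>i<p. emb (c i) * (x 1 + emb (of_nat (tup \<sigma> 1))) ^ i)"
        unfolding \<eta>_def using s tup(2)[OF s one_in] by (simp add: s.e_sum s.e_mult s.e_power)
      hence eta: "\<eta> - \<sigma> \<eta> = \<kappa> (of_nat (tup \<sigma> 1))"
        by (simp add: \<kappa>_def \<eta>_def right_diff_distrib sum_subtractf)
      have "\<sigma> (Y j) = \<sigma> (XX (a n)) - \<sigma> \<eta>" by (simp add: Y_def True s.e_diff)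
      also have "\<dots> = XX (a n) + emb (\<Sum>i=1..j. a j i * of_nat (tup \<sigma> i)) - \<sigma> \<eta>"
        unfolding XX_action[OF s] using S[OF j, of \<sigma>] by (simp only: True)
      also have "\<dots> = Y j + emb (\<Sum>i=1..j. a j i * of_nat (tup \<sigma> i)) + (\<eta> - \<sigma> \<eta>)"
        by (simp add: Y_def True)
      also have "\<eta> - \<sigma> \<eta> = (if j = n \<and> n \<ge> 2 then \<kappa> (of_nat (tup \<sigma> 1)) else 0)"
        unfolding eta using True k1 n_pos by (cases "n = 1") auto
      finally show ?thesis .
    next
      case False
      thus ?thesis using XX_action[OF s, of "a j"] S[OF j, of \<sigma>] by (simp add: Y_def)
    qed
  qed
  \<comment> \<open>The Galois element moving \<open>x n\<close> alone shifts \<open>Y n\<close> by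
    exactly \<open>1\<close>, since \<open>a n n = 1\<close> and \<open>\<kappa> 0 = 0\<close> (for
    \<open>n = 1\<close> the \<kappa> term is absent).\<close>
  have "(\<lambda>i\<in>{1..n}. if i = n then 1 else 0) \<in> Tup" using p_gt1 by (auto simp: Tup_def)
  hence "(\<lambda>i\<in>{1..n}. if i = n then 1 else 0) \<in> tup ` GG" using bij_betw_imp_surj_on[OF tup_bij] by simp
  then obtain \<sigma> where s: "\<sigma> \<in> GG" "tup \<sigma> = (\<lambda>i\<in>{1..n}. if i = n then 1 else 0)" by auto
  have "(\<Sum>i=1..n. a n i * of_nat (tup \<sigma> i)) = (\<Sum>i=1..n. if i = n then a n i else 0)"
    by (intro sum.cong) (auto simp: s(2))
  also have "\<dots> = 1" using nn a(3)[OF nn] by simp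
  finally have "\<sigma> (Y n) = Y n + 1"
    using act[OF s(1) nn] s(2) k0 n_pos by auto
  from degree_and_valuation[OF s(1) this] c(1)
  have N: "N = p ^ n" and Yn: "veq vL (Y n) (- b)" by (auto simp: Y_def \<eta>_def)
  have Yv: "veq vL (Y j) (- (int (p ^ (n - j)) * b))" if j: "j \<in> {1..n}" for j
  proof (cases "j = n")
    case True
    thus ?thesis using Yn by simp
  next
    case False
    have v: "veq vL (Y j ^ (p ^ j)) (- b * int N)"
      using XX_veq[OF a(1)[OF j] _ _ a(4)[OF j] a(5)[OF j]] False j by (simp add: Y_def)
    have "Y j \<noteq> 0" using L.veq_nz[OF v] p_pos by auto
    then obtain y where y: "veq vL (Y j) y" using L.veq_ex by blast
    have "int (p ^ j) * y = - b * int N" using L.veq_unique[OF L.veq_power[OF y] v] .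
    also have "p ^ n = p ^ j * p ^ (n - j)" using j by (simp add: power_add[symmetric])
    hence "- b * int N = int (p ^ j) * (- (int (p ^ (n - j)) * b))" by (simp add: N)
    finally have "y = - (int (p ^ (n - j)) * b)" using p_pos by (simp only: mult_cancel_left) simp
    thus ?thesis using y by simp
  qed
  have kap: "(\<forall>t\<in>F. \<kappa> t = 0) \<or> (\<exists>k0. int p dvd k0 \<and> k0 > int (p ^ (n - 1)) * b - int p * b \<and>
        (\<forall>t\<in>F - {0}. veq vL (\<kappa> t) k0))" if n2: "n \<ge> 2"
  proof (rule kappa_valuation[OF n2 N _ \<kappa>_def c(2)])
    have "Y 1 = XX (a 1)" using n2 by (simp add: Y_def)
    also have "\<dots> = (\<Sum>i=1..n. if i = 1 then x 1 else 0)"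
      unfolding XX_def by (intro sum.cong) (use a(2)[OF one_in] a(3)[OF one_in] in auto)
    also have "\<dots> = x 1" using one_in by simp
    finally show "veq vL (x 1) (- (int (p ^ (n - 1)) * b))" using Yv[OF one_in] by simp
  qed
  hence kap': "(\<forall>t\<in>F. \<kappa> t = 0) \<or> n \<ge> 2 \<and> (\<exists>k0. int p dvd k0 \<and> k0 > int (p ^ (n - 1)) * b - int p * b \<and>
        (\<forall>t\<in>F - {0}. veq vL (\<kappa> t) k0))"
    using k1 n_pos by (cases "n = 1") auto
  have 1: "\<forall>j\<in>{1..n}. \<forall>i. a j i \<in> F" "\<forall>j\<in>{1..n}. a j j = 1" using a(1,3) by blast+
  have 2: "\<forall>\<sigma>\<in>GG. \<forall>j\<in>{1..n}. \<sigma> (Y j) = Y j + emb (\<Sum>i=1..j. a j i * of_nat (tup \<sigma> i))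
        + (if j = n \<and> n \<ge> 2 then \<kappa> (of_nat (tup \<sigma> 1)) else 0)"
    using act by blast
  have 3: "\<forall>j\<in>{1..n}. veq vL (Y j) (- (int (p ^ (n - j)) * b))" using Yv by blast
  have 4: "\<forall>t. (\<Sum>m<p. emb (ell p (t - of_nat m)) * \<kappa> (of_nat m)) = \<kappa> t"
    using kappa_interpolation[OF \<kappa>_def] by blast
  show ?thesis
    by (rule exI[of _ a], rule exI[of _ Y], rule exI[of _ \<kappa>], intro conjI) fact+
qed

end

section \<open>Translations of the scaffold\<close>

lemma digits_bound:
  fixes p :: nat
  assumes "\<And>j. j \<in> {1..m} \<Longrightarrow> \<alpha> j < p"
  shows "(\<Sum>j=1..m. \<alpha> j * p ^ (m - j)) < p ^ m"
  using assms
proof (induction m)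
  case (Suc m)
  have "(\<Sum>j=1..Suc m. \<alpha> j * p ^ (Suc m - j)) = p * (\<Sum>j=1..m. \<alpha> j * p ^ (m - j)) + \<alpha> (Suc m)"
    by (simp add: sum_distrib_left Suc_diff_le algebra_simps)
  moreover have "(\<Sum>j=1..m. \<alpha> j * p ^ (m - j)) + 1 \<le> p ^ m" using Suc by fastforce
  hence "p * ((\<Sum>j=1..m. \<alpha> j * p ^ (m - j)) + 1) \<le> p * p ^ m" by (rule mult_le_mono2)
  moreover have "\<alpha> (Suc m) < p" using Suc.prems by simp
  ultimately show ?case by simp
qed simp

lemma digits_unique:
  fixes p :: nat
  assumes "\<And>j. j \<in> {1..m} \<Longrightarrow> \<alpha> j < p" "\<And>j. j \<in> {1..m} \<Longrightarrow> \<alpha>' j < p"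
    and "(\<Sum>j=1..m. \<alpha> j * p ^ (m - j)) = (\<Sum>j=1..m. \<alpha>' j * p ^ (m - j))" and "i \<in> {1..m}"
  shows "\<alpha> i = \<alpha>' i"
  using assms
proof (induction m)
  case (Suc m)
  have e: "(\<Sum>j=1..Suc m. \<gamma> j * p ^ (Suc m - j)) = p * (\<Sum>j=1..m. \<gamma> j * p ^ (m - j)) + \<gamma> (Suc m)" for \<gamma> :: "nat \<Rightarrow> nat"
    by (simp add: sum_distrib_left Suc_diff_le algebra_simps)
  have lt: "\<alpha> (Suc m) < p" "\<alpha>' (Suc m) < p" using Suc.prems by simp_all
  have eq: "p * (\<Sum>j=1..m. \<alpha> j * p ^ (m - j)) + \<alpha> (Suc m) = p * (\<Sum>j=1..m. \<alpha>' j * p ^ (m - j)) + \<alpha>' (Suc m)"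
    using Suc.prems(3) unfolding e .
  have last: "\<alpha> (Suc m) = \<alpha>' (Suc m)"
    using arg_cong[OF eq, of "\<lambda>z. z mod p"] lt by simp
  have "(\<Sum>j=1..m. \<alpha> j * p ^ (m - j)) = (\<Sum>j=1..m. \<alpha>' j * p ^ (m - j))"
    using eq last lt by simp
  thus ?case using Suc last by (cases "i = Suc m") auto
qed simp

lemma sum_PiE_insert:
  assumes "i \<notin> I"
  shows "(\<Sum>s\<in>PiE (insert i I) A. g s) = (\<Sum>s\<in>PiE I A. \<Sum>y\<in>A i. g (s(i := y)))"
proof -
  have "(\<Sum>s\<in>PiE (insert i I) A. g s) = (\<Sum>(y, s)\<in>A i \<times> PiE I A. g (s(i := y)))"
    unfolding PiE_insert_eq by (subst sum.reindex[OF inj_combinator[OF assms]]) (simp add: case_prod_unfold)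
  also have "\<dots> = (\<Sum>y\<in>A i. \<Sum>s\<in>PiE I A. g (s(i := y)))" by (rule sum.cartesian_product[symmetric])
  also have "\<dots> = (\<Sum>s\<in>PiE I A. \<Sum>y\<in>A i. g (s(i := y)))" by (rule sum.swap)
  finally show ?thesis .
qed

text \<open>Fixes data as in \<open>scaffold_exists\<close>. If \<kappa> vanishes on
  \<open>F\<close>, then \<open>k0\<close> has the conventional value \<open>p ^ n * b\<close>, too
  large to influence the minimum in \<open>thr\<close>, so that one formula covers both
  cases.\<close>

locale scaffold = artin_schreier vK vL emb N F p b n \<beta> \<omega> \<epsilon> x
  for vK :: "'k::field \<Rightarrow> ereal" and vL :: "'l::field \<Rightarrow> ereal" and emb N F p b n \<beta> \<omega> \<epsilon> x +
  fixes a :: "nat \<Rightarrow> nat \<Rightarrow> 'k" and Y :: "nat \<Rightarrow> 'l" and \<kappa> :: "'k \<Rightarrow> 'l" and k0 :: int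
  assumes a_F: "\<And>j i. j \<in> {1..n} \<Longrightarrow> a j i \<in> F"
    and a_diag: "\<And>j. j \<in> {1..n} \<Longrightarrow> a j j = 1"
    and Y_act: "\<And>\<sigma> j. \<sigma> \<in> GG \<Longrightarrow> j \<in> {1..n} \<Longrightarrow> \<sigma> (Y j) = Y j + emb (\<Sum>i=1..j. a j i * of_nat (tup \<sigma> i))
        + (if j = n \<and> n \<ge> 2 then \<kappa> (of_nat (tup \<sigma> 1)) else 0)"
    and Y_val: "\<And>j. j \<in> {1..n} \<Longrightarrow> veq vL (Y j) (- (int (p ^ (n - j)) * b))"
    and N_eq: "N = p ^ n"
    and \<kappa>_interp: "\<And>t. (\<Sum>m<p. emb (ell p (t - of_nat m)) * \<kappa> (of_nat m)) = \<kappa> t"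
    and \<kappa>_0: "\<kappa> 0 = 0"
    and k0_dvd: "int p dvd k0" and k0_gt: "k0 > int (p ^ (n - 1)) * b - int p * b"
    and \<kappa>_val: "(\<forall>t\<in>F. \<kappa> t = 0) \<and> k0 = int (p ^ n) * b \<or> n \<ge> 2 \<and> (\<forall>t\<in>F - {0}. veq vL (\<kappa> t) k0)"
begin

text \<open>The linear form on coordinate tuples; \<open>S\<close> is the same form on Galois
  elements. Sums over the group are carried out as sums over tuples.\<close>

definition SS :: "nat \<Rightarrow> (nat \<Rightarrow> nat) \<Rightarrow> 'k" where "SS j s = (\<Sum>i=1..j. a j i * of_nat (s i))"

definition S :: "nat \<Rightarrow> ('l \<Rightarrow> 'l) \<Rightarrow> 'k" where "S j \<sigma> = SS j (tup \<sigma>)"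

definition K :: "nat \<Rightarrow> 'k \<Rightarrow> 'l" where "K j t = (if j = n \<and> n \<ge> 2 then \<kappa> t else 0)"

lemma K_1 [simp]: "K (Suc 0) t = 0" by (auto simp: K_def)

lemma K_0 [simp]: "K j 0 = 0" by (simp add: K_def \<kappa>_0)

lemma S_F: "j \<in> {1..n} \<Longrightarrow> S j \<sigma> \<in> F" unfolding S_def SS_def using a_F by auto

lemma gal_Y: "\<sigma> \<in> GG \<Longrightarrow> j \<in> {1..n} \<Longrightarrow> \<sigma> (Y j) = Y j + emb (S j \<sigma>) + K j (of_nat (tup \<sigma> 1))"
  unfolding S_def SS_def K_def by (rule Y_act)

lemma Y_nz: "j \<in> {1..n} \<Longrightarrow> Y j \<noteq> 0" using Y_val L.veq_nz by blast

lemma sum_GG: "(\<Sum>\<sigma>\<in>GG. g (tup \<sigma>)) = (\<Sum>s\<in>Tup. g s)"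
  by (rule sum.reindex_bij_betw[OF tup_bij])

lemma of_nat_tup_comp:
  assumes "\<sigma> \<in> GG" "\<tau> \<in> GG" "i \<in> {1..n}"
  shows "(of_nat (tup (\<sigma> \<circ> \<tau>) i) :: 'k) = of_nat (tup \<sigma> i) + of_nat (tup \<tau> i)"
proof -
  interpret s: femb \<sigma> by (rule GG_femb[OF assms(1)])
  have "x i + of_nat (tup (\<sigma> \<circ> \<tau>) i) = x i + of_nat (tup \<sigma> i) + of_nat (tup \<tau> i)"
    using tup(2)[OF GG_comp[OF assms(1,2)] assms(3)] tup(2)[OF assms(1,3)] tup(2)[OF assms(2,3)]
    by (simp add: s.e_add)
  hence "emb (of_nat (tup (\<sigma> \<circ> \<tau>) i)) = emb (of_nat (tup \<sigma> i) + of_nat (tup \<tau> i))"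
    by (simp add: e_add add.assoc)
  thus ?thesis by (simp only: e_inj)
qed

lemma S_comp: "\<sigma> \<in> GG \<Longrightarrow> \<tau> \<in> GG \<Longrightarrow> j \<in> {1..n} \<Longrightarrow> S j (\<sigma> \<circ> \<tau>) = S j \<sigma> + S j \<tau>"
  unfolding S_def SS_def by (simp add: of_nat_tup_comp distrib_left sum.distrib del: o_apply)

text \<open>The forms are triangular with unit diagonal. In general \<open>SS j s\<close> lies only
  in \<open>F\<close>, but where all earlier forms vanish it lies in the prime field; this is what
  lets \<open>ell\<close> act as an indicator.\<close>

lemma tup_0_of_S:
  assumes "j \<in> {1..n}" "\<And>i. i \<in> {1..<j} \<Longrightarrow> SS i s = 0" "\<And>i. i \<in> {1..n} \<Longrightarrow> s i < p"
  shows "SS j s = of_nat (s j) \<and> (\<forall>i\<in>{1..<j}. s i = 0)"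
  using assms
proof (induction j rule: less_induct)
  case (less j)
  have z: "s i = 0" if i: "i \<in> {1..<j}" for i
  proof -
    have "SS i s = of_nat (s i)" using less.IH[of i] less.prems i by auto
    hence "(of_nat (s i) :: 'k) = of_nat 0" using less.prems(2)[OF i] by simp
    thus ?thesis using of_nat_inj_on_char[OF char, of "s i" 0] less.prems i p_pos by simp
  qed
  have "SS j s = (\<Sum>i=1..j. if i = j then of_nat (s j) else 0)"
    unfolding SS_def by (intro sum.cong) (use z less.prems(1) a_diag in auto)
  also have "\<dots> = of_nat (s j)" using less.prems(1) by simp
  finally show ?case using z by blast
qed

lemma S_inj: assumes "\<sigma> \<in> GG" "\<And>j. j \<in> {1..n} \<Longrightarrow> S j \<sigma> = 0" shows "\<sigma> = id"
proof (rule GG_eqI[OF assms(1) GG_id])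
  fix i assume i: "i \<in> {1..n}"
  have "SS i (tup \<sigma>) = of_nat (tup \<sigma> i)"
    using tup_0_of_S[OF i, of "tup \<sigma>"] assms i tup by (auto simp: S_def)
  hence "(of_nat (tup \<sigma> i) :: 'k) = of_nat 0" using assms(2)[OF i] by (simp add: S_def)
  hence "tup \<sigma> i = 0" using of_nat_inj_on_char[OF char, of "tup \<sigma> i" 0] tup(1)[OF assms(1) i] p_pos by simp
  thus "\<sigma> (x i) = id (x i)" using tup(2)[OF assms(1) i] by simp
qed

text \<open>Summing over the last coordinate first decouples the factors, since \<open>S j\<close> involves only the
  coordinates up to \<open>j\<close>.\<close>

lemma iterated_sum:
  fixes \<phi> :: "nat \<Rightarrow> 'k \<Rightarrow> 'k \<Rightarrow> 'b::comm_ring_1"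
  assumes "1 \<le> m" "m \<le> n" and "\<And>j t r. j \<in> {2..m} \<Longrightarrow> (\<Sum>l<p. \<phi> j t (r + of_nat l)) = \<Phi> j t"
  shows "(\<Sum>s\<in>PiE {1..m} (\<lambda>_. {..<p}). \<Prod>j=1..m. \<phi> j (of_nat (s 1)) (SS j s))
       = (\<Sum>l<p. \<phi> 1 (of_nat l) (of_nat l) * (\<Prod>j=2..m. \<Phi> j (of_nat l)))"
  using assms
proof (induction m arbitrary: \<phi> \<Phi> rule: nat_induct_at_least)
  case base
  have "(\<Sum>s\<in>PiE {1..1::nat} (\<lambda>_. {..<p}). \<Prod>j=1..1. \<phi> j (of_nat (s 1)) (SS j s))
     = (\<Sum>s\<in>PiE (insert 1 {}) (\<lambda>_::nat. {..<p}). \<phi> 1 (of_nat (s 1)) (SS 1 s))" by simp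
  also have "\<dots> = (\<Sum>l<p. \<phi> 1 (of_nat l) (of_nat l))"
    unfolding sum_PiE_insert[OF empty_iff[THEN iffD1, THEN notI]]
    using a_diag[OF one_in] by (subst sum_PiE_insert) (auto simp: SS_def)
  finally show ?case by simp
next
  case (Suc m)
  have set: "{1..Suc m} = insert (Suc m) {1..m}" by auto
  have "(\<Sum>s\<in>PiE {1..Suc m} (\<lambda>_. {..<p}). \<Prod>j=1..Suc m. \<phi> j (of_nat (s 1)) (SS j s))
    = (\<Sum>s\<in>PiE {1..m} (\<lambda>_. {..<p}). \<Sum>l<p. \<Prod>j=1..Suc m. \<phi> j (of_nat ((s(Suc m := l)) 1)) (SS j (s(Suc m := l))))"
    unfolding set by (rule sum_PiE_insert) simp
  also have "\<dots> = (\<Sum>s\<in>PiE {1..m} (\<lambda>_. {..<p}). (\<Prod>j=1..m. \<phi> j (of_nat (s 1)) (SS j s)) * \<Phi> (Suc m) (of_nat (s 1)))"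
  proof (intro sum.cong refl)
    fix s
    define r where "r = (\<Sum>i=1..m. a (Suc m) i * of_nat (s i))"
    have 1: "SS j (s(Suc m := l)) = SS j s" if "j \<in> {1..m}" for j l
      unfolding SS_def by (intro sum.cong) (use that in auto)
    have 2: "SS (Suc m) (s(Suc m := l)) = r + of_nat l" for l
    proof -
      have "(\<Sum>i=1..m. a (Suc m) i * of_nat ((s(Suc m := l)) i)) = r"
        unfolding r_def by (intro sum.cong) auto
      thus ?thesis using a_diag[of "Suc m"] Suc.prems by (simp add: SS_def)
    qed
    have 3: "(s(Suc m := l)) 1 = s 1" for l using Suc.hyps by simp
    have "(\<Sum>l<p. \<Prod>j=1..Suc m. \<phi> j (of_nat ((s(Suc m := l)) 1)) (SS j (s(Suc m := l))))
       = (\<Sum>l<p. (\<Prod>j=1..m. \<phi> j (of_nat (s 1)) (SS j s)) * \<phi> (Suc m) (of_nat (s 1)) (r + of_nat l))"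
    proof (intro sum.cong refl)
      fix l
      have "(\<Prod>j=1..m. \<phi> j (of_nat (s 1)) (SS j (s(Suc m := l)))) = (\<Prod>j=1..m. \<phi> j (of_nat (s 1)) (SS j s))"
        by (intro prod.cong) (use 1 in auto)
      thus "(\<Prod>j=1..Suc m. \<phi> j (of_nat ((s(Suc m := l)) 1)) (SS j (s(Suc m := l))))
        = (\<Prod>j=1..m. \<phi> j (of_nat (s 1)) (SS j s)) * \<phi> (Suc m) (of_nat (s 1)) (r + of_nat l)"
        unfolding 3 by (simp add: 2 del: fun_upd_apply)
    qed
    also have "\<dots> = (\<Prod>j=1..m. \<phi> j (of_nat (s 1)) (SS j s)) * \<Phi> (Suc m) (of_nat (s 1))"
      using Suc.prems(2)[of "Suc m"] Suc.hyps by (simp add: sum_distrib_left[symmetric])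
    finally show "(\<Sum>l<p. \<Prod>j=1..Suc m. \<phi> j (of_nat ((s(Suc m := l)) 1)) (SS j (s(Suc m := l))))
       = (\<Prod>j=1..m. \<phi> j (of_nat (s 1)) (SS j s)) * \<Phi> (Suc m) (of_nat (s 1))" .
  qed
  also have "\<dots> = (\<Sum>l<p. \<phi> 1 (of_nat l) (of_nat l) * (\<Prod>j=2..Suc m. \<Phi> j (of_nat l)))"
  proof -
    \<comment> \<open>The factor left by the last coordinate depends only on \<open>s 1\<close>, so
      it is absorbed into factor \<open>1\<close> before the induction hypothesis is
      applied.\<close>
    define \<phi>' where "\<phi>' j t z = (if j = 1 then \<phi> 1 t z * \<Phi> (Suc m) t else \<phi> j t z)" for j t z
    have "(\<Prod>j=1..m. \<phi>' j t (z j)) = (\<Prod>j=1..m. \<phi> j t (z j)) * \<Phi> (Suc m) t" for t z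
    proof -
      have "(\<Prod>j=1..m. \<phi>' j t (z j)) = \<phi>' 1 t (z 1) * (\<Prod>j=2..m. \<phi>' j t (z j))"
        using Suc.hyps by (subst prod.atLeast_Suc_atMost) (auto simp: numeral_2_eq_2)
      also have "(\<Prod>j=2..m. \<phi>' j t (z j)) = (\<Prod>j=2..m. \<phi> j t (z j))"
        by (intro prod.cong) (auto simp: \<phi>'_def)
      also have "\<phi>' 1 t (z 1) * \<dots> = (\<phi> 1 t (z 1) * (\<Prod>j=2..m. \<phi> j t (z j))) * \<Phi> (Suc m) t"
        by (simp add: \<phi>'_def mult_ac)
      also have "\<phi> 1 t (z 1) * (\<Prod>j=2..m. \<phi> j t (z j)) = (\<Prod>j=1..m. \<phi> j t (z j))"
        using Suc.hyps by (subst (2) prod.atLeast_Suc_atMost) (auto simp: numeral_2_eq_2)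
      finally show ?thesis .
    qed
    hence "(\<Sum>s\<in>PiE {1..m} (\<lambda>_. {..<p}). (\<Prod>j=1..m. \<phi> j (of_nat (s 1)) (SS j s)) * \<Phi> (Suc m) (of_nat (s 1)))
      = (\<Sum>s\<in>PiE {1..m} (\<lambda>_. {..<p}). \<Prod>j=1..m. \<phi>' j (of_nat (s 1)) (SS j s))" by simp
    also have "\<dots> = (\<Sum>l<p. \<phi>' 1 (of_nat l) (of_nat l) * (\<Prod>j=2..m. \<Phi> j (of_nat l)))"
      by (rule Suc.IH) (use Suc.prems in \<open>auto simp: \<phi>'_def\<close>)
    also have "\<dots> = (\<Sum>l<p. \<phi> 1 (of_nat l) (of_nat l) * (\<Prod>j=2..Suc m. \<Phi> j (of_nat l)))"
      using Suc.hyps by (intro sum.cong) (auto simp: \<phi>'_def mult_ac)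
    finally show ?thesis .
  qed
  finally show ?case .
qed

end

section \<open>The elements \<open>gam w\<close>: action on monomials, convolution, traces\<close>

context scaffold
begin

text \<open>Coefficients of Lagrange interpolation from the points \<open>(S 1 \<sigma>, \<dots>, S n \<sigma>)\<close> to the point \<open>w\<close>: in
  \<open>F[G]\<close> this element plays the role of the translation by \<open>w\<close>.\<close>

definition gam :: "(nat \<Rightarrow> 'k) \<Rightarrow> ('l \<Rightarrow> 'l) \<Rightarrow> 'k" where
  "gam w \<sigma> = (if \<sigma> \<in> GG then \<Prod>j=1..n. ell p (w j - S j \<sigma>) else 0)"

lemma gam_F: "(\<And>j. j \<in> {1..n} \<Longrightarrow> w j \<in> F) \<Longrightarrow> gam w \<sigma> \<in> F"
  unfolding gam_def using S_F by (auto intro!: F.S_prod F.S_ell F.S_diff simp del: One_nat_def)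

lemma gam_cong: "(\<And>j. j \<in> {1..n} \<Longrightarrow> w j = w' j) \<Longrightarrow> gam w = gam w'"
  by (rule ext) (simp add: gam_def)

lemma act_add: "act emb g (y + z) = act emb g y + act emb g z"
proof -
  have "(\<Sum>\<sigma>\<in>GG. emb (g \<sigma>) * \<sigma> (y + z)) = (\<Sum>\<sigma>\<in>GG. emb (g \<sigma>) * \<sigma> y + emb (g \<sigma>) * \<sigma> z)"
    by (intro sum.cong refl) (simp add: femb.e_add[OF GG_femb] distrib_left)
  thus ?thesis by (simp add: act_def sum.distrib)
qed

lemma act_scale: "act emb g (emb c * y) = emb c * act emb g y"
  unfolding act_def sum_distrib_left
  by (intro sum.cong refl) (simp add: femb.e_mult[OF GG_femb] mult_ac)

lemma act_0 [simp]: "act emb g 0 = 0" using act_scale[of g 0 0] by simp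

lemma act_sum: "act emb g (\<Sum>i\<in>I. emb (c i) * y i) = (\<Sum>i\<in>I. emb (c i) * act emb g (y i))"
  by (induction I rule: infinite_finite_induct) (auto simp: act_add act_scale)

definition Ymon :: "(nat \<Rightarrow> nat) \<Rightarrow> 'l" where "Ymon \<alpha> = (\<Prod>j=1..n. Y j ^ \<alpha> j)"

definition dmon :: "(nat \<Rightarrow> nat) \<Rightarrow> int" where "dmon \<alpha> = - b * int (\<Sum>j=1..n. \<alpha> j * p ^ (n - j))"

lemma Ymon_val: "veq vL (Ymon \<alpha>) (dmon \<alpha>)"
proof -
  have "veq vL (Ymon \<alpha>) (\<Sum>j=1..n. int (\<alpha> j) * (- (int (p ^ (n - j)) * b)))"
    unfolding Ymon_def by (intro L.veq_prod L.veq_power Y_val) auto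
  also have "(\<Sum>j=1..n. int (\<alpha> j) * (- (int (p ^ (n - j)) * b))) = dmon \<alpha>"
    unfolding dmon_def of_nat_sum sum_distrib_left by (intro sum.cong) auto
  finally show ?thesis .
qed

text \<open>Up to the factor \<open>- b\<close>, a unit modulo \<open>N\<close>, the valuation is
  the number with base-\<open>p\<close> digits \<alpha>.\<close>

lemma dmon_inj:
  assumes "\<alpha> \<in> Tup" "\<alpha>' \<in> Tup" "dmon \<alpha> mod int N = dmon \<alpha>' mod int N"
  shows "\<alpha> = \<alpha>'"
proof -
  define A where "A \<gamma> = (\<Sum>j=1..n. \<gamma> j * p ^ (n - j))" for \<gamma> :: "nat \<Rightarrow> nat"
  have lt: "\<gamma> j < p" if "\<gamma> \<in> Tup" "j \<in> {1..n}" for \<gamma> j using that by (auto simp: Tup_def PiE_iff)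
  have A: "A \<gamma> < p ^ n" if "\<gamma> \<in> Tup" for \<gamma> unfolding A_def by (rule digits_bound) (use lt that in auto)
  have "int N dvd dmon \<alpha> - dmon \<alpha>'" using assms(3) by (simp add: mod_eq_dvd_iff)
  hence "int N dvd b * (int (A \<alpha>') - int (A \<alpha>))" by (simp add: dmon_def A_def algebra_simps)
  moreover have "coprime (int N) b"
    unfolding N_eq using p_not_dvd_b prime prime_imp_coprime[of "int p" b] by simp
  ultimately have "int N dvd int (A \<alpha>') - int (A \<alpha>)" by (simp add: coprime_dvd_mult_right_iff)
  hence "int (A \<alpha>') mod int N = int (A \<alpha>) mod int N" by (simp add: mod_eq_dvd_iff)
  hence "A \<alpha>' = A \<alpha>" using A[OF assms(1)] A[OF assms(2)] by (simp add: N_eq)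
  hence "\<alpha> i = \<alpha>' i" if "i \<in> {1..n}" for i
    using digits_unique[of n \<alpha> p \<alpha>' i] lt assms that unfolding A_def by auto
  thus ?thesis using assms(1,2) unfolding Tup_def by (intro PiE_ext) auto
qed

lemma Y_basis: "valbasis Tup Ymon dmon"
  unfolding valbasis_def using fin_Tup card_Tup N_eq Ymon_val dmon_inj by (auto intro: inj_onI)

definition top :: "nat \<Rightarrow> nat" where "top = (\<lambda>j\<in>{1..n}. p - 1)"

lemma top_in: "top \<in> Tup" using p_pos by (auto simp: top_def Tup_def)

text \<open>All digits equal to \<open>p - 1\<close> give
  \<open>- b * (p ^ n - 1) = b - b * N\<close>. So the residue \<open>b\<close> defining valuation
  criterion elements singles out the monomial with maximal exponents, all of them nonzero modulo
  \<open>p\<close>.\<close>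

lemma top_mod: assumes "\<alpha> \<in> Tup" "dmon \<alpha> mod int N = m mod int N" "[m = b] (mod int (p ^ n))" shows "\<alpha> = top"
proof (rule dmon_inj[OF assms(1) top_in])
  have geo: "(\<Sum>j=1..n'. (p - 1) * p ^ (n' - j)) + 1 = p ^ n'" for n'
  proof (induction n')
    case (Suc m)
    have "(\<Sum>j=1..Suc m. (p - 1) * p ^ (Suc m - j)) = p * (\<Sum>j=1..m. (p - 1) * p ^ (m - j)) + (p - 1)"
      by (simp add: sum_distrib_left Suc_diff_le algebra_simps)
    also have "\<dots> + 1 = p * ((\<Sum>j=1..m. (p - 1) * p ^ (m - j)) + 1)" using p_pos by (simp add: algebra_simps)
    also have "\<dots> = p ^ Suc m" by (simp only: Suc power_Suc)
    finally show ?case .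
  qed simp
  have "(\<Sum>j=1..n. top j * p ^ (n - j)) = (\<Sum>j=1..n. (p - 1) * p ^ (n - j))"
    by (intro sum.cong) (auto simp: top_def)
  hence "int (\<Sum>j=1..n. top j * p ^ (n - j)) = int N - 1" using geo[of n] N_eq by linarith
  hence "dmon top = b - b * int N" by (simp only: dmon_def) (simp add: algebra_simps)
  hence "dmon top mod int N = b mod int N"
    by (metis mod_mult_self2 diff_conv_add_uminus mult_minus_left mult.commute)
  thus "dmon \<alpha> mod int N = dmon top mod int N" using assms(2,3) by (simp add: N_eq cong_def)
qed

lemma gal_Ymon:
  assumes "\<sigma> \<in> GG"
  shows "\<sigma> (Ymon \<alpha>) = (\<Prod>j=1..n. (Y j + emb (SS j (tup \<sigma>)) + K j (of_nat (tup \<sigma> 1))) ^ \<alpha> j)"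
proof -
  interpret s: femb \<sigma> by (rule GG_femb[OF assms])
  show ?thesis unfolding Ymon_def s.e_prod s.e_power
    by (intro prod.cong refl) (use gal_Y[OF assms] in \<open>simp add: S_def\<close>)
qed

text \<open>Summation over the coordinates \<open>2, ..., n\<close> is exact interpolation, as the
  exponents are below \<open>p\<close>. Coordinate \<open>1\<close> remains a weighted sum because
  \<kappa> in the last factor depends on it.\<close>

lemma act_gam_Ymon:
  assumes \<alpha>: "\<alpha> \<in> Tup"
  shows "act emb (gam w) (Ymon \<alpha>) = (\<Sum>l<p. emb (ell p (w 1 - of_nat l)) * ((Y 1 + of_nat l) ^ \<alpha> 1 *
     (\<Prod>j=2..n. (Y j + emb (w j) + K j (of_nat l)) ^ \<alpha> j)))"
proof -
  define \<phi> where "\<phi> j t s = emb (ell p (w j - s)) * (Y j + emb s + K j t) ^ \<alpha> j" for j t s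
  have "act emb (gam w) (Ymon \<alpha>) = (\<Sum>\<sigma>\<in>GG. \<Prod>j=1..n. \<phi> j (of_nat (tup \<sigma> 1)) (SS j (tup \<sigma>)))"
    unfolding act_def
    by (intro sum.cong refl) (simp add: gam_def gal_Ymon \<phi>_def e_prod prod.distrib S_def del: One_nat_def)
  also have "\<dots> = (\<Sum>s\<in>Tup. \<Prod>j=1..n. \<phi> j (of_nat (s 1)) (SS j s))" by (rule sum_GG)
  also have "\<dots> = (\<Sum>l<p. \<phi> 1 (of_nat l) (of_nat l) * (\<Prod>j=2..n. (Y j + emb (w j) + K j (of_nat l)) ^ \<alpha> j))"
    unfolding Tup_def
  proof (rule iterated_sum)
    fix j t r assume j: "j \<in> {2..n}"
    have "\<alpha> j < p" using \<alpha> j by (auto simp: Tup_def PiE_iff)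
    from lagrange_power[OF prime charL this, of "emb (w j)" "emb r" "Y j + K j t"]
    show "(\<Sum>l<p. \<phi> j t (r + of_nat l)) = (Y j + emb (w j) + K j t) ^ \<alpha> j"
      by (simp add: \<phi>_def e_ell e_diff e_add add_ac)
  qed (use n_pos in auto)
  finally show ?thesis by (simp add: \<phi>_def mult.assoc)
qed

text \<open>For fixed \<sigma>, the factor \<open>ell p (w j - S j \<sigma> + z)\<close> is a
  polynomial of degree at most \<open>p - 1\<close> in \<open>z\<close>, and the weights from
  \<open>gam v\<close> evaluate it at \<open>z = v j\<close>.\<close>

lemma gam_conv:
  assumes s: "\<sigma> \<in> GG"
  shows "(\<Sum>\<tau>\<in>GG. gam v \<tau> * gam w (inv_into UNIV \<tau> \<circ> \<sigma>)) = gam (\<lambda>j. v j + w j) \<sigma>"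
proof -
  define \<phi> where "\<phi> j t z = ell p (v j - z) * ell p (w j - S j \<sigma> + z)" for j and t :: 'k and z
  have conv: "(\<Sum>l<p. \<phi> j t (r + of_nat l)) = ell p (v j + w j - S j \<sigma>)" for j t r
  proof -
    define g where "g = 1 - [:w j - S j \<sigma>, 1:] ^ (p - 1)"
    have "degree g \<le> p - 1" unfolding g_def by (rule degree_diff_le) (auto simp: degree_linear_power)
    hence "degree g < p" using p_pos by linarith
    from lagrange[OF prime char this, of "v j" r] show ?thesis
      by (simp add: \<phi>_def g_def ell_def poly_power algebra_simps)
  qed
  have "(\<Sum>\<tau>\<in>GG. gam v \<tau> * gam w (inv_into UNIV \<tau> \<circ> \<sigma>)) = (\<Sum>\<tau>\<in>GG. \<Prod>j=1..n. \<phi> j (of_nat (tup \<tau> 1)) (SS j (tup \<tau>)))"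
  proof (intro sum.cong refl)
    fix \<tau> assume t: "\<tau> \<in> GG"
    define \<rho> where "\<rho> = inv_into UNIV \<tau> \<circ> \<sigma>"
    have r: "\<rho> \<in> GG" unfolding \<rho>_def by (intro GG_comp GG_inv(1) s t)
    have "\<tau> \<circ> \<rho> = \<sigma>" unfolding \<rho>_def using GG_inv(2)[OF t] by (simp add: o_assoc)
    hence "S j \<rho> = S j \<sigma> - S j \<tau>" if "j \<in> {1..n}" for j using S_comp[OF t r that] by simp
    hence "gam w \<rho> = (\<Prod>j=1..n. ell p (w j - S j \<sigma> + S j \<tau>))"
      unfolding gam_def using r by (simp add: diff_diff_eq2 diff_add_eq)
    thus "gam v \<tau> * gam w (inv_into UNIV \<tau> \<circ> \<sigma>) = (\<Prod>j=1..n. \<phi> j (of_nat (tup \<tau> 1)) (SS j (tup \<tau>)))"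
      using t by (simp add: \<rho>_def[symmetric] gam_def \<phi>_def prod.distrib S_def)
  qed
  also have "\<dots> = (\<Sum>s\<in>Tup. \<Prod>j=1..n. \<phi> j (of_nat (s 1)) (SS j s))" by (rule sum_GG)
  also have "\<dots> = (\<Sum>l<p. \<phi> 1 (of_nat l) (of_nat l) * (\<Prod>j=2..n. ell p (v j + w j - S j \<sigma>)))"
    unfolding Tup_def by (rule iterated_sum) (use n_pos conv in auto)
  also have "\<dots> = (\<Sum>l<p. \<phi> 1 0 (0 + of_nat l)) * (\<Prod>j=2..n. ell p (v j + w j - S j \<sigma>))"
    by (simp add: \<phi>_def sum_distrib_right)
  also have "\<dots> = (\<Prod>j=1..n. ell p (v j + w j - S j \<sigma>))"
    unfolding conv using n_pos by (subst (2) prod.atLeast_Suc_atMost) (auto simp: numeral_2_eq_2)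
  finally show ?thesis using s by (simp add: gam_def)
qed

definition HH :: "nat \<Rightarrow> ('l \<Rightarrow> 'l) set" where "HH j0 = {\<sigma> \<in> GG. \<forall>j\<in>{1..j0}. S j \<sigma> = 0}"

text \<open>The factors need not be indicators individually, since \<open>S j \<sigma>\<close> may
  lie outside the prime field. At the least \<open>j\<close> with
  \<open>S j \<sigma> \<noteq> 0\<close> it lies inside, and there the factor vanishes.\<close>

lemma HH_indicator:
  assumes "j0 \<le> n" "\<sigma> \<in> GG"
  shows "(\<Prod>j=1..j0. ell p (- S j \<sigma>)) = (if \<sigma> \<in> HH j0 then 1 else 0)"
proof (cases "\<sigma> \<in> HH j0")
  case True
  thus ?thesis by (simp add: HH_def ell_0[OF prime])
next
  case False
  hence ex: "\<exists>j. j \<in> {1..j0} \<and> S j \<sigma> \<noteq> 0" using assms by (auto simp: HH_def)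
  define j where "j = (LEAST j. j \<in> {1..j0} \<and> S j \<sigma> \<noteq> 0)"
  have j: "j \<in> {1..j0}" "S j \<sigma> \<noteq> 0" using LeastI_ex[OF ex] by (auto simp: j_def)
  have least: "S i \<sigma> = 0" if "i \<in> {1..<j}" for i
  proof -
    have "i < (LEAST j. j \<in> {1..j0} \<and> S j \<sigma> \<noteq> 0)" using that by (simp add: j_def)
    from not_less_Least[OF this] that j(1) show ?thesis by auto
  qed
  have "S j \<sigma> = of_nat (tup \<sigma> j)"
    using tup_0_of_S[of j "tup \<sigma>"] least j(1) assms tup by (auto simp: S_def)
  moreover from this have nz: "tup \<sigma> j \<noteq> 0" using j(2) by (intro notI) simp
  ultimately have "ell p (- S j \<sigma>) = ell p (of_nat 0 - of_nat (tup \<sigma> j))" by simp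
  also have "\<dots> = 0"
    using ell_of_nat[OF prime char p_pos, of "tup \<sigma> j"] tup(1)[OF assms(2), of j] j assms(1) nz by auto
  finally have "\<exists>j\<in>{1..j0}. ell p (- S j \<sigma>) = 0" using j(1) by blast
  thus ?thesis using False by simp
qed

text \<open>The indicator evaluates the first \<open>j0\<close> factors at \<open>0\<close>. The
  other coordinates run freely and give power sums over the prime field, which vanish unless the
  exponent is \<open>p - 1\<close>.\<close>

lemma sum_HH_Ymon:
  assumes \<alpha>: "\<alpha> \<in> Tup" and j0: "1 \<le> j0" "j0 \<le> n"
  shows "(\<Sum>\<sigma>\<in>HH j0. \<sigma> (Ymon \<alpha>)) = (\<Prod>j=1..n. if j \<le> j0 then Y j ^ \<alpha> j else if \<alpha> j = p - 1 then - 1 else 0)"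
proof -
  define \<phi> where "\<phi> j t s = (if j \<le> j0 then emb (ell p (- s)) else 1) * (Y j + emb s + K j t) ^ \<alpha> j" for j t s
  define \<Phi> where "\<Phi> j t = (if j \<le> j0 then (Y j + K j t) ^ \<alpha> j else if \<alpha> j = p - 1 then - 1 else 0)" for j t
  have lt: "\<alpha> j < p" if "j \<in> {1..n}" for j using \<alpha> that by (auto simp: Tup_def PiE_iff)
  have cond: "(\<Sum>l<p. \<phi> j t (r + of_nat l)) = \<Phi> j t" if "j \<in> {1..n}" for j t r
  proof (cases "j \<le> j0")
    case True
    have "emb (ell p (- (r + of_nat l))) = ell p (0 - (emb r + of_nat l))" for l
      unfolding e_ell e_minus e_add by simp
    hence "\<phi> j t (r + of_nat l) = ell p (0 - (emb r + of_nat l)) * ((Y j + K j t) + (emb r + of_nat l)) ^ \<alpha> j" for l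
      using True by (simp add: \<phi>_def e_add add_ac)
    thus ?thesis using lagrange_power[OF prime charL lt[OF that], of 0 "emb r" "Y j + K j t"] True
      by (simp only: \<Phi>_def if_True add_0_right)
  next
    case False
    thus ?thesis using sum_power_prime_field[OF prime charL lt[OF that], of "Y j + emb r + K j t"]
      by (simp add: \<phi>_def \<Phi>_def e_add add_ac)
  qed
  have "HH j0 \<subseteq> GG" by (auto simp: HH_def)
  hence "(\<Sum>\<sigma>\<in>HH j0. \<sigma> (Ymon \<alpha>)) = (\<Sum>\<sigma>\<in>GG. if \<sigma> \<in> HH j0 then \<sigma> (Ymon \<alpha>) else 0)"
    using fin_GG by (simp add: sum.If_cases Int_absorb1)
  also have "\<dots> = (\<Sum>\<sigma>\<in>GG. \<Prod>j=1..n. \<phi> j (of_nat (tup \<sigma> 1)) (SS j (tup \<sigma>)))"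
  proof (intro sum.cong refl)
    fix \<sigma> assume s: "\<sigma> \<in> GG"
    have "(\<Prod>j=1..n. if j \<le> j0 then emb (ell p (- S j \<sigma>)) else 1) = (\<Prod>j=1..j0. emb (ell p (- S j \<sigma>)))"
      by (rule prod.mono_neutral_cong_right) (use j0 in auto)
    also have "\<dots> = emb (\<Prod>j=1..j0. ell p (- S j \<sigma>))" by (simp add: e_prod)
    also have "\<dots> = (if \<sigma> \<in> HH j0 then 1 else 0)" unfolding HH_indicator[OF j0(2) s] by simp
    finally have ind: "(\<Prod>j=1..n. if j \<le> j0 then emb (ell p (- S j \<sigma>)) else 1) = (if \<sigma> \<in> HH j0 then 1 else 0)" .
    have "(\<Prod>j=1..n. \<phi> j (of_nat (tup \<sigma> 1)) (SS j (tup \<sigma>))) = (if \<sigma> \<in> HH j0 then 1 else 0) * \<sigma> (Ymon \<alpha>)"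
      unfolding \<phi>_def prod.distrib ind[unfolded S_def] gal_Ymon[OF s] ..
    thus "(if \<sigma> \<in> HH j0 then \<sigma> (Ymon \<alpha>) else 0) = (\<Prod>j=1..n. \<phi> j (of_nat (tup \<sigma> 1)) (SS j (tup \<sigma>)))" by simp
  qed
  also have "\<dots> = (\<Sum>s\<in>Tup. \<Prod>j=1..n. \<phi> j (of_nat (s 1)) (SS j s))" by (rule sum_GG)
  also have "\<dots> = (\<Sum>l<p. \<phi> 1 (of_nat l) (of_nat l) * (\<Prod>j=2..n. \<Phi> j (of_nat l)))"
    unfolding Tup_def by (rule iterated_sum) (use n_pos cond in auto)
  \<comment> \<open>The indicator in coordinate \<open>1\<close> leaves only \<open>l = 0\<close>,
    where \<open>K\<close> vanishes.\<close>
  also have "\<dots> = (\<Sum>l<p. if l = 0 then (\<Prod>j=1..n. \<Phi> j 0) else 0)"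
  proof (intro sum.cong refl)
    fix l assume l: "l \<in> {..<p}"
    have "ell p (- of_nat l :: 'k) = (if l = 0 then 1 else 0)"
      using ell_of_nat[OF prime char p_pos, of l] l by auto
    thus "\<phi> 1 (of_nat l) (of_nat l) * (\<Prod>j=2..n. \<Phi> j (of_nat l)) = (if l = 0 then (\<Prod>j=1..n. \<Phi> j 0) else 0)"
    proof (cases "l = 0")
      case True
      have "(\<Prod>j=1..n. \<Phi> j 0) = \<Phi> 1 0 * (\<Prod>j=2..n. \<Phi> j 0)"
        using n_pos by (subst prod.atLeast_Suc_atMost) (auto simp: numeral_2_eq_2)
      moreover have "\<phi> 1 0 0 = \<Phi> 1 0" using j0 by (simp add: \<phi>_def \<Phi>_def ell_0[OF prime])
      ultimately show ?thesis by (simp only: True of_nat_0 simp_thms if_True)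
    next
      case False
      thus ?thesis using \<open>ell p (- of_nat l :: 'k) = (if l = 0 then 1 else 0)\<close> j0 by (simp add: \<phi>_def)
    qed
  qed
  also have "\<dots> = (\<Prod>j=1..n. \<Phi> j 0)" using p_pos by simp
  finally show ?thesis unfolding \<Phi>_def K_0 add_0_right .
qed

end

section \<open>Valuations gained by \<open>gam w - 1\<close> and by traces\<close>

context scaffold
begin

text \<open>The refined break of a translation by \<open>w\<close>, where \<open>j\<close> is the last index with \<open>w j \<noteq> 0\<close>. For \<open>j = 1\<close> the
  shift of \<open>Y n\<close> by \<open>\<kappa> (w 1)\<close> competes with the shift of \<open>Y 1\<close> by \<open>w 1\<close>.\<close>

definition thr :: "nat \<Rightarrow> int" where
  "thr j = (if j = 1 then min (int (p ^ (n - 1)) * b) (k0 + b) else int (p ^ (n - j)) * b)"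

lemma pow_mono_b: "i \<le> j \<Longrightarrow> int (p ^ i) * b \<le> int (p ^ j) * b"
  using b_pos p_pos by (intro mult_right_mono) (auto intro: power_increasing)

lemma pow_strict_b: "i < j \<Longrightarrow> int (p ^ i) * b < int (p ^ j) * b"
  using b_pos p_gt1 by (intro mult_strict_right_mono) (auto intro: power_strict_increasing)

text \<open>With \<open>r = p ^ (n - 2)\<close> this is
  \<open>p * r - p + 1 - r = (p - 1) * (r - 1) \<ge> 0\<close>. So the relative shift of
  \<open>Y n\<close> by \<kappa> can compete with the shift of \<open>Y 1\<close>, but not with that
  of \<open>Y j\<close> for \<open>j \<ge> 2\<close>.\<close>

lemma k0_big: "n \<ge> 2 \<Longrightarrow> k0 + b > int (p ^ (n - 2)) * b"
proof -
  assume n: "n \<ge> 2"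
  define r where "r = int (p ^ (n - 2))"
  have r: "r \<ge> 1" using p_pos by (simp add: r_def Suc_le_eq)
  have "n - 1 = Suc (n - 2)" using n by simp
  hence "int (p ^ (n - 1)) = int p * r" by (simp add: r_def)
  hence k: "k0 + b > int p * r * b - int p * b + b" using k0_gt by simp
  have "0 \<le> (int p - 1) * (r - 1) * b" using r p_gt1 b_pos by (intro mult_nonneg_nonneg) auto
  hence "r * b \<le> int p * r * b - int p * b + b" by (simp add: algebra_simps)
  thus ?thesis using k by (simp add: r_def)
qed

lemma thr_pos: assumes "j \<in> {1..n}" shows "thr j > 0"
proof -
  have pb: "int (p ^ i) * b > 0" for i using b_pos p_pos by simp
  have "k0 + b > 0"
  proof (cases "n \<ge> 2")
    case True
    thus ?thesis using k0_big[OF True] pb[of "n - 2"] by simp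
  next
    case False
    hence "k0 = int (p ^ n) * b" using \<kappa>_val by blast
    thus ?thesis using pb[of n] b_pos by simp
  qed
  thus ?thesis unfolding thr_def using pb by simp
qed

lemma thr_le: "j \<in> {1..j0} \<Longrightarrow> j0 \<in> {1..n} \<Longrightarrow> thr j0 \<le> int (p ^ (n - j)) * b"
  unfolding thr_def using pow_mono_b[of "n - j0" "n - j"] by auto

lemma K_vge:
  assumes j: "j \<in> {1..n}" and j0: "j0 \<in> {1..n}" and t: "t \<in> F"
  shows "vge vL (K j t / Y j) (thr j0) \<and> (j0 \<noteq> 1 \<longrightarrow> vge vL (K j t / Y j) (thr j0 + 1))"
proof (cases "j = n \<and> n \<ge> 2 \<and> \<kappa> t \<noteq> 0")
  case True
  hence k: "veq vL (\<kappa> t) k0" using \<kappa>_val t \<kappa>_0 by auto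
  have Y: "veq vL (Y j) (- b)" using Y_val[OF j] True by simp
  have v: "veq vL (K j t / Y j) (k0 + b)" using L.veq_divide[OF k Y] True by (simp add: K_def)
  have "thr j0 \<le> k0 + b \<and> (j0 \<noteq> 1 \<longrightarrow> thr j0 + 1 \<le> k0 + b)"
  proof (cases "j0 = 1")
    case False
    have "int (p ^ (n - j0)) * b \<le> int (p ^ (n - 2)) * b" using j0 False by (intro pow_mono_b) auto
    thus ?thesis using k0_big True False by (simp add: thr_def)
  qed (simp add: thr_def)
  thus ?thesis using v by (auto intro: L.veq_vge)
next
  case False
  hence "K j t = 0" by (auto simp: K_def)
  thus ?thesis by simp
qed

lemma ell_vge: "t \<in> F \<Longrightarrow> vge vL (emb (ell p t)) 0" by (intro F_vgeL F.S_ell)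

text \<open>Relative to the monomial, each factor is \<open>1 + u l j\<close> with
  \<open>u l j\<close> at least at the threshold, so the product is linear up to twice the
  threshold. The weights have sum \<open>1\<close> and first moment \<open>w 1\<close> and reproduce
  \<kappa>; hence averaging over \<open>l\<close> is exact on the linear part.\<close>

lemma gam_Ymon_estimate:
  assumes \<alpha>: "\<alpha> \<in> Tup" and j0: "j0 \<in> {1..n}"
    and w: "\<And>j. j \<in> {1..n} \<Longrightarrow> w j \<in> F" "\<And>j. j \<in> {1..n} \<Longrightarrow> j > j0 \<Longrightarrow> w j = 0"
  shows "\<exists>R. vge vL R (2 * thr j0) \<and>
    act emb (gam w) (Ymon \<alpha>) = Ymon \<alpha> * (1 + (\<Sum>j=1..n. of_nat (\<alpha> j) * ((emb (w j) + K j (w 1)) / Y j)) + R)"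
proof -
  define \<theta> where "\<theta> = thr j0"
  have th0: "\<theta> \<ge> 0" using thr_pos[OF j0] by (simp add: \<theta>_def)
  define u where "u l j = ((if j = 1 then of_nat l else emb (w j)) + K j (of_nat l)) / Y j" for l j
  define e where "e l = emb (ell p (w 1 - of_nat l))" for l
  have Yw: "vge vL (emb c / Y j) \<theta>" if "j \<in> {1..j0}" "c \<in> F" for c j
    using L.vge_divide[OF F_vgeL[OF that(2)] Y_val[of j]] that j0 thr_le[OF that(1) j0]
    by (auto simp: \<theta>_def elim: L.vge_mono)
  have u: "vge vL (u l j) \<theta>" if j: "j \<in> {1..n}" for l j
  proof -
    have "vge vL ((if j = 1 then of_nat l else emb (w j)) / Y j) \<theta>"
    proof (cases "j = 1")
      case True
      thus ?thesis using Yw[of 1 "of_nat l"] j0 by simp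
    next
      case False
      thus ?thesis using Yw[of j "w j"] w j by (cases "j \<le> j0") auto
    qed
    moreover have "vge vL (K j (of_nat l) / Y j) \<theta>" using K_vge[OF j j0] by (simp add: \<theta>_def)
    ultimately show ?thesis unfolding u_def add_divide_distrib by (rule L.vge_add)
  qed
  define R where "R l = (\<Prod>j=1..n. (1 + u l j) ^ \<alpha> j) - 1 - (\<Sum>j=1..n. of_nat (\<alpha> j) * u l j)" for l
  have R: "vge vL (R l) (2 * \<theta>)" for l
    unfolding R_def by (rule L.prod_one_plus) (use u th0 in auto)
  have w1: "w 1 \<in> F" using w one_in by blast
  have e0: "vge vL (e l) 0" for l unfolding e_def using w1 by (intro ell_vge) auto
  have prodY: "(Y 1 + of_nat l) ^ \<alpha> 1 * (\<Prod>j=2..n. (Y j + emb (w j) + K j (of_nat l)) ^ \<alpha> j)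
     = Ymon \<alpha> * (\<Prod>j=1..n. (1 + u l j) ^ \<alpha> j)" for l
  proof -
    have 1: "(Y j * (1 + u l j)) = Y j + (if j = 1 then of_nat l else emb (w j)) + K j (of_nat l)" if "j \<in> {1..n}" for j
      using Y_nz[OF that] by (simp add: u_def field_simps)
    have "Ymon \<alpha> * (\<Prod>j=1..n. (1 + u l j) ^ \<alpha> j) = (\<Prod>j=1..n. (Y j * (1 + u l j)) ^ \<alpha> j)"
      by (simp add: Ymon_def prod.distrib power_mult_distrib)
    also have "\<dots> = (Y 1 * (1 + u l 1)) ^ \<alpha> 1 * (\<Prod>j=2..n. (Y j * (1 + u l j)) ^ \<alpha> j)"
      using n_pos by (subst prod.atLeast_Suc_atMost) (auto simp: numeral_2_eq_2)
    also have "(\<Prod>j=2..n. (Y j * (1 + u l j)) ^ \<alpha> j) = (\<Prod>j=2..n. (Y j + emb (w j) + K j (of_nat l)) ^ \<alpha> j)"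
      by (intro prod.cong refl arg_cong2[where f = power]) (use 1 in auto)
    also have "Y 1 * (1 + u l 1) = Y 1 + of_nat l" using 1[OF one_in] by simp
    finally show ?thesis by simp
  qed
  have es: "(\<Sum>l<p. e l) = 1" "(\<Sum>l<p. e l * of_nat l) = emb (w 1)" "(\<Sum>l<p. e l * K j (of_nat l)) = K j (w 1)" for j
  proof -
    show "(\<Sum>l<p. e l) = 1" unfolding e_def using sum_ell[OF prime char, of "w 1"] by (metis e1 e_sum)
    have "(\<Sum>l<p. ell p (w 1 - of_nat l) * of_nat l) = w 1"
      using lagrange_power[OF prime char p_gt1, of "w 1" 0 0] by simp
    hence "emb (\<Sum>l<p. ell p (w 1 - of_nat l) * of_nat l) = emb (w 1)" by simp
    thus "(\<Sum>l<p. e l * of_nat l) = emb (w 1)" by (simp add: e_sum e_mult e_def)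
    show "(\<Sum>l<p. e l * K j (of_nat l)) = K j (w 1)" 
      using \<kappa>_interp[of "w 1"] by (cases "j = n \<and> n \<ge> 2") (auto simp: K_def e_def)
  qed
  have su: "(\<Sum>l<p. e l * u l j) = (emb (w j) + K j (w 1)) / Y j" if "j \<in> {1..n}" for j
  proof -
    have "(\<Sum>l<p. e l * u l j) = ((\<Sum>l<p. e l * (if j = 1 then of_nat l else emb (w j))) + (\<Sum>l<p. e l * K j (of_nat l))) / Y j"
      by (simp add: u_def sum_divide_distrib add_divide_distrib sum.distrib distrib_left)
    also have "(\<Sum>l<p. e l * (if j = 1 then of_nat l else emb (w j))) = emb (w j)"
      using es(1,2) by (cases "j = 1") (simp_all add: sum_distrib_right[symmetric])
    finally show ?thesis unfolding es(3) .
  qed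
  have "act emb (gam w) (Ymon \<alpha>) = (\<Sum>l<p. e l * (Ymon \<alpha> * (1 + (\<Sum>j=1..n. of_nat (\<alpha> j) * u l j) + R l)))"
    unfolding act_gam_Ymon[OF \<alpha>] prodY e_def[symmetric] by (simp add: R_def)
  also have "\<dots> = Ymon \<alpha> * ((\<Sum>l<p. e l) + (\<Sum>l<p. \<Sum>j=1..n. e l * (of_nat (\<alpha> j) * u l j)) + (\<Sum>l<p. e l * R l))"
    by (simp add: sum_distrib_left sum_distrib_right distrib_left sum.distrib mult_ac)
  also have "(\<Sum>l<p. \<Sum>j=1..n. e l * (of_nat (\<alpha> j) * u l j)) = (\<Sum>j=1..n. of_nat (\<alpha> j) * (\<Sum>l<p. e l * u l j))"
    by (subst sum.swap) (simp add: sum_distrib_left mult_ac)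
  also have "\<dots> = (\<Sum>j=1..n. of_nat (\<alpha> j) * ((emb (w j) + K j (w 1)) / Y j))"
    by (intro sum.cong refl) (simp only: su)
  also have "(\<Sum>l<p. e l) = 1" by (rule es(1))
  finally have "act emb (gam w) (Ymon \<alpha>) = Ymon \<alpha> * (1 + (\<Sum>j=1..n. of_nat (\<alpha> j) * ((emb (w j) + K j (w 1)) / Y j))
     + (\<Sum>l<p. e l * R l))" .
  moreover have "vge vL (\<Sum>l<p. e l * R l) (2 * \<theta>)"
    using L.vge_mult[OF e0 R] by (intro L.vge_sum) simp
  ultimately show ?thesis unfolding \<theta>_def by blast
qed

lemma gam_Ymon_vge:
  assumes \<alpha>: "\<alpha> \<in> Tup" and j0: "j0 \<in> {1..n}"
    and w: "\<And>j. j \<in> {1..n} \<Longrightarrow> w j \<in> F" "\<And>j. j \<in> {1..n} \<Longrightarrow> j > j0 \<Longrightarrow> w j = 0"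
  shows "\<exists>z. act emb (gam w) (Ymon \<alpha>) - Ymon \<alpha> = Ymon \<alpha> * z \<and> vge vL z (thr j0)"
proof -
  obtain R where R: "vge vL R (2 * thr j0)" "act emb (gam w) (Ymon \<alpha>) = Ymon \<alpha> * (1 + (\<Sum>j=1..n. of_nat (\<alpha> j) * ((emb (w j) + K j (w 1)) / Y j)) + R)"
    using gam_Ymon_estimate[where w = w, OF \<alpha> j0 w] by blast
  have "vge vL (of_nat (\<alpha> j) * ((emb (w j) + K j (w 1)) / Y j)) (thr j0)" if j: "j \<in> {1..n}" for j
  proof -
    have "vge vL (emb (w j) / Y j) (thr j0)"
    proof (cases "j \<le> j0")
      case True
      thus ?thesis using L.vge_divide[OF F_vgeL[OF w(1)[OF j]] Y_val[OF j]] thr_le[of j j0] j j0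
        by (auto elim: L.vge_mono)
    qed (use w j in auto)
    moreover have "vge vL (K j (w 1) / Y j) (thr j0)" using K_vge[OF j j0] w(1)[OF one_in] by blast
    ultimately have "vge vL ((emb (w j) + K j (w 1)) / Y j) (thr j0)"
      unfolding add_divide_distrib by (rule L.vge_add)
    from L.vge_mult[OF L.vge_of_nat this] show ?thesis by simp
  qed
  hence "vge vL (\<Sum>j=1..n. of_nat (\<alpha> j) * ((emb (w j) + K j (w 1)) / Y j)) (thr j0)" by (rule L.vge_sum)
  moreover have "vge vL R (thr j0)" using R(1) thr_pos[OF j0] by (auto elim: L.vge_mono)
  ultimately have "vge vL ((\<Sum>j=1..n. of_nat (\<alpha> j) * ((emb (w j) + K j (w 1)) / Y j)) + R) (thr j0)" by (rule L.vge_add)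
  moreover have "act emb (gam w) (Ymon \<alpha>) - Ymon \<alpha> = Ymon \<alpha> * ((\<Sum>j=1..n. of_nat (\<alpha> j) * ((emb (w j) + K j (w 1)) / Y j)) + R)"
    unfolding R(2) by (simp add: algebra_simps)
  ultimately show ?thesis by blast
qed

lemma gam_vge:
  assumes j0: "j0 \<in> {1..n}"
    and w: "\<And>j. j \<in> {1..n} \<Longrightarrow> w j \<in> F" "\<And>j. j \<in> {1..n} \<Longrightarrow> j > j0 \<Longrightarrow> w j = 0"
    and y: "vge vL y m"
  shows "vge vL (act emb (gam w) y - y) (m + thr j0)"
proof -
  obtain c where c: "y = (\<Sum>\<alpha>\<in>Tup. emb (c \<alpha>) * Ymon \<alpha>)" using valbasis_expand[OF Y_basis] by blast
  have "act emb (gam w) y - y = (\<Sum>\<alpha>\<in>Tup. emb (c \<alpha>) * (act emb (gam w) (Ymon \<alpha>) - Ymon \<alpha>))"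
    unfolding c act_sum by (simp add: right_diff_distrib sum_subtractf)
  moreover have "vge vL (emb (c \<alpha>) * (act emb (gam w) (Ymon \<alpha>) - Ymon \<alpha>)) (m + thr j0)" if \<alpha>: "\<alpha> \<in> Tup" for \<alpha>
  proof -
    obtain z where z: "act emb (gam w) (Ymon \<alpha>) - Ymon \<alpha> = Ymon \<alpha> * z" "vge vL z (thr j0)"
      using gam_Ymon_vge[where w = w, OF \<alpha> j0 w] by blast
    have "vge vL (emb (c \<alpha>) * Ymon \<alpha>) m" using valbasis_vge[OF Y_basis _ \<alpha>] y c by blast
    from L.vge_mult[OF this z(2)] show ?thesis unfolding z(1) by (simp add: mult.assoc)
  qed
  ultimately show ?thesis by (simp only: L.vge_sum)
qed

lemma veq_add_distinct: "veq vL y m \<Longrightarrow> veq vL z k \<Longrightarrow> m \<noteq> k \<Longrightarrow> veq vL (y + z) (min m k)"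
proof (cases "m < k")
  case True
  assume "veq vL y m" "veq vL z k"
  thus ?thesis using L.veq_add[OF _ L.veq_vge] True by (simp add: min_def)
next
  case False
  assume "veq vL y m" "veq vL z k" "m \<noteq> k"
  thus ?thesis using L.veq_add'[OF L.veq_vge] False by (simp add: min_def)
qed

text \<open>All exponents equal \<open>- 1\<close> in \<open>L\<close>, so no term is lost, and the
  term of index \<open>j0\<close> leads. For \<open>j0 = 1\<close> it meets the \<kappa> term; their
  valuations differ because \<open>p\<close> divides \<open>p ^ (n - 1) * b - k0\<close> but not
  \<open>b\<close>.\<close>

lemma top_linear_veq:
  assumes j0: "j0 \<in> {1..n}"
    and w: "\<And>j. j \<in> {1..n} \<Longrightarrow> w j \<in> F" "\<And>j. j \<in> {1..n} \<Longrightarrow> j > j0 \<Longrightarrow> w j = 0" "w j0 \<noteq> 0"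
  shows "veq vL (\<Sum>j=1..n. of_nat (top j) * ((emb (w j) + K j (w 1)) / Y j)) (thr j0)"
proof -
  have "(of_nat (p - 1) :: 'l) + 1 = of_nat p" using p_pos by (metis Suc_diff_1 of_nat_Suc add.commute)
  hence pm1: "(of_nat (p - 1) :: 'l) = - 1"
    using charL of_nat_CHAR[where 'a = 'l] by (simp add: eq_neg_iff_add_eq_0)
  have "(\<Sum>j=1..n. of_nat (top j) * ((emb (w j) + K j (w 1)) / Y j)) = (\<Sum>j=1..n. - ((emb (w j) + K j (w 1)) / Y j))"
  proof (intro sum.cong refl)
    fix j assume "j \<in> {1..n}"
    hence "of_nat (top j) = (- 1 :: 'l)" by (simp add: top_def pm1 del: One_nat_def)
    thus "of_nat (top j) * ((emb (w j) + K j (w 1)) / Y j) = - ((emb (w j) + K j (w 1)) / Y j)"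
      by (simp only: mult_minus_left mult_1_left)
  qed
  also have "\<dots> = - ((\<Sum>j=1..n. emb (w j) / Y j) + (\<Sum>j=1..n. K j (w 1) / Y j))"
    by (simp only: add_divide_distrib sum.distrib sum_negf)
  finally have e: "(\<Sum>j=1..n. of_nat (top j) * ((emb (w j) + K j (w 1)) / Y j))
     = - ((\<Sum>j=1..n. emb (w j) / Y j) + (\<Sum>j=1..n. K j (w 1) / Y j))" .
  have w1: "w 1 \<in> F" using w(1)[OF one_in] .
  have lead: "veq vL (emb (w j0) / Y j0) (int (p ^ (n - j0)) * b)"
    using L.veq_divide[OF F_veqL[OF w(1)[OF j0] w(3)] Y_val[OF j0]] by simp
  have rest: "vge vL (emb (w j) / Y j) (int (p ^ (n - j0)) * b + 1)" if j: "j \<in> {1..n} - {j0}" for j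
  proof (cases "j < j0")
    case True
    have "int (p ^ (n - j0)) * b < int (p ^ (n - j)) * b" using True j0 by (intro pow_strict_b) auto
    thus ?thesis using L.vge_divide[OF F_vgeL[OF w(1)] Y_val, of j j] j by (auto elim!: L.vge_mono)
  qed (use w(2)[of j] j in auto)
  have "(\<Sum>j=1..n. emb (w j) / Y j) = emb (w j0) / Y j0 + (\<Sum>j\<in>{1..n} - {j0}. emb (w j) / Y j)"
    using j0 by (simp add: sum.remove)
  moreover have "vge vL (\<Sum>j\<in>{1..n} - {j0}. emb (w j) / Y j) (int (p ^ (n - j0)) * b + 1)"
    by (rule L.vge_sum) (rule rest)
  ultimately have A: "veq vL (\<Sum>j=1..n. emb (w j) / Y j) (int (p ^ (n - j0)) * b)"
    using L.veq_add[OF lead] by simp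
  have "veq vL ((\<Sum>j=1..n. emb (w j) / Y j) + (\<Sum>j=1..n. K j (w 1) / Y j)) (thr j0)"
  proof (cases "j0 = 1")
    case False
    have "vge vL (\<Sum>j=1..n. K j (w 1) / Y j) (thr j0 + 1)"
      by (rule L.vge_sum) (use K_vge[OF _ j0 w1] False in blast)
    thus ?thesis using L.veq_add[OF A] False by (simp add: thr_def)
  next
    case True
    have sumK: "(\<Sum>j=1..n. K j (w 1) / Y j) = (if n \<ge> 2 then \<kappa> (w 1) / Y n else 0)"
    proof -
      have "(\<Sum>j=1..n. K j (w 1) / Y j) = (\<Sum>j=1..n. if j = n then K n (w 1) / Y n else 0)"
        by (intro sum.cong refl) (auto simp: K_def)
      thus ?thesis using n_pos by (simp add: K_def)
    qed
    have A': "veq vL (\<Sum>j=1..n. emb (w j) / Y j) (int (p ^ (n - 1)) * b)" using A True by simp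
    show ?thesis
    proof (cases "(\<forall>t\<in>F. \<kappa> t = 0) \<and> k0 = int (p ^ n) * b")
      case True': True
      have "int (p ^ (n - 1)) * b \<le> k0 + b" 
        using True' pow_mono_b[OF diff_le_self, of n 1] b_pos by linarith
      hence "thr j0 = int (p ^ (n - 1)) * b" by (simp add: thr_def True)
      moreover have "(\<Sum>j=1..n. K j (w 1) / Y j) = 0" unfolding sumK using True' w1 by simp
      ultimately show ?thesis using A' by simp
    next
      case False
      hence n2: "n \<ge> 2" and k: "veq vL (\<kappa> (w 1)) k0" using \<kappa>_val w1 w(3) True by auto
      have nn: "n \<in> {1..n}" using n_pos by simp
      have "veq vL (\<kappa> (w 1) / Y n) (k0 + b)" using L.veq_divide[OF k Y_val[OF nn]] by simp
      hence B: "veq vL (\<Sum>j=1..n. K j (w 1) / Y j) (k0 + b)" unfolding sumK using n2 by simp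
      have "int p dvd int (p ^ (n - 1)) * b - k0"
        using k0_dvd n2 by (intro dvd_diff dvd_mult2) (auto simp: dvd_power)
      hence "int (p ^ (n - 1)) * b - k0 \<noteq> b" using p_not_dvd_b by auto
      hence "int (p ^ (n - 1)) * b \<noteq> k0 + b" by linarith
      from veq_add_distinct[OF A' B this] show ?thesis by (simp add: thr_def True)
    qed
  qed
  from L.veq_uminus[OF this] show ?thesis unfolding e .
qed

text \<open>The expansion of \<open>y\<close> is dominated by the monomial \<open>top\<close>, which
  gains exactly the threshold; the other terms start higher and gain at least as much.\<close>

lemma gam_veq:
  assumes j0: "j0 \<in> {1..n}"
    and w: "\<And>j. j \<in> {1..n} \<Longrightarrow> w j \<in> F" "\<And>j. j \<in> {1..n} \<Longrightarrow> j > j0 \<Longrightarrow> w j = 0" "w j0 \<noteq> 0"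
    and y: "veq vL y m" "[m = b] (mod int (p ^ n))"
  shows "veq vL (act emb (gam w) y - y) (m + thr j0)"
proof -
  obtain c where c: "y = (\<Sum>\<alpha>\<in>Tup. emb (c \<alpha>) * Ymon \<alpha>)" using valbasis_expand[OF Y_basis] by blast
  obtain \<alpha>0 where a0: "\<alpha>0 \<in> Tup" "veq vL (emb (c \<alpha>0) * Ymon \<alpha>0) m"
    "\<forall>\<alpha>\<in>Tup - {\<alpha>0}. vge vL (emb (c \<alpha>) * Ymon \<alpha>) (m + 1)" "m mod int N = dmon \<alpha>0 mod int N"
    using valbasis_veq[OF Y_basis] y(1) c by blast
  have top: "\<alpha>0 = top" using top_mod[OF a0(1) a0(4)[symmetric] y(2)] .
  have e: "act emb (gam w) y - y = (\<Sum>\<alpha>\<in>Tup. emb (c \<alpha>) * (act emb (gam w) (Ymon \<alpha>) - Ymon \<alpha>))"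
    unfolding c act_sum by (simp add: right_diff_distrib sum_subtractf)
  also have "\<dots> = emb (c top) * (act emb (gam w) (Ymon top) - Ymon top)
      + (\<Sum>\<alpha>\<in>Tup - {top}. emb (c \<alpha>) * (act emb (gam w) (Ymon \<alpha>) - Ymon \<alpha>))"
    by (rule sum.remove[OF fin_Tup top_in])
  finally have e: "act emb (gam w) y - y = emb (c top) * (act emb (gam w) (Ymon top) - Ymon top)
      + (\<Sum>\<alpha>\<in>Tup - {top}. emb (c \<alpha>) * (act emb (gam w) (Ymon \<alpha>) - Ymon \<alpha>))" .
  have rest: "vge vL (\<Sum>\<alpha>\<in>Tup - {top}. emb (c \<alpha>) * (act emb (gam w) (Ymon \<alpha>) - Ymon \<alpha>)) (m + thr j0 + 1)"
  proof (rule L.vge_sum)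
    fix \<alpha> assume \<alpha>: "\<alpha> \<in> Tup - {top}"
    then obtain z where z: "act emb (gam w) (Ymon \<alpha>) - Ymon \<alpha> = Ymon \<alpha> * z" "vge vL z (thr j0)"
      using gam_Ymon_vge[where w = w, OF _ j0 w(1,2)] by blast
    have "vge vL (emb (c \<alpha>) * Ymon \<alpha>) (m + 1)" using a0(3) \<alpha> top by blast
    from L.vge_mult[OF this z(2)] show "vge vL (emb (c \<alpha>) * (act emb (gam w) (Ymon \<alpha>) - Ymon \<alpha>)) (m + thr j0 + 1)"
      unfolding z(1) by (simp add: algebra_simps)
  qed
  obtain R where R: "vge vL R (2 * thr j0)" "act emb (gam w) (Ymon top) = Ymon top * (1 + (\<Sum>j=1..n. of_nat (top j) * ((emb (w j) + K j (w 1)) / Y j)) + R)"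
    using gam_Ymon_estimate[where w = w, OF top_in j0 w(1,2)] by blast
  have "vge vL R (thr j0 + 1)" using R(1) thr_pos[OF j0] by (auto elim: L.vge_mono)
  from L.veq_add[OF top_linear_veq[where w = w, OF j0 w] this]
  have lin: "veq vL ((\<Sum>j=1..n. of_nat (top j) * ((emb (w j) + K j (w 1)) / Y j)) + R) (thr j0)" .
  have "act emb (gam w) (Ymon top) - Ymon top = Ymon top * ((\<Sum>j=1..n. of_nat (top j) * ((emb (w j) + K j (w 1)) / Y j)) + R)"
    unfolding R(2) by (simp add: algebra_simps)
  hence "veq vL (emb (c top) * (act emb (gam w) (Ymon top) - Ymon top)) (m + thr j0)"
    using L.veq_mult[OF a0(2) lin] by (simp add: top mult.assoc)
  from L.veq_add[OF this rest] show ?thesis unfolding e .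
qed

text \<open>The trace of a monomial vanishes or trades the factors \<open>Y j ^ (p - 1)\<close> with
  \<open>j > j0\<close> for signs, a gain of
  \<open>\<Sum> (p - 1) * p ^ (n - j) * b = (p ^ (n - j0) - 1) * b\<close>. The dominant monomial
  \<open>top\<close> is of the second kind.\<close>

lemma trace_veq:
  assumes j0: "j0 \<in> {1..n}" and y: "veq vL y m" "[m = b] (mod int (p ^ n))"
  shows "veq vL (\<Sum>\<sigma>\<in>HH j0. \<sigma> y) (m + int (p ^ (n - j0) - 1) * b)"
proof -
  define T where "T y = (\<Sum>\<sigma>\<in>HH j0. \<sigma> y)" for y
  define h where "h = int (p ^ (n - j0) - 1) * b"
  have T_sum: "T (\<Sum>\<alpha>\<in>Tup. emb (c \<alpha>) * Ymon \<alpha>) = (\<Sum>\<alpha>\<in>Tup. emb (c \<alpha>) * T (Ymon \<alpha>))" for c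
  proof -
    have "\<sigma> (\<Sum>\<alpha>\<in>Tup. emb (c \<alpha>) * Ymon \<alpha>) = (\<Sum>\<alpha>\<in>Tup. emb (c \<alpha>) * \<sigma> (Ymon \<alpha>))" if "\<sigma> \<in> HH j0" for \<sigma>
    proof -
      have s: "\<sigma> \<in> GG" using that by (simp add: HH_def)
      interpret s: femb \<sigma> by (rule GG_femb[OF s])
      show ?thesis using s by (simp add: s.e_sum s.e_mult)
    qed
    hence "T (\<Sum>\<alpha>\<in>Tup. emb (c \<alpha>) * Ymon \<alpha>) = (\<Sum>\<sigma>\<in>HH j0. \<Sum>\<alpha>\<in>Tup. emb (c \<alpha>) * \<sigma> (Ymon \<alpha>))"
      by (simp add: T_def)
    also have "\<dots> = (\<Sum>\<alpha>\<in>Tup. emb (c \<alpha>) * T (Ymon \<alpha>))"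
      by (subst sum.swap) (simp add: T_def sum_distrib_left)
    finally show ?thesis .
  qed
  have geo: "(\<Sum>j\<in>{j0+1..n}. (p - 1) * p ^ (n - j)) = p ^ (n - j0) - 1"
  proof -
    have "(\<Sum>j\<in>{j0+1..n}. (p - 1) * p ^ (n - j)) = (\<Sum>i<n - j0. (p - 1) * p ^ i)"
      by (rule sum.reindex_bij_witness[where i = "\<lambda>i. n - i" and j = "\<lambda>j. n - j"]) (use j0 in auto)
    also have "\<dots> = p ^ (n - j0) - 1"
    proof -
      have "(\<Sum>i<m. (p - 1) * p ^ i) + 1 = p ^ m" for m
      proof (induction m)
        case (Suc m)
        have "(\<Sum>i<Suc m. (p - 1) * p ^ i) + 1 = p ^ m + (p - 1) * p ^ m" using Suc by simp
        also have "\<dots> = (1 + (p - 1)) * p ^ m" by (simp only: add_mult_distrib mult_1_left)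
        also have "1 + (p - 1) = p" using p_pos by simp
        finally show ?case by simp
      qed simp
      from this[of "n - j0"] show ?thesis by linarith
    qed
    finally show ?thesis .
  qed
  have TY: "T (Ymon \<alpha>) = 0 \<or> veq vL (T (Ymon \<alpha>)) (dmon \<alpha> + h)" and
       TYtop: "\<alpha> = top \<Longrightarrow> veq vL (T (Ymon \<alpha>)) (dmon \<alpha> + h)" if \<alpha>: "\<alpha> \<in> Tup" for \<alpha>
  proof -
    have TYe: "T (Ymon \<alpha>) = (\<Prod>j=1..n. if j \<le> j0 then Y j ^ \<alpha> j else if \<alpha> j = p - 1 then - 1 else 0)"
      unfolding T_def using sum_HH_Ymon[OF \<alpha>] j0 by auto
    have v: "veq vL (T (Ymon \<alpha>)) (dmon \<alpha> + h)" if all: "\<forall>j\<in>{j0+1..n}. \<alpha> j = p - 1"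
    proof -
      have "veq vL (T (Ymon \<alpha>)) (\<Sum>j=1..n. if j \<le> j0 then int (\<alpha> j) * (- (int (p ^ (n - j)) * b)) else 0)"
        unfolding TYe
      proof (rule L.veq_prod)
        fix j assume j: "j \<in> {1..n}"
        show "veq vL (if j \<le> j0 then Y j ^ \<alpha> j else if \<alpha> j = p - 1 then - 1 else 0)
          (if j \<le> j0 then int (\<alpha> j) * (- (int (p ^ (n - j)) * b)) else 0)"
          using all j L.veq_power[OF Y_val[OF j]] L.veq_uminus[OF L.veq_one] by auto
      qed simp
      also have "(\<Sum>j=1..n. if j \<le> j0 then int (\<alpha> j) * (- (int (p ^ (n - j)) * b)) else 0)
        = (\<Sum>j=1..n. int (\<alpha> j) * (- (int (p ^ (n - j)) * b))) + (\<Sum>j=1..n. if j \<le> j0 then 0 else int ((p - 1) * p ^ (n - j)) * b)"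
        unfolding sum.distrib[symmetric] by (intro sum.cong refl) (use all in auto)
      also have "(\<Sum>j=1..n. int (\<alpha> j) * (- (int (p ^ (n - j)) * b))) = dmon \<alpha>"
        unfolding dmon_def of_nat_sum sum_distrib_left by (intro sum.cong) auto
      also have "(\<Sum>j=1..n. if j \<le> j0 then 0 else int ((p - 1) * p ^ (n - j)) * b)
         = (\<Sum>j\<in>{j0+1..n}. int ((p - 1) * p ^ (n - j)) * b)"
        by (rule sum.mono_neutral_cong_right) (use j0 in auto)
      also have "\<dots> = h" unfolding h_def geo[symmetric] of_nat_sum sum_distrib_right ..
      finally show ?thesis .
    qed
    show "T (Ymon \<alpha>) = 0 \<or> veq vL (T (Ymon \<alpha>)) (dmon \<alpha> + h)"
    proof (cases "\<forall>j\<in>{j0+1..n}. \<alpha> j = p - 1")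
      case False
      then obtain j where "j \<in> {j0+1..n}" "\<alpha> j \<noteq> p - 1" by blast
      hence "\<exists>j\<in>{1..n}. (if j \<le> j0 then Y j ^ \<alpha> j else if \<alpha> j = p - 1 then - 1 else 0) = 0"
        by (intro bexI[of _ j]) auto
      thus ?thesis unfolding TYe by simp
    qed (use v in blast)
    show "\<alpha> = top \<Longrightarrow> veq vL (T (Ymon \<alpha>)) (dmon \<alpha> + h)" by (rule v) (auto simp: top_def)
  qed
  have Tz: "\<exists>z. T (Ymon \<alpha>) = Ymon \<alpha> * z \<and> vge vL z h \<and> (\<alpha> = top \<longrightarrow> veq vL z h)" if \<alpha>: "\<alpha> \<in> Tup" for \<alpha>
  proof -
    define z where "z = T (Ymon \<alpha>) / Ymon \<alpha>"
    have "Ymon \<alpha> \<noteq> 0" using Ymon_val L.veq_nz by blast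
    hence "T (Ymon \<alpha>) = Ymon \<alpha> * z" by (simp add: z_def)
    moreover have div: "veq vL (y / Ymon \<alpha>) h" if "veq vL y (dmon \<alpha> + h)" for y
      using L.veq_divide[OF that Ymon_val[of \<alpha>]] by simp
    have "z = 0 \<or> veq vL z h" using TY[OF \<alpha>] div by (auto simp: z_def)
    moreover have "\<alpha> = top \<longrightarrow> veq vL z h" using TYtop[OF \<alpha>] div by (auto simp: z_def)
    ultimately show ?thesis by (auto intro: L.veq_vge)
  qed
  obtain c where c: "y = (\<Sum>\<alpha>\<in>Tup. emb (c \<alpha>) * Ymon \<alpha>)" using valbasis_expand[OF Y_basis] by blast
  obtain \<alpha>0 where a0: "\<alpha>0 \<in> Tup" "veq vL (emb (c \<alpha>0) * Ymon \<alpha>0) m"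
    "\<forall>\<alpha>\<in>Tup - {\<alpha>0}. vge vL (emb (c \<alpha>) * Ymon \<alpha>) (m + 1)" "m mod int N = dmon \<alpha>0 mod int N"
    using valbasis_veq[OF Y_basis] y(1) c by blast
  have top: "\<alpha>0 = top" using top_mod[OF a0(1) a0(4)[symmetric] y(2)] .
  have e: "T y = emb (c top) * T (Ymon top) + (\<Sum>\<alpha>\<in>Tup - {top}. emb (c \<alpha>) * T (Ymon \<alpha>))"
    unfolding c T_sum by (rule sum.remove[OF fin_Tup top_in])
  have "vge vL (\<Sum>\<alpha>\<in>Tup - {top}. emb (c \<alpha>) * T (Ymon \<alpha>)) (m + h + 1)"
  proof (rule L.vge_sum)
    fix \<alpha> assume \<alpha>: "\<alpha> \<in> Tup - {top}"
    then obtain z where z: "T (Ymon \<alpha>) = Ymon \<alpha> * z" "vge vL z h" using Tz by blast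
    have "vge vL (emb (c \<alpha>) * Ymon \<alpha>) (m + 1)" using a0(3) \<alpha> top by blast
    from L.vge_mult[OF this z(2)] show "vge vL (emb (c \<alpha>) * T (Ymon \<alpha>)) (m + h + 1)"
      unfolding z(1) by (simp add: algebra_simps)
  qed
  moreover obtain z where z: "T (Ymon top) = Ymon top * z" "veq vL z h" using Tz[OF top_in] by blast
  have "veq vL (emb (c top) * T (Ymon top)) (m + h)"
    unfolding z(1) using L.veq_mult[OF a0(2) z(2)] by (simp add: top mult.assoc)
  ultimately have "veq vL (T y) (m + h)" unfolding e using L.veq_add by blast
  thus ?thesis by (simp add: T_def h_def)
qed

end

section \<open>Group algebras\<close>

locale group_alg = group G + F: subfld F
  for G :: "('g, 'm) monoid_scheme" (structure) and F :: "'k::field set" +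
  assumes fin: "finite (carrier G)"
begin

abbreviation R where "R \<equiv> group_algebra F G"

abbreviation R_times (infixl \<open>\<star>\<close> 70) where "a \<star> c \<equiv> a \<otimes>\<^bsub>R\<^esub> c"

abbreviation R_plus (infixl \<open>\<boxplus>\<close> 65) where "a \<boxplus> c \<equiv> a \<oplus>\<^bsub>R\<^esub> c"

lemma R_carrier: "a \<in> carrier R \<longleftrightarrow> (\<forall>g\<in>carrier G. a g \<in> F) \<and> (\<forall>g. g \<notin> carrier G \<longrightarrow> a g = 0)"
  by (simp add: group_algebra_def)

lemma R_add: "a \<boxplus> c = (\<lambda>g. a g + c g)"
  and R_zero: "\<zero>\<^bsub>R\<^esub> = (\<lambda>g. 0)"
  and R_one: "\<one>\<^bsub>R\<^esub> = (\<lambda>g. if g = \<one> then 1 else 0)"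
  by (simp_all add: group_algebra_def)

lemma R_mult: "(a \<star> c) g = (\<Sum>x\<in>{x \<in> carrier G \<times> carrier G. fst x \<otimes> snd x = g}. a (fst x) * c (snd x))"
  unfolding group_algebra_def by (simp add: case_prod_unfold conj_assoc) (rule sum.cong, auto)

text \<open>Testing a convolution against functions on the group turns ring identities into
  rearrangements of sums. The embedding \<open>e\<close> admits test functions with values in
  \<open>L\<close>, as for the action.\<close>

lemma pairing:
  assumes "field_embedding e"
  shows "(\<Sum>g\<in>carrier G. e ((a \<star> c) g) * \<phi> g)
    = (\<Sum>s\<in>carrier G. \<Sum>t\<in>carrier G. e (a s) * e (c t) * \<phi> (s \<otimes> t))"
proof -
  interpret e: femb e by (rule femb.intro) (rule assms)
  have "(\<Sum>g\<in>carrier G. e ((a \<star> c) g) * \<phi> g)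
    = (\<Sum>g\<in>carrier G. \<Sum>x\<in>{x \<in> carrier G \<times> carrier G. fst x \<otimes> snd x = g}.
        e (a (fst x)) * e (c (snd x)) * \<phi> (fst x \<otimes> snd x))"
    by (intro sum.cong refl) (simp add: R_mult e.e_sum e.e_mult sum_distrib_right)
  also have "\<dots> = (\<Sum>x\<in>carrier G \<times> carrier G. e (a (fst x)) * e (c (snd x)) * \<phi> (fst x \<otimes> snd x))"
    by (rule sum.group) (use fin in auto)
  finally show ?thesis by (simp add: sum.cartesian_product case_prod_unfold)
qed

lemma sum_unit_left:
  "(\<Sum>s\<in>carrier G. \<Sum>t\<in>carrier G. (if s = \<one> then c else 0) * u t * \<phi> (s \<otimes> t)) = (\<Sum>t\<in>carrier G. c * u t * (\<phi> t :: 'k))"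
proof -
  have "(\<Sum>s\<in>carrier G. \<Sum>t\<in>carrier G. (if s = \<one> then c else 0) * u t * \<phi> (s \<otimes> t))
    = (\<Sum>s\<in>carrier G. if s = \<one> then (\<Sum>t\<in>carrier G. c * u t * \<phi> (s \<otimes> t)) else 0)"
    by (intro sum.cong refl) auto
  thus ?thesis using fin by simp
qed

lemma sum_unit_right:
  "(\<Sum>s\<in>carrier G. \<Sum>t\<in>carrier G. u s * (if t = \<one> then c else 0) * \<phi> (s \<otimes> t)) = (\<Sum>s\<in>carrier G. u s * c * (\<phi> s :: 'k))"
proof (intro sum.cong refl)
  fix s assume s: "s \<in> carrier G"
  have "(\<Sum>t\<in>carrier G. u s * (if t = \<one> then c else 0) * \<phi> (s \<otimes> t))
    = (\<Sum>t\<in>carrier G. if t = \<one> then u s * c * \<phi> (s \<otimes> t) else 0)"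
    by (intro sum.cong refl) auto
  thus "(\<Sum>t\<in>carrier G. u s * (if t = \<one> then c else 0) * \<phi> (s \<otimes> t)) = u s * c * \<phi> s"
    using fin s by simp
qed

lemma R_eqI:
  assumes "\<And>\<phi>. (\<Sum>g\<in>carrier G. a g * \<phi> g) = (\<Sum>g\<in>carrier G. c g * (\<phi> g :: 'k))"
    and "\<And>g. g \<notin> carrier G \<Longrightarrow> a g = 0" "\<And>g. g \<notin> carrier G \<Longrightarrow> c g = 0"
  shows "a = c"
proof
  fix g
  show "a g = c g"
  proof (cases "g \<in> carrier G")
    case True
    have "(\<Sum>h\<in>carrier G. a h * (if h = g then 1 else 0)) = (\<Sum>h\<in>carrier G. c h * (if h = g then 1 else 0))"
      by (rule assms(1))
    moreover have "(\<Sum>h\<in>carrier G. u h * (if h = g then 1 else 0)) = u g" for u :: "'g \<Rightarrow> 'k"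
    proof -
      have "(\<Sum>h\<in>carrier G. u h * (if h = g then 1 else 0)) = (\<Sum>h\<in>carrier G. if h = g then u h else 0)"
        by (intro sum.cong refl) auto
      thus ?thesis using fin True by simp
    qed
    ultimately show ?thesis by simp
  qed (use assms(2,3) in auto)
qed

lemma R_mult_outside: "g \<notin> carrier G \<Longrightarrow> (a \<star> c) g = 0"
  unfolding R_mult by (rule sum.neutral) auto

lemma R_mult_closed: "a \<in> carrier R \<Longrightarrow> c \<in> carrier R \<Longrightarrow> a \<star> c \<in> carrier R"
  unfolding R_carrier using R_mult_outside by (auto simp: R_mult intro!: F.S_sum F.S_mult)

lemma pairing_id: "(\<Sum>g\<in>carrier G. (a \<star> c) g * \<phi> g)
    = (\<Sum>s\<in>carrier G. \<Sum>t\<in>carrier G. a s * c t * \<phi> (s \<otimes> t))"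
  using pairing[OF field_embedding_id(1)] .

lemma R_assoc: "(a \<star> c) \<star> d = a \<star> (c \<star> d)"
proof (rule R_eqI)
  fix \<phi> :: "'g \<Rightarrow> 'k"
  have "(\<Sum>g\<in>carrier G. ((a \<star> c) \<star> d) g * \<phi> g)
    = (\<Sum>t\<in>carrier G. d t * (\<Sum>s\<in>carrier G. (a \<star> c) s * \<phi> (s \<otimes> t)))"
    unfolding pairing_id[of "a \<star> c" d \<phi>] by (subst sum.swap) (simp add: sum_distrib_left mult_ac)
  also have "\<dots> = (\<Sum>t\<in>carrier G. d t * (\<Sum>u\<in>carrier G. \<Sum>r\<in>carrier G. a u * c r * \<phi> (u \<otimes> r \<otimes> t)))"
    by (simp only: pairing_id)
  also have "\<dots> = (\<Sum>t\<in>carrier G. \<Sum>u\<in>carrier G. \<Sum>r\<in>carrier G. a u * c r * d t * \<phi> (u \<otimes> r \<otimes> t))"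
    by (simp add: sum_distrib_left mult_ac)
  also have "\<dots> = (\<Sum>u\<in>carrier G. \<Sum>t\<in>carrier G. \<Sum>r\<in>carrier G. a u * c r * d t * \<phi> (u \<otimes> r \<otimes> t))"
    by (rule sum.swap)
  also have "\<dots> = (\<Sum>u\<in>carrier G. a u * (\<Sum>r\<in>carrier G. \<Sum>t\<in>carrier G. c r * d t * \<phi> (u \<otimes> (r \<otimes> t))))"
    by (intro sum.cong refl, subst sum.swap) (simp add: sum_distrib_left mult_ac m_assoc)
  also have "\<dots> = (\<Sum>u\<in>carrier G. a u * (\<Sum>t\<in>carrier G. (c \<star> d) t * \<phi> (u \<otimes> t)))"
    by (simp only: pairing_id)
  also have "\<dots> = (\<Sum>g\<in>carrier G. (a \<star> (c \<star> d)) g * \<phi> g)"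
    unfolding pairing_id[of a "c \<star> d" \<phi>] by (simp add: sum_distrib_left mult_ac)
  finally show "(\<Sum>g\<in>carrier G. ((a \<star> c) \<star> d) g * \<phi> g)
    = (\<Sum>g\<in>carrier G. (a \<star> (c \<star> d)) g * \<phi> g)" .
qed (use R_mult_outside in auto)

lemma R_ring: "ring R"
proof (rule ringI)
  show "abelian_group R"
  proof (rule abelian_groupI)
    fix a assume "a \<in> carrier R"
    hence "(\<lambda>g. - a g) \<in> carrier R" by (auto simp: R_carrier)
    thus "\<exists>c\<in>carrier R. c \<boxplus> a = \<zero>\<^bsub>R\<^esub>" by (intro bexI[of _ "\<lambda>g. - a g"]) (auto simp: R_add R_zero)
  qed (auto simp: R_carrier R_add R_zero algebra_simps)
  show "monoid R"
  proof (rule monoidI)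
    show one: "\<one>\<^bsub>R\<^esub> \<in> carrier R" by (auto simp: R_carrier R_one)
    fix a assume a: "a \<in> carrier R"
    show "\<one>\<^bsub>R\<^esub> \<star> a = a"
    proof (rule R_eqI)
      show "(\<Sum>g\<in>carrier G. (\<one>\<^bsub>R\<^esub> \<star> a) g * \<phi> g) = (\<Sum>g\<in>carrier G. a g * \<phi> g)" for \<phi>
        unfolding pairing_id R_one sum_unit_left by simp
    qed (use a R_mult_outside in \<open>auto simp: R_carrier\<close>)
    show "a \<star> \<one>\<^bsub>R\<^esub> = a"
    proof (rule R_eqI)
      show "(\<Sum>g\<in>carrier G. (a \<star> \<one>\<^bsub>R\<^esub>) g * \<phi> g) = (\<Sum>g\<in>carrier G. a g * \<phi> g)" for \<phi>
        unfolding pairing_id R_one sum_unit_right by simp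
    qed (use a R_mult_outside in \<open>auto simp: R_carrier\<close>)
  qed (use R_mult_closed R_assoc in auto)
  fix a c d
  show "(a \<boxplus> c) \<star> d = a \<star> d \<boxplus> c \<star> d"
    by (rule ext) (simp add: R_mult R_add distrib_right sum.distrib)
  show "d \<star> (a \<boxplus> c) = d \<star> a \<boxplus> d \<star> c"
    by (rule ext) (simp add: R_mult R_add distrib_left sum.distrib)
qed

sublocale R: ring R by (rule R_ring)

lemma R_minus: "a \<in> carrier R \<Longrightarrow> c \<in> carrier R \<Longrightarrow> a \<ominus>\<^bsub>R\<^esub> c = (\<lambda>g. a g - c g)"
proof -
  assume a: "a \<in> carrier R" and c: "c \<in> carrier R"
  have m: "(\<lambda>g. - c g) \<in> carrier R" using c by (auto simp: R_carrier)
  have "\<ominus>\<^bsub>R\<^esub> c = (\<lambda>g. - c g)"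
    by (rule R.minus_equality) (use m c in \<open>auto simp: R_add R_zero\<close>)
  thus ?thesis by (simp add: a_minus_def R_add)
qed

definition aug :: "('g \<Rightarrow> 'k) \<Rightarrow> 'k" where "aug a = (\<Sum>g\<in>carrier G. a g)"

lemma aug_mult: "aug (a \<star> c) = aug a * aug c"
  using pairing_id[of a c "\<lambda>_. 1"] by (simp add: aug_def sum_product)

lemma A_iff: "a \<in> augmentation_ideal F G \<longleftrightarrow> a \<in> carrier R \<and> aug a = 0"
  by (simp add: augmentation_ideal_def aug_def)

lemma A_ideal: "ideal (augmentation_ideal F G) R"
proof (rule idealI[OF R_ring])
  show "subgroup (augmentation_ideal F G) (add_monoid R)"
  proof (rule R.add.subgroupI)
    have "(\<lambda>g. 0) \<in> augmentation_ideal F G" using R.zero_closed by (simp add: A_iff aug_def R_zero)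
    thus "augmentation_ideal F G \<noteq> {}" by blast
    fix a c assume a: "a \<in> augmentation_ideal F G" and c: "c \<in> augmentation_ideal F G"
    show "\<ominus>\<^bsub>R\<^esub> a \<in> augmentation_ideal F G"
      using a R_minus[OF R.zero_closed, of a] R.a_inv_closed[of a] by (auto simp: A_iff aug_def R_zero a_minus_def R_add sum_negf)
    show "a \<boxplus> c \<in> augmentation_ideal F G"
      using a c by (auto simp: A_iff) (auto simp: aug_def R_add sum.distrib)
  qed (auto simp: A_iff)
qed (auto simp: A_iff aug_mult)

abbreviation AP where "AP \<equiv> augmentation_power F G"

lemma AP_0: "AP 0 = carrier R"
  and AP_Suc: "AP (Suc k) = ideal_prod R (AP k) (augmentation_ideal F G)"
  by (simp_all add: augmentation_power_def ideals_set_def)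

lemma AP_ideal: "ideal (AP k) R"
  by (induction k) (simp_all add: AP_0 AP_Suc R.oneideal R.ideal_prod_is_ideal A_ideal)

lemma AP_carrier: "a \<in> AP k \<Longrightarrow> a \<in> carrier R" using ideal.Icarr[OF AP_ideal] .

lemma AP_1: "AP (Suc 0) \<subseteq> augmentation_ideal F G"
  using R.ideal_prod_inter[OF AP_ideal A_ideal, of 0] by (simp add: AP_Suc)

lemma A_AP1: "a \<in> augmentation_ideal F G \<Longrightarrow> a \<in> AP (Suc 0)"
  using ideal_prod.prod[of "\<one>\<^bsub>R\<^esub>" "carrier R" a "augmentation_ideal F G" R] by (simp add: AP_Suc AP_0 A_iff)

lemma AP_antimono: "i \<le> j \<Longrightarrow> AP j \<subseteq> AP i"
proof (induction j rule: dec_induct)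
  case (step j)
  thus ?case using R.ideal_prod_inter[OF AP_ideal A_ideal, of j] by (auto simp: AP_Suc)
qed simp

lemma AP_add: "a \<in> AP k \<Longrightarrow> c \<in> AP k \<Longrightarrow> (\<lambda>g. a g + c g) \<in> AP k"
  using additive_subgroup.a_closed[OF ideal.axioms(1)[OF AP_ideal]] by (simp add: R_add)

lemma AP_zero: "(\<lambda>g. 0) \<in> AP k"
  using additive_subgroup.zero_closed[OF ideal.axioms(1)[OF AP_ideal]] by (simp add: R_zero)

lemma AP_scale: assumes "a \<in> AP k" "c \<in> F" shows "(\<lambda>g. c * a g) \<in> AP k"
proof -
  define d where "d = (\<lambda>g. if g = \<one> then c else 0)"
  have "d \<in> carrier R" using assms by (auto simp: d_def R_carrier)
  hence "d \<star> a \<in> AP k" using ideal.I_l_closed[OF AP_ideal assms(1)] by blast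
  moreover have "d \<star> a = (\<lambda>g. c * a g)"
  proof (rule R_eqI)
    show "(\<Sum>g\<in>carrier G. (d \<star> a) g * \<phi> g) = (\<Sum>g\<in>carrier G. c * a g * \<phi> g)" for \<phi>
      unfolding pairing_id d_def sum_unit_left by simp
  qed (use AP_carrier[OF assms(1)] R_mult_outside in \<open>auto simp: R_carrier\<close>)
  ultimately show ?thesis by simp
qed

lemma AP_diff: "a \<in> AP k \<Longrightarrow> c \<in> AP k \<Longrightarrow> (\<lambda>g. a g - c g) \<in> AP k"
  using AP_add[OF _ AP_scale[of c k "- 1"], of a] by auto

lemma AP_sum: "(\<And>i. i \<in> I \<Longrightarrow> a i \<in> AP k) \<Longrightarrow> (\<And>i. i \<in> I \<Longrightarrow> c i \<in> F) \<Longrightarrow> (\<lambda>g. \<Sum>i\<in>I. c i * a i g) \<in> AP k"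
  by (induction I rule: infinite_finite_induct) (auto intro!: AP_zero AP_add AP_scale)

lemma AP_mult: "a \<in> AP i \<Longrightarrow> c \<in> AP j \<Longrightarrow> a \<star> c \<in> AP (i + j)"
proof (induction j arbitrary: a c)
  case 0
  thus ?case using ideal.I_r_closed[OF AP_ideal] by (simp add: AP_0)
next
  case (Suc j)
  from Suc.prems(2) show ?case unfolding AP_Suc
  proof (induction c rule: ideal_prod.induct)
    case (prod c1 c2)
    have "a \<star> c1 \<star> c2 \<in> AP (Suc (i + j))"
      unfolding AP_Suc by (rule ideal_prod.prod) (use Suc prod in auto)
    thus ?case by (simp add: R_assoc)
  next
    case (sum c1 c2)
    have "c1 \<in> carrier R" "c2 \<in> carrier R" using sum(1,2) AP_carrier by (auto simp: AP_Suc[symmetric])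
    hence "a \<star> (c1 \<boxplus> c2) = a \<star> c1 \<boxplus> a \<star> c2"
      using AP_carrier[OF Suc.prems(1)] by (simp add: R.r_distr)
    thus ?case using AP_add[OF sum(3,4)] by (simp add: R_add)
  qed
qed

lemma A_power: "a \<in> augmentation_ideal F G \<Longrightarrow> a [^]\<^bsub>R\<^esub> i \<in> AP i"
proof (induction i)
  case (Suc i)
  thus ?case using AP_mult[OF Suc.IH A_AP1, of a] by simp
qed (simp add: AP_0)

lemma class_eq_iff:
  "a \<in> carrier R \<Longrightarrow> c \<in> carrier R \<Longrightarrow> truncated_class F G k a = truncated_class F G k c \<longleftrightarrow> (\<lambda>g. a g - c g) \<in> AP k"
  unfolding truncated_class_def
  using R.quotient_eq_iff_same_a_r_cos[OF AP_ideal, of a c k] by (simp add: R_minus)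

lemma class_mem: "c \<in> carrier R \<Longrightarrow> a \<in> truncated_class F G k c \<longleftrightarrow> (\<lambda>g. a g - c g) \<in> AP k"
proof
  assume "a \<in> truncated_class F G k c"
  then obtain i where "i \<in> AP k" "a = (\<lambda>g. i g + c g)"
    unfolding truncated_class_def a_r_coset_def' by (auto simp: R_add)
  thus "(\<lambda>g. a g - c g) \<in> AP k" by simp
next
  assume "(\<lambda>g. a g - c g) \<in> AP k"
  moreover have "a = (\<lambda>g. a g - c g) \<boxplus> c" by (simp add: R_add)
  ultimately show "a \<in> truncated_class F G k c"
    unfolding truncated_class_def a_r_coset_def' by blast
qed

lemma quot_hom: "ring_hom_ring R (truncated_algebra F G k) (truncated_class F G k)"
  unfolding truncated_algebra_def truncated_class_def by (rule ideal.rcos_ring_hom_ring[OF AP_ideal])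

lemma quot_one: "\<one>\<^bsub>truncated_algebra F G k\<^esub> = truncated_class F G k \<one>\<^bsub>R\<^esub>"
  using ring_hom_ring.homh[OF quot_hom, of k] by (simp add: ring_hom_def)

lemma quot_mult: "a \<in> carrier R \<Longrightarrow> c \<in> carrier R \<Longrightarrow>
  truncated_class F G k a \<otimes>\<^bsub>truncated_algebra F G k\<^esub> truncated_class F G k c = truncated_class F G k (a \<star> c)"
  using ring_hom_ring.homh[OF quot_hom, of k] by (simp add: ring_hom_def)

lemma quot_minus: "a \<in> carrier R \<Longrightarrow> c \<in> carrier R \<Longrightarrow>
  truncated_class F G k a \<ominus>\<^bsub>truncated_algebra F G k\<^esub> truncated_class F G k c = truncated_class F G k (a \<ominus>\<^bsub>R\<^esub> c)"
proof -
  assume a: "a \<in> carrier R" and c: "c \<in> carrier R"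
  interpret h: ring_hom_ring R "truncated_algebra F G k" "truncated_class F G k" by (rule quot_hom)
  show ?thesis using a c by (simp add: a_minus_def)
qed

subsection \<open>Truncated powers\<close>

text \<open>Identifies a truncated power, coordinate by coordinate, as the Newton series of the
  sequence of powers of \<open>a\<close>.\<close>

lemma fdiff_power:
  assumes a: "a \<in> carrier R"
  shows "fdiff (\<lambda>m. (a [^]\<^bsub>R\<^esub> m) g) i m = ((a \<ominus>\<^bsub>R\<^esub> \<one>\<^bsub>R\<^esub>) [^]\<^bsub>R\<^esub> i \<star> a [^]\<^bsub>R\<^esub> m) g"
proof (induction i arbitrary: m)
  case 0
  show ?case using a by simp
next
  case (Suc i)
  define x where "x = a \<ominus>\<^bsub>R\<^esub> \<one>\<^bsub>R\<^esub>"
  have x: "x \<in> carrier R" using a by (simp add: x_def)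
  have "x [^]\<^bsub>R\<^esub> Suc i \<star> a [^]\<^bsub>R\<^esub> m = x [^]\<^bsub>R\<^esub> i \<star> (x \<star> a [^]\<^bsub>R\<^esub> m)"
    using a x by (simp add: R.m_assoc)
  also have "x \<star> a [^]\<^bsub>R\<^esub> m = a [^]\<^bsub>R\<^esub> Suc m \<ominus>\<^bsub>R\<^esub> a [^]\<^bsub>R\<^esub> m"
  proof -
    have "x \<star> a [^]\<^bsub>R\<^esub> m = a \<star> a [^]\<^bsub>R\<^esub> m \<ominus>\<^bsub>R\<^esub> a [^]\<^bsub>R\<^esub> m"
      unfolding x_def a_minus_def using a by (simp add: R.l_distr R.l_minus)
    also have "a \<star> a [^]\<^bsub>R\<^esub> m = a [^]\<^bsub>R\<^esub> Suc m" using R.nat_pow_Suc2[OF a] by simp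
    finally show ?thesis .
  qed
  also have "x [^]\<^bsub>R\<^esub> i \<star> (a [^]\<^bsub>R\<^esub> Suc m \<ominus>\<^bsub>R\<^esub> a [^]\<^bsub>R\<^esub> m)
      = x [^]\<^bsub>R\<^esub> i \<star> a [^]\<^bsub>R\<^esub> Suc m \<ominus>\<^bsub>R\<^esub> x [^]\<^bsub>R\<^esub> i \<star> a [^]\<^bsub>R\<^esub> m"
    unfolding a_minus_def using a x by (simp add: R.r_distr R.r_minus del: R.nat_pow_Suc)
  also have "\<dots> = (\<lambda>g. (x [^]\<^bsub>R\<^esub> i \<star> a [^]\<^bsub>R\<^esub> Suc m) g - (x [^]\<^bsub>R\<^esub> i \<star> a [^]\<^bsub>R\<^esub> m) g)"
    by (rule R_minus) (use a x in auto)
  finally show ?case unfolding x_def using Suc by simp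
qed

lemma fdiff_power0: "a \<in> carrier R \<Longrightarrow> fdiff (\<lambda>m. (a [^]\<^bsub>R\<^esub> m) g) i 0 = ((a \<ominus>\<^bsub>R\<^esub> \<one>\<^bsub>R\<^esub>) [^]\<^bsub>R\<^esub> i) g"
  using fdiff_power[of a g i 0] by simp

lemma truncated_power_carrier:
  assumes "a \<in> carrier R" "c \<in> F" shows "truncated_power F G p a c \<in> carrier R"
proof -
  have "(a \<ominus>\<^bsub>R\<^esub> \<one>\<^bsub>R\<^esub>) [^]\<^bsub>R\<^esub> i \<in> AP 0" for i :: nat using assms by (simp add: AP_0)
  hence "truncated_power F G p a c \<in> AP 0"
    unfolding truncated_power_def by (intro AP_sum) (use assms in auto)
  thus ?thesis by (simp add: AP_0)
qed

lemma truncated_power_interpolation: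
  assumes "prime p" "CHAR('k) = p" and a: "a \<in> carrier R"
    and q: "degree q < p" "\<And>m. m < p \<Longrightarrow> (a [^]\<^bsub>R\<^esub> m) g = poly q (of_nat m)"
  shows "truncated_power F G p a c g = poly q c"
  unfolding truncated_power_def fdiff_power0[OF a, symmetric]
  by (rule newton_interpolation[OF assms(1,2) q])

lemma truncated_power_of_nat:
  assumes "prime p" "CHAR('k) = p" and a: "a \<in> carrier R" and m: "m < p"
  shows "truncated_power F G p a (of_nat m) = a [^]\<^bsub>R\<^esub> m"
proof
  fix g
  have "(a [^]\<^bsub>R\<^esub> m) g = (\<Sum>i\<le>m. of_nat (m choose i) * fdiff (\<lambda>m. (a [^]\<^bsub>R\<^esub> m) g) i 0)"
    using newton_nat[of "\<lambda>m. (a [^]\<^bsub>R\<^esub> m) g" 0 0 m] by simp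
  also have "\<dots> = (\<Sum>i<p. of_nat (m choose i) * fdiff (\<lambda>m. (a [^]\<^bsub>R\<^esub> m) g) i 0)"
    by (rule sum.mono_neutral_left) (use m in \<open>auto simp: binomial_eq_0\<close>)
  also have "\<dots> = truncated_power F G p a (of_nat m) g"
    unfolding truncated_power_def fdiff_power0[OF a, symmetric]
    by (intro sum.cong refl) (simp add: field_binomial_of_nat[OF assms(1,2)])
  finally show "truncated_power F G p a (of_nat m) g = (a [^]\<^bsub>R\<^esub> m) g" by simp
qed

text \<open>Membership is known only for the values at \<open>m < p\<close>; hence the bound on
  \<open>i + j\<close>.\<close>

lemma AP_fdiff:
  assumes "\<And>m. m < p \<Longrightarrow> H m \<in> AP k"
  shows "i + j < p \<Longrightarrow> (\<lambda>g. fdiff (\<lambda>m. H m g) i j) \<in> AP k"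
proof (induction i arbitrary: j)
  case (Suc i)
  thus ?case using AP_diff[OF Suc.IH[of "Suc j"] Suc.IH[of j]] by simp
qed (use assms in simp)

lemma fdiff_minus: "fdiff (\<lambda>m. h m - h' m) i m = fdiff h i m - fdiff h' i m" for h h' :: "nat \<Rightarrow> 'k"
  by (induction i arbitrary: m) simp_all

lemma mult_sums: "(\<lambda>g. \<Sum>i\<in>I. c i * a i g) \<star> (\<lambda>g. \<Sum>l\<in>J. d l * e l g)
  = (\<lambda>g. \<Sum>(i, l)\<in>I \<times> J. c i * d l * (a i \<star> e l) g)"
proof
  fix g
  have "((\<lambda>g. \<Sum>i\<in>I. c i * a i g) \<star> (\<lambda>g. \<Sum>l\<in>J. d l * e l g)) g
    = (\<Sum>x\<in>{x \<in> carrier G \<times> carrier G. fst x \<otimes> snd x = g}. \<Sum>i\<in>I. \<Sum>l\<in>J. c i * d l * (a i (fst x) * e l (snd x)))"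
    unfolding R_mult sum_product by (simp add: mult_ac)
  also have "\<dots> = (\<Sum>i\<in>I. \<Sum>l\<in>J. c i * d l * (a i \<star> e l) g)"
    unfolding R_mult by (simp add: sum_distrib_left sum.swap[of _ _ "{x \<in> carrier G \<times> carrier G. fst x \<otimes> snd x = g}"])
  finally show "((\<lambda>g. \<Sum>i\<in>I. c i * a i g) \<star> (\<lambda>g. \<Sum>l\<in>J. d l * e l g)) g
    = (\<Sum>(i, l)\<in>I \<times> J. c i * d l * (a i \<star> e l) g)" by (simp add: sum.cartesian_product)
qed

text \<open>Modulo \<open>A\<^sup>p\<close> the product of two truncated powers is a polynomial in the exponent of degree less
  than \<open>p\<close>, so it is determined by its values at \<open>0, \<dots>, p - 1\<close>.\<close>

lemma truncated_power_mult:
  assumes p: "prime p" "CHAR('k) = p" and a: "a \<in> carrier R" "aug a = 1" and d: "d \<in> carrier R" "aug d = 1"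
    and comm: "\<And>m. (a \<star> d) [^]\<^bsub>R\<^esub> m = a [^]\<^bsub>R\<^esub> m \<star> d [^]\<^bsub>R\<^esub> (m::nat)" and c: "c \<in> F"
  shows "(\<lambda>g. truncated_power F G p (a \<star> d) c g
    - (truncated_power F G p a c \<star> truncated_power F G p d c) g) \<in> AP p"
proof -
  define x where "x = a \<ominus>\<^bsub>R\<^esub> \<one>\<^bsub>R\<^esub>"
  define y where "y = d \<ominus>\<^bsub>R\<^esub> \<one>\<^bsub>R\<^esub>"
  have aug1: "aug \<one>\<^bsub>R\<^esub> = 1" using fin by (simp add: aug_def R_one)
  have x: "x \<in> augmentation_ideal F G" using a aug1 by (simp add: x_def A_iff) (simp add: R_minus aug_def sum_subtractf)
  have y: "y \<in> augmentation_ideal F G" using d aug1 by (simp add: y_def A_iff) (simp add: R_minus aug_def sum_subtractf)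
  define Z where "Z il = x [^]\<^bsub>R\<^esub> fst il \<star> y [^]\<^bsub>R\<^esub> snd il" for il :: "nat \<times> nat"
  define co where "co c il = field_binomial c (fst il) * field_binomial c (snd il)" for c :: 'k and il
  define P where "P = {..<p} \<times> {..<p}"
  \<comment> \<open>Terms of total order below \<open>p\<close> have coefficients of degree below
    \<open>p\<close> in the exponent; the others contain at least \<open>p\<close> factors from
    \<open>A\<close>.\<close>
  define P1 where "P1 = {il \<in> P. fst il + snd il < p}"
  define B where "B c g = (\<Sum>il\<in>P1. co c il * Z il g)" for c g
  define D where "D c g = (\<Sum>il\<in>P - P1. co c il * Z il g)" for c g
  have finP: "finite P" "P1 \<subseteq> P" by (auto simp: P_def P1_def)
  have prod: "truncated_power F G p a c \<star> truncated_power F G p d c = (\<lambda>g. B c g + D c g)" for c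
  proof -
    have "truncated_power F G p a c \<star> truncated_power F G p d c = (\<lambda>g. \<Sum>il\<in>P. co c il * Z il g)"
      unfolding truncated_power_def mult_sums x_def[symmetric] y_def[symmetric]
      by (simp add: P_def co_def Z_def case_prod_unfold)
    also have "\<dots> = (\<lambda>g. B c g + D c g)"
      unfolding B_def D_def by (rule ext) (simp add: sum.subset_diff[OF finP(2,1)] add.commute)
    finally show ?thesis .
  qed
  have D: "D c \<in> AP p" if "c \<in> F" for c
  proof -
    have "(\<lambda>g. \<Sum>il\<in>P - P1. co c il * Z il g) \<in> AP p"
    proof (rule AP_sum)
      fix il assume il: "il \<in> P - P1"
      have "Z il \<in> AP (fst il + snd il)" unfolding Z_def by (rule AP_mult[OF A_power[OF x] A_power[OF y]])
      moreover have "p \<le> fst il + snd il" using il by (auto simp: P1_def)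
      ultimately show "Z il \<in> AP p" using AP_antimono by blast
      show "co c il \<in> F" unfolding co_def using that by auto
    qed
    thus ?thesis by (simp add: D_def[abs_def])
  qed
  have power: "((a \<star> d) [^]\<^bsub>R\<^esub> m) g - B (of_nat m) g = D (of_nat m) g" if "m < p" for m g
  proof -
    have "(a \<star> d) [^]\<^bsub>R\<^esub> m = truncated_power F G p a (of_nat m) \<star> truncated_power F G p d (of_nat m)"
      using truncated_power_of_nat[OF p] a d that comm by simp
    thus ?thesis by (simp add: prod)
  qed
  have Bpoly: "(\<Sum>i<p. field_binomial c i * fdiff (\<lambda>m. B (of_nat m) g) i 0) = B c g" for g
  proof -
    define q where "q = (\<Sum>il\<in>P1. smult (Z il g) (binomial_poly (fst il) * binomial_poly (snd il)))"
    have Bq: "B c g = poly q c" for c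
      by (simp add: B_def q_def poly_sum co_def poly_binomial_poly mult_ac)
    have "degree q \<le> p - 1"
      unfolding q_def
    proof (rule degree_sum_le)
      fix il assume il: "il \<in> P1"
      have "degree (smult (Z il g) (binomial_poly (fst il) * binomial_poly (snd il))) \<le> fst il + snd il"
        by (rule order_trans[OF degree_smult_le], rule order_trans[OF degree_mult_le], intro add_mono degree_binomial_poly)
      thus "degree (smult (Z il g) (binomial_poly (fst il) * binomial_poly (snd il))) \<le> p - 1"
        using il by (auto simp: P1_def)
    qed (use finP finite_subset in blast)
    hence "degree q < p" using prime_gt_0_nat[OF p(1)] by linarith
    from newton_interpolation[OF p this, of "\<lambda>m. B (of_nat m) g" c] show ?thesis by (simp add: Bq)
  qed
  have ad: "a \<star> d \<in> carrier R" using a d by simp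
  have "truncated_power F G p (a \<star> d) c g - B c g
     = (\<Sum>i<p. field_binomial c i * fdiff (\<lambda>m. ((a \<star> d) [^]\<^bsub>R\<^esub> m) g - B (of_nat m) g) i 0)" for g
    unfolding truncated_power_def fdiff_power0[OF ad, symmetric] Bpoly[symmetric] fdiff_minus
    by (simp add: right_diff_distrib sum_subtractf)
  moreover have "(\<lambda>g. \<Sum>i<p. field_binomial c i * fdiff (\<lambda>m. ((a \<star> d) [^]\<^bsub>R\<^esub> m) g - B (of_nat m) g) i 0) \<in> AP p"
  proof (rule AP_sum)
    fix i assume i: "i \<in> {..<p}"
    have "(\<lambda>g. ((a \<star> d) [^]\<^bsub>R\<^esub> m) g - B (of_nat m) g) \<in> AP p" if "m < p" for m
      unfolding power[OF that] using D[of "of_nat m"] by simp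
    from AP_fdiff[where H = "\<lambda>m g. ((a \<star> d) [^]\<^bsub>R\<^esub> m) g - B (of_nat m) g" and p = p and k = p and i = i and j = 0,
        OF this] i
    show "(\<lambda>g. fdiff (\<lambda>m. ((a \<star> d) [^]\<^bsub>R\<^esub> m) g - B (of_nat m) g) i 0) \<in> AP p" by simp
    show "field_binomial c i \<in> F" using c by blast
  qed
  ultimately have 1: "(\<lambda>g. truncated_power F G p (a \<star> d) c g - B c g) \<in> AP p" by simp
  from AP_diff[OF 1 D[OF c]] show ?thesis unfolding prod by (simp add: diff_diff_eq)
qed

lemma power_congruent:
  assumes "a \<in> carrier R" "d \<in> carrier R" "(\<lambda>g. a g - d g) \<in> AP k"
  shows "(\<lambda>g. (a [^]\<^bsub>R\<^esub> (i::nat)) g - (d [^]\<^bsub>R\<^esub> i) g) \<in> AP k"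
proof (induction i)
  case (Suc i)
  have c: "a [^]\<^bsub>R\<^esub> i \<in> carrier R" "d [^]\<^bsub>R\<^esub> i \<in> carrier R" using assms by auto
  have "(\<lambda>g. (a [^]\<^bsub>R\<^esub> i) g - (d [^]\<^bsub>R\<^esub> i) g) \<star> a \<in> AP k"
    using ideal.I_r_closed[OF AP_ideal Suc] assms(1) by blast
  moreover have "d [^]\<^bsub>R\<^esub> i \<star> (\<lambda>g. a g - d g) \<in> AP k"
    using ideal.I_l_closed[OF AP_ideal assms(3)] c by blast
  ultimately have "(\<lambda>g. ((\<lambda>g. (a [^]\<^bsub>R\<^esub> i) g - (d [^]\<^bsub>R\<^esub> i) g) \<star> a) g
      + (d [^]\<^bsub>R\<^esub> i \<star> (\<lambda>g. a g - d g)) g) \<in> AP k" by (rule AP_add)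
  thus ?case by (simp add: R_mult left_diff_distrib right_diff_distrib sum_subtractf)
qed (simp add: AP_zero)

text \<open>Scalar multiplication is well defined on classes: the rule \<open>scale\<close> of the
  span may use any representative.\<close>

lemma truncated_power_congruent:
  assumes "a \<in> carrier R" "d \<in> carrier R" "(\<lambda>g. a g - d g) \<in> AP k" "c \<in> F"
  shows "(\<lambda>g. truncated_power F G p a c g - truncated_power F G p d c g) \<in> AP k"
proof -
  define x where "x = a \<ominus>\<^bsub>R\<^esub> \<one>\<^bsub>R\<^esub>"
  define y where "y = d \<ominus>\<^bsub>R\<^esub> \<one>\<^bsub>R\<^esub>"
  have xy: "x \<in> carrier R" "y \<in> carrier R" using assms by (auto simp: x_def y_def)
  have "(\<lambda>g. x g - y g) \<in> AP k" using assms by (simp add: x_def y_def R_minus)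
  from power_congruent[OF xy this]
  have "(\<lambda>g. \<Sum>i<p. field_binomial c i * ((x [^]\<^bsub>R\<^esub> i) g - (y [^]\<^bsub>R\<^esub> i) g)) \<in> AP k"
    by (intro AP_sum) (use assms in auto)
  thus ?thesis by (simp add: truncated_power_def x_def y_def right_diff_distrib sum_subtractf)
qed

end

section \<open>The group algebra of the Galois group and the span of its image\<close>

context scaffold
begin

lemma galois_group_simps [simp]: "s \<otimes>\<^bsub>galois_group emb\<^esub> t = s \<circ> t" "\<one>\<^bsub>galois_group emb\<^esub> = id"
  unfolding galois_group_def monoid.select_convs by (rule refl)+

lemma galois_group_group: "group (galois_group emb)"
proof (rule groupI)
  fix s assume s: "s \<in> GG"
  show "\<exists>t\<in>GG. t \<otimes>\<^bsub>galois_group emb\<^esub> s = \<one>\<^bsub>galois_group emb\<^esub>"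
    using GG_inv(1,3)[OF s] by (intro bexI[of _ "inv_into UNIV s"]) auto
qed (use GG_comp GG_id in \<open>auto simp: o_assoc\<close>)

end

sublocale scaffold \<subseteq> GA: group_alg "galois_group emb" F
  by (intro group_alg.intro group_alg_axioms.intro galois_group_group F.subfld_axioms fin_GG)

context scaffold
begin

abbreviation cls :: "nat \<Rightarrow> (('l \<Rightarrow> 'l) \<Rightarrow> 'k) \<Rightarrow> (('l \<Rightarrow> 'l) \<Rightarrow> 'k) set" where
  "cls \<equiv> truncated_class F (galois_group emb)"

abbreviation tpow :: "(('l \<Rightarrow> 'l) \<Rightarrow> 'k) \<Rightarrow> 'k \<Rightarrow> ('l \<Rightarrow> 'l) \<Rightarrow> 'k" where
  "tpow \<equiv> truncated_power F (galois_group emb) p"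

abbreviation Q where "Q \<equiv> truncated_algebra F (galois_group emb)"

abbreviation A where "A \<equiv> augmentation_ideal F (galois_group emb)"

lemma gam_carrier: "(\<And>j. j \<in> {1..n} \<Longrightarrow> w j \<in> F) \<Longrightarrow> gam w \<in> carrier GA.R"
  using gam_F[of w] by (auto simp: GA.R_carrier) (simp add: gam_def)

lemma mult_apply:
  assumes s: "\<sigma> \<in> GG"
  shows "(g \<otimes>\<^bsub>GA.R\<^esub> h) \<sigma> = (\<Sum>\<tau>\<in>GG. g \<tau> * h (inv_into UNIV \<tau> \<circ> \<sigma>))"
  unfolding GA.R_mult
proof (rule sum.reindex_bij_witness[where i = "\<lambda>\<tau>. (\<tau>, inv_into UNIV \<tau> \<circ> \<sigma>)" and j = fst])
  fix x assume x: "x \<in> {x \<in> GG \<times> GG. fst x \<otimes>\<^bsub>galois_group emb\<^esub> snd x = \<sigma>}"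
  hence "inv_into UNIV (fst x) \<circ> \<sigma> = snd x" using GG_inv(3)[of "fst x"] by (auto simp: o_assoc)
  thus "(fst x, inv_into UNIV (fst x) \<circ> \<sigma>) = x" "g (fst x) * h (inv_into UNIV (fst x) \<circ> \<sigma>) = g (fst x) * h (snd x)"
    by (simp_all add: prod_eq_iff)
next
  fix \<tau> assume "\<tau> \<in> GG"
  thus "(\<tau>, inv_into UNIV \<tau> \<circ> \<sigma>) \<in> {x \<in> GG \<times> GG. fst x \<otimes>\<^bsub>galois_group emb\<^esub> snd x = \<sigma>}"
    using GG_comp GG_inv s by (simp add: o_assoc)
qed auto

lemma gam_mult: "gam v \<otimes>\<^bsub>GA.R\<^esub> gam w = gam (\<lambda>j. v j + w j)"
proof
  fix \<sigma>
  show "(gam v \<otimes>\<^bsub>GA.R\<^esub> gam w) \<sigma> = gam (\<lambda>j. v j + w j) \<sigma>"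
    by (cases "\<sigma> \<in> GG") (simp_all add: mult_apply gam_conv GA.R_mult_outside, simp add: gam_def)
qed

lemma S_id: assumes "j \<in> {1..n}" shows "S j id = 0"
proof -
  have "S j id + S j id = S j id + 0" using S_comp[OF GG_id GG_id assms] by simp
  thus ?thesis by (simp only: add_left_cancel)
qed

lemma HH_n: "HH n = {id}"
  using S_inj S_id GG_id by (auto simp: HH_def)

text \<open>Interpolation from the nodes to a node is a Kronecker delta; the nodes are distinct
  because \<open>HH n\<close> is trivial.\<close>

lemma gam_element: assumes s: "\<sigma> \<in> GG" shows "gam (\<lambda>j. S j \<sigma>) = group_element \<sigma>"
proof
  fix \<tau>
  show "gam (\<lambda>j. S j \<sigma>) \<tau> = group_element \<sigma> \<tau>"
  proof (cases "\<tau> \<in> GG")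
    case True
    define \<rho> where "\<rho> = inv_into UNIV \<sigma> \<circ> \<tau>"
    have r: "\<rho> \<in> GG" unfolding \<rho>_def by (intro GG_comp GG_inv(1) s True)
    have t: "\<sigma> \<circ> \<rho> = \<tau>" unfolding \<rho>_def using GG_inv(2)[OF s] by (simp add: o_assoc)
    hence "S j \<tau> = S j \<sigma> + S j \<rho>" if "j \<in> {1..n}" for j using S_comp[OF s r that] by simp
    hence "gam (\<lambda>j. S j \<sigma>) \<tau> = (\<Prod>j=1..n. ell p (- S j \<rho>))" using True by (simp add: gam_def)
    also have "\<dots> = (if \<rho> = id then 1 else 0)" using HH_indicator[OF order_refl r] by (simp add: HH_n)
    also have "\<rho> = id \<longleftrightarrow> \<tau> = \<sigma>"
    proof
      assume "\<tau> = \<sigma>"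
      thus "\<rho> = id" unfolding \<rho>_def using GG_inv(3)[OF s] by simp
    qed (use t in auto)
    finally show ?thesis by (simp add: group_element_def)
  next
    case False
    thus ?thesis using s by (auto simp: gam_def group_element_def)
  qed
qed

lemma gam_one: "(\<And>j. j \<in> {1..n} \<Longrightarrow> w j = 0) \<Longrightarrow> gam w = \<one>\<^bsub>GA.R\<^esub>"
proof -
  assume "\<And>j. j \<in> {1..n} \<Longrightarrow> w j = 0"
  hence "gam w = gam (\<lambda>j. S j id)" by (intro gam_cong) (simp add: S_id)
  also have "\<dots> = \<one>\<^bsub>GA.R\<^esub>" using gam_element[OF GG_id] by (simp add: group_element_def[abs_def] GA.R_one)
  finally show ?thesis .
qed

lemma gam_pow: "gam w [^]\<^bsub>GA.R\<^esub> (m::nat) = gam (\<lambda>j. of_nat m * w j)"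
proof (induction m)
  case 0
  show ?case by (simp add: gam_one)
next
  case (Suc m)
  thus ?case by (simp add: gam_mult distrib_right add.commute)
qed

text \<open>The augmentation is the action on the constant monomial.\<close>

lemma aug_gam: assumes "\<And>j. j \<in> {1..n} \<Longrightarrow> w j \<in> F" shows "GA.aug (gam w) = 1"
proof -
  define \<alpha> where "\<alpha> = (\<lambda>j\<in>{1..n}. 0::nat)"
  have \<alpha>: "\<alpha> \<in> Tup" using p_pos by (auto simp: \<alpha>_def Tup_def)
  have a1: "Ymon \<alpha> = 1" by (simp add: Ymon_def \<alpha>_def)
  have "emb (GA.aug (gam w)) = (\<Sum>\<sigma>\<in>GG. emb (gam w \<sigma>))" by (simp add: GA.aug_def e_sum)
  also have "\<dots> = act emb (gam w) (Ymon \<alpha>)"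
    unfolding act_def a1 by (intro sum.cong refl) (simp add: femb.e1[OF GG_femb])
  also have "\<dots> = (\<Sum>l<p. emb (ell p (w 1 - of_nat l)))"
    unfolding act_gam_Ymon[OF \<alpha>] using n_pos by (simp add: \<alpha>_def)
  also have "\<dots> = emb 1" by (simp add: e_sum[symmetric] sum_ell[OF prime char])
  finally show ?thesis by (simp only: e_inj)
qed

text \<open>With one nonzero coordinate, \<open>gam (\<lambda>i. c * w i)\<close> is at each group
  element a polynomial of degree at most \<open>p - 1\<close> in \<open>c\<close> whose values at
  integers are the powers of \<open>gam w\<close>. So the truncated power is exact, not only a
  congruence.\<close>

lemma truncated_power_single:
  assumes w: "w j \<in> F" "\<And>i. i \<noteq> j \<Longrightarrow> w i = 0" and j: "j \<in> {1..n}"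
  shows "tpow (gam w) c = gam (\<lambda>i. c * w i)"
proof
  fix \<sigma>
  have wF: "w i \<in> F" for i using w by (cases "i = j") auto
  show "tpow (gam w) c \<sigma> = gam (\<lambda>i. c * w i) \<sigma>"
  proof (cases "\<sigma> \<in> GG")
    case True
    define q where "q = smult (\<Prod>i\<in>{1..n} - {j}. ell p (- S i \<sigma>)) (1 - [:- S j \<sigma>, w j:] ^ (p - 1))"
    have q: "gam (\<lambda>i. c * w i) \<sigma> = poly q c" for c
    proof -
      have "gam (\<lambda>i. c * w i) \<sigma> = ell p (c * w j - S j \<sigma>) * (\<Prod>i\<in>{1..n} - {j}. ell p (c * w i - S i \<sigma>))"
        using True j by (simp add: gam_def prod.remove)
      also have "(\<Prod>i\<in>{1..n} - {j}. ell p (c * w i - S i \<sigma>)) = (\<Prod>i\<in>{1..n} - {j}. ell p (- S i \<sigma>))"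
        by (intro prod.cong) (auto simp: w)
      finally show ?thesis by (simp add: q_def ell_def poly_power algebra_simps)
    qed
    have "degree ([:- S j \<sigma>, w j:] ^ (p - 1)) \<le> degree [:- S j \<sigma>, w j:] * (p - 1)" by (rule degree_power_le)
    also have "\<dots> \<le> p - 1" by (simp add: degree_pCons_eq_if)
    finally have "degree (1 - [:- S j \<sigma>, w j:] ^ (p - 1)) \<le> p - 1" by (intro degree_diff_le) auto
    hence "degree q \<le> p - 1" unfolding q_def using degree_smult_le le_trans by blast
    hence dq: "degree q < p" using p_pos by linarith
    show ?thesis
      unfolding q by (rule GA.truncated_power_interpolation[OF prime char gam_carrier dq])
        (use wF q in \<open>auto simp: gam_pow\<close>)
  next
    case False
    have "((gam w \<ominus>\<^bsub>GA.R\<^esub> \<one>\<^bsub>GA.R\<^esub>) [^]\<^bsub>GA.R\<^esub> i) \<sigma> = 0" for i :: nat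
    proof -
      have "(gam w \<ominus>\<^bsub>GA.R\<^esub> \<one>\<^bsub>GA.R\<^esub>) [^]\<^bsub>GA.R\<^esub> i \<in> carrier GA.R" using gam_carrier[of w] wF by simp
      thus ?thesis using False by (simp add: GA.R_carrier)
    qed
    thus ?thesis using False by (simp add: truncated_power_def gam_def)
  qed
qed

text \<open>Several coordinates can push the degree in \<open>c\<close> beyond \<open>p - 1\<close>,
  which leaves a congruence modulo \<open>A^p\<close>. Coordinates are added one at a time through
  \<open>truncated_power_mult\<close>.\<close>

lemma truncated_power_gam:
  assumes w: "\<And>i. w i \<in> F" and c: "c \<in> F"
  shows "(\<lambda>g. tpow (gam w) c g - gam (\<lambda>i. c * w i) g) \<in> GA.AP p"
proof -
  define u where "u j i = (if i \<le> j then w i else 0)" for j i :: nat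
  have uF: "u j i \<in> F" for i j using w by (simp add: u_def)
  have "(\<lambda>g. tpow (gam (u j)) c g - gam (\<lambda>i. c * u j i) g) \<in> GA.AP p" if "j \<le> n" for j
    using that
  proof (induction j)
    case 0
    have e: "gam (u 0) = gam (\<lambda>_. 0)" "gam (\<lambda>i. c * u 0 i) = gam (\<lambda>i. c * 0)" by (intro gam_cong; simp add: u_def)+
    have "tpow (gam (\<lambda>_. 0)) c = gam (\<lambda>i. c * 0)"
      by (rule truncated_power_single[OF _ _ one_in]) auto
    thus ?case unfolding e by (simp add: GA.AP_zero)
  next
    case (Suc j)
    define v where "v i = (if i = Suc j then w i else 0)" for i
    have vF: "v i \<in> F" for i using w by (simp add: v_def)
    have split: "gam (u (Suc j)) = gam (u j) \<otimes>\<^bsub>GA.R\<^esub> gam v" "gam (\<lambda>i. c * u (Suc j) i) = gam (\<lambda>i. c * u j i) \<otimes>\<^bsub>GA.R\<^esub> gam (\<lambda>i. c * v i)"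
      unfolding gam_mult by (intro gam_cong; auto simp: u_def v_def)+
    have tv: "tpow (gam v) c = gam (\<lambda>i. c * v i)"
      by (rule truncated_power_single[where j = "Suc j"]) (use Suc.prems w in \<open>auto simp: v_def\<close>)
    have car: "gam (u j) \<in> carrier GA.R" "gam v \<in> carrier GA.R" "gam (\<lambda>i. c * v i) \<in> carrier GA.R"
      using uF vF c by (auto intro!: gam_carrier)
    have 1: "(\<lambda>g. tpow (gam (u j) \<otimes>\<^bsub>GA.R\<^esub> gam v) c g
      - (tpow (gam (u j)) c \<otimes>\<^bsub>GA.R\<^esub> tpow (gam v) c) g) \<in> GA.AP p"
    proof (rule GA.truncated_power_mult[OF prime char])
      show "(gam (u j) \<otimes>\<^bsub>GA.R\<^esub> gam v) [^]\<^bsub>GA.R\<^esub> m = gam (u j) [^]\<^bsub>GA.R\<^esub> m \<otimes>\<^bsub>GA.R\<^esub> gam v [^]\<^bsub>GA.R\<^esub> m" for m :: nat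
        unfolding gam_mult gam_pow by (simp add: distrib_left)
    qed (use car uF vF c aug_gam in auto)
    have "(\<lambda>g. tpow (gam (u j)) c g - gam (\<lambda>i. c * u j i) g) \<otimes>\<^bsub>GA.R\<^esub> gam (\<lambda>i. c * v i) \<in> GA.AP p"
      using ideal.I_r_closed[OF GA.AP_ideal Suc.IH] Suc.prems car by simp
    hence 2: "(\<lambda>g. (tpow (gam (u j)) c \<otimes>\<^bsub>GA.R\<^esub> gam (\<lambda>i. c * v i)) g
        - (gam (\<lambda>i. c * u j i) \<otimes>\<^bsub>GA.R\<^esub> gam (\<lambda>i. c * v i)) g) \<in> GA.AP p"
      by (simp add: GA.R_mult[abs_def] left_diff_distrib sum_subtractf)
    from GA.AP_add[OF 1 2] show ?case unfolding split tv by simp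
  qed
  from this[OF order_refl] show ?thesis
  proof -
    assume "(\<lambda>g. tpow (gam (u n)) c g - gam (\<lambda>i. c * u n i) g) \<in> GA.AP p"
    moreover have "gam (u n) = gam w" "gam (\<lambda>i. c * u n i) = gam (\<lambda>i. c * w i)"
      by (intro gam_cong; simp add: u_def)+
    ultimately show ?thesis by simp
  qed
qed

text \<open>\<open>k \<le> p\<close> turns congruences modulo \<open>A^p\<close> into congruences
  modulo \<open>A^k\<close>. This inclusion is the one that the breaks call for: they are computed
  class by class, from the representative \<open>gam w\<close>.\<close>

lemma span_gam:
  assumes k: "k \<le> p" and X: "X \<in> G_span F (galois_group emb) p k"
  shows "\<exists>w. (\<forall>i. w i \<in> F) \<and> X = cls k (gam w)"
  using X
proof (induction rule: G_span.induct)
  case one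
  have "gam (\<lambda>_. 0) = \<one>\<^bsub>GA.R\<^esub>" by (rule gam_one) simp
  thus ?case by (intro exI[of _ "\<lambda>_. 0"]) (simp add: GA.quot_one)
next
  case (element g)
  define w where "w j = (if j \<in> {1..n} then S j g else 0)" for j
  have "gam w = group_element g" unfolding gam_element[OF element, symmetric] by (rule gam_cong) (simp add: w_def)
  moreover have "\<forall>i. w i \<in> F" using S_F by (simp add: w_def)
  ultimately show ?case by (intro exI[of _ w]) simp
next
  case (mult X Y)
  then obtain v w where v: "\<forall>i. v i \<in> F" "X = cls k (gam v)"
    and w: "\<forall>i. w i \<in> F" "Y = cls k (gam w)" by blast
  have "X \<otimes>\<^bsub>Q k\<^esub> Y = cls k (gam (\<lambda>i. v i + w i))"
    using v w GA.quot_mult[OF gam_carrier gam_carrier, of v w k] by (simp add: gam_mult)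
  thus ?case using v(1) w(1) by (intro exI[of _ "\<lambda>i. v i + w i"]) auto
next
  case (scale \<gamma> c)
  then obtain w where w: "\<forall>i. w i \<in> F" "cls k \<gamma> = cls k (gam w)"
    by blast
  have g: "\<gamma> \<in> carrier GA.R"
    using scale(1) GA.R.a_r_coset_subset_G[OF ideal.axioms(1)[OF GA.A_ideal, THEN additive_subgroup.a_subset], of "\<one>\<^bsub>GA.R\<^esub>"]
    by auto
  have gw: "gam w \<in> carrier GA.R" "gam (\<lambda>i. c * w i) \<in> carrier GA.R" using w(1) scale(2) by (auto intro!: gam_carrier)
  have "(\<lambda>x. \<gamma> x - gam w x) \<in> GA.AP k" using GA.class_eq_iff[OF g gw(1)] w(2) by simp
  from GA.truncated_power_congruent[OF g gw(1) this scale(2)]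
  have 1: "(\<lambda>x. tpow \<gamma> c x - tpow (gam w) c x) \<in> GA.AP k" .
  have 2: "(\<lambda>x. tpow (gam w) c x - gam (\<lambda>i. c * w i) x) \<in> GA.AP k"
    using truncated_power_gam[of w c] w(1) scale(2) GA.AP_antimono[OF k] by blast
  have "cls k (tpow \<gamma> c) = cls k (gam (\<lambda>i. c * w i))"
    using GA.class_eq_iff[OF GA.truncated_power_carrier[OF g scale(2)] gw(2)] GA.AP_add[OF 1 2] by simp
  thus ?case using w(1) scale(2) by (intro exI[of _ "\<lambda>i. c * w i"]) auto
qed

section \<open>Optimality of the translations\<close>

lemma act_mult: "act emb (g \<otimes>\<^bsub>GA.R\<^esub> h) y = act emb g (act emb h y)"
proof -
  have "act emb (g \<otimes>\<^bsub>GA.R\<^esub> h) y = (\<Sum>s\<in>GG. \<Sum>t\<in>GG. emb (g s) * emb (h t) * (s \<circ> t) y)"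
    unfolding act_def using GA.pairing[OF fe, of g h "\<lambda>\<sigma>. \<sigma> y"] by simp
  also have "\<dots> = (\<Sum>s\<in>GG. emb (g s) * s (act emb h y))"
  proof (intro sum.cong refl)
    fix s assume s: "s \<in> GG"
    interpret s: femb s by (rule GG_femb[OF s])
    show "(\<Sum>t\<in>GG. emb (g s) * emb (h t) * (s \<circ> t) y) = emb (g s) * s (act emb h y)"
      unfolding act_def using s by (simp add: s.e_sum s.e_mult sum_distrib_left mult_ac)
  qed
  finally show ?thesis by (simp add: act_def)
qed

lemma act_plus: "act emb (\<lambda>\<sigma>. g \<sigma> + h \<sigma>) y = act emb g y + act emb h y"
  by (simp add: act_def e_add distrib_right sum.distrib)

lemma act_minus: "act emb (\<lambda>\<sigma>. g \<sigma> - h \<sigma>) y = act emb g y - act emb h y"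
  by (simp add: act_def e_diff left_diff_distrib sum_subtractf)

lemma act_element: "\<tau> \<in> GG \<Longrightarrow> act emb (group_element \<tau>) y = \<tau> y"
proof -
  assume t: "\<tau> \<in> GG"
  have "act emb (group_element \<tau>) y = (\<Sum>\<sigma>\<in>GG. if \<sigma> = \<tau> then \<sigma> y else 0)"
    unfolding act_def group_element_def by (intro sum.cong refl) auto
  thus ?thesis using t fin_GG by simp
qed

lemma act_one: "act emb \<one>\<^bsub>GA.R\<^esub> y = y"
  using act_element[OF GG_id] by (simp add: GA.R_one group_element_def[abs_def])

lemma act_vge: "g \<in> carrier GA.R \<Longrightarrow> vge vL y m \<Longrightarrow> vge vL (act emb g y) m"
  unfolding act_def
  using L.vge_mult[OF F_vgeL GG_vge] by (intro L.vge_sum) (fastforce simp: GA.R_carrier)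

text \<open>An element of augmentation \<open>0\<close> is a combination of differences \<sigma> -
  1, each of which gains \<open>b\<close>.\<close>

lemma act_A_vge:
  assumes g: "g \<in> A" and y: "vge vL y m"
  shows "vge vL (act emb g y) (m + b)"
proof -
  have "(\<Sum>\<sigma>\<in>GG. emb (g \<sigma>)) = 0" using g by (simp add: GA.A_iff GA.aug_def e_sum[symmetric])
  hence "act emb g y = (\<Sum>\<sigma>\<in>GG. emb (g \<sigma>) * (\<sigma> y - y))"
    by (simp add: act_def right_diff_distrib sum_subtractf sum_distrib_right[symmetric])
  moreover have "vge vL (\<Sum>\<sigma>\<in>GG. emb (g \<sigma>) * (\<sigma> y - y)) (m + b)"
  proof (rule L.vge_sum)
    fix \<sigma> assume s: "\<sigma> \<in> GG"
    have "g \<sigma> \<in> F" using g s by (simp add: GA.A_iff GA.R_carrier)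
    from L.vge_mult[OF F_vgeL[OF this] shift_vge[OF s y]] show "vge vL (emb (g \<sigma>) * (\<sigma> y - y)) (m + b)" by simp
  qed
  ultimately show ?thesis by simp
qed

definition supp_HH :: "nat \<Rightarrow> (('l \<Rightarrow> 'l) \<Rightarrow> 'k) \<Rightarrow> bool" where
  "supp_HH j0 q \<longleftrightarrow> q \<in> carrier GA.R \<and> (\<forall>\<sigma>. \<sigma> \<notin> HH j0 \<longrightarrow> q \<sigma> = 0)"

text \<open>Split the coordinates of each \<tau> at \<open>j0\<close>: \<tau> is
  \<open>gam v\<close> times \<open>gam w\<close> with \<open>v\<close> supported up to
  \<open>j0\<close> and \<open>w\<close> beyond. Then \<open>gam w\<close> is supported on
  \<open>HH j0\<close> and \<open>gam v - 1\<close> gains the threshold. Collecting the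
  \<open>gam w\<close> gives \<open>q\<close>, and the rest is \<open>d\<close>.\<close>

lemma A_decompose:
  assumes j0: "j0 \<in> {1..n}" and g: "g \<in> A"
  shows "\<exists>q d. g = q \<oplus>\<^bsub>GA.R\<^esub> d \<and> supp_HH j0 q \<and> GA.aug q = 0 \<and> d \<in> carrier GA.R \<and>
    (\<forall>y m. vge vL y m \<longrightarrow> vge vL (act emb d y) (m + thr j0))"
proof -
  define w where "w \<tau> j = (if j \<in> {1..n} \<and> j > j0 then S j \<tau> else 0)" for \<tau> j
  define v where "v \<tau> j = (if j \<in> {1..n} \<and> j \<le> j0 then S j \<tau> else 0)" for \<tau> j
  have wF: "w \<tau> j \<in> F" and vF: "v \<tau> j \<in> F" for \<tau> j using S_F by (auto simp: w_def v_def)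
  have gF: "g \<tau> \<in> F" if "\<tau> \<in> GG" for \<tau> using g that by (simp add: GA.A_iff GA.R_carrier)
  define q where "q \<sigma> = (\<Sum>\<tau>\<in>GG. g \<tau> * gam (w \<tau>) \<sigma>)" for \<sigma>
  have qc: "q \<in> carrier GA.R"
  proof -
    have "(\<lambda>\<sigma>. \<Sum>\<tau>\<in>GG. g \<tau> * gam (w \<tau>) \<sigma>) \<in> GA.AP 0"
      by (rule GA.AP_sum) (use gF gam_carrier wF in \<open>auto simp: GA.AP_0\<close>)
    thus ?thesis by (simp add: q_def[abs_def] GA.AP_0)
  qed
  have qsupp: "q \<sigma> = 0" if "\<sigma> \<notin> HH j0" for \<sigma>
  proof -
    have "gam (w \<tau>) \<sigma> = 0" for \<tau>
    proof (cases "\<sigma> \<in> GG")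
      case True
      have "(\<Prod>j=1..j0. ell p (- S j \<sigma>)) = 0" using HH_indicator[of j0 \<sigma>] j0 True that by simp
      then obtain j where j: "j \<in> {1..j0}" "ell p (- S j \<sigma>) = 0" by auto
      hence "j \<in> {1..n}" "ell p (w \<tau> j - S j \<sigma>) = 0" using j0 by (auto simp: w_def)
      hence "\<exists>j\<in>{1..n}. ell p (w \<tau> j - S j \<sigma>) = 0" by blast
      thus ?thesis by (simp add: gam_def)
    qed (simp add: gam_def)
    thus ?thesis by (simp add: q_def)
  qed
  have qaug: "GA.aug q = 0"
  proof -
    have "GA.aug q = (\<Sum>\<tau>\<in>GG. g \<tau> * GA.aug (gam (w \<tau>)))"
      unfolding GA.aug_def q_def by (subst sum.swap) (simp add: sum_distrib_left)
    also have "\<dots> = GA.aug g" using aug_gam[OF wF] by (simp add: GA.aug_def)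
    finally show ?thesis using g by (simp add: GA.A_iff)
  qed
  define d where "d = g \<ominus>\<^bsub>GA.R\<^esub> q"
  have gc: "g \<in> carrier GA.R" using g by (simp add: GA.A_iff)
  have dc: "d \<in> carrier GA.R" using gc qc by (simp add: d_def)
  have de: "d = (\<lambda>\<sigma>. g \<sigma> - q \<sigma>)" unfolding d_def by (rule GA.R_minus[OF gc qc])
  have "vge vL (act emb d y) (m + thr j0)" if y: "vge vL y m" for y m
  proof -
    have "act emb q y = (\<Sum>\<tau>\<in>GG. emb (g \<tau>) * act emb (gam (w \<tau>)) y)"
      unfolding act_def q_def e_sum sum_distrib_right
      by (subst sum.swap) (simp add: e_mult sum_distrib_left mult_ac)
    hence "act emb d y = (\<Sum>\<tau>\<in>GG. emb (g \<tau>) * (\<tau> y - act emb (gam (w \<tau>)) y))"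
      unfolding de act_minus by (simp add: act_def[of emb g] right_diff_distrib sum_subtractf)
    moreover have "vge vL (emb (g \<tau>) * (\<tau> y - act emb (gam (w \<tau>)) y)) (m + thr j0)" if t: "\<tau> \<in> GG" for \<tau>
    proof -
      define z where "z = act emb (gam (w \<tau>)) y"
      have z: "vge vL z m" unfolding z_def by (rule act_vge[OF gam_carrier y]) (rule wF)
      have "gam (\<lambda>j. S j \<tau>) = gam (v \<tau>) \<otimes>\<^bsub>GA.R\<^esub> gam (w \<tau>)"
        unfolding gam_mult by (rule gam_cong) (auto simp: v_def w_def)
      hence "\<tau> y = act emb (gam (v \<tau>)) z"
        using act_element[OF t, of y] gam_element[OF t] by (simp add: act_mult z_def)
      moreover have "vge vL (act emb (gam (v \<tau>)) z - z) (m + thr j0)"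
        by (rule gam_vge[OF j0 _ _ z]) (use S_F in \<open>auto simp: v_def\<close>)
      ultimately have "vge vL (\<tau> y - act emb (gam (w \<tau>)) y) (m + thr j0)" by (simp add: z_def)
      from L.vge_mult[OF F_vgeL[OF gF[OF t]] this] show ?thesis by simp
    qed
    ultimately show ?thesis by (simp only: L.vge_sum)
  qed
  moreover have "g = q \<oplus>\<^bsub>GA.R\<^esub> d" by (simp add: GA.R_add de)
  ultimately show ?thesis using qc qsupp qaug dc unfolding supp_HH_def by blast
qed

lemma HH_closed: "\<sigma> \<in> HH j0 \<Longrightarrow> \<tau> \<in> HH j0 \<Longrightarrow> j0 \<le> n \<Longrightarrow> \<sigma> \<circ> \<tau> \<in> HH j0"
  using GG_comp S_comp by (auto simp: HH_def)

text \<open>In a product of two decomposed elements only \<open>q\<close> times \<open>q'\<close> is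
  kept on the subgroup. Each other term has one factor gaining the threshold and one from
  \<open>A\<close> gaining \<open>b \<ge> 1\<close> more; this surplus is what membership in
  \<open>A^2\<close> buys.\<close>

lemma AP2_decompose:
  assumes j0: "j0 \<in> {1..n}" and g: "g \<in> GA.AP 2"
  shows "\<exists>q d. g = q \<oplus>\<^bsub>GA.R\<^esub> d \<and> supp_HH j0 q \<and> GA.aug q = 0 \<and>
    (\<forall>y m. vge vL y m \<longrightarrow> vge vL (act emb d y) (m + thr j0 + 1))"
proof -
  have "g \<in> ideal_prod GA.R (GA.AP (Suc 0)) (A)"
    using g GA.AP_Suc[of "Suc 0"] by (simp add: numeral_2_eq_2)
  thus ?thesis
  proof (induction g rule: ideal_prod.induct)
    case (prod g h)
    have gA: "g \<in> A" using prod(1) GA.AP_1 by blast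
    obtain q d where q: "g = q \<oplus>\<^bsub>GA.R\<^esub> d" "supp_HH j0 q" "GA.aug q = 0" "d \<in> carrier GA.R"
      "\<And>y m. vge vL y m \<Longrightarrow> vge vL (act emb d y) (m + thr j0)"
      using A_decompose[OF j0 gA] by blast
    obtain q' d' where q': "h = q' \<oplus>\<^bsub>GA.R\<^esub> d'" "supp_HH j0 q'" "GA.aug q' = 0" "d' \<in> carrier GA.R"
      "\<And>y m. vge vL y m \<Longrightarrow> vge vL (act emb d' y) (m + thr j0)"
      using A_decompose[OF j0 prod(2)] by blast
    have c: "q \<in> carrier GA.R" "q' \<in> carrier GA.R" "h \<in> carrier GA.R"
      using q q' prod(2) by (auto simp: supp_HH_def GA.A_iff)
    define D where "D = q \<otimes>\<^bsub>GA.R\<^esub> d' \<oplus>\<^bsub>GA.R\<^esub> d \<otimes>\<^bsub>GA.R\<^esub> h"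
    have "g \<otimes>\<^bsub>GA.R\<^esub> h = q \<otimes>\<^bsub>GA.R\<^esub> h \<oplus>\<^bsub>GA.R\<^esub> d \<otimes>\<^bsub>GA.R\<^esub> h"
      unfolding q(1) using c q(4) by (simp add: GA.R.l_distr)
    also have "q \<otimes>\<^bsub>GA.R\<^esub> h = q \<otimes>\<^bsub>GA.R\<^esub> q' \<oplus>\<^bsub>GA.R\<^esub> q \<otimes>\<^bsub>GA.R\<^esub> d'"
      unfolding q'(1) using c q'(4) by (simp add: GA.R.r_distr)
    finally have "g \<otimes>\<^bsub>GA.R\<^esub> h = q \<otimes>\<^bsub>GA.R\<^esub> q' \<oplus>\<^bsub>GA.R\<^esub> D"
      unfolding D_def using c q(4) q'(4) by (simp add: GA.R.a_assoc)
    moreover have "supp_HH j0 (q \<otimes>\<^bsub>GA.R\<^esub> q')"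
    proof -
      have "(q \<otimes>\<^bsub>GA.R\<^esub> q') \<sigma> = 0" if s: "\<sigma> \<notin> HH j0" for \<sigma>
        unfolding GA.R_mult
      proof (rule sum.neutral, rule ballI)
        fix x assume x: "x \<in> {x \<in> GG \<times> GG. fst x \<otimes>\<^bsub>galois_group emb\<^esub> snd x = \<sigma>}"
        hence "fst x \<notin> HH j0 \<or> snd x \<notin> HH j0" using s HH_closed j0 by auto
        thus "q (fst x) * q' (snd x) = 0" using q(2) q'(2) by (auto simp: supp_HH_def)
      qed
      thus ?thesis using c by (simp add: supp_HH_def)
    qed
    moreover have "GA.aug (q \<otimes>\<^bsub>GA.R\<^esub> q') = 0" using q(3) by (simp add: GA.aug_mult)
    moreover have "vge vL (act emb D y) (m + thr j0 + 1)" if y: "vge vL y m" for y m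
    proof -
      have "q \<in> A" using c q(3) by (simp add: GA.A_iff)
      from act_A_vge[OF this q'(5)[OF y]] b_pos have "vge vL (act emb q (act emb d' y)) (m + thr j0 + 1)"
        by (auto elim: L.vge_mono)
      moreover have "vge vL (act emb d (act emb h y)) (m + thr j0 + 1)"
        using q(5)[OF act_A_vge[OF prod(2) y]] b_pos by (auto elim: L.vge_mono)
      ultimately show ?thesis unfolding D_def GA.R_add act_plus act_mult by (rule L.vge_add)
    qed
    ultimately show ?case by blast
  next
    case (sum g h)
    then obtain q d where q: "g = q \<oplus>\<^bsub>GA.R\<^esub> d" "supp_HH j0 q" "GA.aug q = 0"
      "\<And>y m. vge vL y m \<Longrightarrow> vge vL (act emb d y) (m + thr j0 + 1)" by blast
    from sum obtain q' d' where q': "h = q' \<oplus>\<^bsub>GA.R\<^esub> d'" "supp_HH j0 q'" "GA.aug q' = 0"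
      "\<And>y m. vge vL y m \<Longrightarrow> vge vL (act emb d' y) (m + thr j0 + 1)" by blast
    have "g \<oplus>\<^bsub>GA.R\<^esub> h = (q \<oplus>\<^bsub>GA.R\<^esub> q') \<oplus>\<^bsub>GA.R\<^esub> (d \<oplus>\<^bsub>GA.R\<^esub> d')"
      unfolding q(1) q'(1) by (simp add: GA.R_add add_ac)
    moreover have "supp_HH j0 (q \<oplus>\<^bsub>GA.R\<^esub> q')" using q(2) q'(2) unfolding supp_HH_def by (auto, simp add: GA.R_add)
    moreover have "GA.aug (q \<oplus>\<^bsub>GA.R\<^esub> q') = 0"
      using q(3) q'(3) by (simp add: GA.aug_def GA.R_add sum.distrib)
    moreover have "vge vL (act emb (d \<oplus>\<^bsub>GA.R\<^esub> d') y) (m + thr j0 + 1)" if "vge vL y m" for y m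
      unfolding GA.R_add act_plus using q(4)[OF that] q'(4)[OF that] by (rule L.vge_add)
    ultimately show ?case by blast
  qed
qed

section \<open>Differences by Galois elements inside the group algebra\<close>

definition Del :: "('l \<Rightarrow> 'l) \<Rightarrow> (('l \<Rightarrow> 'l) \<Rightarrow> 'k) \<Rightarrow> ('l \<Rightarrow> 'l) \<Rightarrow> 'k" where
  "Del \<tau> q = (group_element \<tau> \<ominus>\<^bsub>GA.R\<^esub> \<one>\<^bsub>GA.R\<^esub>) \<otimes>\<^bsub>GA.R\<^esub> q"

lemma element_carrier: "\<tau> \<in> GG \<Longrightarrow> group_element \<tau> \<in> carrier GA.R"
  by (auto simp: GA.R_carrier group_element_def)

lemma Del_act: "\<tau> \<in> GG \<Longrightarrow> act emb (Del \<tau> q) y = \<tau> (act emb q y) - act emb q y"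
  unfolding Del_def act_mult by (simp add: GA.R_minus element_carrier act_minus act_element act_one)

lemma Del_apply:
  assumes t: "\<tau> \<in> GG" and s: "\<sigma> \<in> GG"
  shows "Del \<tau> q \<sigma> = q (inv_into UNIV \<tau> \<circ> \<sigma>) - q \<sigma>"
proof -
  have e: "(group_element \<tau> \<ominus>\<^bsub>GA.R\<^esub> \<one>\<^bsub>GA.R\<^esub>) \<rho> = (if \<rho> = \<tau> then 1 else 0) - (if \<rho> = id then 1 else 0)" for \<rho>
    using GA.R_minus[OF element_carrier[OF t] GA.R.one_closed] by (simp add: GA.R_one group_element_def)
  have i: "inv_into UNIV id = (id :: 'l \<Rightarrow> 'l)" by (rule ext) (simp add: inv_into_def)
  have "Del \<tau> q \<sigma> = (\<Sum>\<rho>\<in>GG. (if \<rho> = \<tau> then q (inv_into UNIV \<rho> \<circ> \<sigma>) else 0) - (if \<rho> = id then q (inv_into UNIV \<rho> \<circ> \<sigma>) else 0))"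
    unfolding Del_def mult_apply[OF s] e by (intro sum.cong refl) (auto simp: algebra_simps)
  also have "\<dots> = q (inv_into UNIV \<tau> \<circ> \<sigma>) - q (inv_into UNIV id \<circ> \<sigma>)"
    unfolding sum_subtractf using t fin_GG GG_id by simp
  finally show ?thesis by (simp add: i)
qed

lemma Del_supp: "\<tau> \<in> HH j0 \<Longrightarrow> j0 \<le> n \<Longrightarrow> supp_HH j0 q \<Longrightarrow> supp_HH j0 (Del \<tau> q)"
proof -
  assume t: "\<tau> \<in> HH j0" and j0: "j0 \<le> n" and q: "supp_HH j0 q"
  have tG: "\<tau> \<in> GG" using t by (simp add: HH_def)
  have c: "Del \<tau> q \<in> carrier GA.R" using q element_carrier[OF tG] by (simp add: Del_def supp_HH_def)
  have "Del \<tau> q \<sigma> = 0" if s: "\<sigma> \<notin> HH j0" for \<sigma>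
  proof (cases "\<sigma> \<in> GG")
    case True
    have "inv_into UNIV \<tau> \<circ> \<sigma> \<notin> HH j0"
    proof
      assume "inv_into UNIV \<tau> \<circ> \<sigma> \<in> HH j0"
      hence "\<tau> \<circ> (inv_into UNIV \<tau> \<circ> \<sigma>) \<in> HH j0" by (rule HH_closed[OF t _ j0])
      thus False using s GG_inv(2)[OF tG] by (simp add: o_assoc)
    qed
    thus ?thesis unfolding Del_apply[OF tG True] using q s by (simp add: supp_HH_def)
  qed (use c in \<open>simp add: GA.R_carrier\<close>)
  thus ?thesis using c by (simp add: supp_HH_def)
qed

lemma Del_pow_supp: "\<tau> \<in> HH j0 \<Longrightarrow> j0 \<le> n \<Longrightarrow> supp_HH j0 q \<Longrightarrow> supp_HH j0 ((Del \<tau> ^^ i) q)"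
  by (induction i) (auto intro: Del_supp)

lemma Del_zero: "Del \<tau> (\<lambda>_. 0) = (\<lambda>_. 0)"
  by (rule ext) (simp add: Del_def GA.R_mult)

lemma Del_commute: assumes "\<sigma> \<in> GG" "\<tau> \<in> GG" "q \<in> carrier GA.R" shows "Del \<sigma> (Del \<tau> q) = Del \<tau> (Del \<sigma> q)"
proof -
  have e: "group_element \<sigma> \<otimes>\<^bsub>GA.R\<^esub> group_element \<tau> = group_element \<tau> \<otimes>\<^bsub>GA.R\<^esub> group_element \<sigma>"
    unfolding gam_element[OF assms(1), symmetric] gam_element[OF assms(2), symmetric] gam_mult
    by (rule gam_cong) simp
  have "(group_element \<sigma> \<ominus>\<^bsub>GA.R\<^esub> \<one>\<^bsub>GA.R\<^esub>) \<otimes>\<^bsub>GA.R\<^esub> (group_element \<tau> \<ominus>\<^bsub>GA.R\<^esub> \<one>\<^bsub>GA.R\<^esub>)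
    = (group_element \<tau> \<ominus>\<^bsub>GA.R\<^esub> \<one>\<^bsub>GA.R\<^esub>) \<otimes>\<^bsub>GA.R\<^esub> (group_element \<sigma> \<ominus>\<^bsub>GA.R\<^esub> \<one>\<^bsub>GA.R\<^esub>)"
    using element_carrier[OF assms(1)] element_carrier[OF assms(2)] e
    unfolding a_minus_def by (simp add: GA.R.l_distr GA.R.r_distr GA.R.l_minus GA.R.r_minus GA.R.minus_add GA.R.a_ac)
  thus ?thesis unfolding Del_def GA.R_assoc[symmetric] by simp
qed

lemma Del_pow_commute:
  assumes "\<sigma> \<in> GG" "\<tau> \<in> GG" "q \<in> carrier GA.R"
  shows "Del \<sigma> ((Del \<tau> ^^ i) q) = (Del \<tau> ^^ i) (Del \<sigma> q)"
proof (induction i)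
  case (Suc i)
  have "(Del \<tau> ^^ i) q \<in> carrier GA.R"
    using assms(2,3) element_carrier[OF assms(2)] by (induction i) (auto simp: Del_def)
  thus ?case using Suc Del_commute[OF assms(1,2)] by simp
qed simp

text \<open>Along the orbit of \<sigma> under powers of the inverse of \<tau>, the iterates are
  forward differences of a \<open>p\<close>-periodic sequence.\<close>

lemma Del_pow_p: assumes t: "\<tau> \<in> GG" and q: "q \<in> carrier GA.R" shows "(Del \<tau> ^^ p) q = (\<lambda>_. 0)"
proof
  fix \<sigma>
  define \<mu> where "\<mu> = inv_into UNIV \<tau>"
  have \<mu>: "\<mu> \<in> GG" unfolding \<mu>_def by (rule GG_inv(1)[OF t])
  have c: "(Del \<tau> ^^ i) q \<in> carrier GA.R" for i
    using q element_carrier[OF t] by (induction i) (auto simp: Del_def)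
  show "(Del \<tau> ^^ p) q \<sigma> = 0"
  proof (cases "\<sigma> \<in> GG")
    case True
    define h where "h m = q ((\<mu> ^^ m) \<circ> \<sigma>)" for m
    have \<mu>m: "(\<mu> ^^ m) \<circ> \<sigma> \<in> GG" for m
    proof (induction m)
      case (Suc m)
      show ?case unfolding funpow.simps comp_assoc by (rule GG_comp[OF \<mu> Suc])
    qed (use True in simp)
    have "(Del \<tau> ^^ i) q ((\<mu> ^^ m) \<circ> \<sigma>) = fdiff h i m" for i m
    proof (induction i arbitrary: m)
      case (Suc i)
      have "(Del \<tau> ^^ Suc i) q ((\<mu> ^^ m) \<circ> \<sigma>) = (Del \<tau> ^^ i) q (\<mu> \<circ> ((\<mu> ^^ m) \<circ> \<sigma>)) - (Del \<tau> ^^ i) q ((\<mu> ^^ m) \<circ> \<sigma>)"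
        using Del_apply[OF t \<mu>m] by (simp add: \<mu>_def)
      also have "\<mu> \<circ> ((\<mu> ^^ m) \<circ> \<sigma>) = (\<mu> ^^ Suc m) \<circ> \<sigma>" by (simp add: o_assoc)
      finally show ?case by (simp only: Suc fdiff.simps)
    qed (simp add: h_def)
    from this[of p 0] have "(Del \<tau> ^^ p) q \<sigma> = fdiff h p 0" by simp
    also have "\<dots> = 0"
      by (rule fdiff_periodic[OF prime char]) (simp add: h_def funpow_add GG_pow_p[OF \<mu>])
    finally show ?thesis .
  next
    case False
    thus ?thesis using c[of p] by (simp add: GA.R_carrier)
  qed
qed

text \<open>Applying \<open>\<tau> - 1\<close> as often as possible for every \<open>\<tau>\<close> in the subgroup ends in a nonzero multiple of the
  trace, without decreasing valuations.\<close>

lemma invariant_multiple: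
  assumes j0: "j0 \<le> n" and q: "supp_HH j0 q" "q \<noteq> (\<lambda>_. 0)" and J: "finite J" "J \<subseteq> HH j0"
  shows "\<exists>q'. supp_HH j0 q' \<and> q' \<noteq> (\<lambda>_. 0) \<and> (\<forall>\<tau>\<in>J. Del \<tau> q' = (\<lambda>_. 0)) \<and>
    (\<forall>k. vge vL (act emb q y) k \<longrightarrow> vge vL (act emb q' y) k)"
  using J
proof (induction J rule: finite_induct)
  case (insert \<tau> J)
  then obtain q' where q': "supp_HH j0 q'" "q' \<noteq> (\<lambda>_. 0)" "\<forall>\<tau>\<in>J. Del \<tau> q' = (\<lambda>_. 0)"
    "\<And>k. vge vL (act emb q y) k \<Longrightarrow> vge vL (act emb q' y) k" by blast
  have t: "\<tau> \<in> HH j0" "\<tau> \<in> GG" using insert.prems by (auto simp: HH_def)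
  have c: "q' \<in> carrier GA.R" using q' by (simp add: supp_HH_def)
  \<comment> \<open>A vanishing iterate exists by \<open>Del_pow_p\<close>. The one before the first
    is nonzero and killed by \<tau> - 1, and it remains killed by the earlier differences because
    they commute.\<close>
  define i where "i = (LEAST i. (Del \<tau> ^^ i) q' = (\<lambda>_. 0))"
  have i: "(Del \<tau> ^^ i) q' = (\<lambda>_. 0)" unfolding i_def by (rule LeastI[of _ p]) (rule Del_pow_p[OF t(2) c])
  have "i \<noteq> 0" using i q'(2) by (metis funpow_0)
  then obtain r where r: "i = Suc r" by (cases i) auto
  have "r < i" using r by simp
  define q'' where "q'' = (Del \<tau> ^^ r) q'"
  have "q'' \<noteq> (\<lambda>_. 0)" unfolding q''_def using not_less_Least[of r "\<lambda>i. (Del \<tau> ^^ i) q' = (\<lambda>_. 0)"] \<open>r < i\<close> by (simp add: i_def)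
  moreover have "supp_HH j0 q''" unfolding q''_def by (rule Del_pow_supp[OF t(1) j0 q'(1)])
  moreover have "Del \<rho> q'' = (\<lambda>_. 0)" if \<rho>: "\<rho> \<in> insert \<tau> J" for \<rho>
  proof (cases "\<rho> = \<tau>")
    case True
    thus ?thesis using i r by (simp add: q''_def)
  next
    case False
    hence \<rho>J: "\<rho> \<in> J" "\<rho> \<in> GG" using \<rho> insert.prems by (auto simp: HH_def)
    have "Del \<rho> q'' = (Del \<tau> ^^ r) (Del \<rho> q')" unfolding q''_def by (rule Del_pow_commute[OF \<rho>J(2) t(2) c])
    also have "\<dots> = (Del \<tau> ^^ r) (\<lambda>_. 0)" using q'(3) \<rho>J by simp
    also have "\<dots> = (\<lambda>_. 0)" by (induction r) (simp_all add: Del_zero)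
    finally show ?thesis .
  qed
  moreover have "vge vL (act emb q'' y) k" if k: "vge vL (act emb q y) k" for k
  proof -
    have "vge vL (act emb ((Del \<tau> ^^ i) q') y) k" for i
    proof (induction i)
      case (Suc i)
      show ?case using L.vge_diff[OF GG_vge[OF t(2) Suc] Suc] by (simp add: Del_act[OF t(2)])
    qed (use q'(4)[OF k] in simp)
    thus ?thesis by (simp add: q''_def)
  qed
  ultimately show ?case by blast
qed (use q in auto)

text \<open>An invariant element supported on \<open>HH j0\<close> is a constant multiple of the
  trace, whose value on \<open>y\<close> has known valuation. Passing from \<open>q\<close> to such
  an element preserves lower bounds, so no nonzero \<open>q\<close> gains more than the
  trace.\<close>

lemma supp_HH_upper_bound:
  assumes j0: "j0 \<in> {1..n}" and q: "supp_HH j0 q" "q \<noteq> (\<lambda>_. 0)"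
    and y: "veq vL y m" "[m = b] (mod int (p ^ n))" and k: "vge vL (act emb q y) k"
  shows "k \<le> m + int (p ^ (n - j0) - 1) * b"
proof -
  have jn: "j0 \<le> n" using j0 by simp
  have fin: "finite (HH j0)" by (rule finite_subset[OF _ fin_GG]) (auto simp: HH_def)
  obtain q' where q': "supp_HH j0 q'" "q' \<noteq> (\<lambda>_. 0)" "\<forall>\<tau>\<in>HH j0. Del \<tau> q' = (\<lambda>_. 0)" "vge vL (act emb q' y) k"
    using invariant_multiple[OF jn q fin order_refl, of y] k by blast
  have const: "q' \<sigma> = q' id" if s: "\<sigma> \<in> HH j0" for \<sigma>
  proof -
    have sG: "\<sigma> \<in> GG" using s by (simp add: HH_def)
    have "Del \<sigma> q' \<sigma> = 0" using q'(3) s by simp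
    thus ?thesis unfolding Del_apply[OF sG sG] GG_inv(3)[OF sG] by simp
  qed
  have nz: "q' id \<noteq> 0"
  proof
    assume "q' id = 0"
    hence "q' \<sigma> = 0" for \<sigma> using const[of \<sigma>] q'(1) by (cases "\<sigma> \<in> HH j0") (auto simp: supp_HH_def)
    thus False using q'(2) by blast
  qed
  have "act emb q' y = (\<Sum>\<sigma>\<in>HH j0. emb (q' \<sigma>) * \<sigma> y)"
    unfolding act_def by (rule sum.mono_neutral_right) (use fin_GG q'(1) in \<open>auto simp: supp_HH_def HH_def\<close>)
  also have "\<dots> = emb (q' id) * (\<Sum>\<sigma>\<in>HH j0. \<sigma> y)" unfolding sum_distrib_left by (intro sum.cong refl) (simp add: const)
  finally have e: "act emb q' y = emb (q' id) * (\<Sum>\<sigma>\<in>HH j0. \<sigma> y)" .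
  have "q' id \<in> F" using q'(1) GG_id by (simp add: supp_HH_def GA.R_carrier)
  from L.veq_mult[OF F_veqL[OF this nz] trace_veq[OF j0 y]]
  have "veq vL (act emb q' y) (m + int (p ^ (n - j0) - 1) * b)" unfolding e by simp
  thus ?thesis using q'(4) L.vge_veq_iff by blast
qed

text \<open>Modulo terms of higher valuation, \<open>g \<in> A\<^sup>2\<close> lies in the group algebra of the subgroup fixing
  \<open>Y 1, \<dots>, Y j0\<close>. If it cancelled the leading term of \<open>(gam w - 1) y\<close>, then \<open>g y\<close> would exceed the valuation of the
  trace of \<open>y\<close>, possibly after applying \<open>(\<sigma> - 1)\<^bsup>p-2\<^esup>\<close>; this contradicts \<open>supp_HH_upper_bound\<close>.\<close>

theorem gam_optimal:
  assumes j0: "j0 \<in> {1..n}"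
    and w: "\<And>j. j \<in> {1..n} \<Longrightarrow> w j \<in> F" "\<And>j. j \<in> {1..n} \<Longrightarrow> j > j0 \<Longrightarrow> w j = 0" "w j0 \<noteq> 0"
    and y: "veq vL y m" "[m = b] (mod int (p ^ n))" and g: "g \<in> GA.AP 2"
    and k: "vge vL (act emb (gam w) y - y + act emb g y) k"
  shows "k \<le> m + thr j0"
proof (rule ccontr)
  assume "\<not> k \<le> m + thr j0"
  hence kk: "m + thr j0 + 1 \<le> k" by simp
  obtain q d where q: "g = q \<oplus>\<^bsub>GA.R\<^esub> d" "supp_HH j0 q" "GA.aug q = 0"
    "\<And>y m. vge vL y m \<Longrightarrow> vge vL (act emb d y) (m + thr j0 + 1)" using AP2_decompose[OF j0 g] by blast
  define z where "z = act emb (gam w) y - y"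
  have z: "veq vL z (m + thr j0)" unfolding z_def by (rule gam_veq[where w = w, OF j0 w y])
  have "act emb g y = act emb q y + act emb d y" unfolding q(1) GA.R_add act_plus ..
  hence aq: "act emb q y = (z + act emb g y) - act emb d y + (- z)" by simp
  have "vge vL (z + act emb g y) (m + thr j0 + 1)" using k kk unfolding z_def by (rule L.vge_mono)
  moreover have "vge vL (act emb d y) (m + thr j0 + 1)" by (rule q(4)[OF L.veq_vge[OF y(1) order_refl]])
  ultimately have "vge vL ((z + act emb g y) - act emb d y) (m + thr j0 + 1)" by (rule L.vge_diff)
  from L.veq_add'[OF this L.veq_uminus[OF z]] have qv: "veq vL (act emb q y) (m + thr j0)" unfolding aq .
  have nz: "q' \<noteq> (\<lambda>_. 0)" if "veq vL (act emb q' y) l" for q' l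
    using L.veq_nz[OF that] by (auto simp: act_def)
  have pj: "int (p ^ i - 1) = int (p ^ i) - 1" for i using p_pos by (simp add: of_nat_diff Suc_le_eq)
  \<comment> \<open>A threshold \<open>p ^ (n - j0) * b\<close> is already beyond the trace bound.
    Only the threshold \<open>k0 + b\<close> with \<open>j0 = 1\<close> is left.\<close>
  have "m + thr j0 \<le> m + int (p ^ (n - j0) - 1) * b"
    by (rule supp_HH_upper_bound[OF j0 q(2) nz[OF qv] y L.veq_vge[OF qv order_refl]])
  hence th: "thr j0 < int (p ^ (n - j0)) * b" using b_pos unfolding pj by (simp add: left_diff_distrib)
  hence j1: "j0 = 1" by (auto simp: thr_def split: if_splits)
  hence t1: "thr j0 = k0 + b" "k0 + b < int (p ^ (n - 1)) * b" using th by (auto simp: thr_def min_def split: if_splits)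
  have n2: "n \<ge> 2"
  proof (rule ccontr)
    assume "\<not> n \<ge> 2"
    hence "k0 = int (p ^ n) * b" using \<kappa>_val by blast
    thus False using t1(2) pow_mono_b[OF diff_le_self, of n 1] b_pos by linarith
  qed
  \<comment> \<open>A nontrivial element of \<open>HH 1\<close>, available because
    \<open>n \<ge> 2\<close>.\<close>
  have "(\<lambda>i\<in>{1..n}. if i = n then 1 else 0) \<in> Tup" using p_gt1 by (auto simp: Tup_def)
  hence "(\<lambda>i\<in>{1..n}. if i = n then 1 else 0) \<in> tup ` GG" using bij_betw_imp_surj_on[OF tup_bij] by simp
  then obtain \<sigma> where s: "\<sigma> \<in> GG" "tup \<sigma> = (\<lambda>i\<in>{1..n}. if i = n then 1 else 0)" by auto
  have "S 1 \<sigma> = 0" using n2 by (simp add: S_def SS_def s(2))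
  hence sH: "\<sigma> \<in> HH j0" using s(1) j1 by (simp add: HH_def)
  have sid: "\<sigma> \<noteq> id"
  proof
    assume "\<sigma> = id"
    hence "x n = x n + of_nat (tup \<sigma> n)" using tup(2)[OF s(1), of n] n_pos by simp
    thus False using n_pos by (simp add: s(2))
  qed
  have mb: "int p dvd m - b"
  proof -
    have "int (p ^ n) dvd m - b" using y(2) by (simp add: cong_iff_dvd_diff)
    moreover have "int p dvd int (p ^ n)" using n_pos by simp
    ultimately show ?thesis by (rule dvd_trans[rotated])
  qed
  have "veq vL (act emb ((Del \<sigma> ^^ i) q) y) (m + k0 + b + int i * b)" if "i \<le> p - 2" for i
    using that
  proof (induction i)
    case 0
    show ?case using qv by (simp add: t1(1) add_ac)
  next
    case (Suc i)
    \<comment> \<open>Modulo \<open>p\<close> this valuation is \<open>(i + 2) * b\<close>, since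
      \<open>m\<close> is congruent to \<open>b\<close> and \<open>p\<close> divides
      \<open>k0\<close>. Here \<open>i + 2 < p\<close>, so the difference gains exactly
      \<open>b\<close>; after \<open>p - 2\<close> differences this fails.\<close>
    have "\<not> int p dvd m + k0 + b + int i * b"
    proof
      assume "int p dvd m + k0 + b + int i * b"
      moreover have "m + k0 + b + int i * b = (m - b) + k0 + (int i + 2) * b" by (simp add: algebra_simps)
      ultimately have "int p dvd (int i + 2) * b"
        using mb k0_dvd by (metis dvd_add dvd_add_right_iff)
      hence "int p dvd int i + 2" using p_not_dvd_b prime by (simp add: prime_dvd_mult_iff)
      moreover have "int (i + 2) = int i + 2" by simp
      ultimately have "int p dvd int (i + 2)" by (simp only:)
      hence "p dvd i + 2" by (simp only: int_dvd_int_iff)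
      thus False using Suc.prems by (auto dest: dvd_imp_le)
    qed
    from shift_veq[OF s(1) sid Suc.IH this] Suc.prems
    show ?case by (simp add: Del_act[OF s(1)] algebra_simps)
  qed
  from this[OF order_refl] have v: "veq vL (act emb ((Del \<sigma> ^^ (p - 2)) q) y) (m + k0 + b + int (p - 2) * b)" .
  \<comment> \<open>The valuation reached is \<open>m + k0 + (p - 1) * b\<close>, and
    \<open>k0_gt\<close> says precisely that it exceeds the trace bound
    \<open>m + (p ^ (n - 1) - 1) * b\<close>.\<close>
  have "m + k0 + b + int (p - 2) * b \<le> m + int (p ^ (n - j0) - 1) * b"
    by (rule supp_HH_upper_bound[OF j0 Del_pow_supp[OF sH _ q(2)] nz[OF v] y L.veq_vge[OF v order_refl]]) (use j0 in simp)
  moreover have "int (p - 2) = int p - 2" using p_ge2 by simp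
  ultimately show False using k0_gt unfolding j1 pj by (simp add: algebra_simps)
qed

end

section \<open>Refined breaks\<close>

text \<open>\<open>LEAST\<close> over extended reals is meaningful only with an attained minimum;
  integrality and nonnegativity reduce this to the well-ordering of the naturals.\<close>

lemma Least_ereal_nonneg:
  fixes T :: "ereal set"
  assumes "T \<noteq> {}" "\<And>y. y \<in> T \<Longrightarrow> y = \<infinity> \<or> (\<exists>k\<ge>0. y = ereal (real_of_int k))"
  shows "\<exists>y\<in>T. \<forall>z\<in>T. y \<le> z"
proof (cases "T = {\<infinity>}")
  case False
  then obtain y where y: "y \<in> T" "y \<noteq> \<infinity>" using assms(1) by blast
  then obtain i where "i \<ge> 0" "y = ereal (real_of_int i)" using assms(2) by blast
  hence "ereal (real (nat i)) \<in> T" using y by simp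
  hence "\<exists>k. ereal (real k) \<in> T" by blast
  define k where "k = (LEAST k. ereal (real k) \<in> T)"
  have k: "ereal (real k) \<in> T" unfolding k_def by (rule LeastI_ex) fact
  moreover have "ereal (real k) \<le> z" if z: "z \<in> T" for z
  proof (cases "z = \<infinity>")
    case False
    then obtain i where i: "i \<ge> 0" "z = ereal (real_of_int i)" using assms(2)[OF z] by blast
    hence "ereal (real (nat i)) \<in> T" using z by simp
    hence "k \<le> nat i" unfolding k_def by (rule Least_le)
    thus ?thesis using i by simp
  qed simp
  ultimately show ?thesis by blast
qed auto

lemma (in nval) v_le:
  assumes "\<And>k. vge v x k \<Longrightarrow> k \<le> m"
  shows "v x \<le> ereal (real_of_int m)"
proof -
  have "x \<noteq> 0" using assms[of "m + 1"] by auto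
  then obtain k where k: "veq v x k" using veq_ex by blast
  have "k \<le> m" using assms[of k] k by (simp add: veq_vge)
  thus ?thesis using k by (simp add: veq_def)
qed

context scaffold
begin

lemma operator_valuation_least:
  assumes g: "g \<in> carrier GA.R"
  shows "\<exists>y0. operator_valuation vL emb g = y0 \<and> (\<exists>x. x \<noteq> 0 \<and> y0 = vL (act emb g x) - vL x) \<and>
    (\<forall>x. x \<noteq> 0 \<longrightarrow> y0 \<le> vL (act emb g x) - vL x)"
proof -
  define T where "T = {y. \<exists>x. x \<noteq> 0 \<and> y = vL (act emb g x) - vL x}"
  have "\<exists>y\<in>T. \<forall>z\<in>T. y \<le> z"
  proof (rule Least_ereal_nonneg)
    show "T \<noteq> {}" unfolding T_def by (auto intro: exI[of _ 1])
    fix y assume "y \<in> T"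
    then obtain x where x: "x \<noteq> 0" "y = vL (act emb g x) - vL x" by (auto simp: T_def)
    obtain m where m: "veq vL x m" using L.veq_ex x(1) by blast
    show "y = \<infinity> \<or> (\<exists>k\<ge>0. y = ereal (real_of_int k))"
    proof (cases "act emb g x = 0")
      case True
      thus ?thesis using x(2) m L.v_infty[of 0] by (simp add: veq_def)
    next
      case False
      then obtain k where k: "veq vL (act emb g x) k" using L.veq_ex by blast
      have "m \<le> k" using act_vge[OF g L.veq_vge[OF m order_refl]] L.vge_veq_iff[OF k] by blast
      thus ?thesis using x(2) m k by (auto simp: veq_def intro!: exI[of _ "k - m"])
    qed
  qed
  then obtain y0 where y0: "y0 \<in> T" "\<forall>z\<in>T. y0 \<le> z" by blast
  have "operator_valuation vL emb g = y0"
    unfolding operator_valuation_def by (rule Least_equality) (use y0 in \<open>auto simp: T_def\<close>)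
  thus ?thesis using y0 by (auto simp: T_def)
qed

lemma vc_element_iff: "vc_element vL p n b \<rho> \<longleftrightarrow> (\<exists>m. veq vL \<rho> m \<and> [m = b] (mod int (p ^ n)))"
  by (simp add: vc_element_def veq_def)

text \<open>The representative \<open>gam w\<close> is optimal for both notions. By
  \<open>gam_optimal\<close> and \<open>A^k \<subseteq> A^2\<close>, no representative gains more on
  a valuation criterion element, while \<open>gam w\<close> gains the threshold on each of these and
  at least as much on every element.\<close>

lemma span_nontrivial:
  assumes k: "2 \<le> k" "k \<le> p" and X: "X \<in> galois_span F emb p k"
    and X1: "X \<noteq> \<one>\<^bsub>Q k\<^esub>"
  shows "\<exists>t > 0. (\<forall>\<rho>. vc_element vL p n b \<rho> \<longrightarrow> vc_index F vL emb \<rho> X - vL \<rho> = ereal (real_of_int t)) \<and>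
    class_valuation vL emb (X \<ominus>\<^bsub>Q k\<^esub> \<one>\<^bsub>Q k\<^esub>)
      = ereal (real_of_int t)"
proof -
  obtain w where w: "\<And>i. w i \<in> F" "X = cls k (gam w)"
    using span_gam[OF k(2)] X unfolding galois_span_def by blast
  have "\<exists>j\<in>{1..n}. w j \<noteq> 0"
  proof (rule ccontr)
    assume "\<not> ?thesis"
    hence "gam w = \<one>\<^bsub>GA.R\<^esub>" by (intro gam_one) auto
    thus False using X1 w(2) GA.quot_one by simp
  qed
  hence ne: "{j \<in> {1..n}. w j \<noteq> 0} \<noteq> {}" by blast
  define j0 where "j0 = Max {j \<in> {1..n}. w j \<noteq> 0}"
  have "j0 \<in> {j \<in> {1..n}. w j \<noteq> 0}" unfolding j0_def by (rule Max_in) (use ne in auto)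
  hence j0: "j0 \<in> {1..n}" "w j0 \<noteq> 0" by auto
  have wj: "w j = 0" if "j \<in> {1..n}" "j > j0" for j
  proof (rule ccontr)
    assume "w j \<noteq> 0"
    hence "j \<le> j0" unfolding j0_def using that by (intro Max_ge) auto
    thus False using that by simp
  qed
  define t where "t = thr j0"
  have gc: "gam w \<in> carrier GA.R" using w(1) by (intro gam_carrier)
  define g1 where "g1 = gam w \<ominus>\<^bsub>GA.R\<^esub> \<one>\<^bsub>GA.R\<^esub>"
  have g1c: "g1 \<in> carrier GA.R" using gc by (simp add: g1_def)
  have actg1: "act emb g1 y = act emb (gam w) y - y" for y
    unfolding g1_def by (simp add: GA.R_minus[OF gc] act_minus act_one)
  have upper: "vL (act emb h \<rho>) \<le> ereal (real_of_int (m + t))"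
    if h: "(\<lambda>x. h x - g1 x) \<in> GA.AP k" and \<rho>: "veq vL \<rho> m" "[m = b] (mod int (p ^ n))" for h \<rho> m
  proof (rule L.v_le)
    fix l assume l: "vge vL (act emb h \<rho>) l"
    have "h = (\<lambda>x. g1 x + (h x - g1 x))" by simp
    hence "act emb h \<rho> = act emb g1 \<rho> + act emb (\<lambda>x. h x - g1 x) \<rho>" using act_plus[of g1 "\<lambda>x. h x - g1 x" \<rho>] by simp
    hence "vge vL (act emb (gam w) \<rho> - \<rho> + act emb (\<lambda>x. h x - g1 x) \<rho>) l" using l by (simp add: actg1)
    moreover have "(\<lambda>x. h x - g1 x) \<in> GA.AP 2" using h GA.AP_antimono[OF k(1)] by blast
    ultimately show "l \<le> m + t" unfolding t_def
      using gam_optimal[where w = w, OF j0(1) w(1) wj j0(2) \<rho>] by blast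
  qed
  have attained: "vL (act emb g1 \<rho>) = ereal (real_of_int (m + t))"
    if \<rho>: "veq vL \<rho> m" "[m = b] (mod int (p ^ n))" for \<rho> m
    using gam_veq[where w = w, OF j0(1) w(1) wj j0(2) \<rho>] by (simp add: actg1 t_def veq_def)
  have vc: "vc_index F vL emb \<rho> X - vL \<rho> = ereal (real_of_int t)" if vc: "vc_element vL p n b \<rho>" for \<rho>
  proof -
    obtain m where m: "veq vL \<rho> m" "[m = b] (mod int (p ^ n))" using vc vc_element_iff by blast
    have "vc_index F vL emb \<rho> X = ereal (real_of_int (m + t))"
      unfolding vc_index_def
    proof (rule Greatest_equality)
      have "gam w \<in> X" unfolding w(2) GA.class_mem[OF gc] by (simp add: GA.AP_zero)
      thus "\<exists>\<gamma>\<in>X. ereal (real_of_int (m + t)) = vL (act emb (\<gamma> \<ominus>\<^bsub>GA.R\<^esub> \<one>\<^bsub>GA.R\<^esub>) \<rho>)"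
        using attained[OF m] by (intro bexI[of _ "gam w"]) (simp_all add: g1_def)
      fix y assume "\<exists>\<gamma>\<in>X. y = vL (act emb (\<gamma> \<ominus>\<^bsub>GA.R\<^esub> \<one>\<^bsub>GA.R\<^esub>) \<rho>)"
      then obtain \<gamma> where \<gamma>: "\<gamma> \<in> X" "y = vL (act emb (\<gamma> \<ominus>\<^bsub>GA.R\<^esub> \<one>\<^bsub>GA.R\<^esub>) \<rho>)" by blast
      have d: "(\<lambda>x. \<gamma> x - gam w x) \<in> GA.AP k" using \<gamma>(1) unfolding w(2) GA.class_mem[OF gc] .
      have "\<gamma> = (\<lambda>x. \<gamma> x - gam w x) \<oplus>\<^bsub>GA.R\<^esub> gam w" by (simp add: GA.R_add)
      hence \<gamma>c: "\<gamma> \<in> carrier GA.R" using GA.R.a_closed[OF GA.AP_carrier[OF d] gc] by simp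
      have "(\<lambda>x. (\<gamma> \<ominus>\<^bsub>GA.R\<^esub> \<one>\<^bsub>GA.R\<^esub>) x - g1 x) = (\<lambda>x. \<gamma> x - gam w x)"
        unfolding g1_def using GA.R_minus[OF \<gamma>c] GA.R_minus[OF gc] by simp
      thus "y \<le> ereal (real_of_int (m + t))" unfolding \<gamma>(2) using upper[OF _ m] d by simp
    qed
    thus ?thesis using m(1) by (simp add: veq_def)
  qed
  \<comment> \<open>Operator valuations are minima over all elements, so this one valuation
    criterion element bounds them from above.\<close>
  obtain \<rho> where \<rho>: "veq vL \<rho> b" using L.veq_surj by blast
  have \<rho>0: "\<rho> \<noteq> 0" using L.veq_nz[OF \<rho>] .
  have bb: "[b = b] (mod int (p ^ n))" by simp
  have Xm: "X \<ominus>\<^bsub>Q k\<^esub> \<one>\<^bsub>Q k\<^esub>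
      = cls k g1"
    unfolding w(2) GA.quot_one g1_def by (rule GA.quot_minus) (use gc in auto)
  have "class_valuation vL emb (cls k g1) = ereal (real_of_int t)"
    unfolding class_valuation_def
  proof (rule Greatest_equality)
    obtain y0 where y0: "operator_valuation vL emb g1 = y0" "\<exists>x. x \<noteq> 0 \<and> y0 = vL (act emb g1 x) - vL x"
      "\<forall>x. x \<noteq> 0 \<longrightarrow> y0 \<le> vL (act emb g1 x) - vL x" using operator_valuation_least[OF g1c] by blast
    have "y0 \<le> ereal (real_of_int t)" using y0(3) \<rho>0 attained[OF \<rho> bb] \<rho> by (auto simp: veq_def)
    moreover have "ereal (real_of_int t) \<le> y0"
    proof -
      obtain x where x: "x \<noteq> 0" "y0 = vL (act emb g1 x) - vL x" using y0(2) by blast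
      obtain m where m: "veq vL x m" using L.veq_ex x(1) by blast
      have "vge vL (act emb g1 x) (m + t)" unfolding actg1 t_def
        by (rule gam_vge[where w = w, OF j0(1) w(1) wj L.veq_vge[OF m order_refl]])
      thus ?thesis unfolding x(2) using m
        by (cases "vL (act emb g1 x)") (auto simp: vge_def veq_def)
    qed
    ultimately have "operator_valuation vL emb g1 = ereal (real_of_int t)" using y0(1) by simp
    moreover have "g1 \<in> cls k g1"
      unfolding GA.class_mem[OF g1c] by (simp add: GA.AP_zero)
    ultimately show "\<exists>\<gamma>\<in>cls k g1. ereal (real_of_int t) = operator_valuation vL emb \<gamma>"
      by metis
    fix y assume "\<exists>\<gamma>\<in>cls k g1. y = operator_valuation vL emb \<gamma>"
    then obtain \<gamma> where \<gamma>: "\<gamma> \<in> cls k g1" "y = operator_valuation vL emb \<gamma>" by blast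
    have d: "(\<lambda>x. \<gamma> x - g1 x) \<in> GA.AP k" using \<gamma>(1) unfolding GA.class_mem[OF g1c] .
    have "\<gamma> = (\<lambda>x. \<gamma> x - g1 x) \<oplus>\<^bsub>GA.R\<^esub> g1" by (simp add: GA.R_add)
    hence \<gamma>c: "\<gamma> \<in> carrier GA.R" using GA.R.a_closed[OF GA.AP_carrier[OF d] g1c] by simp
    have "y \<le> vL (act emb \<gamma> \<rho>) - vL \<rho>" using operator_valuation_least[OF \<gamma>c] \<gamma>(2) \<rho>0 by auto
    also have "\<dots> \<le> ereal (real_of_int t)"
      using upper[OF d \<rho> bb] \<rho> by (cases "vL (act emb \<gamma> \<rho>)") (auto simp: veq_def)
    finally show "y \<le> ereal (real_of_int t)" .
  qed
  moreover have "t > 0" unfolding t_def by (rule thr_pos[OF j0(1)])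
  ultimately show ?thesis using vc unfolding Xm by blast
qed

text \<open>The trivial class lies in every step of the filtration and so produces no break.\<close>

lemma class_valuation_zero:
  "class_valuation vL emb (\<one>\<^bsub>Q k\<^esub> \<ominus>\<^bsub>Q k\<^esub>
     \<one>\<^bsub>Q k\<^esub>) = \<infinity>"
proof -
  define z where "z = \<one>\<^bsub>GA.R\<^esub> \<ominus>\<^bsub>GA.R\<^esub> \<one>\<^bsub>GA.R\<^esub>"
  have z: "z = (\<lambda>_. 0)" unfolding z_def by (simp add: GA.R_minus)
  have zc: "z \<in> carrier GA.R" by (simp add: z_def)
  have e: "\<one>\<^bsub>Q k\<^esub> \<ominus>\<^bsub>Q k\<^esub>
     \<one>\<^bsub>Q k\<^esub> = cls k z"
    unfolding GA.quot_one z_def by (rule GA.quot_minus) auto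
  obtain x where x: "x \<noteq> 0" "operator_valuation vL emb z = vL (act emb z x) - vL x"
    using operator_valuation_least[OF zc] by blast
  obtain m where m: "veq vL x m" using L.veq_ex x(1) by blast
  have "act emb z x = 0" by (simp add: z act_def)
  hence inf: "operator_valuation vL emb z = \<infinity>" using x(2) m L.v_infty[of 0] by (simp add: veq_def)
  show ?thesis unfolding e class_valuation_def
  proof (rule Greatest_equality)
    have "z \<in> cls k z" unfolding GA.class_mem[OF zc] by (simp add: GA.AP_zero)
    thus "\<exists>\<gamma>\<in>cls k z. \<infinity> = operator_valuation vL emb \<gamma>" using inf by metis
  qed simp
qed

text \<open>A filtration by an integer-valued function jumps exactly at its finite values, and these
  form every \<open>vc_set\<close>. They are positive integers, so letting \<open>h\<close> run
  through the naturals misses none.\<close>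

theorem refined_breaks_eq:
  assumes k: "2 \<le> k" "k \<le> p"
  shows "vc_breaks_defined F vL emb p n b k \<and>
    vc_refined_breaks F vL emb p n b k = ss_refined_breaks F vL emb p k"
proof -
  define one where "one = \<one>\<^bsub>Q k\<^esub>"
  define cv where "cv X = class_valuation vL emb (X \<ominus>\<^bsub>Q k\<^esub> one)" for X
  have ex: "\<exists>t > 0. (\<forall>\<rho>. vc_element vL p n b \<rho> \<longrightarrow> vc_index F vL emb \<rho> X - vL \<rho> = ereal (real_of_int t)) \<and>
     cv X = ereal (real_of_int t)" if "X \<in> galois_span F emb p k" "X \<noteq> one" for X
    using span_nontrivial[OF k] that unfolding cv_def one_def by blast
  have cv1: "cv one = \<infinity>" unfolding cv_def one_def by (rule class_valuation_zero)
  define B where "B = {cv X | X. X \<in> galois_span F emb p k \<and> X \<noteq> one}"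
  have vc: "vc_set F vL emb p k \<rho> = B" if "vc_element vL p n b \<rho>" for \<rho>
  proof -
    have "vc_index F vL emb \<rho> X - vL \<rho> = cv X" if "X \<in> galois_span F emb p k" "X \<noteq> one" for X
      using ex[OF that] \<open>vc_element vL p n b \<rho>\<close> by metis
    thus ?thesis unfolding vc_set_def B_def one_def[symmetric] by (intro Collect_cong) metis
  qed
  obtain \<rho> where \<rho>: "veq vL \<rho> b" using L.veq_surj by blast
  have \<rho>: "vc_element vL p n b \<rho>" unfolding vc_element_iff using \<rho> by (intro exI[of _ b]) simp
  have "vc_refined_breaks F vL emb p n b k = B"
    unfolding vc_refined_breaks_def using vc \<rho> by (intro the_equality) blast+
  moreover have "ss_refined_breaks F vL emb p k = B"
  proof -
    define f where "f h = {X \<in> galois_span F emb p k. cv X \<ge> ereal (real h)}" for h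
    have filt: "ss_filtration F vL emb p k h = f h" for h
      by (simp add: ss_filtration_def f_def cv_def one_def)
    have "f (h + 1) \<noteq> f h \<longleftrightarrow> ereal (real h) \<in> B" for h
    proof
      assume "f (h + 1) \<noteq> f h"
      moreover have "f (h + 1) \<subseteq> f h" unfolding f_def by (auto elim: order_trans[rotated])
      ultimately obtain X where X: "X \<in> galois_span F emb p k" "ereal (real h) \<le> cv X" "\<not> ereal (real (h + 1)) \<le> cv X"
        unfolding f_def by blast
      have X1: "X \<noteq> one" using X(3) cv1 by auto
      then obtain t where t: "cv X = ereal (real_of_int t)" using ex[OF X(1)] by blast
      have "int h \<le> t" "t < int h + 1" using X(2,3) t by simp_all
      hence "cv X = ereal (real h)" using t by simp
      thus "ereal (real h) \<in> B" unfolding B_def using X(1) X1 by force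
    next
      assume "ereal (real h) \<in> B"
      then obtain X where "X \<in> galois_span F emb p k" "ereal (real h) = cv X" unfolding B_def by blast
      moreover from this have "cv X = ereal (real h)" by simp
      ultimately have "X \<in> f h" "X \<notin> f (h + 1)" by (auto simp: f_def)
      thus "f (h + 1) \<noteq> f h" by blast
    qed
    hence "ss_refined_breaks F vL emb p k = {ereal (real h) | h. ereal (real h) \<in> B}"
      unfolding ss_refined_breaks_def filt by simp
    also have "\<dots> = B"
    proof -
      have "\<exists>h. y = ereal (real h)" if "y \<in> B" for y
      proof -
        obtain X where "X \<in> galois_span F emb p k" "X \<noteq> one" "y = cv X" using \<open>y \<in> B\<close> B_def by blast
        then obtain t where "t > 0" "y = ereal (real_of_int t)" using ex by metis
        thus ?thesis by (intro exI[of _ "nat t"]) simp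
      qed
      thus ?thesis by blast
    qed
    finally show ?thesis .
  qed
  moreover have "vc_breaks_defined F vL emb p n b k" unfolding vc_breaks_defined_def using vc by simp
  ultimately show ?thesis by simp
qed

end

lemma (in nval) v_gt_imp_vge: "v x > ereal (real_of_int m) \<Longrightarrow> vge v x (m + 1)"
proof (cases "x = 0")
  case False
  assume "v x > ereal (real_of_int m)"
  moreover obtain k where k: "veq v x k" using veq_ex False by blast
  ultimately have "m < k" by (simp add: veq_def)
  thus ?thesis using k by (auto intro: veq_vge)
qed simp

theorem corollary4p4:
  fixes vK :: "'k::field \<Rightarrow> ereal" and F :: "'k set"
    and vL :: "'l::field \<Rightarrow> ereal" and emb :: "'k \<Rightarrow> 'l"
    and p n k :: nat and b :: int
    and \<beta> :: 'k and \<omega> \<epsilon> :: "nat \<Rightarrow> 'k"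
  assumes "prime p" and "CHAR('k) = p"
    and "local_field vK" and "coefficient_field vK F" and "perfect_subfield F"
    and "local_field vL" and "galois_extension emb" and "totally_ramified vK vL emb"
    and "galois_group emb \<cong> product_group {..<n} (\<lambda>_. integer_mod_group p)"
    and "b > 0" and "ramification_breaks vL emb = {b}"
    and "artin_schreier_data vK F emb p n b \<beta> \<omega> \<epsilon>"
    and "\<forall>i\<in>{1..n}. vK (\<epsilon> i) > ereal (- real_of_int b / real p powi (int n - 2))"
    and "2 \<le> k" and "k \<le> p"
  shows "vc_breaks_defined F vL emb p n b k \<and>
         vc_refined_breaks F vL emb p n b k = ss_refined_breaks F vL emb p k"
proof -
  define N where "N = ext_degree emb"
  have p0: "p > 0" using prime_gt_0_nat[OF assms(1)] .
  interpret K0: nval vK by unfold_locales (use assms(3) in \<open>simp add: local_field_def\<close>)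
  interpret L0: nval vL by unfold_locales (use assms(6) in \<open>simp add: local_field_def\<close>)
  have "field_embedding emb" using assms(8) by (simp add: totally_ramified_def finite_extension_def)
  then interpret E0: femb emb by unfold_locales
  have F: "subfld F" using assms(4) by unfold_locales (simp add: coefficient_field_def)
  interpret T0: tot_ram vK vL emb N by unfold_locales (use assms(8) in \<open>simp_all add: N_def\<close>)
  interpret F0: subfld F by (rule F)
  interpret R0: ram vK vL emb N F p b
    by unfold_locales (use assms in auto)
  have card: "card R0.GG = p ^ n"
  proof -
    obtain h where "h \<in> iso (galois_group emb) (product_group {..<n} (\<lambda>_. integer_mod_group p))"
      using assms(9) by (auto simp: is_iso_def)
    hence "bij_betw h R0.GG (carrier (product_group {..<n} (\<lambda>_. integer_mod_group p)))"
      by (simp add: iso_def)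
    hence "card R0.GG = card (\<Pi>\<^sub>E i\<in>{..<n}. {0..<int p})"
      using p0 by (simp add: bij_betw_same_card carrier_integer_mod_group)
    thus ?thesis by (simp add: card_PiE)
  qed
  have as: "veq vK \<beta> (- b)" "\<And>i. i \<in> {1..n} \<Longrightarrow> \<omega> i \<in> F" "prime_field_independent p n \<omega>"
    using assms(12) unfolding artin_schreier_data_def by (auto simp: veq_def)
  have "\<forall>i\<in>{1..n}. vK (\<epsilon> i) > ereal (real_of_int (- b))"
    using assms(12) unfolding artin_schreier_data_def by blast
  hence eps: "\<And>i. i \<in> {1..n} \<Longrightarrow> vge vK (\<epsilon> i) (- b + 1)" using K0.v_gt_imp_vge by blast
  obtain x :: "nat \<Rightarrow> 'l" where x: "\<And>i. i \<in> {1..n} \<Longrightarrow> x i ^ p - x i = emb (\<omega> i ^ (p ^ n) * \<beta> + \<epsilon> i)"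
    "adjoin emb (x ` {1..n}) = UNIV"
    using assms(12) unfolding artin_schreier_data_def by blast
  \<comment> \<open>The denominator is cleared over the reals; over the integers the strict
    inequality then becomes a bound by \<open>- b + 1\<close>.\<close>
  have strong: "vge vK (\<epsilon> i ^ (p ^ (n - 2))) (- b + 1)" if n2: "n \<ge> 2" and i: "i \<in> {1..n}" for i
  proof (cases "\<epsilon> i = 0")
    case False
    then obtain l where l: "veq vK (\<epsilon> i) l" using K0.veq_ex by blast
    have "real p powi (int n - 2) = real p ^ (n - 2)"
      using n2 by (simp add: power_int_def nat_diff_distrib)
    moreover have "ereal (- real_of_int b / real p powi (int n - 2)) < ereal (real_of_int l)"
      using bspec[OF assms(13) i] l by (simp only: veq_def)
    ultimately have "- real_of_int b / real p ^ (n - 2) < real_of_int l" by simp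
    moreover have "0 < real p ^ (n - 2)" using p0 by simp
    ultimately have "- real_of_int b < real_of_int l * real p ^ (n - 2)"
      by (simp only: pos_divide_less_eq)
    hence "real_of_int (- b) < real_of_int (l * int (p ^ (n - 2)))" by simp
    hence "- b + 1 \<le> int (p ^ (n - 2)) * l" by (simp only: of_int_less_iff mult.commute)
    thus ?thesis using K0.veq_power[OF l, of "p ^ (n - 2)"] by (auto intro: K0.veq_vge)
  qed (use p0 in \<open>simp add: zero_power\<close>)
  interpret A0: artin_schreier vK vL emb N F p b n \<beta> \<omega> \<epsilon> x
    by unfold_locales (use card assms(5) as eps strong x in auto)
  obtain a Y \<kappa> where sc: "\<forall>j\<in>{1..n}. \<forall>i. a j i \<in> F" "\<forall>j\<in>{1..n}. a j j = 1"
    "\<forall>\<sigma>\<in>R0.GG. \<forall>j\<in>{1..n}. \<sigma> (Y j) = Y j + emb (\<Sum>i=1..j. a j i * of_nat (A0.tup \<sigma> i))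
        + (if j = n \<and> n \<ge> 2 then \<kappa> (of_nat (A0.tup \<sigma> 1)) else 0)"
    "\<forall>j\<in>{1..n}. veq vL (Y j) (- (int (p ^ (n - j)) * b))" "N = p ^ n"
    "\<forall>t. (\<Sum>m<p. emb (ell p (t - of_nat m)) * \<kappa> (of_nat m)) = \<kappa> t" "\<kappa> 0 = 0"
    and kap: "(\<forall>t\<in>F. \<kappa> t = 0) \<or> n \<ge> 2 \<and> (\<exists>k0. int p dvd k0 \<and> k0 > int (p ^ (n - 1)) * b - int p * b \<and>
        (\<forall>t\<in>F - {0}. veq vL (\<kappa> t) k0))"
    using A0.scaffold_exists by blast
  \<comment> \<open>Supplies the conventional value \<open>p ^ n * b\<close> when \<kappa> vanishes
    on \<open>F\<close>.\<close>
  have "\<exists>k0. int p dvd k0 \<and> k0 > int (p ^ (n - 1)) * b - int p * b \<and>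
      ((\<forall>t\<in>F. \<kappa> t = 0) \<and> k0 = int (p ^ n) * b \<or> n \<ge> 2 \<and> (\<forall>t\<in>F - {0}. veq vL (\<kappa> t) k0))"
  proof (cases "\<forall>t\<in>F. \<kappa> t = 0")
    case True
    have "int p dvd int (p ^ n) * b" using A0.n_pos by simp
    moreover have "int (p ^ (n - 1)) * b \<le> int (p ^ n) * b"
      using assms(10) p0 by (intro mult_right_mono) (auto intro: power_increasing)
    moreover have "int p * b > 0" using assms(10) p0 by simp
    ultimately show ?thesis using True by (intro exI[of _ "int (p ^ n) * b"]) auto
  qed (use kap in blast)
  then obtain k0 where k0: "int p dvd k0" "k0 > int (p ^ (n - 1)) * b - int p * b"
      "(\<forall>t\<in>F. \<kappa> t = 0) \<and> k0 = int (p ^ n) * b \<or> n \<ge> 2 \<and> (\<forall>t\<in>F - {0}. veq vL (\<kappa> t) k0)" by blast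
  interpret scaffold vK vL emb N F p b n \<beta> \<omega> \<epsilon> x a Y \<kappa> k0
    by unfold_locales (use sc k0 in blast)+
  show ?thesis by (rule refined_breaks_eq[OF assms(14,15)])
qed

end
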